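(* Each of MR-DP, MR-AP and MR-SP is in XP when parameterized by the number $k$ of base-paths, and can be solved in $\mathcal O\big(|V|^k\cdot(\log k)^{\mathcal O(k)}\cdot \mathrm{poly}(|\mathcal G|)\big)$ time, where $V$ is the vertex set and $|\mathcal G|$ the size of the input temporal $k$-path graph.
   Context: A temporal multigraph $\mathcal G=(V,E,\lambda)$ consists of a directed multigraph $(V,E)$ and a labeling $\lambda$ assigning integer time labels to edges; a pair $(e,t)$ with $t\in\lambda(e)$ is a temporal edge. A temporal path is a sequence of temporal edges $((e_1,t_1),\dots,(e_m,t_m))$ such that $e_1,\dots,e_m$ form a directed path and $t_1<\dots<t_m$. A vertex $u$ reaches $v$ if there is a temporal path from $u$ to $v$; $R^{\mathcal G}(u)$ is the set of vertices reached by $u$. A temporal $k$-path graph is a temporal multigraph $\mathcal G$ together with a collection $\mathcal P=\{P_1,\dots,P_k\}$ of temporal paths (base-paths) whose multiset union of temporal edges is exactly the multiset of temporal edges of $\mathcal G$. A shifting operation is a pair $((e,t),\delta)$ where $(e,t)$ is a temporal edge lying on base-path $P_i$ and $\delta\in\mathbb Z$. Applying it sets the label of $(e,t)$ to $t+\delta$; every edge $e'$ that is the $d$-th edge after $e$ on $P_i$ gets label $\max(\lambda(e'),t+\delta+d)$; every edge $e'$ that is the $d$-th edge before $e$ on $P_i$ gets label $\min(\lambda(e'),t+\delta-d)$; edges of other base-paths are unchanged. It is delaying if $\delta>0$, advancing if $\delta<0$; its cost is $|\delta|$; a sequence is applied one after another and its cost is the sum of costs. MR-SP: given a temporal $k$-path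 graph $\mathcal G$, a budget $b\in\mathbb N$ and a vertex $s$, find a sequence of shifting operations of total cost at most $b$ maximizing $|R^{\mathcal G'}(s)|$, where $\mathcal G'$ is the resulting graph. MR-DP (resp. MR-AP) is the same with only delaying (resp. only advancing) operations allowed. *)

theory Defs
  imports
    Complex_Main
    "HOL-Library.Multiset"
    "HOL-Computational_Algebra.Polynomial"
    "Graph_Theory.Arc_Walk"
begin

section \<open>Model of computation\<close>

text \<open>
  Programs are finite systems of first-order, mutually recursive, call-by-value functions on binary
  trees; evaluating any subexpression costs one time unit (this is the language F of N. Jones,
  "Computability and Complexity from a Programming Perspective").  With trees represented by
  pointers, a random access machine executes every evaluation step in constant time.  Conversely, by
  keeping the memory in a balanced search tree, T steps of a logarithmic-cost random access machine
  are simulated in time T times a polynomial in log T.  Time bounds that are stated up to a factor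
  polynomial in the input size and in log T are therefore the same in both models.
\<close>

datatype data = Leaf | Node data data

primrec data_size :: "data \<Rightarrow> nat" where
  "data_size Leaf = 1"
| "data_size (Node l r) = data_size l + data_size r + 1"

datatype expr =
    EVar nat
  | ENil
  | ECons expr expr
  | EHd expr
  | ETl expr
  | ECond expr expr expr
  | ECall nat "expr list"

text \<open>
  The \<open>f\<close>-th entry of a program is the body of its \<open>f\<close>-th function; variables are
  positions in the list of actual arguments.  \<open>Leaf\<close> is the truth value false, every other tree
  is true.  The last argument of \<open>eval\<close> and \<open>evals\<close> is the running time.
\<close>

type_synonym program = "expr list"

inductive
  eval :: "program \<Rightarrow> data list \<Rightarrow> expr \<Rightarrow> data \<Rightarrow> nat \<Rightarrow> bool" and
  evals :: "program \<Rightarrow> data list \<Rightarrow> expr list \<Rightarrow> data list \<Rightarrow> nat \<Rightarrow> bool"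
  for p :: program
where
  eval_Var: "i < length xs \<Longrightarrow> eval p xs (EVar i) (xs ! i) 1"
| eval_Nil: "eval p xs ENil Leaf 1"
| eval_Cons: "\<lbrakk>eval p xs e1 v1 n1; eval p xs e2 v2 n2\<rbrakk>
    \<Longrightarrow> eval p xs (ECons e1 e2) (Node v1 v2) (n1 + n2 + 1)"
| eval_Hd: "eval p xs e v n
    \<Longrightarrow> eval p xs (EHd e) (case v of Leaf \<Rightarrow> Leaf | Node l r \<Rightarrow> l) (n + 1)"
| eval_Tl: "eval p xs e v n
    \<Longrightarrow> eval p xs (ETl e) (case v of Leaf \<Rightarrow> Leaf | Node l r \<Rightarrow> r) (n + 1)"
| eval_Cond: "\<lbrakk>eval p xs e v n; eval p xs (if v \<noteq> Leaf then e1 else e2) w m\<rbrakk>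
    \<Longrightarrow> eval p xs (ECond e e1 e2) w (n + m + 1)"
| eval_Call: "\<lbrakk>evals p xs es vs n; f < length p; eval p vs (p ! f) w m\<rbrakk>
    \<Longrightarrow> eval p xs (ECall f es) w (n + m + 1)"
| evals_Nil: "evals p xs [] [] 0"
| evals_Cons: "\<lbrakk>eval p xs e v n; evals p xs es vs m\<rbrakk>
    \<Longrightarrow> evals p xs (e # es) (v # vs) (n + m)"

lemma
  eval_deterministic: "eval p xs e v n \<Longrightarrow> eval p xs e v' n' \<Longrightarrow> v' = v \<and> n' = n" and
  evals_deterministic: "evals p xs es vs n \<Longrightarrow> evals p xs es vs' n' \<Longrightarrow> vs' = vs \<and> n' = n"
  apply (induction arbitrary: v' n' and vs' n' rule: eval_evals.inducts)
  subgoal by (erule eval.cases; force)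
  subgoal by (erule eval.cases; force)
  subgoal premises prems for xs e1 v1 n1 e2 v2 n2 v' n'
    using prems(5) by (cases rule: eval.cases) (use prems in blast)
  subgoal premises prems
    using prems(3) by (cases rule: eval.cases) (use prems in blast)
  subgoal premises prems
    using prems(3) by (cases rule: eval.cases) (use prems in blast)
  subgoal premises prems
    using prems(5) by (cases rule: eval.cases) (use prems in blast)
  subgoal premises prems
    using prems(6) by (cases rule: eval.cases) (use prems in blast)
  subgoal by (erule evals.cases; force)
  subgoal premises prems
    using prems(5) by (cases rule: evals.cases) (use prems in blast)
  done

definition run :: "program \<Rightarrow> data \<Rightarrow> data \<Rightarrow> nat \<Rightarrow> bool" where
  "run p x v n \<longleftrightarrow> p \<noteq> [] \<and> eval p [x] (p ! 0) v n"

section \<open>Encodings\<close>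

definition enc_bool :: "bool \<Rightarrow> data" where
  "enc_bool b = (if b then Node Leaf Leaf else Leaf)"

text \<open>Binary, least significant bit first, without superfluous zeros.\<close>

fun enc_nat :: "nat \<Rightarrow> data" where
  "enc_nat n = (if n = 0 then Leaf else Node (enc_bool (odd n)) (enc_nat (n div 2)))"

declare enc_nat.simps [simp del]

definition enc_int :: "int \<Rightarrow> data" where
  "enc_int i = Node (enc_bool (i < 0)) (enc_nat (nat \<bar>i\<bar>))"

primrec enc_list :: "('a \<Rightarrow> data) \<Rightarrow> 'a list \<Rightarrow> data" where
  "enc_list enc [] = Leaf"
| "enc_list enc (x # xs) = Node (enc x) (enc_list enc xs)"

definition enc_pair :: "('a \<Rightarrow> data) \<Rightarrow> ('b \<Rightarrow> data) \<Rightarrow> 'a \<times> 'b \<Rightarrow> data" where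
  "enc_pair enc1 enc2 = (\<lambda>(x, y). Node (enc1 x) (enc2 y))"

section \<open>Parameterized problems\<close>

text \<open>
  A parameterized search problem: for each instance, any one element of \<open>solutions\<close> has to be
  computed.
\<close>

record 'i param_problem =
  instances :: "'i set"
  encode :: "'i \<Rightarrow> data"
  param :: "'i \<Rightarrow> nat"
  solutions :: "'i \<Rightarrow> data set"

definition solves_in_time :: "program \<Rightarrow> 'i param_problem \<Rightarrow> ('i \<Rightarrow> real) \<Rightarrow> bool" where
  "solves_in_time p \<Pi> T \<longleftrightarrow>
     (\<forall>x \<in> instances \<Pi>. \<exists>v n. run p (encode \<Pi> x) v n \<and> v \<in> solutions \<Pi> x \<and> real n \<le> T x)"

definition computable :: "(nat \<Rightarrow> nat) \<Rightarrow> bool" where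
  "computable f \<longleftrightarrow> (\<exists>p. \<forall>m. \<exists>n. run p (enc_nat m) (enc_nat (f m)) n)"

definition in_XP :: "'i param_problem \<Rightarrow> bool" where
  "in_XP \<Pi> \<longleftrightarrow> (\<exists>p f. computable f \<and>
     solves_in_time p \<Pi> (\<lambda>x. real (f (param \<Pi> x) * data_size (encode \<Pi> x) ^ f (param \<Pi> x))))"

section \<open>Temporal path graphs\<close>

text \<open>
  Labels form a multiset, since shifting can give two temporal edges the same edge and label.
\<close>

record ('a, 'b) temporal_multigraph =
  digraph_of :: "('a, 'b) pre_digraph"
  labels :: "'b \<Rightarrow> int multiset"

record ('a, 'b) path_graph = "('a, 'b) temporal_multigraph" +
  base_paths :: "('b \<times> int) list list"

definition temporal_edges ::
    "('a, 'b, 'z) temporal_multigraph_scheme \<Rightarrow> ('b \<times> int) multiset" where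
  "temporal_edges G = (\<Sum>e \<in> arcs (digraph_of G). image_mset (Pair e) (labels G e))"

definition temporal_path ::
    "('a, 'b, 'z) temporal_multigraph_scheme \<Rightarrow> 'a \<Rightarrow> ('b \<times> int) list \<Rightarrow> 'a \<Rightarrow> bool" where
  "temporal_path G u p v \<longleftrightarrow>
     pre_digraph.apath (digraph_of G) u (map fst p) v \<and>
     set p \<subseteq> set_mset (temporal_edges G) \<and>
     sorted_wrt (<) (map snd p)"

text \<open>Every vertex reaches itself by the empty path.\<close>

definition reached ::
    "('a, 'b, 'z) temporal_multigraph_scheme \<Rightarrow> 'a \<Rightarrow> 'a set" where
  "reached G u = {v. \<exists>p. temporal_path G u p v}"

definition wf_path_graph :: "('a, 'b) path_graph \<Rightarrow> bool" where
  "wf_path_graph G \<longleftrightarrow>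
     fin_digraph (digraph_of G) \<and>
     (\<forall>p \<in> set (base_paths G). \<exists>u v. temporal_path G u p v) \<and>
     (\<Sum>p \<in># mset (base_paths G). mset p) = temporal_edges G"

section \<open>Shifting operations\<close>

text \<open>
  \<open>(i, (e, t), \<delta>)\<close> shifts the temporal edge \<open>(e, t)\<close> of the \<open>i\<close>-th base-path
  by \<open>\<delta>\<close>.  The index tells apart equal temporal edges of different base-paths.
\<close>

type_synonym 'b shift = "nat \<times> ('b \<times> int) \<times> int"

definition shift_path :: "nat \<Rightarrow> int \<Rightarrow> ('b \<times> int) list \<Rightarrow> ('b \<times> int) list" where
  "shift_path j \<delta> p = map (\<lambda>m. (fst (p ! m),
     if m = j then snd (p ! j) + \<delta>
     else if j < m then max (snd (p ! m)) (snd (p ! j) + \<delta> + int (m - j))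
     else min (snd (p ! m)) (snd (p ! j) + \<delta> - int (j - m)))) [0..<length p]"

definition path_labels :: "('b \<times> int) list list \<Rightarrow> 'b \<Rightarrow> int multiset" where
  "path_labels P e = image_mset snd (filter_mset (\<lambda>x. fst x = e) (\<Sum>p \<in># mset P. mset p))"

definition set_base_paths ::
    "('b \<times> int) list list \<Rightarrow> ('a, 'b) path_graph \<Rightarrow> ('a, 'b) path_graph" where
  "set_base_paths P G = G\<lparr>labels := path_labels P, base_paths := P\<rparr>"

definition shift_to :: "('a, 'b) path_graph \<Rightarrow> 'b shift \<Rightarrow> ('a, 'b) path_graph \<Rightarrow> bool" where
  "shift_to G = (\<lambda>(i, et, \<delta>) G'. \<exists>j.
     i < length (base_paths G) \<and> j < length (base_paths G ! i) \<and> base_paths G ! i ! j = et \<and>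
     G' = set_base_paths ((base_paths G)[i := shift_path j \<delta> (base_paths G ! i)]) G)"

primrec shifts_to :: "('a, 'b) path_graph \<Rightarrow> 'b shift list \<Rightarrow> ('a, 'b) path_graph \<Rightarrow> bool" where
  "shifts_to G [] G' \<longleftrightarrow> G' = G"
| "shifts_to G (\<sigma> # \<sigma>s) G' \<longleftrightarrow> (\<exists>H. shift_to G \<sigma> H \<and> shifts_to H \<sigma>s G')"

definition shift_amount :: "'b shift \<Rightarrow> int" where
  "shift_amount = (\<lambda>(i, et, \<delta>). \<delta>)"

definition cost :: "'b shift list \<Rightarrow> int" where
  "cost \<sigma>s = (\<Sum>\<sigma> \<leftarrow> \<sigma>s. \<bar>shift_amount \<sigma>\<bar>)"

section \<open>The reachability problems\<close>

text \<open>\<open>D\<close> is the set of permitted shift amounts.\<close>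

definition feasible ::
    "int set \<Rightarrow> ('a, 'b) path_graph \<Rightarrow> nat \<Rightarrow> 'b shift list \<Rightarrow> ('a, 'b) path_graph \<Rightarrow> bool" where
  "feasible D G b \<sigma>s G' \<longleftrightarrow>
     shifts_to G \<sigma>s G' \<and> shift_amount ` set \<sigma>s \<subseteq> D \<and> cost \<sigma>s \<le> int b"

definition optimal ::
    "int set \<Rightarrow> ('a, 'b) path_graph \<Rightarrow> nat \<Rightarrow> 'a \<Rightarrow> 'b shift list \<Rightarrow> bool" where
  "optimal D G b s \<sigma>s \<longleftrightarrow> (\<exists>G'. feasible D G b \<sigma>s G' \<and>
     (\<forall>\<sigma>s' H. feasible D G b \<sigma>s' H \<longrightarrow> card (reached H s) \<le> card (reached G' s)))"

definition enc_temporal_path :: "(nat \<times> int) list \<Rightarrow> data" where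
  "enc_temporal_path = enc_list (enc_pair enc_nat enc_int)"

definition enc_path_graph :: "(nat, nat) path_graph \<Rightarrow> data" where
  "enc_path_graph G = (let D = digraph_of G in
     Node (enc_list enc_nat (sorted_list_of_set (verts D)))
       (Node
         (enc_list
           (\<lambda>e. Node (enc_nat e) (Node (enc_nat (tail D e)) (Node (enc_nat (head D e))
              (enc_list enc_int (sorted_list_of_multiset (labels G e))))))
           (sorted_list_of_set (arcs D)))
         (enc_list enc_temporal_path (base_paths G))))"

definition enc_shifts :: "nat shift list \<Rightarrow> data" where
  "enc_shifts = enc_list (enc_pair enc_nat (enc_pair (enc_pair enc_nat enc_int) enc_int))"

type_synonym mr_instance = "(nat, nat) path_graph \<times> nat \<times> nat"

definition MR :: "int set \<Rightarrow> mr_instance param_problem" where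
  "MR D = \<lparr>
     instances = {(G, b, s). wf_path_graph G \<and> s \<in> verts (digraph_of G)},
     encode = enc_pair enc_path_graph (enc_pair enc_nat enc_nat),
     param = (\<lambda>(G, b, s). length (base_paths G)),
     solutions = (\<lambda>(G, b, s). {enc_shifts \<sigma>s | \<sigma>s. optimal D G b s \<sigma>s})\<rparr>"

definition MR_DP :: "mr_instance param_problem" where
  "MR_DP = MR {\<delta>. \<delta> > 0}"

definition MR_AP :: "mr_instance param_problem" where
  "MR_AP = MR {\<delta>. \<delta> < 0}"

definition MR_SP :: "mr_instance param_problem" where
  "MR_SP = MR UNIV"

end

theory Submission
  imports Defs "HOL-Library.Sublist"
begin

text \<open>
  The temporal edges of a base path that are usable from the source form a suffix of the path, and
  only the labels of these suffixes have to change. Base paths are simple, so there are at most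
  \<open>|V| ^ k\<close> ways to choose a suffix of each. For a fixed choice the set of reached vertices is fixed,
  and the task is to find a cheapest relabelling under which every chosen suffix can be boarded at its
  first edge, from the source or from another suffix. As labels increase along temporal paths, the
  boarding relation can be taken to be a tree rooted at the source, and an optimal one is found by
  dynamic programming over sets of base paths, as in the algorithm of Dreyfus and Wagner for Steiner
  trees. This takes time \<open>2 ^ O(k)\<close> times a polynomial, for two reasons. The least cost of shifts that
  realize a given relabelling is a sum of terms for single edges and pairs of consecutive edges. Being
  piecewise affine, this cost is minimal for some relabelling with labels close to the given ones.
\<close>

section \<open>Time-bounded computations\<close>

text \<open>The exponent of \<open>|V|\<close> must be \<open>k\<close> itself. A bound polynomial
  in the number of choices would only give \<open>|V| ^ O(k)\<close>; hence the enumeration is a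
  program with its own time analysis (\<open>tm_search\<close>), and only the work for a single
  choice is shown to be polynomial, in \<open>2 ^ k\<close> times the size of the graph. The factor
  \<open>(log k) ^ O(k)\<close> of the claim merely has to dominate \<open>2 ^ O(k)\<close>.

  The relabelling cost is a potential: a shift by \<open>d\<close> raises it by at most
  \<open>|d|\<close>, and explicit shifts attain it. So sequences of shifts disappear from the
  optimization, and base paths interact only through boarding. Labels in front of a chosen suffix
  are left to the side effects of the shifts. Their edges can only add reached vertices, so the
  vertices counted for a choice give a lower bound, which is exact for the choice induced by an
  optimal solution.

  Step counts alone do not compose: with sharing, a result can be exponentially larger than the time
  spent on it. Polynomial time therefore includes a bound on the result, and each recursion needs
  one on its intermediate results.\<close>

primrec shift_calls :: "nat \<Rightarrow> expr \<Rightarrow> expr" where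
  "shift_calls k (EVar i) = EVar i"
| "shift_calls k ENil = ENil"
| "shift_calls k (ECons a b) = ECons (shift_calls k a) (shift_calls k b)"
| "shift_calls k (EHd a) = EHd (shift_calls k a)"
| "shift_calls k (ETl a) = ETl (shift_calls k a)"
| "shift_calls k (ECond a b c) = ECond (shift_calls k a) (shift_calls k b) (shift_calls k c)"
| "shift_calls k (ECall f es) = ECall (k + f) (map (shift_calls k) es)"

text \<open>Functions are called by position, so a program keeps its meaning inside a longer one
  once its calls are renumbered by the number of bodies in front of it.\<close>

lemma
  eval_relocate: "eval p xs e v n \<Longrightarrow>
    eval (q @ map (shift_calls (length q)) p @ r) xs (shift_calls (length q) e) v n" and
  evals_relocate: "evals p xs es vs n \<Longrightarrow>
    evals (q @ map (shift_calls (length q)) p @ r) xs (map (shift_calls (length q)) es) vs n"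
proof (induction rule: eval_evals.inducts)
  case (eval_Cond xs e v n e1 e2 w m)
  then show ?case
    by (simp only: shift_calls.simps) (rule eval_evals.eval_Cond, simp, cases "v \<noteq> Leaf", auto)
next
  case (eval_Call xs es vs n f w m)
  have "(q @ map (shift_calls (length q)) p @ r) ! (length q + f) = shift_calls (length q) (p ! f)"
    using eval_Call by (simp add: nth_append)
  with eval_Call show ?case
    by (simp only: shift_calls.simps) (rule eval_evals.eval_Call, auto)
qed (simp_all only: shift_calls.simps list.map, auto simp only: intro: eval_evals.intros)

lemma shift_calls_0 [simp]: "shift_calls 0 e = e"
  by (induction e) (simp_all add: map_idI)

lemma eval_append: "eval p xs e v n \<Longrightarrow> eval (p @ r) xs e v n"
  using eval_relocate[of p xs e v n "[]" r] by (simp add: map_idI)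

text \<open>The entry expression \<open>e\<close> is kept apart from the bodies, so that combinators
  can embed it without a call; \<open>tm_run\<close> makes it body number 0 in the end. The set
  \<open>A\<close> carries invariants of the arguments on which the time bound may depend.\<close>

definition tm :: "'a set \<Rightarrow> ('a \<Rightarrow> data) \<Rightarrow> ('b \<Rightarrow> data) \<Rightarrow> ('a \<Rightarrow> 'b) \<Rightarrow> ('a \<Rightarrow> nat) \<Rightarrow> bool" where
  "tm A ea eb f T \<longleftrightarrow> (\<exists>p e. \<forall>x\<in>A. \<exists>n\<le>T x. eval p [ea x] e (eb (f x)) n)"

text \<open>The arbitrary rest \<open>r\<close> reserves room for further bodies, which then have
  the indices from \<open>length p\<close> on.\<close>

lemma tm_pair_programs:
  assumes "tm A ea eb f S" "tm B ec ed g T"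
  obtains p e e' where
    "\<forall>x r. x \<in> A \<longrightarrow> (\<exists>n\<le>S x. eval (p @ r) [ea x] e (eb (f x)) n)"
    "\<forall>x r. x \<in> B \<longrightarrow> (\<exists>n\<le>T x. eval (p @ r) [ec x] e' (ed (g x)) n)"
proof -
  obtain p1 e1 where 1: "\<And>x. x \<in> A \<Longrightarrow> \<exists>n\<le>S x. eval p1 [ea x] e1 (eb (f x)) n"
    using assms(1) unfolding tm_def by blast
  obtain p2 e2 where 2: "\<And>x. x \<in> B \<Longrightarrow> \<exists>n\<le>T x. eval p2 [ec x] e2 (ed (g x)) n"
    using assms(2) unfolding tm_def by blast
  show ?thesis
  proof (rule that[of "p1 @ map (shift_calls (length p1)) p2" e1 "shift_calls (length p1) e2"], safe)
    show "\<exists>n\<le>S x. eval ((p1 @ map (shift_calls (length p1)) p2) @ r) [ea x] e1 (eb (f x)) n" if "x \<in> A" for x r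
      using 1[OF that] eval_append by fastforce
    show "\<exists>n\<le>T x. eval ((p1 @ map (shift_calls (length p1)) p2) @ r) [ec x] (shift_calls (length p1) e2) (ed (g x)) n"
      if "x \<in> B" for x r
      using 2[OF that] eval_relocate by fastforce
  qed
qed

lemma tm_mono: "tm A ea eb f S \<Longrightarrow> B \<subseteq> A \<Longrightarrow> (\<And>x. x \<in> B \<Longrightarrow> S x \<le> T x) \<Longrightarrow> tm B ea eb f T"
  unfolding tm_def by (meson order_trans subsetD)

lemma tm_cong: "tm A ea eb f S \<Longrightarrow> (\<And>x. x \<in> A \<Longrightarrow> ec (g x) = eb (f x)) \<Longrightarrow> tm A ea ec g S"
  unfolding tm_def by simp

lemma tm_comp:
  assumes "tm A ea eb f S" "tm B eb ec g T" "\<And>x. x \<in> A \<Longrightarrow> f x \<in> B"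
  shows "tm A ea ec (\<lambda>x. g (f x)) (\<lambda>x. S x + T (f x) + 1)"
proof -
  obtain p e e' where 1[rule_format]: "\<forall>x r. x \<in> A \<longrightarrow> (\<exists>n\<le>S x. eval (p @ r) [ea x] e (eb (f x)) n)"
    and 2[rule_format]: "\<forall>x r. x \<in> B \<longrightarrow> (\<exists>n\<le>T x. eval (p @ r) [eb x] e' (ec (g x)) n)"
    by (rule tm_pair_programs[OF assms(1,2)])
  show ?thesis unfolding tm_def
  proof (rule exI, rule exI, rule ballI)
    fix x assume x: "x \<in> A"
    obtain n where n: "n \<le> S x" "eval (p @ [e']) [ea x] e (eb (f x)) n" using 1[OF x] by blast
    obtain m where m: "m \<le> T (f x)" "eval (p @ [e']) [eb (f x)] e' (ec (g (f x))) m"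
      using 2 assms(3)[OF x] by blast
    have "eval (p @ [e']) [ea x] (ECall (length p) [e]) (ec (g (f x))) (n + 0 + m + 1)"
      by (rule eval_Call, rule evals_Cons[OF n(2) evals_Nil]) (use m in auto)
    moreover have "n + 0 + m + 1 \<le> S x + T (f x) + 1" using n m by simp
    ultimately show "\<exists>k\<le>S x + T (f x) + 1. eval (p @ [e']) [ea x] (ECall (length p) [e]) (ec (g (f x))) k"
      by blast
  qed
qed

lemma tm_pair:
  assumes "tm A ea eb f S" "tm A ea ec g T"
  shows "tm A ea (enc_pair eb ec) (\<lambda>x. (f x, g x)) (\<lambda>x. S x + T x + 1)"
proof -
  obtain p e e' where 1[rule_format]: "\<forall>x r. x \<in> A \<longrightarrow> (\<exists>n\<le>S x. eval (p @ r) [ea x] e (eb (f x)) n)"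
    and 2[rule_format]: "\<forall>x r. x \<in> A \<longrightarrow> (\<exists>n\<le>T x. eval (p @ r) [ea x] e' (ec (g x)) n)"
    by (rule tm_pair_programs[OF assms])
  show ?thesis unfolding tm_def
  proof (rule exI, rule exI, rule ballI)
    fix x assume x: "x \<in> A"
    obtain n where n: "n \<le> S x" "eval (p @ []) [ea x] e (eb (f x)) n" using 1[OF x] by blast
    obtain m where m: "m \<le> T x" "eval (p @ []) [ea x] e' (ec (g x)) m" using 2[OF x] by blast
    have "eval (p @ []) [ea x] (ECons e e') (enc_pair eb ec (f x, g x)) (n + m + 1)"
      using eval_Cons[OF n(2) m(2)] by (simp add: enc_pair_def)
    moreover have "n + m + 1 \<le> S x + T x + 1" using n m by simp
    ultimately show "\<exists>k\<le>S x + T x + 1. eval (p @ []) [ea x] (ECons e e') (enc_pair eb ec (f x, g x)) k"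
      by blast
  qed
qed

lemma tm_id: "tm A ea ea (\<lambda>x. x) (\<lambda>_. 1)"
  unfolding tm_def
proof (rule exI, rule exI, rule ballI)
  fix x show "\<exists>n\<le>1. eval [] [ea x] (EVar 0) (ea x) n" using eval_Var[of 0 "[ea x]" "[]"] by auto
qed

lemma eval_const: "\<exists>e. \<forall>p xs. eval p xs e d (data_size d)"
proof (induction d)
  case Leaf
  then show ?case using eval_Nil by (intro exI[of _ ENil]) simp
next
  case (Node l r)
  then obtain e1 e2 where "\<forall>p xs. eval p xs e1 l (data_size l)" "\<forall>p xs. eval p xs e2 r (data_size r)"
    by blast
  then have "\<forall>p xs. eval p xs (ECons e1 e2) (Node l r) (data_size (Node l r))"
    by (metis data_size.simps(2) eval_Cons)
  then show ?case by blast
qed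

lemma tm_const: "tm A ea eb (\<lambda>_. c) (\<lambda>_. data_size (eb c))"
  using eval_const[of "eb c"] unfolding tm_def by blast

lemma tm_fst:
  assumes "tm A ea (enc_pair eb ec) f T" shows "tm A ea eb (\<lambda>x. fst (f x)) (\<lambda>x. T x + 1)"
proof -
  obtain p e where 1: "\<And>x. x \<in> A \<Longrightarrow> \<exists>n\<le>T x. eval p [ea x] e (enc_pair eb ec (f x)) n"
    using assms unfolding tm_def by blast
  have "\<exists>n\<le>T x + 1. eval p [ea x] (EHd e) (eb (fst (f x))) n" if x: "x \<in> A" for x
  proof -
    obtain n where n: "n \<le> T x" "eval p [ea x] e (enc_pair eb ec (f x)) n" using 1[OF x] by blast
    show ?thesis using eval_Hd[OF n(2)] n(1)
      by (intro exI[of _ "n + 1"]) (simp add: enc_pair_def split: prod.splits)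
  qed
  then show ?thesis unfolding tm_def by blast
qed

lemma tm_snd:
  assumes "tm A ea (enc_pair eb ec) f T" shows "tm A ea ec (\<lambda>x. snd (f x)) (\<lambda>x. T x + 1)"
proof -
  obtain p e where 1: "\<And>x. x \<in> A \<Longrightarrow> \<exists>n\<le>T x. eval p [ea x] e (enc_pair eb ec (f x)) n"
    using assms unfolding tm_def by blast
  have "\<exists>n\<le>T x + 1. eval p [ea x] (ETl e) (ec (snd (f x))) n" if x: "x \<in> A" for x
  proof -
    obtain n where n: "n \<le> T x" "eval p [ea x] e (enc_pair eb ec (f x)) n" using 1[OF x] by blast
    show ?thesis using eval_Tl[OF n(2)] n(1)
      by (intro exI[of _ "n + 1"]) (simp add: enc_pair_def split: prod.splits)
  qed
  then show ?thesis unfolding tm_def by blast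
qed

lemma tm_if:
  assumes "tm A ea enc_bool c R" "tm {x \<in> A. c x} ea eb f S" "tm {x \<in> A. \<not> c x} ea eb g T"
  shows "tm A ea eb (\<lambda>x. if c x then f x else g x)
    (\<lambda>x. R x + (if c x then S x else T x) + 1)"
proof -
  obtain p e1 where 1: "\<And>x. x \<in> A \<Longrightarrow> \<exists>n\<le>R x. eval p [ea x] e1 (enc_bool (c x)) n"
    using assms(1) unfolding tm_def by blast
  obtain q e2 e3 where 2[rule_format]: "\<forall>x r. x \<in> {x \<in> A. c x} \<longrightarrow> (\<exists>n\<le>S x. eval (q @ r) [ea x] e2 (eb (f x)) n)"
    and 3[rule_format]: "\<forall>x r. x \<in> {x \<in> A. \<not> c x} \<longrightarrow> (\<exists>n\<le>T x. eval (q @ r) [ea x] e3 (eb (g x)) n)"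
    by (rule tm_pair_programs[OF assms(2,3)])
  let ?q = "q @ map (shift_calls (length q)) p"
  show ?thesis unfolding tm_def
  proof (rule exI, rule exI, rule ballI)
    fix x assume x: "x \<in> A"
    obtain n where n: "n \<le> R x" "eval p [ea x] e1 (enc_bool (c x)) n" using 1[OF x] by blast
    have n2: "eval ?q [ea x] (shift_calls (length q) e1) (enc_bool (c x)) n"
      using eval_relocate[OF n(2), of q "[]"] by simp
    obtain m where m: "m \<le> (if c x then S x else T x)"
      "eval ?q [ea x] (if c x then e2 else e3) (eb (if c x then f x else g x)) m"
      using 2[of x] 3[of x] x by (cases "c x") auto
    have "eval ?q [ea x] (ECond (shift_calls (length q) e1) e2 e3) (eb (if c x then f x else g x)) (n + m + 1)"
      by (rule eval_Cond[OF n2]) (use m(2) in \<open>auto simp: enc_bool_def\<close>)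
    moreover have "n + m + 1 \<le> R x + (if c x then S x else T x) + 1" using n m by simp
    ultimately show "\<exists>k\<le>R x + (if c x then S x else T x) + 1.
        eval ?q [ea x] (ECond (shift_calls (length q) e1) e2 e3) (eb (if c x then f x else g x)) k"
      by blast
  qed
qed

text \<open>The step only ever meets suffixes of the given list and the values of \<open>F\<close>
  on them. Hypothesis \<open>B\<close> asks for a time bound on such arguments alone, so the size of
  these values may be controlled by an invariant.\<close>

lemma tm_list_rec:
  assumes init: "tm A ea ec i S"
    and step: "tm B (enc_pair ea (enc_pair eb (enc_pair (enc_list eb) ec))) ec
      (\<lambda>z. s (fst z) (fst (snd z)) (fst (snd (snd z))) (snd (snd (snd z)))) T"
    and nil: "\<And>x. x \<in> A \<Longrightarrow> F x [] = i x"
    and cons: "\<And>x a l. x \<in> A \<Longrightarrow> F x (a # l) = s x a l (F x l)"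
    and B: "\<And>x l k a l'. (x, l) \<in> C \<Longrightarrow> drop k l = a # l' \<Longrightarrow>
       (x, a, l', F x l') \<in> B \<and> T (x, a, l', F x l') \<le> U x l"
    and A: "\<And>x l. (x, l) \<in> C \<Longrightarrow> x \<in> A"
  shows "tm C (enc_pair ea (enc_list eb)) ec (\<lambda>z. F (fst z) (snd z))
    (\<lambda>z. S (fst z) + (length (snd z) + 1) * (U (fst z) (snd z) + 30))"
proof -
  obtain p e1 e2 where 1[rule_format]: "\<forall>x r. x \<in> A \<longrightarrow> (\<exists>n\<le>S x. eval (p @ r) [ea x] e1 (ec (i x)) n)"
    and 2[rule_format]: "\<forall>z r. z \<in> B \<longrightarrow> (\<exists>n\<le>T z. eval (p @ r) [enc_pair ea (enc_pair eb (enc_pair (enc_list eb) ec)) z]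
        e2 (ec (s (fst z) (fst (snd z)) (fst (snd (snd z))) (snd (snd (snd z))))) n)"
    by (rule tm_pair_programs[OF init step])
  define N where "N = length p"
  define body where "body = ECond (EVar 1)
    (ECall (N + 1) [ECons (EVar 0) (ECons (EHd (EVar 1)) (ECons (ETl (EVar 1))
       (ECall (N + 2) [EVar 0, ETl (EVar 1)])))])
    (ECall N [EVar 0])"
  define q where "q = p @ [e1, e2, body]"
  have q: "q ! N = e1" "q ! (N + 1) = e2" "q ! (N + 2) = body" "length q = N + 3"
    by (auto simp: q_def N_def nth_append)
  have var: "eval q [u, v] (EVar 0) u 1" "eval q [u, v] (EVar (Suc 0)) v 1" for u v
    using eval_Var[of 0 "[u, v]" q] eval_Var[of "Suc 0" "[u, v]" q] by auto
  \<comment> \<open>The 18 pays for the evaluation of \<open>body\<close> around the call of the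
    step function.\<close>
  have rec: "\<exists>n \<le> S x + (length l' + 1) * (U x l + 18).
      eval q [ea x, enc_list eb l'] body (ec (F x l')) n"
    if xl: "(x, l) \<in> C" and k: "drop k l = l'" for x l l' k
    using k
  proof (induction l' arbitrary: k)
    case Nil
    obtain n where n: "n \<le> S x" "eval q [ea x] e1 (ec (i x)) n"
      using 1[OF A[OF xl]] unfolding q_def by blast
    have "eval q [ea x, Leaf] (ECall N [EVar 0]) (ec (i x)) (1 + 0 + n + 1)"
      by (rule eval_Call, rule evals_Cons[OF _ evals_Nil], rule var) (use n q in auto)
    then have "eval q [ea x, Leaf] body (ec (i x)) (1 + (1 + 0 + n + 1) + 1)"
      unfolding body_def by (intro eval_Cond[where v = Leaf]) (use var in auto)
    moreover have "1 + (1 + 0 + n + 1) + 1 \<le> S x + (length ([]::'c list) + 1) * (U x l + 18)"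
      using n by simp
    ultimately show ?case using nil[OF A[OF xl]] by (metis enc_list.simps(1))
  next
    case (Cons a l')
    have "drop (Suc k) l = l'" using Cons.prems by (metis drop_Suc list.sel(3) tl_drop)
    from Cons.IH[OF this] obtain n where n: "n \<le> S x + (length l' + 1) * (U x l + 18)"
      "eval q [ea x, enc_list eb l'] body (ec (F x l')) n" by blast
    have b: "(x, a, l', F x l') \<in> B" "T (x, a, l', F x l') \<le> U x l" using B[OF xl Cons.prems] by auto
    let ?z = "(x, a, l', F x l')"
    obtain m where m: "m \<le> U x l"
      "eval q [enc_pair ea (enc_pair eb (enc_pair (enc_list eb) ec)) ?z] e2 (ec (s x a l' (F x l'))) m"
      using 2[OF b(1), of "[e1, e2, body]"] b(2) unfolding q_def fst_conv snd_conv by (meson order_trans)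
    let ?env = "[ea x, enc_list eb (a # l')]"
    have hd: "eval q ?env (EHd (EVar 1)) (eb a) (1 + 1)"
      using eval_Hd[OF var(2), of "ea x" "enc_list eb (a # l')"] by simp
    have tl: "eval q ?env (ETl (EVar 1)) (enc_list eb l') (1 + 1)"
      using eval_Tl[OF var(2), of "ea x" "enc_list eb (a # l')"] by simp
    have call: "eval q ?env (ECall (N + 2) [EVar 0, ETl (EVar 1)]) (ec (F x l')) (1 + ((1 + 1) + 0) + n + 1)"
      by (rule eval_Call, rule evals_Cons, rule var, rule evals_Cons, rule tl, rule evals_Nil)
        (use n q in auto)
    have arg: "eval q ?env (ECons (EVar 0) (ECons (EHd (EVar 1)) (ECons (ETl (EVar 1))
       (ECall (N + 2) [EVar 0, ETl (EVar 1)]))))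
       (enc_pair ea (enc_pair eb (enc_pair (enc_list eb) ec)) ?z)
       (1 + ((1 + 1) + ((1 + 1) + (1 + ((1 + 1) + 0) + n + 1) + 1) + 1) + 1)"
      unfolding enc_pair_def prod.case by (intro eval_Cons var hd tl call)
    have "eval q ?env (ECall (N + 1) [ECons (EVar 0) (ECons (EHd (EVar 1)) (ECons (ETl (EVar 1))
       (ECall (N + 2) [EVar 0, ETl (EVar 1)])))]) (ec (s x a l' (F x l')))
       ((1 + ((1 + 1) + ((1 + 1) + (1 + ((1 + 1) + 0) + n + 1) + 1) + 1) + 1) + 0 + m + 1)"
      by (rule eval_Call, rule evals_Cons[OF arg evals_Nil]) (use m q in auto)
    then have "eval q ?env body (ec (F x (a # l')))
       (1 + ((1 + ((1 + 1) + ((1 + 1) + (1 + ((1 + 1) + 0) + n + 1) + 1) + 1) + 1) + 0 + m + 1) + 1)"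
      unfolding body_def cons[OF A[OF xl]] by (intro eval_Cond[where v = "enc_list eb (a # l')"]) (use var in auto)
    moreover have "1 + ((1 + ((1 + 1) + ((1 + 1) + (1 + ((1 + 1) + 0) + n + 1) + 1) + 1) + 1) + 0 + m + 1) + 1
       \<le> S x + (length (a # l') + 1) * (U x l + 18)"
      using n m by simp
    ultimately show ?case by blast
  qed
  show ?thesis unfolding tm_def
  proof (rule exI, rule exI, rule ballI)
    fix z assume z: "z \<in> C"
    obtain x l where xl: "z = (x, l)" by fastforce
    obtain n where n: "n \<le> S x + (length l + 1) * (U x l + 18)"
      "eval q [ea x, enc_list eb l] body (ec (F x l)) n" using rec[of x l 0 l] z xl by auto
    have v: "eval q [enc_pair ea (enc_list eb) z] (EVar 0) (enc_pair ea (enc_list eb) z) 1"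
      using eval_Var[of 0 "[enc_pair ea (enc_list eb) z]" q] by simp
    have h: "eval q [enc_pair ea (enc_list eb) z] (EHd (EVar 0)) (ea x) (1 + 1)"
      using eval_Hd[OF v] by (simp add: enc_pair_def xl)
    have t: "eval q [enc_pair ea (enc_list eb) z] (ETl (EVar 0)) (enc_list eb l) (1 + 1)"
      using eval_Tl[OF v] by (simp add: enc_pair_def xl)
    have "eval q [enc_pair ea (enc_list eb) z] (ECall (N + 2) [EHd (EVar 0), ETl (EVar 0)])
        (ec (F x l)) ((1 + 1) + ((1 + 1) + 0) + n + 1)"
      by (rule eval_Call, rule evals_Cons[OF h], rule evals_Cons[OF t], rule evals_Nil) (use n q in auto)
    moreover have "(1 + 1) + ((1 + 1) + 0) + n + 1 \<le> S x + (length l + 1) * (U x l + 30)"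
      using n(1) by (simp add: algebra_simps)
    ultimately show "\<exists>n\<le>S (fst z) + (length (snd z) + 1) * (U (fst z) (snd z) + 30).
        eval q [enc_pair ea (enc_list eb) z] (ECall (N + 2) [EHd (EVar 0), ETl (EVar 0)])
          (ec (F (fst z) (snd z))) n"
      unfolding xl fst_conv snd_conv by blast
  qed
qed

section \<open>Polynomial time relative to a measure\<close>

text \<open>The summand 2 keeps the base at least 2, so that constants and sums are absorbed by the
  exponent.\<close>

definition pb :: "'a set \<Rightarrow> ('a \<Rightarrow> nat) \<Rightarrow> ('a \<Rightarrow> nat) \<Rightarrow> bool" where
  "pb A \<mu> g \<longleftrightarrow> (\<exists>c. \<forall>x\<in>A. g x \<le> (\<mu> x + 2) ^ c)"

lemma pb_mono: "pb A \<mu> h \<Longrightarrow> (\<And>x. x \<in> A \<Longrightarrow> g x \<le> h x) \<Longrightarrow> pb A \<mu> g"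
  unfolding pb_def by (meson order_trans)

lemma pb_id: "pb A \<mu> \<mu>"
  unfolding pb_def by (rule exI[of _ 1]) auto

lemma pb_const: "pb A \<mu> (\<lambda>_. c)"
proof -
  have "c \<le> (\<mu> x + 2) ^ c" for x
    using less_exp[of c] power_mono[of 2 "\<mu> x + 2" c] by linarith
  then show ?thesis unfolding pb_def by blast
qed

lemma pb_add: assumes "pb A \<mu> g" "pb A \<mu> h" shows "pb A \<mu> (\<lambda>x. g x + h x)"
proof -
  obtain c d where c: "\<forall>x\<in>A. g x \<le> (\<mu> x + 2) ^ c" and d: "\<forall>x\<in>A. h x \<le> (\<mu> x + 2) ^ d"
    using assms unfolding pb_def by blast
  have "g x + h x \<le> (\<mu> x + 2) ^ (max c d + 1)" if "x \<in> A" for x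
  proof -
    have "(\<mu> x + 2) ^ c \<le> (\<mu> x + 2) ^ max c d" "(\<mu> x + 2) ^ d \<le> (\<mu> x + 2) ^ max c d"
      by (auto intro: power_increasing)
    then have "g x + h x \<le> 2 * (\<mu> x + 2) ^ max c d" using c[rule_format, OF that] d[rule_format, OF that] by linarith
    also have "\<dots> \<le> (\<mu> x + 2) * (\<mu> x + 2) ^ max c d" by (rule mult_right_mono) auto
    finally show ?thesis by simp
  qed
  then show ?thesis unfolding pb_def by blast
qed

lemma pb_mult: assumes "pb A \<mu> g" "pb A \<mu> h" shows "pb A \<mu> (\<lambda>x. g x * h x)"
proof -
  obtain c d where c: "\<forall>x\<in>A. g x \<le> (\<mu> x + 2) ^ c" and d: "\<forall>x\<in>A. h x \<le> (\<mu> x + 2) ^ d"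
    using assms unfolding pb_def by blast
  have "\<forall>x\<in>A. g x * h x \<le> (\<mu> x + 2) ^ (c + d)"
    using c d by (auto simp: power_add intro!: mult_mono)
  then show ?thesis unfolding pb_def by blast
qed

lemma pb_power: assumes "pb A \<mu> g" shows "pb A \<mu> (\<lambda>x. g x ^ c)"
  by (induction c) (auto intro: pb_const pb_mult assms)

lemma pb_comp:
  assumes "pb B \<nu> g" "pb A \<mu> (\<lambda>x. \<nu> (f x))" "\<And>x. x \<in> A \<Longrightarrow> f x \<in> B"
  shows "pb A \<mu> (\<lambda>x. g (f x))"
proof -
  obtain c where "\<forall>x\<in>B. g x \<le> (\<nu> x + 2) ^ c" using assms unfolding pb_def by blast
  then show ?thesis
    using assms(3) by (intro pb_mono[OF pb_power[OF pb_add[OF assms(2) pb_const[of A \<mu> 2]], of c]]) auto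
qed

lemmas pb_intros = pb_const pb_add pb_mult pb_power pb_id

lemma data_size_pos: "data_size d > 0" by (cases d) auto

lemma size_pair [simp]: "data_size (enc_pair ea eb z) = data_size (ea (fst z)) + data_size (eb (snd z)) + 1"
  by (cases z) (simp add: enc_pair_def)

lemma size_bool: "data_size (enc_bool b) \<le> 3" by (simp add: enc_bool_def)

lemma size_drop: "data_size (enc_list e (drop k l)) \<le> data_size (enc_list e l)"
proof (induction l arbitrary: k)
  case (Cons a l)
  then show ?case by (cases k) (auto intro: le_SucI trans_le_add2)
qed simp

lemma size_mem: "a \<in> set l \<Longrightarrow> data_size (e a) \<le> data_size (enc_list e l)"
  by (induction l) auto

lemma length_le_size: "length l < data_size (enc_list e l)"
  by (induction l) auto

lemma size_append: "data_size (enc_list e (l @ m)) + 1 = data_size (enc_list e l) + data_size (enc_list e m)"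
  by (induction l) auto

text \<open>The measure is not tied to the size of the argument: later it leaves out the budget or
  includes the factor \<open>2 ^ k\<close>. The result size needs its own bound, since
  \<open>ECons\<close> of a variable with itself doubles a tree in constant time.\<close>

definition pt :: "'a set \<Rightarrow> ('a \<Rightarrow> nat) \<Rightarrow> ('a \<Rightarrow> data) \<Rightarrow> ('b \<Rightarrow> data) \<Rightarrow> ('a \<Rightarrow> 'b) \<Rightarrow> bool" where
  "pt A \<mu> ea eb f \<longleftrightarrow>
     (\<exists>T. tm A ea eb f T \<and> pb A \<mu> T) \<and> pb A \<mu> (\<lambda>x. data_size (eb (f x)))"

abbreviation ptime :: "('a \<Rightarrow> data) \<Rightarrow> ('b \<Rightarrow> data) \<Rightarrow> ('a \<Rightarrow> 'b) \<Rightarrow> bool" where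
  "ptime ea eb f \<equiv> pt UNIV (\<lambda>x. data_size (ea x)) ea eb f"

text \<open>One rule per program construct: a goal \<open>ptime\<close> about a function is proved
  by following the structure of its definition.\<close>

named_theorems pt_intros

lemma ptI: "tm A ea eb f T \<Longrightarrow> pb A \<mu> T \<Longrightarrow> pb A \<mu> (\<lambda>x. data_size (eb (f x))) \<Longrightarrow> pt A \<mu> ea eb f"
  unfolding pt_def by blast

lemma pt_size: "pt A \<mu> ea eb f \<Longrightarrow> pb A \<mu> (\<lambda>x. data_size (eb (f x)))"
  by (simp add: pt_def)

lemma pt_subset: "pt A \<mu> ea eb f \<Longrightarrow> B \<subseteq> A \<Longrightarrow> pt B \<mu> ea eb f"
  unfolding pt_def pb_def by (meson subsetD tm_mono order_refl)

lemma pt_cong: "pt A \<mu> ea eb f \<Longrightarrow> (\<And>x. x \<in> A \<Longrightarrow> ec (g x) = eb (f x)) \<Longrightarrow> pt A \<mu> ea ec g"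
  unfolding pt_def pb_def using tm_cong[of A ea eb f _ ec g] by (metis (no_types, lifting))

lemma pt_comp_on:
  assumes "pt B (\<lambda>x. data_size (eb x)) eb ec g" "pt A \<mu> ea eb f" "\<And>x. x \<in> A \<Longrightarrow> f x \<in> B"
  shows "pt A \<mu> ea ec (\<lambda>x. g (f x))"
proof -
  obtain S T where S: "tm A ea eb f S" "pb A \<mu> S"
    and T: "tm B eb ec g T" "pb B (\<lambda>x. data_size (eb x)) T" using assms unfolding pt_def by blast
  have size: "pb A \<mu> (\<lambda>x. data_size (eb (f x)))" by (rule pt_size[OF assms(2)])
  have "pb A \<mu> (\<lambda>x. S x + T (f x) + 1)"
    by (intro pb_intros S pb_comp[OF T(2) size]) (use assms(3) in auto)
  moreover have "pb A \<mu> (\<lambda>x. data_size (ec (g (f x))))"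
    using pb_comp[OF pt_size[OF assms(1)] size] assms(3) by blast
  ultimately show ?thesis unfolding pt_def using tm_comp[OF S(1) T(1) assms(3)] by blast
qed

lemma pt_comp:
  assumes "ptime eb ec g" "pt A \<mu> ea eb f" shows "pt A \<mu> ea ec (\<lambda>x. g (f x))"
  using pt_comp_on[OF assms] by simp

lemma pt_const [pt_intros]: "pt A \<mu> ea eb (\<lambda>_. c)"
  by (rule ptI[OF tm_const pb_const pb_const])

lemma pt_id [pt_intros]: "pt A (\<lambda>x. data_size (ea x)) ea ea (\<lambda>x. x)"
  by (rule ptI[OF tm_id pb_const pb_id])

lemma pt_pair [pt_intros]:
  assumes "pt A \<mu> ea eb f" "pt A \<mu> ea ec g"
  shows "pt A \<mu> ea (enc_pair eb ec) (\<lambda>x. (f x, g x))"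
proof -
  obtain S T where S: "tm A ea eb f S" "pb A \<mu> S"
    and T: "tm A ea ec g T" "pb A \<mu> T" using assms unfolding pt_def by blast
  show ?thesis
    by (rule ptI[OF tm_pair[OF S(1) T(1)]]) (auto intro!: pb_add pb_const S T assms[THEN pt_size] simp del: One_nat_def add_Suc_right)
qed

lemma pt_fst [pt_intros]:
  assumes "pt A \<mu> ea (enc_pair eb ec) f" shows "pt A \<mu> ea eb (\<lambda>x. fst (f x))"
proof -
  obtain S where S: "tm A ea (enc_pair eb ec) f S" "pb A \<mu> S" using assms unfolding pt_def by blast
  have "pb A \<mu> (\<lambda>x. data_size (eb (fst (f x))))"
    by (rule pb_mono[OF pt_size[OF assms]]) simp
  then show ?thesis by (rule ptI[OF tm_fst[OF S(1)] pb_add[OF S(2) pb_const]])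
qed

lemma pt_snd [pt_intros]:
  assumes "pt A \<mu> ea (enc_pair eb ec) f" shows "pt A \<mu> ea ec (\<lambda>x. snd (f x))"
proof -
  obtain S where S: "tm A ea (enc_pair eb ec) f S" "pb A \<mu> S" using assms unfolding pt_def by blast
  have "pb A \<mu> (\<lambda>x. data_size (ec (snd (f x))))"
    by (rule pb_mono[OF pt_size[OF assms]]) simp
  then show ?thesis by (rule ptI[OF tm_snd[OF S(1)] pb_add[OF S(2) pb_const]])
qed

text \<open>Each branch has to be efficient only where it is taken; \<open>pt_truncate\<close>
  depends on this.\<close>

lemma pt_if_on:
  assumes "pt A \<mu> ea enc_bool c" "pt {x \<in> A. c x} \<mu> ea eb f" "pt {x \<in> A. \<not> c x} \<mu> ea eb g"
  shows "pt A \<mu> ea eb (\<lambda>x. if c x then f x else g x)"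
proof -
  obtain R S T where R: "tm A ea enc_bool c R" "pb A \<mu> R"
    and S: "tm {x \<in> A. c x} ea eb f S" "pb {x \<in> A. c x} \<mu> S"
    and T: "tm {x \<in> A. \<not> c x} ea eb g T" "pb {x \<in> A. \<not> c x} \<mu> T" using assms unfolding pt_def by blast
  have *: "pb A \<mu> (\<lambda>x. if c x then u x else v x)"
    if u: "pb {x \<in> A. c x} \<mu> u" and v: "pb {x \<in> A. \<not> c x} \<mu> v" for u v
  proof -
    obtain a b where "\<forall>x\<in>{x \<in> A. c x}. u x \<le> (\<mu> x + 2) ^ a" "\<forall>x\<in>{x \<in> A. \<not> c x}. v x \<le> (\<mu> x + 2) ^ b"
      using u v unfolding pb_def by blast
    then show ?thesis
      by (intro pb_mono[OF pb_add[OF pb_power[OF pb_add[OF pb_id pb_const[of A \<mu> 2]], of a]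
          pb_power[OF pb_add[OF pb_id pb_const[of A \<mu> 2]], of b]]])
        (auto intro: trans_le_add1 trans_le_add2)
  qed
  have "pb A \<mu> (\<lambda>x. data_size (eb (if c x then f x else g x)))"
    using *[OF assms(2,3)[THEN pt_size]] by (simp add: if_distrib)
  moreover have "pb A \<mu> (\<lambda>x. R x + (if c x then S x else T x) + 1)"
    by (intro pb_intros R * S T)
  ultimately show ?thesis unfolding pt_def using tm_if[OF R(1) S(1) T(1)] by blast
qed

lemma pt_if [pt_intros]:
  assumes "pt A \<mu> ea enc_bool c" "pt A \<mu> ea eb f" "pt A \<mu> ea eb g"
  shows "pt A \<mu> ea eb (\<lambda>x. if c x then f x else g x)"
  by (intro pt_if_on assms pt_subset[OF assms(2)] pt_subset[OF assms(3)]) auto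

lemma pt_not [pt_intros]: "pt A \<mu> ea enc_bool c \<Longrightarrow> pt A \<mu> ea enc_bool (\<lambda>x. \<not> c x)"
  using pt_if[of A \<mu> ea c enc_bool "\<lambda>_. False" "\<lambda>_. True"]
  by (simp add: pt_const if_bool_eq_conj)

lemma pt_conj [pt_intros]:
  "pt A \<mu> ea enc_bool c \<Longrightarrow> pt A \<mu> ea enc_bool d \<Longrightarrow> pt A \<mu> ea enc_bool (\<lambda>x. c x \<and> d x)"
  using pt_if[of A \<mu> ea c enc_bool d "\<lambda>_. False"]
  by (simp add: pt_const if_bool_eq_disj)

lemma pt_disj [pt_intros]:
  "pt A \<mu> ea enc_bool c \<Longrightarrow> pt A \<mu> ea enc_bool d \<Longrightarrow> pt A \<mu> ea enc_bool (\<lambda>x. c x \<or> d x)"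
  using pt_not[OF pt_conj[OF pt_not pt_not], of A \<mu> ea c d] by simp

lemma pt_iff: "pt A \<mu> ea enc_bool c \<Longrightarrow> pt A \<mu> ea enc_bool d \<Longrightarrow> pt A \<mu> ea enc_bool (\<lambda>x. c x = d x)"
proof -
  assume "pt A \<mu> ea enc_bool c" "pt A \<mu> ea enc_bool d"
  then have "pt A \<mu> ea enc_bool (\<lambda>x. (c x \<and> d x) \<or> (\<not> c x \<and> \<not> d x))"
    by (intro pt_conj pt_disj pt_not)
  moreover have "((c x \<and> d x) \<or> (\<not> c x \<and> \<not> d x)) = (c x = d x)" for x by blast
  ultimately show ?thesis by simp
qed

text \<open>Programs see a single argument. A bound variable becomes the second component of a pair
  with the old argument, and the body reads its variables by \<open>fst\<close> and
  \<open>snd\<close>.\<close>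

lemma pt_let:
  assumes "pt A \<mu> ea eb f" "ptime (enc_pair ea eb) ec (\<lambda>z. g (fst z) (snd z))" "pt A \<mu> ea ea (\<lambda>x. x)"
  shows "pt A \<mu> ea ec (\<lambda>x. let y = f x in g x y)"
  using pt_comp[OF assms(2) pt_pair[OF assms(3,1)]] by simp

lemma pt_Let [pt_intros]:
  assumes "ptime ea eb f" "ptime (enc_pair ea eb) ec (\<lambda>z. g (fst z) (snd z))"
  shows "ptime ea ec (\<lambda>x. let y = f x in g x y)"
  by (rule pt_let[OF assms pt_id])

lemma pt_Cons [pt_intros]:
  assumes "pt A \<mu> ea eb f" "pt A \<mu> ea (enc_list eb) g"
  shows "pt A \<mu> ea (enc_list eb) (\<lambda>x. f x # g x)"
  by (rule pt_cong[OF pt_pair[OF assms]]) (simp add: enc_pair_def)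

lemma pt_null: "pt A \<mu> ea (enc_list eb) f \<Longrightarrow> pt A \<mu> ea enc_bool (\<lambda>x. f x \<noteq> [])"
proof -
  assume f: "pt A \<mu> ea (enc_list eb) f"
  obtain T where T: "tm A ea (enc_list eb) f T" "pb A \<mu> T" using f unfolding pt_def by blast
  obtain p e where e: "\<forall>x\<in>A. \<exists>n\<le>T x. eval p [ea x] e (enc_list eb (f x)) n"
    using T unfolding tm_def by blast
  have "tm A ea enc_bool (\<lambda>x. f x \<noteq> []) (\<lambda>x. T x + 4)"
    unfolding tm_def
  proof (rule exI, rule exI, rule ballI)
    fix x assume "x \<in> A"
    then obtain n where n: "n \<le> T x" "eval p [ea x] e (enc_list eb (f x)) n" using e by blast
    have t: "eval p [ea x] (ECons ENil ENil) (Node Leaf Leaf) (1 + 1 + 1)"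
      and l: "eval p [ea x] ENil Leaf 1" by (intro eval_Cons eval_Nil)+
    have "\<exists>m\<le>3. eval p [ea x] (ECond e (ECons ENil ENil) ENil) (enc_bool (f x \<noteq> [])) (n + m + 1)"
    proof (cases "f x")
      case Nil
      then show ?thesis using l n by (intro exI[of _ 1] conjI eval_Cond) (auto simp: enc_bool_def)
    next
      case Cons
      then show ?thesis using t n by (intro exI[of _ "1 + 1 + 1"] conjI eval_Cond) (auto simp: enc_bool_def)
    qed
    then obtain m where "m \<le> 3" "eval p [ea x] (ECond e (ECons ENil ENil) ENil) (enc_bool (f x \<noteq> [])) (n + m + 1)"
      by blast
    then show "\<exists>n\<le>T x + 4. eval p [ea x] (ECond e (ECons ENil ENil) ENil) (enc_bool (f x \<noteq> [])) n"
      using n by (intro exI[of _ "n + m + 1"]) auto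
  qed
  moreover have "pb A \<mu> (\<lambda>x. T x + 4)" by (intro pb_intros T)
  moreover have "pb A \<mu> (\<lambda>x. data_size (enc_bool (f x \<noteq> [])))"
    by (rule pb_mono[OF pb_const[of A \<mu> 3]]) (rule size_bool)
  ultimately show ?thesis unfolding pt_def by blast
qed

lemma pt_not_Nil [pt_intros]:
  "pt A \<mu> ea (enc_list eb) f \<Longrightarrow> pt A \<mu> ea enc_bool (\<lambda>x. f x \<noteq> [])"
  "pt A \<mu> ea (enc_list eb) f \<Longrightarrow> pt A \<mu> ea enc_bool (\<lambda>x. f x = [])"
  using pt_null[of A \<mu> ea eb f] pt_not[of A \<mu> ea "\<lambda>x. f x \<noteq> []"] by auto

lemma pt_case_list_on:
  assumes l: "pt A \<mu> ea (enc_list eb) l" and d: "pt A \<mu> ea ec d"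
    and g: "pt B (\<lambda>x. data_size (enc_pair ea (enc_pair eb (enc_list eb)) x))
       (enc_pair ea (enc_pair eb (enc_list eb))) ec (\<lambda>z. g (fst z) (fst (snd z)) (snd (snd z)))"
    and i: "pt A \<mu> ea ea (\<lambda>x. x)"
    and B: "\<And>x a r. x \<in> A \<Longrightarrow> l x = a # r \<Longrightarrow> (x, a, r) \<in> B"
  shows "pt A \<mu> ea ec (\<lambda>x. case l x of [] \<Rightarrow> d x | a # r \<Rightarrow> g x a r)"
proof -
  let ?A = "{x \<in> A. l x \<noteq> []}"
  have 1: "pt ?A \<mu> ea (enc_pair ea (enc_pair eb (enc_list eb))) (\<lambda>x. (x, hd (l x), tl (l x)))"
    by (rule pt_cong[OF pt_subset[OF pt_pair[OF i l]]]) (auto simp: enc_pair_def neq_Nil_conv)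
  have 2: "pt ?A \<mu> ea ec (\<lambda>x. g x (hd (l x)) (tl (l x)))"
    using pt_comp_on[OF g 1] B by simp
  have "pt A \<mu> ea ec (\<lambda>x. if l x \<noteq> [] then g x (hd (l x)) (tl (l x)) else d x)"
    by (intro pt_if_on 2 pt_not_Nil[OF l] pt_subset[OF d]) auto
  then show ?thesis by (rule pt_cong) (auto split: list.split)
qed

lemma pt_case_list [pt_intros]:
  assumes "ptime ea (enc_list eb) l" "ptime ea ec d"
    and "ptime (enc_pair ea (enc_pair eb (enc_list eb))) ec (\<lambda>z. g (fst z) (fst (snd z)) (snd (snd z)))"
  shows "ptime ea ec (\<lambda>x. case l x of [] \<Rightarrow> d x | a # r \<Rightarrow> g x a r)"
  by (rule pt_case_list_on[OF assms pt_id]) auto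

lemma pt_tl [pt_intros]:
  assumes "pt A \<mu> ea (enc_list eb) f" shows "pt A \<mu> ea (enc_list eb) (\<lambda>x. tl (f x))"
proof -
  have "ptime (enc_list eb) (enc_list eb) (\<lambda>l. case l of [] \<Rightarrow> [] | a # r \<Rightarrow> r)"
    by (rule pt_intros)+
  from pt_comp[OF this assms] show ?thesis by (simp add: tl_def)
qed

text \<open>Iterating a polynomial-time step may square the size in every round. The hypothesis
  \<open>bound\<close> excludes this by limiting the values on all suffixes in terms of the
  measure.\<close>

lemma pt_list_rec_on:
  assumes xs: "pt A \<mu> ea (enc_list eb) xs"
    and id: "pt A \<mu> ea ea (\<lambda>x. x)"
    and init: "pt A \<mu> ea ec i"
    and step: "pt B (\<lambda>x. data_size (enc_pair ea (enc_pair eb (enc_pair (enc_list eb) ec)) x))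
      (enc_pair ea (enc_pair eb (enc_pair (enc_list eb) ec))) ec
      (\<lambda>z. s (fst z) (fst (snd z)) (fst (snd (snd z))) (snd (snd (snd z))))"
    and nil: "\<And>x. x \<in> A \<Longrightarrow> F x [] = i x"
    and cons: "\<And>x a l. x \<in> A \<Longrightarrow> F x (a # l) = s x a l (F x l)"
    and B: "\<And>x k a l. x \<in> A \<Longrightarrow> drop k (xs x) = a # l \<Longrightarrow> (x, a, l, F x l) \<in> B"
    and bound: "\<exists>c. \<forall>x\<in>A. \<forall>k. data_size (ec (F x (drop k (xs x)))) \<le> (\<mu> x + 2) ^ c"
  shows "pt A \<mu> ea ec (\<lambda>x. F x (xs x))"
proof -
  let ?e = "enc_pair ea (enc_pair eb (enc_pair (enc_list eb) ec))"
  obtain S where S: "tm A ea ec i S" "pb A \<mu> S" using init unfolding pt_def by blast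
  obtain T d where T: "tm B ?e ec (\<lambda>z. s (fst z) (fst (snd z)) (fst (snd (snd z))) (snd (snd (snd z)))) T"
    and d: "\<And>z. z \<in> B \<Longrightarrow> T z \<le> (data_size (?e z) + 2) ^ d" using step unfolding pt_def pb_def by blast
  obtain c where c: "\<And>x k. x \<in> A \<Longrightarrow> data_size (ec (F x (drop k (xs x)))) \<le> (\<mu> x + 2) ^ c"
    using bound by blast
  define U where "U x = (data_size (ea x) + 2 * data_size (enc_list eb (xs x)) + (\<mu> x + 2) ^ c + 5) ^ d" for x
  have pU: "pb A \<mu> U" unfolding U_def
    by (intro pb_intros pt_size[OF id] pt_size[OF xs])
  let ?C = "(\<lambda>x. (x, xs x)) ` A"
  have "tm ?C (enc_pair ea (enc_list eb)) ec (\<lambda>z. F (fst z) (snd z))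
     (\<lambda>z. S (fst z) + (length (snd z) + 1) * (U (fst z) + 30))"
  proof (rule tm_list_rec[OF S(1) T nil cons, where U = "\<lambda>x l. U x"])
    fix x l k a l' assume *: "(x, l) \<in> ?C" "drop k l = a # l'"
    then have x: "x \<in> A" "l = xs x" by auto
    have l': "drop (Suc k) (xs x) = l'" using * x by (metis drop_Suc list.sel(3) tl_drop)
    have 1: "data_size (enc_list eb l') \<le> data_size (enc_list eb (xs x))"
      using size_drop[of eb "Suc k" "xs x"] l' by simp
    have 2: "data_size (eb a) \<le> data_size (enc_list eb (xs x))"
      by (rule size_mem) (metis * x in_set_dropD list.set_intros(1))
    have 3: "data_size (ec (F x l')) \<le> (\<mu> x + 2) ^ c" using c[OF x(1), of "Suc k"] l' by simp
    have b: "(x, a, l', F x l') \<in> B" using B x * by blast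
    have "T (x, a, l', F x l') \<le> (data_size (?e (x, a, l', F x l')) + 2) ^ d" by (rule d[OF b])
    also have "\<dots> \<le> U x" unfolding U_def by (rule power_mono) (use 1 2 3 in auto)
    finally show "(x, a, l', F x l') \<in> B \<and> T (x, a, l', F x l') \<le> U x" using b by blast
  qed auto
  from tm_comp[OF tm_pair[OF _ _] this] obtain Q where Q: "tm A ea ec (\<lambda>x. F x (xs x)) Q" "pb A \<mu> Q"
  proof -
    obtain I where I: "tm A ea ea (\<lambda>x. x) I" "pb A \<mu> I" using id unfolding pt_def by blast
    obtain X where X: "tm A ea (enc_list eb) xs X" "pb A \<mu> X" using xs unfolding pt_def by blast
    have l: "pb A \<mu> (\<lambda>x. length (xs x))"
      by (rule pb_mono[OF pt_size[OF xs]]) (simp add: length_le_size less_imp_le)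
    have "tm A ea ec (\<lambda>x. F x (xs x)) (\<lambda>x. (I x + X x + 1) + (S x + (length (xs x) + 1) * (U x + 30)) + 1)"
      using tm_comp[OF tm_pair[OF I(1) X(1)] \<open>tm ?C _ _ _ _\<close>] by simp
    moreover have "pb A \<mu> (\<lambda>x. (I x + X x + 1) + (S x + (length (xs x) + 1) * (U x + 30)) + 1)"
      by (intro pb_intros I X S l pU)
    ultimately show ?thesis by (rule that)
  qed
  moreover have "pb A \<mu> (\<lambda>x. data_size (ec (F x (xs x))))"
    unfolding pb_def using c[of _ 0] by auto
  ultimately show ?thesis unfolding pt_def by blast
qed

text \<open>
  A recursion stays polynomial if each step increases the size \<open>\<sigma>\<close> of the result only by an amount
  that does not depend on the result of the recursive call.
\<close>

lemma pt_list_rec: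
  assumes xs: "ptime ea (enc_list eb) xs"
    and init: "ptime ea ec i"
    and step: "ptime (enc_pair ea (enc_pair eb (enc_pair (enc_list eb) ec))) ec
      (\<lambda>z. s (fst z) (fst (snd z)) (fst (snd (snd z))) (snd (snd (snd z))))"
    and nil: "\<And>x. F x [] = i x"
    and cons: "\<And>x a l. F x (a # l) = s x a l (F x l)"
    and sig: "\<And>r. \<sigma> r \<le> data_size (ec r)" "\<And>r. data_size (ec r) \<le> (\<sigma> r + 2) ^ d"
    and grow: "\<exists>c. \<forall>x a l r. \<sigma> (s x a l r) \<le> \<sigma> r +
       (data_size (ea x) + data_size (eb a) + data_size (enc_list eb l) + 2) ^ c"
  shows "ptime ea ec (\<lambda>x. F x (xs x))"
proof (rule pt_list_rec_on[OF xs pt_id init step nil cons])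
  obtain c where c: "\<And>x a l r. \<sigma> (s x a l r) \<le> \<sigma> r +
       (data_size (ea x) + data_size (eb a) + data_size (enc_list eb l) + 2) ^ c" using grow by blast
  have *: "\<sigma> (F x l) \<le> data_size (ec (i x)) + length l * (data_size (ea x) + data_size (enc_list eb l) + 2) ^ c" for x l
  proof (induction l)
    case (Cons a l)
    have "\<sigma> (F x (a # l)) \<le> \<sigma> (F x l) + (data_size (ea x) + data_size (eb a) + data_size (enc_list eb l) + 2) ^ c"
      unfolding cons by (rule c)
    also have "\<dots> \<le> (data_size (ec (i x)) + length l * (data_size (ea x) + data_size (enc_list eb l) + 2) ^ c)
        + (data_size (ea x) + data_size (enc_list eb (a # l)) + 2) ^ c"
      by (rule add_mono[OF Cons.IH], rule power_mono) auto
    also have "\<dots> \<le> (data_size (ec (i x)) + length l * (data_size (ea x) + data_size (enc_list eb (a # l)) + 2) ^ c)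
        + (data_size (ea x) + data_size (enc_list eb (a # l)) + 2) ^ c"
      by (intro add_mono mult_left_mono power_mono) auto
    finally show ?case by simp
  qed (simp add: nil sig)
  define G where "G x = (data_size (ec (i x)) + data_size (enc_list eb (xs x)) * (data_size (ea x) + data_size (enc_list eb (xs x)) + 2) ^ c + 2) ^ d" for x
  have G: "pb UNIV (\<lambda>x. data_size (ea x)) G" unfolding G_def
    by (intro pb_intros pt_size[OF init] pt_size[OF xs])
  have "data_size (ec (F x (drop k (xs x)))) \<le> G x" for x k
  proof -
    have "length (drop k (xs x)) \<le> data_size (enc_list eb (xs x))"
      using length_le_size[of "xs x" eb] by simp
    then have "length (drop k (xs x)) * (data_size (ea x) + data_size (enc_list eb (drop k (xs x))) + 2) ^ c \<le>
      data_size (enc_list eb (xs x)) * (data_size (ea x) + data_size (enc_list eb (xs x)) + 2) ^ c"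
      by (intro mult_mono power_mono add_mono size_drop) auto
    then have "\<sigma> (F x (drop k (xs x))) + 2 \<le> data_size (ec (i x)) + data_size (enc_list eb (xs x)) * (data_size (ea x) + data_size (enc_list eb (xs x)) + 2) ^ c + 2"
      using *[of x "drop k (xs x)"] by linarith
    then show ?thesis unfolding G_def using sig(2) power_mono le_trans by blast
  qed
  then show "\<exists>c. \<forall>x\<in>UNIV. \<forall>k. data_size (ec (F x (drop k (xs x)))) \<le> (data_size (ea x) + 2) ^ c"
    using G unfolding pb_def by (meson le_trans)
qed auto

lemma pt_list_rec_size:
  assumes "ptime ea (enc_list eb) xs"
    and "ptime ea ec i"
    and "ptime (enc_pair ea (enc_pair eb (enc_pair (enc_list eb) ec))) ec
      (\<lambda>z. s (fst z) (fst (snd z)) (fst (snd (snd z))) (snd (snd (snd z))))"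
    and "\<And>x. F x [] = i x"
    and "\<And>x a l. F x (a # l) = s x a l (F x l)"
    and "\<exists>c. \<forall>x a l r. data_size (ec (s x a l r)) \<le> data_size (ec r) +
       (data_size (ea x) + data_size (eb a) + data_size (enc_list eb l) + 2) ^ c"
  shows "ptime ea ec (\<lambda>x. F x (xs x))"
  by (rule pt_list_rec[OF assms(1-5), where \<sigma> = "\<lambda>r. data_size (ec r)" and d = 1]) (use assms(6) in auto)

lemma pt_map [pt_intros]:
  assumes "ptime ea (enc_list eb) xs" and g: "ptime (enc_pair ea eb) ec (\<lambda>z. g (fst z) (snd z))"
  shows "ptime ea (enc_list ec) (\<lambda>x. map (g x) (xs x))"
proof (rule pt_list_rec_size[where F = "\<lambda>x. map (g x)" and i = "\<lambda>_. []" and s = "\<lambda>x a l r. g x a # r", OF assms(1)])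
  have "ptime (enc_pair ea (enc_pair eb (enc_pair (enc_list eb) (enc_list ec)))) (enc_pair ea eb)
     (\<lambda>z. (fst z, fst (snd z)))" by (rule pt_intros)+
  from pt_comp[OF g this] show "ptime (enc_pair ea (enc_pair eb (enc_pair (enc_list eb) (enc_list ec)))) (enc_list ec)
     (\<lambda>z. g (fst z) (fst (snd z)) # snd (snd (snd z)))"
    unfolding fst_conv snd_conv by (rule pt_Cons) (rule pt_intros)+
  obtain c where c: "\<And>x a. data_size (ec (g x a)) \<le> (data_size (ea x) + data_size (eb a) + 1 + 2) ^ c"
    using pt_size[OF g] unfolding pb_def by fastforce
  have "data_size (ec (g x a)) + 1 \<le> (data_size (ea x) + data_size (eb a) + data_size (enc_list eb l) + 2) ^ (c + 1)"
    for x a l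
  proof -
    let ?m = "data_size (ea x) + data_size (eb a) + data_size (enc_list eb l) + 2"
    have "data_size (ec (g x a)) \<le> ?m ^ c"
      by (rule le_trans[OF c power_mono]) (use data_size_pos[of "enc_list eb l"] in auto)
    moreover have "1 \<le> ?m ^ c" by simp
    ultimately have "data_size (ec (g x a)) + 1 \<le> 2 * ?m ^ c" by linarith
    also have "\<dots> \<le> ?m * ?m ^ c" by (rule mult_right_mono) auto
    finally show ?thesis by simp
  qed
  then show "\<exists>c. \<forall>x a l r. data_size (enc_list ec (g x a # r)) \<le> data_size (enc_list ec r) +
    (data_size (ea x) + data_size (eb a) + data_size (enc_list eb l) + 2) ^ c"
    by (intro exI[of _ "c + 1"]) (simp add: add.commute add.left_commute)
qed (auto intro: pt_const)

lemma pt_append [pt_intros]: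
  assumes "pt A \<mu> ea (enc_list eb) xs" "pt A \<mu> ea (enc_list eb) ys"
  shows "pt A \<mu> ea (enc_list eb) (\<lambda>x. xs x @ ys x)"
proof -
  have "ptime (enc_pair (enc_list eb) (enc_list eb)) (enc_list eb) (\<lambda>z. (\<lambda>z l. l @ snd z) z (fst z))"
    by (rule pt_list_rec_size[where F = "\<lambda>z l. l @ snd z" and xs = fst and i = snd and s = "\<lambda>x a l r. a # r"],
        (rule pt_intros)+)
      (auto intro!: exI[of _ 1])
  from pt_comp[OF this pt_pair[OF assms]] show ?thesis by simp
qed

lemma pt_concat [pt_intros]:
  assumes "pt A \<mu> ea (enc_list (enc_list eb)) xs"
  shows "pt A \<mu> ea (enc_list eb) (\<lambda>x. concat (xs x))"
proof -
  have grow: "data_size (enc_list eb (a @ r)) \<le> data_size (enc_list eb r) +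
      (data_size (enc_list (enc_list eb) x) + data_size (enc_list eb a) + data_size (enc_list (enc_list eb) l) + 2) ^ 1"
    for x a l r using size_append[of eb a r] by simp
  have "ptime (enc_list (enc_list eb)) (enc_list eb) (\<lambda>z. (\<lambda>_. concat) z z)"
    by (rule pt_list_rec_size[where F = "\<lambda>_. concat" and xs = "\<lambda>z. z" and i = "\<lambda>_. []" and s = "\<lambda>x a l r. a @ r"],
        (rule pt_intros)+, simp, simp, intro exI[of _ 1] allI, rule grow)
  from pt_comp[OF this assms] show ?thesis by simp
qed

lemma pt_filter [pt_intros]:
  assumes "ptime ea (enc_list eb) xs" and g: "ptime (enc_pair ea eb) enc_bool (\<lambda>z. g (fst z) (snd z))"
  shows "ptime ea (enc_list eb) (\<lambda>x. filter (g x) (xs x))"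
proof -
  have "ptime ea (enc_list eb) (\<lambda>x. concat (map (\<lambda>a. if g x a then [a] else []) (xs x)))"
    by (rule pt_intros assms)+
  moreover have "concat (map (\<lambda>a. if P a then [a] else []) l) = filter P l" for P and l :: "'b list"
    by (induction l) auto
  ultimately show ?thesis by simp
qed

lemma pt_list_ex [pt_intros]:
  assumes "ptime ea (enc_list eb) xs" and g: "ptime (enc_pair ea eb) enc_bool (\<lambda>z. g (fst z) (snd z))"
  shows "ptime ea enc_bool (\<lambda>x. list_ex (g x) (xs x))"
proof -
  have "ptime ea enc_bool (\<lambda>x. filter (g x) (xs x) \<noteq> [])" by (rule pt_intros assms)+
  then show ?thesis by (simp add: filter_empty_conv list_ex_iff)
qed

lemma pt_list_all [pt_intros]:
  assumes "ptime ea (enc_list eb) xs" and g: "ptime (enc_pair ea eb) enc_bool (\<lambda>z. g (fst z) (snd z))"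
  shows "ptime ea enc_bool (\<lambda>x. list_all (g x) (xs x))"
proof -
  have "ptime ea enc_bool (\<lambda>x. filter (\<lambda>a. \<not> g x a) (xs x) = [])" by (rule pt_intros assms)+
  then show ?thesis by (simp add: filter_empty_conv list_all_iff)
qed

section \<open>Equality and arithmetic\<close>

definition data_eq_body :: expr where
  "data_eq_body = ECond (EVar 0)
     (ECond (EVar 1)
       (ECond (ECall 0 [EHd (EVar 0), EHd (EVar 1)]) (ECall 0 [ETl (EVar 0), ETl (EVar 1)]) ENil)
       ENil)
     (ECond (EVar 1) ENil (ECons ENil ENil))"

lemma eval_data_eq: "\<exists>n \<le> 20 * data_size x. eval [data_eq_body] [x, y] data_eq_body (enc_bool (x = y)) n"
proof (induction x arbitrary: y)
  let ?p = "[data_eq_body]"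
  have v: "eval ?p [u, w] (EVar 0) u 1" "eval ?p [u, w] (EVar 1) w 1" for u w
    using eval_Var[of 0 "[u, w]" ?p] eval_Var[of 1 "[u, w]" ?p] by auto
  have l: "eval ?p xs ENil Leaf 1" and t: "eval ?p xs (ECons ENil ENil) (Node Leaf Leaf) (1 + 1 + 1)" for xs
    by (intro eval_Cons eval_Nil)+
  {
    case Leaf
    have "\<exists>n\<le>3. eval ?p [Leaf, y] (if y \<noteq> Leaf then ENil else ECons ENil ENil) (enc_bool (Leaf = y)) n"
      using l t by (cases y) (auto simp: enc_bool_def intro: exI[of _ "1 + 1 + 1 :: nat"] exI[of _ "1 :: nat"])
    then obtain n where n: "n \<le> 3" "eval ?p [Leaf, y] (if y \<noteq> Leaf then ENil else ECons ENil ENil) (enc_bool (Leaf = y)) n"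
      by blast
    have "eval ?p [Leaf, y] (ECond (EVar 1) ENil (ECons ENil ENil)) (enc_bool (Leaf = y)) (1 + n + 1)"
      by (rule eval_Cond[OF v(2) n(2)])
    then have "eval ?p [Leaf, y] data_eq_body (enc_bool (Leaf = y)) (1 + (1 + n + 1) + 1)"
      unfolding data_eq_body_def[THEN sym] by (subst (2) data_eq_body_def, intro eval_Cond[OF v(1)]) simp
    with n(1) show ?case by (intro exI[of _ "1 + (1 + n + 1) + 1"]) auto
  next
    case (Node a b)
    let ?x = "Node a b"
    let ?in = "ECond (ECall 0 [EHd (EVar 0), EHd (EVar 1)]) (ECall 0 [ETl (EVar 0), ETl (EVar 1)]) ENil"
    have "\<exists>n \<le> 20 * data_size a + 20 * data_size b + 14. eval ?p [?x, y] (if y \<noteq> Leaf then ?in else ENil) (enc_bool (?x = y)) n"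
    proof (cases y)
      case Leaf
      then show ?thesis using l by (auto simp: enc_bool_def intro: exI[of _ "1 :: nat"])
    next
      case y: (Node c d)
      obtain n where n: "n \<le> 20 * data_size a" "eval ?p [a, c] data_eq_body (enc_bool (a = c)) n" using Node.IH by blast
      obtain m where m: "m \<le> 20 * data_size b" "eval ?p [b, d] data_eq_body (enc_bool (b = d)) m" using Node.IH by blast
      have h: "eval ?p [?x, y] (EHd (EVar 0)) a (1 + 1)" "eval ?p [?x, y] (EHd (EVar 1)) c (1 + 1)"
        "eval ?p [?x, y] (ETl (EVar 0)) b (1 + 1)" "eval ?p [?x, y] (ETl (EVar 1)) d (1 + 1)"
        using eval_Hd[OF v(1)[of ?x y]] eval_Hd[OF v(2)[of ?x y]] eval_Tl[OF v(1)[of ?x y]] eval_Tl[OF v(2)[of ?x y]] y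
        by auto
      have c1: "eval ?p [?x, y] (ECall 0 [EHd (EVar 0), EHd (EVar 1)]) (enc_bool (a = c)) ((1 + 1) + ((1 + 1) + 0) + n + 1)"
        by (rule eval_Call, rule evals_Cons[OF h(1)], rule evals_Cons[OF h(2)], rule evals_Nil) (use n in auto)
      have c2: "eval ?p [?x, y] (ECall 0 [ETl (EVar 0), ETl (EVar 1)]) (enc_bool (b = d)) ((1 + 1) + ((1 + 1) + 0) + m + 1)"
        by (rule eval_Call, rule evals_Cons[OF h(3)], rule evals_Cons[OF h(4)], rule evals_Nil) (use m in auto)
      have "\<exists>k \<le> m + 5. eval ?p [?x, y] (if enc_bool (a = c) \<noteq> Leaf then ECall 0 [ETl (EVar 0), ETl (EVar 1)] else ENil) (enc_bool (?x = y)) k"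
      proof (cases "a = c")
        case True
        then show ?thesis using c2 y by (intro exI[of _ "(1 + 1) + ((1 + 1) + 0) + m + 1"]) (auto simp: enc_bool_def)
      next
        case False
        then show ?thesis using l y by (intro exI[of _ 1]) (auto simp: enc_bool_def)
      qed
      then obtain k where k: "k \<le> m + 5" "eval ?p [?x, y] (if enc_bool (a = c) \<noteq> Leaf then ECall 0 [ETl (EVar 0), ETl (EVar 1)] else ENil) (enc_bool (?x = y)) k" by blast
      show ?thesis using eval_Cond[OF c1 k(2)] y n(1) m(1) k(1)
        by (intro exI[of _ "(1 + 1) + ((1 + 1) + 0) + n + 1 + k + 1"]) auto
    qed
    then obtain n where n: "n \<le> 20 * data_size a + 20 * data_size b + 14"
      "eval ?p [?x, y] (if y \<noteq> Leaf then ?in else ENil) (enc_bool (?x = y)) n" by blast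
    have "eval ?p [?x, y] (ECond (EVar 1) ?in ENil) (enc_bool (?x = y)) (1 + n + 1)"
      by (rule eval_Cond[OF v(2) n(2)])
    then have "eval ?p [?x, y] data_eq_body (enc_bool (?x = y)) (1 + (1 + n + 1) + 1)"
      by (subst (2) data_eq_body_def, intro eval_Cond[OF v(1)]) simp
    with n(1) show ?case by (intro exI[of _ "1 + (1 + n + 1) + 1"]) auto
  }
qed

text \<open>Trees are compared by \<open>data_eq_body\<close>, and injectivity transfers the answer
  to the encoded values.\<close>

lemma pt_eq:
  assumes f: "pt A \<mu> ea eb f" and g: "pt A \<mu> ea eb g" and "inj eb"
  shows "pt A \<mu> ea enc_bool (\<lambda>x. f x = g x)"
proof -
  let ?e = "enc_pair eb eb"
  have "tm UNIV ?e enc_bool (\<lambda>z. fst z = snd z) (\<lambda>z. 20 * data_size (?e z) + 5)"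
    unfolding tm_def
  proof (rule exI, rule exI, rule ballI)
    fix z
    let ?p = "[data_eq_body]"
    obtain n where n: "n \<le> 20 * data_size (eb (fst z))"
      "eval ?p [eb (fst z), eb (snd z)] data_eq_body (enc_bool (eb (fst z) = eb (snd z))) n"
      using eval_data_eq by blast
    have v: "eval ?p [?e z] (EVar 0) (?e z) 1" using eval_Var[of 0 "[?e z]" ?p] by simp
    have h: "eval ?p [?e z] (EHd (EVar 0)) (eb (fst z)) (1 + 1)" "eval ?p [?e z] (ETl (EVar 0)) (eb (snd z)) (1 + 1)"
      using eval_Hd[OF v] eval_Tl[OF v] by (cases z; simp add: enc_pair_def)+
    have "eval ?p [?e z] (ECall 0 [EHd (EVar 0), ETl (EVar 0)]) (enc_bool (eb (fst z) = eb (snd z))) ((1 + 1) + ((1 + 1) + 0) + n + 1)"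
      by (rule eval_Call, rule evals_Cons[OF h(1)], rule evals_Cons[OF h(2)], rule evals_Nil) (use n in auto)
    then show "\<exists>n\<le>20 * data_size (?e z) + 5. eval ?p [?e z] (ECall 0 [EHd (EVar 0), ETl (EVar 0)]) (enc_bool (fst z = snd z)) n"
      using n(1) assms(3) by (intro exI[of _ "(1 + 1) + ((1 + 1) + 0) + n + 1"]) (auto simp: inj_eq)
  qed
  moreover have "pb UNIV (\<lambda>z. data_size (?e z)) (\<lambda>z. 20 * data_size (?e z) + 5)"
    by (intro pb_intros)
  moreover have "pb UNIV (\<lambda>z. data_size (?e z)) (\<lambda>z. data_size (enc_bool (fst z = snd z)))"
    by (rule pb_mono[OF pb_const[of _ _ 3]]) (rule size_bool)
  ultimately have "ptime ?e enc_bool (\<lambda>z. fst z = snd z)" by (rule ptI)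
  from pt_comp[OF this pt_pair[OF f g]] show ?thesis by simp
qed

section \<open>Binary numbers and their arithmetic\<close>

fun bits :: "nat \<Rightarrow> bool list" where
  "bits n = (if n = 0 then [] else odd n # bits (n div 2))"

declare bits.simps [simp del]

primrec bits_val :: "bool list \<Rightarrow> nat" where
  "bits_val [] = 0"
| "bits_val (b # l) = of_bool b + 2 * bits_val l"

text \<open>Arithmetic on digit lists leaves zeros at the most significant end, while
  \<open>enc_nat\<close> is canonical; they have to be cut off.\<close>

primrec trim :: "bool list \<Rightarrow> bool list" where
  "trim [] = []"
| "trim (b # l) = (if b \<or> trim l \<noteq> [] then b # trim l else [])"

lemma enc_nat_bits: "enc_nat n = enc_list enc_bool (bits n)"
  by (induction n rule: bits.induct) (subst enc_nat.simps, subst bits.simps, auto)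

lemma bits_val_bits [simp]: "bits_val (bits n) = n"
  by (induction n rule: bits.induct) (subst bits.simps, auto)

lemma bits_eq_Nil [simp]: "bits n = [] \<longleftrightarrow> n = 0"
  by (subst bits.simps) auto

lemma bits_bits_val: "bits (bits_val l) = trim l"
proof (induction l)
  case Nil
  then show ?case by (simp add: bits.simps)
next
  case (Cons b l)
  have "trim l = [] \<longleftrightarrow> bits_val l = 0" using Cons by (metis bits_eq_Nil)
  then show ?case using Cons by (subst bits.simps) auto
qed

lemma bits_val_append: "bits_val (l @ m) = bits_val l + 2 ^ length l * bits_val m"
  by (induction l) (auto simp: algebra_simps)

lemma inj_enc_bool: "inj enc_bool" by (auto simp: inj_def enc_bool_def split: if_splits)

lemma inj_enc_list: assumes "inj e" shows "inj (enc_list e)"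
proof (rule injI)
  fix l m show "enc_list e l = enc_list e m \<Longrightarrow> l = m"
  proof (induction l arbitrary: m)
    case Nil then show ?case by (cases m) auto
  next
    case (Cons a l) then show ?case using assms by (cases m) (auto simp: inj_eq)
  qed
qed

lemma inj_enc_pair: "inj ea \<Longrightarrow> inj eb \<Longrightarrow> inj (enc_pair ea eb)"
  by (auto simp: inj_def enc_pair_def)

lemma inj_enc_nat: "inj enc_nat"
  unfolding enc_nat_bits by (rule injI) (metis bits_val_bits inj_enc_bool inj_enc_list injD)

lemma enc_int_pair: "enc_int i = enc_pair enc_bool enc_nat (i < 0, nat \<bar>i\<bar>)"
  by (simp add: enc_int_def enc_pair_def)

lemma inj_enc_int: "inj enc_int"
proof (rule injI)
  fix i j assume "enc_int i = enc_int j"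
  then have "(i < 0) = (j < 0)" "nat \<bar>i\<bar> = nat \<bar>j\<bar>"
    using inj_enc_bool inj_enc_nat by (auto simp: enc_int_def inj_eq)
  then show "i = j" by (cases "i < 0") auto
qed

lemmas inj_encs = inj_enc_bool inj_enc_list inj_enc_pair inj_enc_nat inj_enc_int

lemma pt_bits: "pt A \<mu> ea enc_nat f \<Longrightarrow> pt A \<mu> ea (enc_list enc_bool) (\<lambda>x. bits (f x))"
  by (erule pt_cong) (simp add: enc_nat_bits)

lemma pt_of_bits: "pt A \<mu> ea (enc_list enc_bool) (\<lambda>x. bits (f x)) \<Longrightarrow> pt A \<mu> ea enc_nat f"
  by (erule pt_cong) (simp add: enc_nat_bits)

lemma pt_trim: assumes "pt A \<mu> ea (enc_list enc_bool) f" shows "pt A \<mu> ea (enc_list enc_bool) (\<lambda>x. trim (f x))"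
proof -
  have "ptime (enc_list enc_bool) (enc_list enc_bool) (\<lambda>x. (\<lambda>_. trim) x x)"
    by (rule pt_list_rec_size[where F = "\<lambda>_. trim" and i = "\<lambda>_. []" and xs = "\<lambda>x. x"
          and s = "\<lambda>x a l r. if a \<or> r \<noteq> [] then a # r else []"], (rule pt_intros)+)
      (auto intro!: exI[of _ 1])
  from pt_comp[OF this assms] show ?thesis by simp
qed

lemma pt_rev [pt_intros]: assumes "pt A \<mu> ea (enc_list eb) f" shows "pt A \<mu> ea (enc_list eb) (\<lambda>x. rev (f x))"
proof -
  have grow: "data_size (enc_list eb (r @ [a])) \<le> data_size (enc_list eb r) +
      (data_size (enc_list eb x) + data_size (eb a) + data_size (enc_list eb l) + 2) ^ 1"
    for x a l r using size_append[of eb r "[a]"] by simp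
  have "ptime (enc_list eb) (enc_list eb) (\<lambda>x. (\<lambda>_. rev) x x)"
    by (rule pt_list_rec_size[where F = "\<lambda>_. rev" and i = "\<lambda>_. []" and xs = "\<lambda>x. x"
          and s = "\<lambda>x a l r. r @ [a]"], (rule pt_intros)+, simp, simp, intro exI[of _ 1] allI, rule grow)
  from pt_comp[OF this assms] show ?thesis by simp
qed

text \<open>
  \<open>ripple\<close> adds (\<open>m\<close> false) or subtracts (\<open>m\<close> true) the number \<open>ys\<close>, least significant bit first; the
  first operand is given most significant bit first, so that the recursion starts at the low end.
  The result is the unread rest of \<open>ys\<close>, the carry and the output, most significant bit first.
\<close>

primrec ripple :: "bool \<times> bool list \<Rightarrow> bool list \<Rightarrow> bool list \<times> bool \<times> bool list" where
  "ripple mys [] = (snd mys, False, [])"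
| "ripple mys (a # l) = (let r = ripple mys l; b = (case fst r of [] \<Rightarrow> False | b # _ \<Rightarrow> b); c = fst (snd r);
     a' = (a \<noteq> fst mys) in
     (tl (fst r), a' \<and> b \<or> a' \<and> c \<or> b \<and> c, (a = (b = c)) # snd (snd r)))"

lemma bits_val_take_Suc:
  "bits_val (take (Suc n) l) = bits_val (take n l) + 2 ^ n * of_bool (case drop n l of [] \<Rightarrow> False | b # _ \<Rightarrow> b)"
proof (cases "n < length l")
  case True
  then have "drop n l = l ! n # drop (Suc n) l" by (rule Cons_nth_drop_Suc[symmetric])
  then show ?thesis using True by (simp add: take_Suc_conv_app_nth bits_val_append)
qed simp

text \<open>The pending carry has weight \<open>2 ^ length l\<close>, and for a subtraction it is a
  borrow of negative weight. The recursion meets the low digits first because \<open>l\<close>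
  starts with the high ones.\<close>

lemma ripple_correct:
  "fst (ripple (m, ys) l) = drop (length l) ys \<and> length (snd (snd (ripple (m, ys) l))) = length l \<and>
   int (bits_val (rev l)) + (if m then -1 else 1) * int (bits_val (take (length l) ys)) =
   int (bits_val (rev (snd (snd (ripple (m, ys) l))))) + (if m then -1 else 1) * 2 ^ length l * of_bool (fst (snd (ripple (m, ys) l)))"
proof (induction l)
  case (Cons a l)
  obtain zs c out where r: "ripple (m, ys) l = (zs, c, out)" by (metis prod_cases3)
  define b where "b = (case drop (length l) ys of [] \<Rightarrow> False | b # _ \<Rightarrow> b)"
  have IH: "zs = drop (length l) ys" "length out = length l"
    "int (bits_val (rev l)) + (if m then -1 else 1) * int (bits_val (take (length l) ys)) =
     int (bits_val (rev out)) + (if m then -1 else 1) * 2 ^ length l * of_bool c" using Cons r by auto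
  have 1: "ripple (m, ys) (a # l) = (tl zs, (a \<noteq> m) \<and> b \<or> (a \<noteq> m) \<and> c \<or> b \<and> c, (a = (b = c)) # out)"
    using r IH(1) by (simp add: Let_def b_def)
  have 2: "bits_val (take (length (a # l)) ys) = bits_val (take (length l) ys) + 2 ^ length l * of_bool b"
    using bits_val_take_Suc[of "length l" ys] by (simp add: b_def)
  have 3: "int (bits_val (rev (a # l))) + (if m then -1 else 1) * int (bits_val (take (length (a # l)) ys)) =
     int (bits_val (rev l)) + (if m then -1 else 1) * int (bits_val (take (length l) ys))
      + 2 ^ length l * (of_bool a + (if m then -1 else 1) * of_bool b)"
    unfolding 2 by (simp add: bits_val_append algebra_simps)
  show ?case unfolding 1 3 IH(3) using IH(1,2)
    by (auto simp: bits_val_append algebra_simps drop_Suc tl_drop of_bool_def split: if_splits)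
qed simp

lemma bits_val_zeros [simp]: "bits_val (map (\<lambda>_. False) l) = 0" by (induction l) auto

text \<open>Padding the first operand with one zero per digit of the second guarantees that all
  digits of \<open>j\<close> are read.\<close>

definition add_sub :: "bool \<Rightarrow> nat \<Rightarrow> nat \<Rightarrow> bool list \<times> bool \<times> bool list" where
  "add_sub m i j = ripple (m, bits j) (rev (bits i @ map (\<lambda>_. False) (bits j)))"

lemma add_sub_correct:
  "int i + (if m then -1 else 1) * int j = int (bits_val (rev (snd (snd (add_sub m i j))))) +
     (if m then -1 else 1) * 2 ^ length (snd (snd (add_sub m i j))) * of_bool (fst (snd (add_sub m i j)))"
  using ripple_correct[of m "bits j" "rev (bits i @ map (\<lambda>_. False) (bits j))"]
  by (simp add: add_sub_def bits_val_append)

lemma add_eq_add_sub: "bits (i + j) = trim (rev (fst (snd (add_sub False i j)) # snd (snd (add_sub False i j))))"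
proof -
  have "int (i + j) = int (bits_val (rev (fst (snd (add_sub False i j)) # snd (snd (add_sub False i j)))))"
    using add_sub_correct[of i False j] by (simp add: bits_val_append)
  then have "i + j = bits_val (rev (fst (snd (add_sub False i j)) # snd (snd (add_sub False i j))))"
    by (simp only: of_nat_eq_iff)
  then show ?thesis by (metis bits_bits_val)
qed

lemma bits_val_less: "bits_val l < 2 ^ length l"
  by (induction l) auto

text \<open>The output is below \<open>2 ^ length\<close>, so the final borrow is set exactly if the
  difference is negative. Otherwise the output is the difference itself.\<close>

lemma less_eq_add_sub: "i < j \<longleftrightarrow> fst (snd (add_sub True i j))"
  and diff_eq_add_sub: "\<not> i < j \<Longrightarrow> bits (i - j) = trim (rev (snd (snd (add_sub True i j))))"
proof -
  let ?o = "snd (snd (add_sub True i j))" and ?c = "fst (snd (add_sub True i j))"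
  have 1: "int i - int j = int (bits_val (rev ?o)) - 2 ^ length ?o * of_bool ?c"
    using add_sub_correct[of i True j] by simp
  have 2: "int (bits_val (rev ?o)) < 2 ^ length ?o"
    using bits_val_less[of "rev ?o"] by (metis length_rev of_nat_less_numeral_power_cancel_iff)
  show "i < j \<longleftrightarrow> ?c"
  proof (cases ?c)
    case True
    then have "int i - int j = int (bits_val (rev ?o)) - 2 ^ length ?o" using 1 by simp
    then show ?thesis using 2 True by linarith
  next
    case False
    then have "int i - int j = int (bits_val (rev ?o))" using 1 by simp
    then show ?thesis using False by linarith
  qed
  moreover assume "\<not> i < j"
  ultimately have "\<not> ?c" by simp
  then have "i - j = bits_val (rev ?o)" using 1 by simp
  then show "bits (i - j) = trim (rev ?o)" by (metis bits_bits_val)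
qed

lemma pt_add_sub:
  assumes "pt A \<mu> ea enc_nat f" "pt A \<mu> ea enc_nat g"
  shows "pt A \<mu> ea (enc_pair (enc_list enc_bool) (enc_pair enc_bool (enc_list enc_bool)))
    (\<lambda>x. add_sub m (f x) (g x))"
proof -
  let ?L = "enc_list enc_bool"
  let ?e = "enc_pair ?L ?L" and ?o = "enc_pair ?L (enc_pair enc_bool ?L)"
  define stp where "stp = (\<lambda>(x :: bool list \<times> bool list) a (l :: bool list) (r :: bool list \<times> bool \<times> bool list).
    let b = (case fst r of [] \<Rightarrow> False | b # _ \<Rightarrow> b); c = fst (snd r); a' = (a \<noteq> m) in
     (tl (fst r), a' \<and> b \<or> a' \<and> c \<or> b \<and> c, (a = (b = c)) # snd (snd r)))"
  have tl: "data_size (?L (tl l)) \<le> data_size (?L l)" for l by (cases l) auto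
  have grow: "data_size (?o (stp x a l r)) \<le> data_size (?o r) +
      (data_size (?e x) + data_size (enc_bool a) + data_size (?L l) + 2) ^ 3" for x a l r
  proof -
    have b: "data_size (enc_bool u) \<le> 3" for u by (rule size_bool)
    have "data_size (?o (stp x a l r)) \<le> data_size (?o r) + 8"
      using tl[of "fst r"] b[of "fst (snd (stp x a l r))"] b[of "hd (snd (snd (stp x a l r)))"]
      by (simp add: stp_def Let_def)
    also have "\<dots> \<le> data_size (?o r) + (data_size (?e x) + data_size (enc_bool a) + data_size (?L l) + 2) ^ 3"
      using power_mono[of 2 "data_size (?e x) + data_size (enc_bool a) + data_size (?L l) + 2" 3] by simp
    finally show ?thesis .
  qed
  have "ptime ?e ?o (\<lambda>z. (\<lambda>z l. ripple (m, snd z) l) z (rev (fst z @ map (\<lambda>_. False) (snd z))))"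
  proof (rule pt_list_rec_size[where F = "\<lambda>z l. ripple (m, snd z) l"
        and i = "\<lambda>z. (snd z, False, [])" and s = stp])
    show "ptime ?e ?L (\<lambda>z. rev (fst z @ map (\<lambda>_. False) (snd z)))" by (rule pt_intros)+
    show "ptime ?e ?o (\<lambda>z. (snd z, False, []))" by (rule pt_intros)+
    show "ptime (enc_pair ?e (enc_pair enc_bool (enc_pair ?L ?o))) ?o
     (\<lambda>z. stp (fst z) (fst (snd z)) (fst (snd (snd z))) (snd (snd (snd z))))"
      unfolding stp_def by (rule pt_intros pt_iff)+
    show "\<exists>c. \<forall>x a l r. data_size (?o (stp x a l r)) \<le> data_size (?o r) +
      (data_size (?e x) + data_size (enc_bool a) + data_size (?L l) + 2) ^ c" using grow by blast
  qed (simp_all add: stp_def Let_def)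
  from pt_comp[OF this pt_pair[OF assms[THEN pt_bits]]] show ?thesis by (simp add: add_sub_def)
qed

lemma pt_nat_add [pt_intros]:
  assumes "pt A \<mu> ea enc_nat f" "pt A \<mu> ea enc_nat g"
  shows "pt A \<mu> ea enc_nat (\<lambda>x. f x + g x)"
  by (rule pt_of_bits, unfold add_eq_add_sub) (rule pt_trim pt_intros pt_add_sub assms)+

lemma pt_nat_less [pt_intros]:
  assumes "pt A \<mu> ea enc_nat f" "pt A \<mu> ea enc_nat g"
  shows "pt A \<mu> ea enc_bool (\<lambda>x. f x < g x)"
  by (unfold less_eq_add_sub) (rule pt_intros pt_add_sub assms)+

lemma pt_nat_diff [pt_intros]:
  assumes "pt A \<mu> ea enc_nat f" "pt A \<mu> ea enc_nat g"
  shows "pt A \<mu> ea enc_nat (\<lambda>x. f x - g x)"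
proof (rule pt_of_bits)
  have "pt A \<mu> ea (enc_list enc_bool) (\<lambda>x. if f x < g x then [] else trim (rev (snd (snd (add_sub True (f x) (g x))))))"
    by (rule pt_intros pt_trim pt_add_sub assms)+
  moreover have "bits (f x - g x) = (if f x < g x then [] else trim (rev (snd (snd (add_sub True (f x) (g x))))))" for x
    using diff_eq_add_sub[of "f x" "g x"] by simp
  ultimately show "pt A \<mu> ea (enc_list enc_bool) (\<lambda>x. bits (f x - g x))" by presburger
qed

lemma pt_neg [pt_intros]: "pt A \<mu> ea enc_int f \<Longrightarrow> pt A \<mu> ea enc_bool (\<lambda>x. f x < 0)"
  using pt_fst[OF pt_cong[where ec = "enc_pair enc_bool enc_nat" and g = "\<lambda>x. (f x < 0, nat \<bar>f x\<bar>)"]]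
  by (force simp: enc_int_pair)

lemma pt_nat_abs [pt_intros]: "pt A \<mu> ea enc_int f \<Longrightarrow> pt A \<mu> ea enc_nat (\<lambda>x. nat \<bar>f x\<bar>)"
  using pt_snd[OF pt_cong[where ec = "enc_pair enc_bool enc_nat" and g = "\<lambda>x. (f x < 0, nat \<bar>f x\<bar>)"]]
  by (force simp: enc_int_pair)

definition signed :: "bool \<Rightarrow> nat \<Rightarrow> int" where
  "signed s m = (if s then - int m else int m)"

lemma pt_signed [pt_intros]:
  assumes "pt A \<mu> ea enc_bool s" "pt A \<mu> ea enc_nat m"
  shows "pt A \<mu> ea enc_int (\<lambda>x. signed (s x) (m x))"
proof -
  \<comment> \<open>Zero is encoded only with a nonnegative sign.\<close>
  have "pt A \<mu> ea (enc_pair enc_bool enc_nat) (\<lambda>x. (s x \<and> m x \<noteq> 0, m x))"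
    by (rule pt_intros pt_eq inj_encs assms)+
  then show ?thesis by (rule pt_cong) (simp add: enc_int_pair signed_def)
qed

lemma pt_uminus [pt_intros]:
  assumes "pt A \<mu> ea enc_int f" shows "pt A \<mu> ea enc_int (\<lambda>x. - f x)"
proof -
  have "pt A \<mu> ea enc_int (\<lambda>x. signed (\<not> f x < 0) (nat \<bar>f x\<bar>))" by (rule pt_intros assms)+
  then show ?thesis by (rule pt_cong) (auto simp: signed_def)
qed

lemma pt_int_add [pt_intros]:
  assumes f: "pt A \<mu> ea enc_int f" and g: "pt A \<mu> ea enc_int g"
  shows "pt A \<mu> ea enc_int (\<lambda>x. f x + g x)"
proof -
  let ?m = "\<lambda>x. nat \<bar>f x\<bar>" and ?n = "\<lambda>x. nat \<bar>g x\<bar>"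
  have "pt A \<mu> ea enc_int (\<lambda>x. if (f x < 0) = (g x < 0) then signed (f x < 0) (?m x + ?n x)
     else if ?m x < ?n x then signed (g x < 0) (?n x - ?m x) else signed (f x < 0) (?m x - ?n x))"
    by (rule pt_intros pt_iff assms)+
  then show ?thesis by (rule pt_cong) (auto simp: signed_def add.commute)
qed

lemma pt_int_diff [pt_intros]:
  assumes f: "pt A \<mu> ea enc_int f" and g: "pt A \<mu> ea enc_int g"
  shows "pt A \<mu> ea enc_int (\<lambda>x. f x - g x)"
  using pt_int_add[OF f pt_uminus[OF g]] by simp

lemma pt_int_less [pt_intros]:
  assumes f: "pt A \<mu> ea enc_int f" and g: "pt A \<mu> ea enc_int g"
  shows "pt A \<mu> ea enc_bool (\<lambda>x. f x < g x)"
  using pt_neg[OF pt_int_diff[OF f g]] by simp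

lemma pt_int_le [pt_intros]:
  assumes f: "pt A \<mu> ea enc_int f" and g: "pt A \<mu> ea enc_int g"
  shows "pt A \<mu> ea enc_bool (\<lambda>x. f x \<le> g x)"
  using pt_not[OF pt_int_less[OF g f]] by (simp add: not_less)

lemma pt_int_max [pt_intros]:
  assumes f: "pt A \<mu> ea enc_int f" and g: "pt A \<mu> ea enc_int g"
  shows "pt A \<mu> ea enc_int (\<lambda>x. max (f x) (g x))"
  unfolding max_def by (rule pt_intros assms)+

lemma pt_int_min [pt_intros]:
  assumes f: "pt A \<mu> ea enc_int f" and g: "pt A \<mu> ea enc_int g"
  shows "pt A \<mu> ea enc_int (\<lambda>x. min (f x) (g x))"
  unfolding min_def by (rule pt_intros assms)+

lemma pt_int_abs [pt_intros]:
  assumes f: "pt A \<mu> ea enc_int f" shows "pt A \<mu> ea enc_int (\<lambda>x. \<bar>f x\<bar>)"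
  unfolding abs_if by (rule pt_intros assms)+

lemma length_bits_le: "n < 2 ^ k \<Longrightarrow> length (bits n) \<le> k"
proof (induction k arbitrary: n)
  case (Suc k)
  then have "n div 2 < 2 ^ k" by auto
  from Suc.IH[OF this] show ?case by (subst bits.simps) simp
qed (simp add: bits.simps)

lemma less_length_bits: "n < 2 ^ length (bits n)"
  using bits_val_less[of "bits n"] by simp

lemma size_bools: "data_size (enc_list enc_bool l) \<le> 4 * length l + 1"
proof (induction l)
  case (Cons b l) then show ?case using size_bool[of b] by simp
qed simp

lemma size_enc_int: "data_size (enc_int i) \<le> 4 * length (bits (nat \<bar>i\<bar>)) + 5"
  using size_bool[of "i < 0"] size_bools[of "bits (nat \<bar>i\<bar>)"] by (simp add: enc_int_pair enc_nat_bits)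

lemma length_bits_le_size: "length (bits (nat \<bar>i\<bar>)) \<le> data_size (enc_int i)"
  using length_le_size[of "bits (nat \<bar>i\<bar>)" enc_bool] by (simp add: enc_int_pair enc_nat_bits)

lemma length_bits_add: "length (bits (nat \<bar>i + j\<bar>)) \<le> length (bits (nat \<bar>i\<bar>)) + length (bits (nat \<bar>j\<bar>)) + 1"
proof (rule length_bits_le)
  let ?k = "length (bits (nat \<bar>i\<bar>))" and ?l = "length (bits (nat \<bar>j\<bar>))"
  have "nat \<bar>i + j\<bar> \<le> nat \<bar>i\<bar> + nat \<bar>j\<bar>" by linarith
  also have "\<dots> < 2 ^ ?k + 2 ^ ?l" by (intro add_strict_mono less_length_bits)
  also have "\<dots> \<le> 2 ^ (?k + ?l) + 2 ^ (?k + ?l)" by (intro add_mono power_increasing) auto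
  finally show "nat \<bar>i + j\<bar> < 2 ^ (?k + ?l + 1)" by simp
qed

text \<open>The tree size is unsuitable as the growing quantity: adding -1 to a power of 2 turns all
  its zeros into ones, whose codes are larger. The number of digits grows additively and is
  polynomially related to the tree size.\<close>

lemma pt_sum_list [pt_intros]:
  assumes "pt A \<mu> ea (enc_list enc_int) f" shows "pt A \<mu> ea enc_int (\<lambda>x. sum_list (f x))"
proof -
  have grow: "length (bits (nat \<bar>a + r\<bar>)) \<le> length (bits (nat \<bar>r\<bar>)) +
    (data_size (enc_list enc_int x) + data_size (enc_int a) + data_size (enc_list enc_int l) + 2) ^ 1" for x a l r
    using length_bits_add[of a r] length_bits_le_size[of a] by simp
  have size: "data_size (enc_int r) \<le> (length (bits (nat \<bar>r\<bar>)) + 2) ^ 3" for r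
  proof -
    have "4 * n + 5 \<le> (n + 2) ^ 3" for n :: nat by (simp add: power3_eq_cube algebra_simps)
    then show ?thesis using size_enc_int[of r] le_trans by blast
  qed
  have "ptime (enc_list enc_int) enc_int (\<lambda>x. (\<lambda>_. sum_list) x x)"
    by (rule pt_list_rec[where F = "\<lambda>_. sum_list" and i = "\<lambda>_. 0" and xs = "\<lambda>x. x"
          and s = "\<lambda>x a l r. a + r" and \<sigma> = "\<lambda>i. length (bits (nat \<bar>i\<bar>))" and d = 3],
        (rule pt_intros)+, simp, simp, rule length_bits_le_size, rule size, intro exI[of _ 1] allI, rule grow)
  from pt_comp[OF this assms] show ?thesis by simp
qed

section \<open>Membership, length and suffixes of lists\<close>

lemma pt_mem:
  assumes "pt A \<mu> ea eb f" "pt A \<mu> ea (enc_list eb) l" "inj eb"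
  shows "pt A \<mu> ea enc_bool (\<lambda>x. f x \<in> set (l x))"
proof -
  have "ptime (enc_pair eb (enc_list eb)) enc_bool (\<lambda>z. list_ex (\<lambda>a. a = fst z) (snd z))"
    by (rule pt_intros pt_eq assms)+
  from pt_comp[OF this pt_pair[OF assms(1,2)]] show ?thesis by (simp add: list_ex_iff)
qed

lemma pt_remdups:
  assumes "pt A \<mu> ea (enc_list eb) f" "inj eb" shows "pt A \<mu> ea (enc_list eb) (\<lambda>x. remdups (f x))"
proof -
  have "ptime (enc_list eb) (enc_list eb) (\<lambda>x. (\<lambda>_. remdups) x x)"
    by (rule pt_list_rec_size[where F = "\<lambda>_. remdups" and i = "\<lambda>_. []" and xs = "\<lambda>x. x"
          and s = "\<lambda>x a l r. if a \<in> set l then r else a # r"], (rule pt_intros pt_mem assms)+)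
      (auto intro!: exI[of _ 1])
  from pt_comp[OF this assms(1)] show ?thesis by simp
qed

lemma pt_int_length [pt_intros]:
  assumes "pt A \<mu> ea (enc_list eb) f" shows "pt A \<mu> ea enc_int (\<lambda>x. int (length (f x)))"
proof -
  have "ptime (enc_list eb) enc_int (\<lambda>l. sum_list (map (\<lambda>_. 1) l))" by (rule pt_intros)+
  from pt_comp[OF this assms] show ?thesis by (simp add: sum_list_triv)
qed

lemma pt_length [pt_intros]:
  assumes "pt A \<mu> ea (enc_list eb) f" shows "pt A \<mu> ea enc_nat (\<lambda>x. length (f x))"
  using pt_nat_abs[OF pt_int_length[OF assms]] by simp

primrec tails :: "'a list \<Rightarrow> 'a list list" where
  "tails [] = [[]]"
| "tails (a # l) = (a # l) # tails l"

lemma set_tails: "set (tails l) = {drop k l |k. True}"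
proof (induction l)
  case (Cons a l)
  have "{drop k (a # l) |k. True} = insert (a # l) {drop k l |k. True}"
  proof (intro equalityI subsetI)
    fix m assume "m \<in> {drop k (a # l) |k. True}"
    then obtain k where "m = drop k (a # l)" by blast
    then show "m \<in> insert (a # l) {drop k l |k. True}" by (cases k) auto
  next
    fix m assume "m \<in> insert (a # l) {drop k l |k. True}"
    then consider "m = drop 0 (a # l)" | k where "m = drop (Suc k) (a # l)" by auto
    then show "m \<in> {drop k (a # l) |k. True}" by cases blast+
  qed
  then show ?case using Cons by simp
qed simp

lemma length_tails [simp]: "length (tails l) = length l + 1" by (induction l) auto

lemma pt_tails [pt_intros]:
  assumes "pt A \<mu> ea (enc_list eb) f" shows "pt A \<mu> ea (enc_list (enc_list eb)) (\<lambda>x. tails (f x))"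
proof -
  have "ptime (enc_list eb) (enc_list (enc_list eb)) (\<lambda>x. (\<lambda>_. tails) x x)"
    by (rule pt_list_rec_size[where F = "\<lambda>_. tails" and i = "\<lambda>_. [[]]" and xs = "\<lambda>x. x"
          and s = "\<lambda>x a l r. (a # l) # r"], (rule pt_intros)+)
      (auto intro!: exI[of _ 1])
  from pt_comp[OF this assms] show ?thesis by simp
qed

section \<open>The cost of relabelling a path\<close>

text \<open>
  Relabelling consecutive edges from \<open>l, l'\<close> to \<open>x, x'\<close> requires delaying the second edge beyond the
  label \<open>x + 1\<close> to which the first one pushes it, and advancing the first edge beyond the label
  \<open>x' - 1\<close> to which the second one pulls it.
\<close>

definition tc :: "int \<Rightarrow> int \<Rightarrow> int \<Rightarrow> int \<Rightarrow> int" where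
  "tc l x l' x' = max 0 (x' - max l' (x + 1)) + max 0 (min l (x' - 1) - x)"

text \<open>The last edge has no successor that pulls it and pays for its whole advance; likewise
  \<open>pcost\<close> adds the whole delay of the first edge. Keeping this delay apart makes
  \<open>scost\<close> change only by its front term when an edge is prepended, as the dynamic
  program requires.\<close>

primrec scost :: "(int \<times> int) list \<Rightarrow> int" where
  "scost [] = 0"
| "scost (a # r) = (case r of [] \<Rightarrow> max 0 (fst a - snd a) | b # _ \<Rightarrow> tc (fst a) (snd a) (fst b) (snd b)) + scost r"

definition pcost :: "(int \<times> int) list \<Rightarrow> int" where
  "pcost q = (case q of [] \<Rightarrow> 0 | a # _ \<Rightarrow> max 0 (snd a - fst a)) + scost q"

lemma tc_nonneg: "tc l x l' x' \<ge> 0" by (simp add: tc_def)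

lemma scost_nonneg: "scost q \<ge> 0"
  by (induction q) (auto split: list.splits simp: tc_nonneg)

lemma pcost_nonneg: "pcost q \<ge> 0"
  using scost_nonneg[of q] by (auto simp: pcost_def split: list.splits)

lemma scost_sum: "scost q = (\<Sum>m<length q - 1. tc (fst (q ! m)) (snd (q ! m)) (fst (q ! Suc m)) (snd (q ! Suc m)))
   + (if q = [] then 0 else max 0 (fst (q ! (length q - 1)) - snd (q ! (length q - 1))))"
proof (induction q)
  case (Cons a r)
  show ?case
  proof (cases r)
    case (Cons b s)
    have "(\<Sum>m<length (a # r) - 1. tc (fst ((a # r) ! m)) (snd ((a # r) ! m)) (fst ((a # r) ! Suc m)) (snd ((a # r) ! Suc m)))
      = tc (fst a) (snd a) (fst b) (snd b) + (\<Sum>m<length r - 1. tc (fst (r ! m)) (snd (r ! m)) (fst (r ! Suc m)) (snd (r ! Suc m)))"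
    proof -
      have len: "length (a # r) - 1 = Suc (length r - 1)" using Cons by simp
      show ?thesis unfolding len sum.lessThan_Suc_shift using Cons by simp
    qed
    then show ?thesis using Cons.IH Cons by simp
  qed simp
qed simp

text \<open>The delay of the second edge consists of the part by which the first edge pushes it, at
  most the delay of the first edge because \<open>fst a < fst b\<close>, and of the rest, which
  \<open>tc\<close> charges.\<close>

lemma pcost_tl: assumes "fst a < fst b" "snd a < snd b" shows "pcost (b # l) \<le> pcost (a # b # l)"
  using assms by (simp add: pcost_def tc_def max_def min_def)

lemma pcost_drop:
  assumes "sorted_wrt (<) (map fst q)" "sorted_wrt (<) (map snd q)"
  shows "pcost (drop n q) \<le> pcost q"
  using assms
proof (induction n arbitrary: q)
  case (Suc n)
  show ?case
  proof (cases q)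
    case (Cons a r)
    have "pcost r \<le> pcost q"
    proof (cases r)
      case Nil
      then show ?thesis using pcost_nonneg[of q] by (simp add: pcost_def)
    next
      case (Cons b s)
      then show ?thesis using Suc.prems \<open>q = a # r\<close> pcost_tl[of a b s] by simp
    qed
    then show ?thesis using Suc.IH[of r] Suc.prems Cons by simp
  qed (use Suc in simp)
qed simp

lemma pcost_le_sum: "sorted_wrt (<) (map fst q) \<Longrightarrow> sorted_wrt (<) (map snd q) \<Longrightarrow> pcost q \<le> (\<Sum>z\<leftarrow>q. \<bar>snd z - fst z\<bar>)"
proof -
  have *: "scost q \<le> (case q of [] \<Rightarrow> 0 | a # _ \<Rightarrow> max 0 (fst a - snd a)) + (\<Sum>z\<leftarrow>tl q. \<bar>snd z - fst z\<bar>)"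
    if "sorted_wrt (<) (map fst q)" "sorted_wrt (<) (map snd q)" for q
    using that
  proof (induction q)
    case (Cons a r)
    show ?case
    proof (cases r)
      case (Cons b s)
      have "scost r \<le> max 0 (fst b - snd b) + (\<Sum>z\<leftarrow>s. \<bar>snd z - fst z\<bar>)" using Cons.IH Cons.prems Cons by simp
      moreover have "tc (fst a) (snd a) (fst b) (snd b) \<le> max 0 (fst a - snd a) + max 0 (snd b - fst b)"
        using Cons.prems Cons by (simp add: tc_def max_def min_def)
      ultimately show ?thesis using Cons by (simp add: max_def abs_if split: if_splits)
    qed simp
  qed simp
  assume "sorted_wrt (<) (map fst q)" "sorted_wrt (<) (map snd q)"
  from *[OF this] show ?thesis
  proof (cases q)
    case (Cons a r)
    have "scost q \<le> max 0 (fst a - snd a) + (\<Sum>z\<leftarrow>r. \<bar>snd z - fst z\<bar>)"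
      using *[OF \<open>sorted_wrt (<) (map fst q)\<close> \<open>sorted_wrt (<) (map snd q)\<close>] Cons by simp
    moreover have "pcost q = max 0 (snd a - fst a) + scost q" using Cons by (simp add: pcost_def)
    moreover have "\<bar>snd a - fst a\<bar> = max 0 (fst a - snd a) + max 0 (snd a - fst a)" by linarith
    moreover have "(\<Sum>z\<leftarrow>q. \<bar>snd z - fst z\<bar>) = \<bar>snd a - fst a\<bar> + (\<Sum>z\<leftarrow>r. \<bar>snd z - fst z\<bar>)" using Cons by simp
    ultimately show ?thesis by linarith
  qed (simp add: pcost_def)
qed

lemma pcost_same: "sorted_wrt (<) l \<Longrightarrow> pcost (zip l l) = 0"
proof -
  have "scost (zip l l) = 0" if "sorted_wrt (<) l" for l
    using that
  proof (induction l)
    case (Cons a r)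
    then show ?case by (cases r) (auto simp: tc_def)
  qed simp
  moreover have "(case zip l l of [] \<Rightarrow> 0 | a # _ \<Rightarrow> max 0 (snd a - fst a)) = (0 :: int)" by (cases l) auto
  ultimately show "sorted_wrt (<) l \<Longrightarrow> pcost (zip l l) = 0" by (simp add: pcost_def)
qed

text \<open>Effect of one shift on a pair of consecutive edges. If both edges are pushed or pulled
  together, the pair does not become more expensive; only a pair of which one edge is shifted while
  the other stays can be charged.\<close>

lemma tc_push: "x < y \<Longrightarrow> tc l (max x c) l' (max y (c + 1)) \<le> tc l x l' y"
  unfolding tc_def max_def min_def by (smt (verit))

lemma tc_pull: "x < y \<Longrightarrow> tc l (min x c) l' (min y (c + 1)) \<le> tc l x l' y"
  unfolding tc_def max_def min_def by (smt (verit))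

lemma tc_delay: "l < l' \<Longrightarrow> x < y \<Longrightarrow> 0 \<le> d \<Longrightarrow> tc l x l' (y + d) \<le> tc l x l' y + d"
  unfolding tc_def max_def min_def by (smt (verit))

lemma tc_advance: "l < l' \<Longrightarrow> x < y \<Longrightarrow> 0 \<le> d \<Longrightarrow> tc l (x - d) l' y \<le> tc l x l' y + d"
  unfolding tc_def max_def min_def by (smt (verit))

section \<open>Labels and cost after a single shift\<close>

lemma strict_int_gap:
  assumes "sorted_wrt (<) (X :: int list)" "i \<le> j" "j < length X"
  shows "X ! i + int (j - i) \<le> X ! j"
  using assms(2,3)
proof (induction j rule: dec_induct)
  case (step m)
  have "X ! m < X ! Suc m" using assms(1) step by (simp add: sorted_wrt_nth_less)
  then show ?case using step by (simp add: Suc_diff_le)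
qed simp

lemma length_shift_path [simp]: "length (shift_path j d p) = length p"
  by (simp add: shift_path_def)

lemma fst_shift_path [simp]: "map fst (shift_path j d p) = map fst p"
  by (rule nth_equalityI) (auto simp: shift_path_def)

lemma snd_shift_path:
  "m < length p \<Longrightarrow> snd (shift_path j d p ! m) = (if m = j then snd (p ! j) + d
     else if j < m then max (snd (p ! m)) (snd (p ! j) + d + int (m - j))
     else min (snd (p ! m)) (snd (p ! j) + d - int (j - m)))"
  by (simp add: shift_path_def)

context
  fixes p :: "('b \<times> int) list" and j :: nat and d :: int
  assumes sorted: "sorted_wrt (<) (map snd p)" and j: "j < length p"
begin

lemma shift_gap: "i \<le> m \<Longrightarrow> m < length p \<Longrightarrow> snd (p ! i) + int (m - i) \<le> snd (p ! m)"
  using strict_int_gap[OF sorted, of i m] by simp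

text \<open>Labels increase by at least one per edge, so a delay pulls none of the edges before
  \<open>j\<close>, and edge \<open>j\<close> itself fits the formula for the later ones.\<close>

lemma shift_delay_nth:
  assumes "d \<ge> 0" "m < length p"
  shows "snd (shift_path j d p ! m) =
     (if m < j then snd (p ! m) else max (snd (p ! m)) (snd (p ! j) + d + int m - int j))"
proof -
  consider "m < j" | "m = j" | "j < m" by linarith
  then show ?thesis
  proof cases
    case 1
    then show ?thesis using shift_gap[of m j] assms j by (simp add: snd_shift_path)
  qed (use assms in \<open>simp_all add: snd_shift_path max_def\<close>)
qed

lemma shift_advance_nth:
  assumes "d \<le> 0" "m < length p"
  shows "snd (shift_path j d p ! m) =
     (if j < m then snd (p ! m) else min (snd (p ! m)) (snd (p ! j) + d + int m - int j))"
proof -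
  consider "m < j" | "m = j" | "j < m" by linarith
  then show ?thesis
  proof cases
    case 3
    then show ?thesis using shift_gap[of j m] assms j by (simp add: snd_shift_path)
  qed (use assms in \<open>simp_all add: snd_shift_path min_def\<close>)
qed

lemma shift_nth_less: "Suc m < length p \<Longrightarrow> snd (p ! m) < snd (p ! Suc m)"
  using shift_gap[of m "Suc m"] by simp

lemma sorted_shift_path: "sorted_wrt (<) (map snd (shift_path j d p))"
proof (rule sorted_wrt_iff_nth_Suc_transp[THEN iffD2])
  show "transp ((<) :: int \<Rightarrow> int \<Rightarrow> bool)" by (simp add: transp_on_less)
  show "\<forall>i. Suc i < length (map snd (shift_path j d p)) \<longrightarrow>
    map snd (shift_path j d p) ! i < map snd (shift_path j d p) ! Suc i"
  proof (intro allI impI)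
    fix i assume i: "Suc i < length (map snd (shift_path j d p))"
    then have i: "Suc i < length p" by simp
    show "map snd (shift_path j d p) ! i < map snd (shift_path j d p) ! Suc i"
      using shift_nth_less[OF i] i by (cases "d \<ge> 0") (auto simp: shift_delay_nth shift_advance_nth max_def min_def)
  qed
qed

text \<open>Exactly one term is charged with \<open>\<bar>d\<bar>\<close>. For a delay it is the
  pair that ends in edge \<open>j\<close>, or the term of the first edge if \<open>j = 0\<close>;
  for an advance it is the pair that begins with edge \<open>j\<close>, or the term of the last
  edge.\<close>

lemma pcost_shift_path:
  assumes L: "sorted_wrt (<) L" "length L = length p"
  shows "pcost (zip L (map snd (shift_path j d p))) \<le> pcost (zip L (map snd p)) + \<bar>d\<bar>"
proof -
  let ?n = "length p"
  define X where "X m = snd (p ! m)" for m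
  define Y where "Y m = snd (shift_path j d p ! m)" for m
  have L': "L ! m < L ! Suc m" if "Suc m < ?n" for m
    using L that by (simp add: sorted_wrt_nth_less)
  have n: "?n > 0" using j by linarith
  have form: "pcost (zip L (map snd q)) = max 0 (snd (q ! 0) - L ! 0) +
     (\<Sum>m<?n - 1. tc (L ! m) (snd (q ! m)) (L ! Suc m) (snd (q ! Suc m))) + max 0 (L ! (?n - 1) - snd (q ! (?n - 1)))"
    if q: "length q = ?n" for q :: "('b \<times> int) list"
  proof -
    have "length (zip L (map snd q)) = ?n" using q L by simp
    then have ne: "zip L (map snd q) \<noteq> []" using n by (metis length_0_conv less_numeral_extra(3))
    then have "(case zip L (map snd q) of [] \<Rightarrow> 0 | a # _ \<Rightarrow> max 0 (snd a - fst a)) = max 0 (snd (q ! 0) - L ! 0)"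
      using ne by (cases L; cases q) auto
    moreover have "(\<Sum>m<?n - 1. tc (fst (zip L (map snd q) ! m)) (snd (zip L (map snd q) ! m))
        (fst (zip L (map snd q) ! Suc m)) (snd (zip L (map snd q) ! Suc m)))
      = (\<Sum>m<?n - 1. tc (L ! m) (snd (q ! m)) (L ! Suc m) (snd (q ! Suc m)))"
      using q L by (intro sum.cong) auto
    ultimately show ?thesis unfolding pcost_def scost_sum using q L n ne by simp
  qed
  have "max 0 (Y 0 - L ! 0) + (\<Sum>m<?n - 1. tc (L ! m) (Y m) (L ! Suc m) (Y (Suc m))) + max 0 (L ! (?n - 1) - Y (?n - 1))
    \<le> max 0 (X 0 - L ! 0) + (\<Sum>m<?n - 1. tc (L ! m) (X m) (L ! Suc m) (X (Suc m))) + max 0 (L ! (?n - 1) - X (?n - 1)) + \<bar>d\<bar>"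
  proof (cases "d \<ge> 0")
    case True
    have Y: "Y m = (if m < j then X m else max (X m) (X j + d + int m - int j))" if "m < ?n" for m
      using shift_delay_nth[OF True that] by (simp add: X_def Y_def)
    have t: "tc (L ! m) (Y m) (L ! Suc m) (Y (Suc m)) \<le> tc (L ! m) (X m) (L ! Suc m) (X (Suc m)) + (if Suc m = j then d else 0)"
      if m: "m \<in> {..<?n - 1}" for m
    proof -
      have m: "Suc m < ?n" using m by simp
      have X: "X m < X (Suc m)" using shift_nth_less[OF m] by (simp add: X_def)
      consider "Suc m < j" | "Suc m = j" | "j \<le> m" by linarith
      then show ?thesis
      proof cases
        case 1 then show ?thesis using m by (simp add: Y)
      next
        case 2 then show ?thesis using m tc_delay[OF L'[OF m] X True] True by (simp add: Y max_def)
      next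
        case 3
        then show ?thesis using m tc_push[OF X, of "L ! m" "X j + d + int m - int j" "L ! Suc m"]
          by (simp add: Y algebra_simps)
      qed
    qed
    have "(\<Sum>m<?n - 1. tc (L ! m) (Y m) (L ! Suc m) (Y (Suc m))) \<le>
      (\<Sum>m<?n - 1. tc (L ! m) (X m) (L ! Suc m) (X (Suc m)) + (if Suc m = j then d else 0))" by (rule sum_mono[OF t])
    also have "\<dots> = (\<Sum>m<?n - 1. tc (L ! m) (X m) (L ! Suc m) (X (Suc m))) + (\<Sum>m<?n - 1. if Suc m = j then d else 0)"
      by (rule sum.distrib)
    also have "(\<Sum>m<?n - 1. if Suc m = j then d else 0) \<le> (if j = 0 then 0 else d)"
    proof (cases j)
      case (Suc i)
      have "(\<Sum>m<?n - 1. if Suc m = j then d else 0) = (\<Sum>m<?n - 1. if i = m then d else 0)" using Suc by (intro sum.cong) auto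
      then show ?thesis using True Suc by (simp add: sum.delta')
    qed simp
    finally have s: "(\<Sum>m<?n - 1. tc (L ! m) (Y m) (L ! Suc m) (Y (Suc m))) \<le>
      (\<Sum>m<?n - 1. tc (L ! m) (X m) (L ! Suc m) (X (Suc m))) + (if j = 0 then 0 else d)" by simp
    have f: "max 0 (Y 0 - L ! 0) \<le> max 0 (X 0 - L ! 0) + (if j = 0 then d else 0)"
      by (subst Y[OF n]) (use True in auto)
    have n1: "?n - 1 < ?n" using n by linarith
    have l: "max 0 (L ! (?n - 1) - Y (?n - 1)) \<le> max 0 (L ! (?n - 1) - X (?n - 1))"
    proof -
      have "X (?n - 1) \<le> Y (?n - 1)" unfolding Y[OF n1] by (simp del: One_nat_def)
      then show ?thesis by linarith
    qed
    show ?thesis using s f l True by (smt (verit))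
  next
    case False
    then have d: "d \<le> 0" by simp
    have Y: "Y m = (if j < m then X m else min (X m) (X j + d + int m - int j))" if "m < ?n" for m
      using shift_advance_nth[OF d that] by (simp add: X_def Y_def)
    have t: "tc (L ! m) (Y m) (L ! Suc m) (Y (Suc m)) \<le> tc (L ! m) (X m) (L ! Suc m) (X (Suc m)) + (if j = m then - d else 0)"
      if m: "m \<in> {..<?n - 1}" for m
    proof -
      have m: "Suc m < ?n" using m by simp
      have X: "X m < X (Suc m)" using shift_nth_less[OF m] by (simp add: X_def)
      consider "j < m" | "m = j" | "m < j" by linarith
      then show ?thesis
      proof cases
        case 1 then show ?thesis using m by (simp add: Y)
      next
        case 2 then show ?thesis using m tc_advance[OF L'[OF m] X, of "- d"] d by (simp add: Y min_def)
      next
        case 3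
        then show ?thesis using m tc_pull[OF X, of "L ! m" "X j + d + int m - int j" "L ! Suc m"]
          by (simp add: Y algebra_simps)
      qed
    qed
    have "(\<Sum>m<?n - 1. tc (L ! m) (Y m) (L ! Suc m) (Y (Suc m))) \<le>
      (\<Sum>m<?n - 1. tc (L ! m) (X m) (L ! Suc m) (X (Suc m)) + (if j = m then - d else 0))" by (rule sum_mono[OF t])
    also have "\<dots> = (\<Sum>m<?n - 1. tc (L ! m) (X m) (L ! Suc m) (X (Suc m))) + (\<Sum>m<?n - 1. if j = m then - d else 0)"
      by (rule sum.distrib)
    also have "(\<Sum>m<?n - 1. if j = m then - d else 0) = (if j < ?n - 1 then - d else 0)"
      by (simp add: sum.delta')
    finally have s: "(\<Sum>m<?n - 1. tc (L ! m) (Y m) (L ! Suc m) (Y (Suc m))) \<le>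
      (\<Sum>m<?n - 1. tc (L ! m) (X m) (L ! Suc m) (X (Suc m))) + (if j < ?n - 1 then - d else 0)" by simp
    have f: "max 0 (Y 0 - L ! 0) \<le> max 0 (X 0 - L ! 0)"
      by (subst Y[OF n]) (use d in auto)
    have n1: "?n - 1 < ?n" using n by linarith
    have l: "max 0 (L ! (?n - 1) - Y (?n - 1)) \<le> max 0 (L ! (?n - 1) - X (?n - 1)) + (if j < ?n - 1 then 0 else - d)"
    proof (cases "j < ?n - 1")
      case True then show ?thesis by (subst Y[OF n1]) simp
    next
      case False
      then have "j = ?n - 1" using j by linarith
      then have "Y (?n - 1) = min (X (?n - 1)) (X (?n - 1) + d)" unfolding Y[OF n1] by simp
      then show ?thesis using False d by (simp del: One_nat_def)
    qed
    show ?thesis using s f l d by (smt (verit))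
  qed
  then show ?thesis unfolding form[OF refl] form[OF length_shift_path] X_def Y_def .
qed

end

section \<open>Sequences of shifts on the base paths\<close>

text \<open>The digraph never changes and new labels are determined by the base paths, so operations
  are studied on the list of paths alone.\<close>

primrec pshifts :: "('b \<times> int) list list \<Rightarrow> 'b shift list \<Rightarrow> ('b \<times> int) list list \<Rightarrow> bool" where
  "pshifts P [] P' \<longleftrightarrow> P' = P"
| "pshifts P (\<sigma> # \<sigma>s) P' \<longleftrightarrow> (\<exists>j. fst \<sigma> < length P \<and> j < length (P ! fst \<sigma>) \<and> P ! fst \<sigma> ! j = fst (snd \<sigma>) \<and>
     pshifts (P[fst \<sigma> := shift_path j (snd (snd \<sigma>)) (P ! fst \<sigma>)]) \<sigma>s P')"

lemma pshifts_append: "pshifts P (\<sigma>s @ \<tau>s) Q \<longleftrightarrow> (\<exists>R. pshifts P \<sigma>s R \<and> pshifts R \<tau>s Q)"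
  by (induction \<sigma>s arbitrary: P) auto

lemma set_base_paths_simps [simp]:
  "base_paths (set_base_paths P G) = P" "digraph_of (set_base_paths P G) = digraph_of G"
  "set_base_paths P (set_base_paths Q G) = set_base_paths P G"
  by (simp_all add: set_base_paths_def)

text \<open>The empty sequence is separate because the labels of \<open>G\<close> outside its arcs
  are arbitrary, whereas \<open>set_base_paths\<close> makes them empty for paths along
  arcs.\<close>

lemma shifts_to_iff_pshifts:
  "shifts_to G \<sigma>s G' \<longleftrightarrow>
     (\<exists>P'. pshifts (base_paths G) \<sigma>s P' \<and> G' = (if \<sigma>s = [] then G else set_base_paths P' G))"
proof (induction \<sigma>s arbitrary: G)
  case (Cons \<sigma> \<sigma>s)
  obtain i et d where s: "\<sigma> = (i, et, d)" by (metis prod_cases3)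
  let ?Q = "\<lambda>j. (base_paths G)[i := shift_path j d (base_paths G ! i)]"
  let ?c = "\<lambda>j. i < length (base_paths G) \<and> j < length (base_paths G ! i) \<and> base_paths G ! i ! j = et"
  have IH: "shifts_to (set_base_paths P G) \<sigma>s G' \<longleftrightarrow> (\<exists>P'. pshifts P \<sigma>s P' \<and> G' = set_base_paths P' G)" for P
    unfolding Cons.IH by (cases \<sigma>s) auto
  have "shifts_to G (\<sigma> # \<sigma>s) G' \<longleftrightarrow> (\<exists>j. ?c j \<and> shifts_to (set_base_paths (?Q j) G) \<sigma>s G')"
    by (auto simp: s shift_to_def)
  also have "\<dots> \<longleftrightarrow> (\<exists>j. ?c j \<and> (\<exists>P'. pshifts (?Q j) \<sigma>s P' \<and> G' = set_base_paths P' G))"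
    unfolding IH ..
  also have "\<dots> \<longleftrightarrow> (\<exists>P'. pshifts (base_paths G) (\<sigma> # \<sigma>s) P' \<and> G' = (if \<sigma> # \<sigma>s = [] then G else set_base_paths P' G))"
    unfolding s by auto
  finally show ?case .
qed simp

definition tcost :: "('b \<times> int) list list \<Rightarrow> ('b \<times> int) list list \<Rightarrow> int" where
  "tcost P0 P = (\<Sum>i<length P0. pcost (zip (map snd (P0 ! i)) (map snd (P ! i))))"

definition same_arcs :: "('b \<times> int) list list \<Rightarrow> ('b \<times> int) list list \<Rightarrow> bool" where
  "same_arcs P0 P \<longleftrightarrow> length P = length P0 \<and>
     (\<forall>i<length P0. map fst (P ! i) = map fst (P0 ! i) \<and> sorted_wrt (<) (map snd (P ! i)))"

lemma tcost_same: "same_arcs P P \<Longrightarrow> tcost P P = 0"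
  by (simp add: tcost_def same_arcs_def pcost_same)

text \<open>Potential argument: every operation raises \<open>tcost\<close> by at most its own cost.
  Starting from the given paths, where \<open>tcost\<close> is 0, this makes \<open>tcost\<close> a
  lower bound on the cost of any sequence with the same result.\<close>

lemma pshifts_cost:
  assumes "same_arcs P0 P0" "same_arcs P0 P" "pshifts P \<sigma>s P'"
  shows "same_arcs P0 P' \<and> tcost P0 P' \<le> tcost P0 P + cost \<sigma>s"
  using assms(2,3)
proof (induction \<sigma>s arbitrary: P)
  case Nil
  then show ?case by (simp add: cost_def)
next
  case (Cons \<sigma> \<sigma>s)
  obtain i et d where s: "\<sigma> = (i, et, d)" by (metis prod_cases3)
  obtain j where j: "i < length P" "j < length (P ! i)"
    and rest: "pshifts (P[i := shift_path j d (P ! i)]) \<sigma>s P'" using Cons.prems s by auto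
  let ?P = "P[i := shift_path j d (P ! i)]"
  have i: "i < length P0" and len: "length P = length P0" using Cons.prems j by (auto simp: same_arcs_def)
  have srt: "sorted_wrt (<) (map snd (P ! i))" "sorted_wrt (<) (map snd (P0 ! i))"
    and "map fst (P ! i) = map fst (P0 ! i)"
    using Cons.prems(1) assms(1) i by (auto simp: same_arcs_def)
  then have leni: "length (P0 ! i) = length (P ! i)" by (metis length_map)
  have sa: "same_arcs P0 ?P"
    using Cons.prems(1) i sorted_shift_path[OF srt(1) j(2)] by (auto simp: same_arcs_def nth_list_update)
  have "tcost P0 ?P \<le> tcost P0 P + \<bar>d\<bar>"
  proof -
    have "tcost P0 ?P \<le> (\<Sum>m<length P0. pcost (zip (map snd (P0 ! m)) (map snd (P ! m))) + (if m = i then \<bar>d\<bar> else 0))"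
      unfolding tcost_def
    proof (rule sum_mono)
      fix m assume "m \<in> {..<length P0}"
      then show "pcost (zip (map snd (P0 ! m)) (map snd (?P ! m))) \<le>
        pcost (zip (map snd (P0 ! m)) (map snd (P ! m))) + (if m = i then \<bar>d\<bar> else 0)"
        using pcost_shift_path[OF srt(1) j(2), of "map snd (P0 ! i)" d] srt leni len i by (auto simp: nth_list_update)
    qed
    also have "\<dots> = tcost P0 P + \<bar>d\<bar>" using i by (simp add: sum.distrib tcost_def sum.delta)
    finally show ?thesis .
  qed
  with Cons.IH[OF sa rest] show ?case by (simp add: cost_def s shift_amount_def)
qed

text \<open>Shows that the labels produced by one-sided operations satisfy
  \<open>ok\<close>.\<close>

lemma pshifts_sign:
  assumes "same_arcs P0 P" "pshifts P \<sigma>s P'" "i < length P" "m < length (P ! i)"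
  shows "(\<forall>\<sigma>\<in>set \<sigma>s. shift_amount \<sigma> \<ge> 0) \<Longrightarrow> snd (P ! i ! m) \<le> snd (P' ! i ! m)"
    and "(\<forall>\<sigma>\<in>set \<sigma>s. shift_amount \<sigma> \<le> 0) \<Longrightarrow> snd (P' ! i ! m) \<le> snd (P ! i ! m)"
proof -
  have "((\<forall>\<sigma>\<in>set \<sigma>s. shift_amount \<sigma> \<ge> 0) \<longrightarrow> snd (P ! i ! m) \<le> snd (P' ! i ! m)) \<and>
    ((\<forall>\<sigma>\<in>set \<sigma>s. shift_amount \<sigma> \<le> 0) \<longrightarrow> snd (P' ! i ! m) \<le> snd (P ! i ! m))"
    using assms
  proof (induction \<sigma>s arbitrary: P)
    case (Cons \<sigma> \<sigma>s)
    obtain k et d where s: "\<sigma> = (k, et, d)" by (metis prod_cases3)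
    obtain j where j: "k < length P" "j < length (P ! k)"
      and rest: "pshifts (P[k := shift_path j d (P ! k)]) \<sigma>s P'" using Cons.prems s by auto
    let ?P = "P[k := shift_path j d (P ! k)]"
    have srt: "sorted_wrt (<) (map snd (P ! k))" using Cons.prems(1) j by (auto simp: same_arcs_def)
    have sa: "same_arcs P0 ?P"
      using Cons.prems(1) j sorted_shift_path[OF srt j(2)] by (auto simp: same_arcs_def nth_list_update)
    have m: "m < length (?P ! i)" using Cons.prems(3,4) by (cases "i = k") simp_all
    have 1: "d \<ge> 0 \<Longrightarrow> snd (P ! i ! m) \<le> snd (?P ! i ! m)"
      using Cons.prems(3,4) shift_delay_nth[OF srt j(2), of d m] by (cases "i = k") auto
    have 2: "d \<le> 0 \<Longrightarrow> snd (?P ! i ! m) \<le> snd (P ! i ! m)"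
      using Cons.prems(3,4) shift_advance_nth[OF srt j(2), of d m] by (cases "i = k") auto
    show ?case using Cons.IH[OF sa rest _ m] Cons.prems(3) 1 2 by (auto simp: s shift_amount_def)
  qed simp
  then show "(\<forall>\<sigma>\<in>set \<sigma>s. shift_amount \<sigma> \<ge> 0) \<Longrightarrow> snd (P ! i ! m) \<le> snd (P' ! i ! m)"
    and "(\<forall>\<sigma>\<in>set \<sigma>s. shift_amount \<sigma> \<le> 0) \<Longrightarrow> snd (P' ! i ! m) \<le> snd (P ! i ! m)" by auto
qed

section \<open>Optimal shift sequences for a given relabelling\<close>

text \<open>The component of type \<open>'c\<close> carries data that shifts ignore, such as the
  ends of the arc.\<close>

type_synonym ('b, 'c) prof = "(('b \<times> int \<times> 'c) \<times> int) list"

abbreviation arc_of :: "('b \<times> int \<times> 'c) \<times> int \<Rightarrow> 'b" where "arc_of z \<equiv> fst (fst z)"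
abbreviation old :: "('b \<times> int \<times> 'c) \<times> int \<Rightarrow> int" where "old z \<equiv> fst (snd (fst z))"
abbreviation new :: "('b \<times> int \<times> 'c) \<times> int \<Rightarrow> int" where "new z \<equiv> snd z"

definition labs :: "('b, 'c) prof \<Rightarrow> (int \<times> int) list" where
  "labs q = map (\<lambda>z. (old z, new z)) q"

text \<open>Advances run from the last edge to the first, so each edge has already been pulled to
  \<open>c\<close> by its successor and pays only for the rest.\<close>

primrec adv_ops :: "nat \<Rightarrow> ('b, 'c) prof \<Rightarrow> 'b shift list" where
  "adv_ops i [] = []"
| "adv_ops i (z # r) = adv_ops i r @
     (let c = (case r of [] \<Rightarrow> old z | w # _ \<Rightarrow> min (old z) (new w - 1)) in
      if new z < c then [(i, (arc_of z, c), new z - c)] else [])"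

text \<open>Delays run from the first edge to the last. Here \<open>c\<close> is where the edge
  stands after all advances and the push by its predecessor.\<close>

primrec del_ops :: "nat \<Rightarrow> ('b, 'c) prof \<Rightarrow> 'b shift list" where
  "del_ops i [] = []"
| "del_ops i (z # r) =
     (case r of [] \<Rightarrow> [] | w # _ \<Rightarrow>
       (let c = max (min (old w) (new w)) (new z + 1) in
        if c < new w then [(i, (arc_of w, c), new w - c)] else [])) @ del_ops i r"

definition prof_ops :: "nat \<Rightarrow> ('b, 'c) prof \<Rightarrow> 'b shift list" where
  "prof_ops i q = adv_ops i q @ (case q of [] \<Rightarrow> [] | z # _ \<Rightarrow>
     (if old z < new z then [(i, (arc_of z, old z), new z - old z)] else [])) @ del_ops i q"

text \<open>\<open>pull\<close> and \<open>push\<close> describe the effect of a shift on the parts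
  of a path before and after an edge that receives label \<open>c\<close>, without the indices of
  \<open>shift_path\<close>.\<close>

primrec pull :: "('b \<times> int) list \<Rightarrow> int \<Rightarrow> ('b \<times> int) list" where
  "pull [] c = []"
| "pull (a # l) c = (fst a, min (snd a) (c - int (length l) - 1)) # pull l c"

primrec push :: "('b \<times> int) list \<Rightarrow> int \<Rightarrow> ('b \<times> int) list" where
  "push [] c = []"
| "push (a # l) c = (fst a, max (snd a) (c + 1)) # push l (c + 1)"

lemma length_pull [simp]: "length (pull l c) = length l" by (induction l) auto
lemma length_push [simp]: "length (push l c) = length l" by (induction l arbitrary: c) auto

lemma pull_nth: "m < length l \<Longrightarrow> pull l c ! m = (fst (l ! m), min (snd (l ! m)) (c - int (length l - m)))"
proof (induction l arbitrary: m)
  case (Cons a l)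
  then show ?case by (cases m) (auto simp: of_nat_diff)
qed simp

lemma push_nth: "m < length l \<Longrightarrow> push l c ! m = (fst (l ! m), max (snd (l ! m)) (c + int m + 1))"
proof (induction l arbitrary: m c)
  case (Cons a l)
  then show ?case by (cases m) (auto simp: algebra_simps)
qed simp

lemma shift_path_nth: "m < length p \<Longrightarrow> shift_path j d p ! m = (fst (p ! m), snd (shift_path j d p ! m))"
  by (simp add: shift_path_def)

lemma shift_path_append:
  "shift_path (length xs) d (xs @ a # ys) = pull xs (snd a + d) @ (fst a, snd a + d) # push ys (snd a + d)"
proof (rule nth_equalityI)
  fix m assume "m < length (shift_path (length xs) d (xs @ a # ys))"
  then have m: "m < length xs + Suc (length ys)" by simp
  have s: "shift_path (length xs) d (xs @ a # ys) ! m = (fst ((xs @ a # ys) ! m), snd (shift_path (length xs) d (xs @ a # ys) ! m))"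
    by (rule shift_path_nth) (use m in simp)
  consider "m < length xs" | "m = length xs" | "length xs < m" by linarith
  then show "shift_path (length xs) d (xs @ a # ys) ! m =
    (pull xs (snd a + d) @ (fst a, snd a + d) # push ys (snd a + d)) ! m"
  proof cases
    case 1
    then show ?thesis by (subst s) (simp add: snd_shift_path nth_append pull_nth)
  next
    case 2
    then show ?thesis by (subst s) (simp add: snd_shift_path nth_append)
  next
    case 3
    then obtain k where "m = Suc (length xs + k)" using less_imp_Suc_add by blast
    then show ?thesis using m by (subst s) (simp add: snd_shift_path nth_append push_nth algebra_simps)
  qed
qed simp

lemma pull_snoc: "pull (l @ [a]) c = pull l (c - 1) @ [(fst a, min (snd a) (c - 1))]"
  by (induction l) auto

lemma pull_pull: "pull (pull l c) d = pull l (min c d)"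
  by (induction l) auto

lemma pull_id: "sorted_wrt (<) (map snd l) \<Longrightarrow> (\<And>a. a \<in> set l \<Longrightarrow> snd a < c) \<Longrightarrow> pull l c = l"
proof (induction l)
  case (Cons a l)
  have "snd a + int (length l) \<le> c - 1"
  proof (cases "l = []")
    case False
    have "(map snd (a # l)) ! 0 + int (length l - 0) \<le> (map snd (a # l)) ! length l"
      using strict_int_gap[of "map snd (a # l)" 0 "length l"] Cons.prems(1) by simp
    then have "snd a + int (length l) \<le> snd (last l)" using False
      by (metis (no_types, lifting) diff_zero last_ConsR last_conv_nth length_map list.map_disc_iff list.simps(3)
          list.simps(9) nth_Cons_0 last_map length_Cons diff_Suc_1)
    moreover have "snd (last l) < c" using Cons.prems(2) False by simp
    ultimately show ?thesis by simp
  qed (use Cons in auto)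
  then show ?case using Cons by (auto simp: min_def)
qed simp

lemma push_id: "sorted_wrt (<) (map snd l) \<Longrightarrow> (\<And>a. a \<in> set l \<Longrightarrow> c < snd a) \<Longrightarrow> push l c = l"
proof (induction l arbitrary: c)
  case (Cons a l)
  have "push l (c + 1) = l"
  proof (rule Cons.IH)
    fix b assume "b \<in> set l"
    then have "c < snd a" "snd a < snd b" using Cons.prems by auto
    then show "c + 1 < snd b" by linarith
  qed (use Cons.prems in simp)
  then show ?case using Cons.prems(2)[of a] by (cases a) (auto simp: max_def)
qed simp

lemma push_push: "c \<le> d \<Longrightarrow> push (push l c) d = push l d"
  by (induction l arbitrary: c d) (auto simp: max_def)

text \<open>\<open>at_old\<close>, \<open>at_min\<close> and \<open>at_new\<close> are the labels of
  a suffix at the beginning, between the advances and the delays, and at the end.\<close>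

definition at_old :: "('b, 'c) prof \<Rightarrow> ('b \<times> int) list" where
  "at_old q = map (\<lambda>z. (arc_of z, old z)) q"
definition at_min :: "('b, 'c) prof \<Rightarrow> ('b \<times> int) list" where
  "at_min q = map (\<lambda>z. (arc_of z, min (old z) (new z))) q"
definition at_new :: "('b, 'c) prof \<Rightarrow> ('b \<times> int) list" where
  "at_new q = map (\<lambda>z. (arc_of z, new z)) q"

lemmas at_defs = at_old_def at_min_def at_new_def

lemma pshifts_single:
  assumes "i < length P" "P ! i = xs @ a # ys"
  shows "pshifts P [(i, a, d)] (P[i := pull xs (snd a + d) @ (fst a, snd a + d) # push ys (snd a + d)])"
  using assms shift_path_append[of xs d a ys] by (auto intro!: exI[of _ "length xs"])

lemma sorted_at_min:
  assumes "sorted_wrt (<) (map old q)" "sorted_wrt (<) (map new q)"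
  shows "sorted_wrt (<) (map snd (at_min q))"
  using assms by (induction q) (auto simp: at_min_def)

text \<open>No operation is spent on \<open>pre\<close>. Its edges are merely pulled, which is
  harmless because only the suffix provides the vertices that are counted.\<close>

lemma pshifts_adv_ops:
  assumes "i < length P" "P ! i = pre @ at_old q"
    and "sorted_wrt (<) (map snd pre @ map old q)" "sorted_wrt (<) (map new q)"
  shows "pshifts P (adv_ops i q) (P[i := (case q of [] \<Rightarrow> pre | z # _ \<Rightarrow> pull pre (min (old z) (new z))) @ at_min q])"
  using assms
proof (induction q arbitrary: pre)
  case Nil
  then show ?case by (auto simp: at_defs)
next
  case (Cons z r)
  let ?z = "(arc_of z, old z)"
  define c where "c = (case r of [] \<Rightarrow> old z | w # _ \<Rightarrow> min (old z) (new w - 1))"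
  define P1 where "P1 = P[i := pull pre c @ (arc_of z, c) # at_min r]"
  have pre: "sorted_wrt (<) (map snd pre)" "\<And>a. a \<in> set pre \<Longrightarrow> snd a < old z"
    using Cons.prems by (auto simp: sorted_wrt_append)
  have "pshifts P (adv_ops i r) P1"
  proof -
    have "pshifts P (adv_ops i r) (P[i := (case r of [] \<Rightarrow> pre @ [?z] | w # _ \<Rightarrow> pull (pre @ [?z]) (min (old w) (new w))) @ at_min r])"
      by (rule Cons.IH) (use Cons.prems in \<open>auto simp: at_defs\<close>)
    moreover have "(case r of [] \<Rightarrow> pre @ [?z] | w # _ \<Rightarrow> pull (pre @ [?z]) (min (old w) (new w))) = pull pre c @ [(arc_of z, c)]"
    proof (cases r)
      case Nil
      then show ?thesis using pull_id[OF pre] by (simp add: c_def)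
    next
      case (Cons w s)
      have ow: "old z < old w" using Cons.prems Cons by (simp add: sorted_wrt_append)
      \<comment> \<open>The labels in \<open>pre\<close> are below \<open>old z\<close>, so pulling
        towards \<open>old z\<close> changes nothing; merging both pulls replaces the bound by
        \<open>c\<close>.\<close>
      have "pull pre (min (old w) (new w) - 1) = pull (pull pre (old z)) (min (old w) (new w) - 1)"
        using pull_id[OF pre] by simp
      also have "\<dots> = pull pre c" unfolding pull_pull using ow Cons by (simp add: c_def min_def)
      finally show ?thesis using ow Cons by (auto simp: pull_snoc c_def min_def)
    qed
    ultimately show ?thesis by (simp add: P1_def)
  qed
  moreover have "pshifts P1 (if new z < c then [(i, (arc_of z, c), new z - c)] else [])
     (P[i := pull pre (min (old z) (new z)) @ at_min (z # r)])"
  proof (cases "new z < c")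
    case True
    have oz: "new z < old z" using True by (auto simp: c_def split: list.splits)
    have "pshifts P1 [(i, (arc_of z, c), new z - c)]
      (P1[i := pull (pull pre c) (c + (new z - c)) @ (arc_of z, c + (new z - c)) # push (at_min r) (c + (new z - c))])"
      using pshifts_single[of i P1 "pull pre c" "(arc_of z, c)" "at_min r" "new z - c"] Cons.prems(1) by (simp add: P1_def)
    moreover have "push (at_min r) (new z) = at_min r"
    proof (rule push_id)
      show "sorted_wrt (<) (map snd (at_min r))"
        by (rule sorted_at_min) (use Cons.prems in \<open>auto simp: sorted_wrt_append\<close>)
      show "new z < snd a" if "a \<in> set (at_min r)" for a
        using that Cons.prems oz by (force simp: at_min_def sorted_wrt_append)
    qed
    ultimately show ?thesis using True oz by (simp add: pull_pull P1_def at_min_def min_def del: pshifts.simps(2))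
  next
    case False
    have "min (old z) (new z) = c"
      using False Cons.prems by (cases r) (auto simp: c_def min_def)
    then show ?thesis using False by (simp add: P1_def at_min_def)
  qed
  ultimately have *: "\<exists>R. pshifts P (adv_ops i r) R \<and> pshifts R (if new z < c then [(i, (arc_of z, c), new z - c)] else [])
     (P[i := pull pre (min (old z) (new z)) @ at_min (z # r)])" by blast
  have "adv_ops i (z # r) = adv_ops i r @ (if new z < c then [(i, (arc_of z, c), new z - c)] else [])"
    by (simp add: Let_def c_def)
  then show ?case using * by (simp only: pshifts_append list.case)
qed

text \<open>Invariant of the pass: the edges up to \<open>z\<close> have their new labels, and the
  rest stands at \<open>at_min\<close>, pushed by \<open>z\<close>.\<close>

lemma pshifts_del_ops:
  assumes "i < length P" "P ! i = pre @ (arc_of z, new z) # push (at_min q) (new z)"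
    and "sorted_wrt (<) (map snd pre @ map new (z # q))" "sorted_wrt (<) (map old q)"
  shows "pshifts P (del_ops i (z # q)) (P[i := pre @ at_new (z # q)])"
  using assms
proof (induction q arbitrary: pre z P)
  case Nil
  then have "P ! i = pre @ [(arc_of z, new z)]" by (simp add: at_min_def)
  from list_update_id[of P i, unfolded this] show ?case by (simp add: at_new_def)
next
  case (Cons w r)
  define c where "c = max (min (old w) (new w)) (new z + 1)"
  let ?pre = "pre @ [(arc_of z, new z)]"
  have i: "P ! i = ?pre @ (arc_of w, c) # push (at_min r) (new z + 1)"
    using Cons.prems(2) by (simp add: at_min_def c_def)
  have nw: "new z + 1 \<le> new w" using Cons.prems(3) by (simp add: sorted_wrt_append)
  have srt: "sorted_wrt (<) (map snd (at_min r))"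
    by (rule sorted_at_min) (use Cons.prems in \<open>auto simp: sorted_wrt_append\<close>)
  define P1 where "P1 = P[i := ?pre @ (arc_of w, new w) # push (at_min r) (new w)]"
  have "pshifts P (if c < new w then [(i, (arc_of w, c), new w - c)] else []) P1"
  proof (cases "c < new w")
    case True
    have "pull ?pre (new w) = ?pre"
      by (rule pull_id) (use Cons.prems(3) in \<open>auto simp: sorted_wrt_append\<close>)
    moreover have "push (push (at_min r) (new z + 1)) (new w) = push (at_min r) (new w)"
      by (rule push_push[OF nw])
    ultimately show ?thesis
      using True pshifts_single[OF Cons.prems(1) i, of "new w - c"] by (simp add: P1_def del: pshifts.simps(2))
  next
    case False
    then have c: "c = new w" using nw by (auto simp: c_def max_def min_def split: if_splits)
    \<comment> \<open>If \<open>w\<close> needs no delay, either \<open>z\<close> pushes it exactly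
      to \<open>new w\<close>, or it already stands there because \<open>new w \<le> old w\<close>;
      then neither push moves the rest.\<close>
    have "push (at_min r) (new z + 1) = push (at_min r) (new w)"
    proof (cases "new z + 1 = new w")
      case False
      then have "new w \<le> old w" using c nw by (auto simp: c_def max_def min_def split: if_splits)
      then have "new w < snd a" if "a \<in> set (at_min r)" for a
        using that Cons.prems by (force simp: at_min_def sorted_wrt_append)
      then have "push (at_min r) (new w) = at_min r" "push (at_min r) (new z + 1) = at_min r"
        using nw by (auto intro!: push_id[OF srt] intro: order.strict_trans1)
      then show ?thesis by simp
    qed simp
    then show ?thesis using False i c list_update_id[of P i] by (simp add: P1_def)
  qed
  moreover have "pshifts P1 (del_ops i (w # r)) (P1[i := ?pre @ at_new (w # r)])"
    by (rule Cons.IH) (use Cons.prems in \<open>auto simp: P1_def sorted_wrt_append\<close>)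
  ultimately have *: "\<exists>R. pshifts P (if c < new w then [(i, (arc_of w, c), new w - c)] else []) R \<and>
     pshifts R (del_ops i (w # r)) (P1[i := ?pre @ at_new (w # r)])" by blast
  have "del_ops i (z # w # r) = (if c < new w then [(i, (arc_of w, c), new w - c)] else []) @ del_ops i (w # r)"
    by (simp add: Let_def c_def)
  moreover have "P1[i := ?pre @ at_new (w # r)] = P[i := pre @ at_new (z # w # r)]"
    by (simp add: P1_def at_new_def)
  ultimately show ?case using * by (simp only: pshifts_append)
qed

lemma pshifts_prof_ops:
  assumes "i < length P" "P ! i = pre @ at_old q" "q \<noteq> []"
    and "sorted_wrt (<) (map snd pre @ map old q)" "sorted_wrt (<) (map new q)"
  shows "\<exists>pre'. pshifts P (prof_ops i q) (P[i := pre' @ at_new q])"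
proof -
  obtain z r where q: "q = z # r" using assms(3) by (cases q) auto
  let ?pre = "pull pre (min (old z) (new z))"
  define P1 where "P1 = P[i := ?pre @ at_min q]"
  have 1: "pshifts P (adv_ops i q) P1"
    using pshifts_adv_ops[OF assms(1,2,4,5)] by (simp add: q P1_def)
  have i1: "i < length P1" using assms by (simp add: P1_def)
  have i2: "P1 ! i = ?pre @ (arc_of z, min (old z) (new z)) # at_min r" using assms by (simp add: P1_def q at_min_def)
  have pre: "sorted_wrt (<) (map snd ?pre)" "\<And>a. a \<in> set ?pre \<Longrightarrow> snd a < min (old z) (new z)"
  proof -
    have p: "sorted_wrt (<) (map snd pre)" using assms(4) by (simp add: sorted_wrt_append)
    have "pull pre (min (old z) (new z)) ! m = (fst (pre ! m), min (snd (pre ! m)) (min (old z) (new z) - int (length pre - m)))"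
      if "m < length pre" for m using pull_nth that by blast
    then show "\<And>a. a \<in> set ?pre \<Longrightarrow> snd a < min (old z) (new z)"
      by (auto simp: in_set_conv_nth)
    show "sorted_wrt (<) (map snd ?pre)"
    proof (rule sorted_wrt_iff_nth_less[THEN iffD2], intro allI impI)
      fix a b assume ab: "a < b" "b < length (map snd ?pre)"
      then have "snd (pre ! a) < snd (pre ! b)" using p by (auto simp: sorted_wrt_iff_nth_less)
      then show "map snd ?pre ! a < map snd ?pre ! b" using ab by (auto simp: pull_nth)
    qed
  qed
  have srt: "sorted_wrt (<) (map snd (at_min r))"
    by (rule sorted_at_min) (use assms q in \<open>auto simp: sorted_wrt_append\<close>)
  define P2 where "P2 = P[i := ?pre @ (arc_of z, new z) # push (at_min r) (new z)]"
  have 2: "pshifts P1 (if old z < new z then [(i, (arc_of z, old z), new z - old z)] else []) P2"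
  proof (cases "old z < new z")
    case True
    have "pull ?pre (new z) = ?pre" by (rule pull_id[OF pre(1)]) (use pre(2) True in fastforce)
    then show ?thesis using True pshifts_single[OF i1 i2, of "new z - old z"]
      by (simp add: P1_def P2_def min_def del: pshifts.simps(2))
  next
    case False
    have "push (at_min r) (new z) = at_min r"
      by (rule push_id[OF srt]) (use False assms q in \<open>force simp: at_min_def sorted_wrt_append\<close>)
    then show ?thesis using False by (simp add: P1_def P2_def q at_min_def min_def)
  qed
  have 3: "pshifts P2 (del_ops i (z # r)) (P2[i := ?pre @ at_new (z # r)])"
  proof (rule pshifts_del_ops)
    show "sorted_wrt (<) (map snd ?pre @ map new (z # r))"
      unfolding sorted_wrt_append
    proof (intro conjI ballI)
      show "sorted_wrt (<) (map snd ?pre)" "sorted_wrt (<) (map new (z # r))" using pre assms(5) q by simp_all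
      fix x y assume x: "x \<in> set (map snd ?pre)" and y: "y \<in> set (map new (z # r))"
      have "x < new z" using x pre(2) by (auto simp: image_iff)
      moreover have "new z \<le> y" using y assms(5) q by auto
      ultimately show "x < y" by simp
    qed
  qed (use assms q in \<open>auto simp: P2_def sorted_wrt_append\<close>)
  show ?thesis
  proof -
    have "prof_ops i q = adv_ops i q @ (if old z < new z then [(i, (arc_of z, old z), new z - old z)] else []) @ del_ops i (z # r)"
      by (simp add: prof_ops_def q)
    moreover have "P2[i := ?pre @ at_new (z # r)] = P[i := ?pre @ at_new q]" by (simp add: P2_def q)
    moreover have "\<exists>R. pshifts P (adv_ops i q) R \<and> (\<exists>S. pshifts R (if old z < new z then [(i, (arc_of z, old z), new z - old z)] else []) S \<and>
        pshifts S (del_ops i (z # r)) (P2[i := ?pre @ at_new (z # r)]))" using 1 2 3 by blast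
    ultimately show ?thesis by (auto simp only: pshifts_append)
  qed
qed

lemma cost_append [simp]: "cost (a @ b) = cost a + cost b" by (simp add: cost_def)

text \<open>Advancing the first and delaying the second edge of a consecutive pair cost exactly the
  two summands of \<open>tc\<close>. So the potential is attained.\<close>

lemma cost_adv_del:
  assumes "sorted_wrt (<) (map old q)" "sorted_wrt (<) (map new q)"
  shows "cost (adv_ops i q) + cost (del_ops i q) = scost (labs q)"
  using assms
proof (induction q)
  case Nil
  then show ?case by (simp add: cost_def labs_def)
next
  case (Cons z r)
  have IH: "cost (adv_ops i r) + cost (del_ops i r) = scost (labs r)" using Cons by simp
  show ?case
  proof (cases r)
    case Nil
    then show ?thesis by (auto simp: cost_def labs_def shift_amount_def Let_def)
  next
    case (Cons w s)
    have *: "old z < old w" "new z < new w" using Cons.prems Cons by auto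
    have a: "cost (adv_ops i (z # r)) = cost (adv_ops i r) + max 0 (min (old z) (new w - 1) - new z)"
      using Cons by (auto simp: Let_def cost_def shift_amount_def max_def)
    have d: "cost (del_ops i (z # r)) = max 0 (new w - max (old w) (new z + 1)) + cost (del_ops i r)"
      using Cons * by (auto simp: Let_def cost_def shift_amount_def min_def max_def)
    have "scost (labs (z # r)) = tc (old z) (new z) (old w) (new w) + scost (labs r)"
      using Cons by (simp add: labs_def)
    then show ?thesis unfolding a d using IH by (simp add: tc_def)
  qed
qed

lemma cost_prof_ops:
  assumes "sorted_wrt (<) (map old q)" "sorted_wrt (<) (map new q)"
  shows "cost (prof_ops i q) = pcost (labs q)"
proof (cases q)
  case (Cons z r)
  have "cost (prof_ops i q) = scost (labs q) + max 0 (new z - old z)"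
    using cost_adv_del[OF assms, of i] Cons by (auto simp: prof_ops_def cost_def shift_amount_def simp del: adv_ops.simps del_ops.simps)
  then show ?thesis using Cons by (simp add: pcost_def labs_def)
qed (simp add: prof_ops_def pcost_def cost_def labs_def)

lemma amount_adv_ops: "\<sigma> \<in> set (adv_ops i q) \<Longrightarrow> shift_amount \<sigma> < 0 \<and> (\<exists>z\<in>set q. new z < old z)"
proof (induction q)
  case (Cons z r)
  define c where "c = (case r of [] \<Rightarrow> old z | w # _ \<Rightarrow> min (old z) (new w - 1))"
  have c: "c \<le> old z" by (cases r) (auto simp: c_def)
  have eq: "adv_ops i (z # r) = adv_ops i r @ (if new z < c then [(i, (arc_of z, c), new z - c)] else [])"
    by (simp add: Let_def c_def)
  have "\<sigma> \<in> set (adv_ops i r @ (if new z < c then [(i, (arc_of z, c), new z - c)] else []))"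
    using Cons.prems unfolding eq .
  then consider "\<sigma> \<in> set (adv_ops i r)" | "new z < c" "\<sigma> = (i, (arc_of z, c), new z - c)"
    by (cases "new z < c") auto
  then show ?case
  proof cases
    case 1 then show ?thesis using Cons.IH by simp
  next
    case 2 then show ?thesis using c by (simp add: shift_amount_def)
  qed
qed simp

lemma amount_del_ops: "sorted_wrt (<) (map new q) \<Longrightarrow> \<sigma> \<in> set (del_ops i q) \<Longrightarrow> shift_amount \<sigma> > 0 \<and> (\<exists>z\<in>set q. old z < new z)"
proof (induction q)
  case (Cons z r)
  show ?case
  proof (cases r)
    case Nil then show ?thesis using Cons.prems by simp
  next
    case r: (Cons w s)
    define c where "c = max (min (old w) (new w)) (new z + 1)"
    have eq: "del_ops i (z # r) = (if c < new w then [(i, (arc_of w, c), new w - c)] else []) @ del_ops i r"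
      by (simp add: Let_def c_def r)
    have "\<sigma> \<in> set ((if c < new w then [(i, (arc_of w, c), new w - c)] else []) @ del_ops i r)"
      using Cons.prems(2) unfolding eq .
    then consider "\<sigma> \<in> set (del_ops i r)" | "c < new w" "\<sigma> = (i, (arc_of w, c), new w - c)"
      by (cases "c < new w") auto
    then show ?thesis
    proof cases
      case 1 then show ?thesis using Cons.IH Cons.prems(1) by simp
    next
      case 2
      then have "old w < new w" by (auto simp: c_def)
      then show ?thesis using 2 r by (simp add: shift_amount_def)
    qed
  qed
qed simp

text \<open>An operation in one direction occurs only if some edge has to move in this direction. A
  relabelling that satisfies \<open>ok\<close> thus leads to permitted operations only.\<close>

lemma amount_prof_ops:
  assumes "sorted_wrt (<) (map new q)" "\<sigma> \<in> set (prof_ops i q)"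
  shows "(shift_amount \<sigma> < 0 \<and> (\<exists>z\<in>set q. new z < old z)) \<or> (shift_amount \<sigma> > 0 \<and> (\<exists>z\<in>set q. old z < new z))"
  using amount_adv_ops[of \<sigma> i q] amount_del_ops[OF assms(1), of \<sigma> i] assms(2)
  by (auto simp: prof_ops_def shift_amount_def split: list.splits if_splits)

definition all_ops :: "(nat \<times> ('b, 'c) prof) list \<Rightarrow> 'b shift list" where
  "all_ops iqs = concat (map (\<lambda>iq. prof_ops (fst iq) (snd iq)) iqs)"

lemma pshifts_all_ops:
  assumes "distinct (map fst iqs)"
    and "\<And>i q. (i, q) \<in> set iqs \<Longrightarrow> i < length P \<and> q \<noteq> [] \<and> (\<exists>pre. P ! i = pre @ at_old q) \<and>
      sorted_wrt (<) (map snd (P ! i)) \<and> sorted_wrt (<) (map new q)"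
  shows "\<exists>P'. pshifts P (all_ops iqs) P' \<and> length P' = length P \<and>
    (\<forall>(i, q)\<in>set iqs. \<exists>pre. P' ! i = pre @ at_new q) \<and> (\<forall>i. i \<notin> fst ` set iqs \<longrightarrow> P' ! i = P ! i)"
  using assms
proof (induction iqs arbitrary: P)
  case Nil
  then show ?case by (simp add: all_ops_def)
next
  case (Cons iq iqs)
  obtain i q where iq: "iq = (i, q)" by fastforce
  have c: "i < length P" "q \<noteq> []" "sorted_wrt (<) (map snd (P ! i))" "sorted_wrt (<) (map new q)"
    using Cons.prems(2)[of i q] iq by auto
  obtain pre where pre: "P ! i = pre @ at_old q" using Cons.prems(2)[of i q] iq by auto
  have "sorted_wrt (<) (map snd pre @ map old q)" using c(3) by (simp add: pre at_old_def comp_def)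
  from pshifts_prof_ops[OF c(1) pre c(2) this c(4)] obtain pre' where
    1: "pshifts P (prof_ops i q) (P[i := pre' @ at_new q])" by blast
  let ?P = "P[i := pre' @ at_new q]"
  have ni: "i \<notin> fst ` set iqs" using Cons.prems(1) iq by simp
  have "\<exists>P'. pshifts ?P (all_ops iqs) P' \<and> length P' = length ?P \<and>
    (\<forall>(i, q)\<in>set iqs. \<exists>pre. P' ! i = pre @ at_new q) \<and> (\<forall>i. i \<notin> fst ` set iqs \<longrightarrow> P' ! i = ?P ! i)"
  proof (rule Cons.IH)
    fix j p assume jp: "(j, p) \<in> set iqs"
    then have "j \<noteq> i" using ni by force
    then show "j < length ?P \<and> p \<noteq> [] \<and> (\<exists>pre. ?P ! j = pre @ at_old p) \<and>
      sorted_wrt (<) (map snd (?P ! j)) \<and> sorted_wrt (<) (map new p)"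
      using Cons.prems(2)[of j p] jp by simp
  qed (use Cons.prems in simp)
  then obtain P' where P': "pshifts ?P (all_ops iqs) P'" "length P' = length P"
    "\<forall>(i, q)\<in>set iqs. \<exists>pre. P' ! i = pre @ at_new q" "\<forall>j. j \<notin> fst ` set iqs \<longrightarrow> P' ! j = ?P ! j" by auto
  have "pshifts P (all_ops (iq # iqs)) P'" using 1 P'(1) by (auto simp: all_ops_def iq pshifts_append)
  moreover have "\<exists>pre. P' ! i = pre @ at_new q" using P'(4) ni c(1) by auto
  ultimately show ?case using P' iq by (intro exI[of _ P']) auto
qed

lemma cost_all_ops:
  assumes "\<And>i q. (i, q) \<in> set iqs \<Longrightarrow> sorted_wrt (<) (map old q) \<and> sorted_wrt (<) (map new q)"
  shows "cost (all_ops iqs) = (\<Sum>iq\<leftarrow>iqs. pcost (labs (snd iq)))"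
  using assms
proof (induction iqs)
  case (Cons iq iqs)
  have "cost (prof_ops (fst iq) (snd iq)) = pcost (labs (snd iq))"
    using Cons.prems[of "fst iq" "snd iq"] by (auto intro!: cost_prof_ops)
  moreover have "cost (all_ops iqs) = (\<Sum>iq\<leftarrow>iqs. pcost (labs (snd iq)))"
    by (rule Cons.IH) (use Cons.prems in auto)
  moreover have "all_ops (iq # iqs) = prof_ops (fst iq) (snd iq) @ all_ops iqs" by (simp add: all_ops_def)
  ultimately show ?case by simp
qed (simp add: all_ops_def cost_def)

section \<open>Reachability in terms of base paths\<close>

context fin_digraph begin

text \<open>Usable temporal edges are defined by walks with increasing labels. Vertices may repeat,
  which removes the simplicity of temporal paths from the later arguments.\<close>

inductive_set act :: "('b \<times> int) set \<Rightarrow> 'a \<Rightarrow> ('b \<times> int) set" for E s where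
  start: "(a, t) \<in> E \<Longrightarrow> tail G a = s \<Longrightarrow> (a, t) \<in> act E s"
| step: "(a', t') \<in> act E s \<Longrightarrow> (a, t) \<in> E \<Longrightarrow> head G a' = tail G a \<Longrightarrow> t' < t \<Longrightarrow> (a, t) \<in> act E s"

lemma act_subset: "act E s \<subseteq> E"
  by (auto elim: act.cases)

lemma apath_snocD:
  assumes "apath u (p @ [a]) v"
  shows "apath u p (tail G a)" "a \<in> arcs G" "v = head G a"
  using assms unfolding apath_append_iff by (auto simp: apath_simps awalk_simps apath_def)

lemma apath_snoc:
  assumes "apath u p (tail G a)" "a \<in> arcs G" "head G a \<notin> set (awalk_verts u p)"
  shows "apath u (p @ [a]) (head G a)"
proof -
  have w: "awalk u p (tail G a)" using assms(1) by (simp add: apath_def)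
  then have w2: "awalk u (p @ [a]) (head G a)" using assms(2)
    by (simp add: arc_implies_awalk)
  have "awalk_verts u (p @ [a]) = awalk_verts u p @ tl (awalk_verts (tail G a) [a])"
    using awalk_verts_append[OF w2] awlast_of_awalk[OF w] by simp
  then have "awalk_verts u (p @ [a]) = awalk_verts u p @ [head G a]" by simp
  then show ?thesis using w2 assms by (simp add: apath_def)
qed

lemma apath_prefix:
  assumes "apath u p v" "w \<in> set (awalk_verts u p)"
  shows "\<exists>q r. p = q @ r \<and> apath u q w"
proof -
  have "awalk u p v" using assms by (simp add: apath_def)
  from awalk_decomp[OF this assms(2)] obtain q r where "p = q @ r" "awalk u q w" "awalk w r v" by blast
  moreover from this have "apath u q w" using assms(1) by (auto simp: apath_append_iff awlast_of_awalk)
  ultimately show ?thesis by blast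
qed

text \<open>If the head of the new edge has been visited before, the path is cut back to that
  vertex. The bound by \<open>t\<close> on the labels is what allows the next edge to be
  appended.\<close>

lemma act_reached:
  fixes H :: "('a, 'b, 'z) temporal_multigraph_scheme"
  assumes H: "digraph_of H = G" "set_mset (temporal_edges H) = E" and E: "fst ` E \<subseteq> arcs G" and s: "s \<in> verts G"
    and at: "(a, t) \<in> act E s"
  shows "\<exists>p. temporal_path H s p (head G a) \<and> (\<forall>x\<in>set p. snd x \<le> t)"
  using at
proof (induction rule: act.induct)
  case (start a t)
  then have a: "a \<in> arcs G" using E by force
  show ?case
  proof (cases "head G a = s")
    case True
    have "temporal_path H s [] s" using s by (simp add: temporal_path_def H apath_Nil_iff)
    then show ?thesis using True by (intro exI[of _ "[]"]) simp
  next
    case False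
    have "apath s ([] @ [a]) (head G a)"
      by (rule apath_snoc) (use start a s False in \<open>auto simp: apath_Nil_iff\<close>)
    then have "temporal_path H s [(a, t)] (head G a)" using start by (simp add: temporal_path_def H)
    then show ?thesis by (intro exI[of _ "[(a, t)]"]) simp
  qed
next
  case (step a' t' a t)
  then obtain p where p: "temporal_path H s p (tail G a)" "\<forall>x\<in>set p. snd x \<le> t'" by auto
  have a: "a \<in> arcs G" using step E by force
  have ap: "apath s (map fst p) (tail G a)" "set p \<subseteq> E" "sorted_wrt (<) (map snd p)"
    using p by (auto simp: temporal_path_def H)
  show ?case
  proof (cases "head G a \<in> set (awalk_verts s (map fst p))")
    case True
    from apath_prefix[OF ap(1) True] obtain q r where qr: "map fst p = q @ r" "apath s q (head G a)" by blast
    then have q: "q = map fst (take (length q) p)" by (metis append_eq_conv_conj take_map)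
    have "temporal_path H s (take (length q) p) (head G a)"
      unfolding temporal_path_def H using qr(2) q ap
      by (auto simp: take_map[symmetric] sorted_wrt_take dest: in_set_takeD)
    moreover have "\<forall>x\<in>set (take (length q) p). snd x \<le> t"
      using p(2) step by (meson in_set_takeD dual_order.strict_implies_order order_trans)
    ultimately show ?thesis by blast
  next
    case False
    have "apath s (map fst p @ [a]) (head G a)" by (rule apath_snoc[OF ap(1) a False])
    then have "temporal_path H s (p @ [(a, t)]) (head G a)"
      using ap p(2) step by (fastforce simp: temporal_path_def H sorted_wrt_append)
    moreover have "\<forall>x\<in>set (p @ [(a, t)]). snd x \<le> t" using p(2) step by fastforce
    ultimately show ?thesis by blast
  qed
qed

lemma reached_act:
  fixes H :: "('a, 'b, 'z) temporal_multigraph_scheme"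
  assumes H: "digraph_of H = G" "set_mset (temporal_edges H) = E"
    and p: "temporal_path H s p v"
  shows "v = s \<or> (p \<noteq> [] \<and> last p \<in> act E s \<and> v = head G (fst (last p)))"
proof -
  have "apath s (map fst p) v" "set p \<subseteq> E" "sorted_wrt (<) (map snd p)"
    using p by (auto simp: temporal_path_def H)
  then show ?thesis
  proof (induction p arbitrary: v rule: rev_induct)
    case Nil
    then show ?case by (simp add: apath_Nil_iff)
  next
    case (snoc x p)
    obtain a t where x: "x = (a, t)" by fastforce
    have ap: "apath s (map fst p @ [a]) v" using snoc.prems by (simp add: x)
    note d = apath_snocD[OF ap]
    have E: "(a, t) \<in> E" using snoc.prems x by simp
    have "tail G a = s \<or> (p \<noteq> [] \<and> last p \<in> act E s \<and> tail G a = head G (fst (last p)))"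
      by (rule snoc.IH) (use snoc.prems d in \<open>auto simp: sorted_wrt_append\<close>)
    then have "(a, t) \<in> act E s"
    proof
      assume "tail G a = s" then show ?thesis using E by (rule act.start[rotated])
    next
      assume *: "p \<noteq> [] \<and> last p \<in> act E s \<and> tail G a = head G (fst (last p))"
      then have "snd (last p) < t" using snoc.prems(3) x by (simp add: sorted_wrt_append)
      then show ?thesis using * E act.step[of "fst (last p)" "snd (last p)" E s a t] by simp
    qed
    then show ?case using d x by simp
  qed
qed

theorem reached_eq:
  fixes H :: "('a, 'b, 'z) temporal_multigraph_scheme"
  assumes H: "digraph_of H = G" "set_mset (temporal_edges H) = E" and E: "fst ` E \<subseteq> arcs G" and s: "s \<in> verts G"
  shows "reached H s = insert s (head G ` fst ` act E s)"
proof (intro equalityI subsetI)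
  fix v assume "v \<in> reached H s"
  then obtain p where "temporal_path H s p v" by (auto simp: reached_def)
  from reached_act[OF H this] show "v \<in> insert s (head G ` fst ` act E s)" by auto
next
  fix v assume "v \<in> insert s (head G ` fst ` act E s)"
  moreover have "temporal_path H s [] s" using s by (simp add: temporal_path_def H apath_Nil_iff)
  ultimately show "v \<in> reached H s"
    using act_reached[OF H E s] by (fastforce simp: reached_def)
qed

text \<open>On a base path each edge starts where its predecessor ends and has a larger label, so
  usability passes on to the next edge.\<close>

lemma act_suffix:
  assumes l: "set l \<subseteq> E" "apath u (map fst l) v" "sorted_wrt (<) (map snd l)"
    and m: "l ! m \<in> act E s" "m \<le> n" "n < length l"
  shows "l ! n \<in> act E s"
  using m(2,3)
proof (induction n rule: dec_induct)
  case base
  then show ?case using m by simp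
next
  case (step n)
  have n: "n < length (map fst l)" "Suc n < length (map fst l)" using step.prems by simp_all
  have "map fst l = take n (map fst l) @ map fst l ! n # map fst l ! Suc n # drop (Suc (Suc n)) (map fst l)"
    using id_take_nth_drop[OF n(1)] Cons_nth_drop_Suc[OF n(2)] by simp
  then have "awalk u (take n (map fst l) @ map fst l ! n # map fst l ! Suc n # drop (Suc (Suc n)) (map fst l)) v"
    using l(2) by (simp add: apath_def)
  then have "tail G (fst (l ! Suc n)) = head G (fst (l ! n))"
    using n by (simp add: awalk_append_iff awalk_Cons_iff)
  moreover have "map snd l ! n < map snd l ! Suc n"
    using sorted_wrt_nth_less[OF l(3), of n "Suc n"] step.prems by simp
  then have "snd (l ! n) < snd (l ! Suc n)" using n by simp
  moreover have "l ! Suc n \<in> E" using l(1) step.prems by auto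
  moreover have "l ! n \<in> act E s" using step by simp
  ultimately show ?case
    using act.step[of "fst (l ! n)" "snd (l ! n)" E s "fst (l ! Suc n)" "snd (l ! Suc n)"] by simp
qed

end

section \<open>Relabellings near the given labels\<close>

definition values_of :: "'i set \<Rightarrow> ('i \<Rightarrow> ('b, 'c) prof) \<Rightarrow> int set" where
  "values_of I f = (\<Union>i\<in>I. new ` set (f i))"

definition relabel :: "(int \<Rightarrow> int) \<Rightarrow> ('b, 'c) prof \<Rightarrow> ('b, 'c) prof" where
  "relabel \<phi> q = map (\<lambda>z. (fst z, \<phi> (new z))) q"

text \<open>
  The cost of a relabelling is a sum of functions of single new labels that are affine between two
  consecutive points of \<open>\<Lambda>\<close>. Hence moving a maximal run \<open>K\<close> of consecutive labels that avoids
  \<open>\<Lambda>\<close> up or down by one changes the cost by opposite amounts.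
\<close>

lemma max_affine:
  assumes "c \<noteq> y \<or> u = 0" "\<bar>u\<bar> \<le> 1"
  shows "max 0 (y + u - c) + max 0 (y - u - c) = 2 * max 0 (y - (c :: int))"
    and "max 0 (c - (y + u)) + max 0 (c - (y - u)) = 2 * max 0 (c - (y :: int))"
  using assms by (auto simp: max_def)

text \<open>For increasing new labels the two nested extrema come apart into functions of
  \<open>x\<close> alone and of \<open>x'\<close> alone. Their breakpoints are given labels and
  neighbours of these, which is why the neighbours of \<open>Lb\<close> are added in
  \<open>rounding\<close>.\<close>

lemma tc_split:
  assumes "x < x'"
  shows "tc l x l' x' = max 0 (x' - l') - max 0 (x - (l' - 1)) + max 0 (l - x) - max 0 (l + 1 - x')"
  using assms unfolding tc_def max_def min_def by (smt (verit))

lemma pcost_relabel: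
  fixes q :: "('b, 'c) prof" and K :: "int set"
  defines "up \<equiv> \<lambda>y. y + of_bool (y \<in> K)" and "dn \<equiv> \<lambda>y. y - of_bool (y \<in> K)"
  assumes K: "\<And>z. z \<in> set q \<Longrightarrow> old z \<notin> K \<and> old z - 1 \<notin> K \<and> old z + 1 \<notin> K"
    and srt: "sorted_wrt (<) (map new q)" "sorted_wrt (<) (map new (relabel up q))" "sorted_wrt (<) (map new (relabel dn q))"
  shows "pcost (labs (relabel up q)) + pcost (labs (relabel dn q)) = 2 * pcost (labs q)"
proof -
  have s: "scost (labs (relabel up q)) + scost (labs (relabel dn q)) = 2 * scost (labs q)"
    using K srt
  proof (induction q)
    case Nil
    then show ?case by (simp add: labs_def relabel_def)
  next
    case (Cons z r)
    have IH: "scost (labs (relabel up r)) + scost (labs (relabel dn r)) = 2 * scost (labs r)"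
      using Cons by (simp add: relabel_def)
    let ?u = "of_bool (new z \<in> K) :: int"
    show ?case
    proof (cases r)
      case Nil
      have "max 0 (old z - (new z + ?u)) + max 0 (old z - (new z - ?u)) = 2 * max 0 (old z - new z)"
        by (rule max_affine) (use Cons.prems(1)[of z] in auto)
      then show ?thesis using Nil by (simp add: labs_def relabel_def up_def dn_def)
    next
      case r: (Cons w t)
      let ?v = "of_bool (new w \<in> K) :: int"
      have lt: "new z < new w" "new z + ?u < new w + ?v" "new z - ?u < new w - ?v"
        using Cons.prems r by (auto simp: relabel_def up_def dn_def)
      have z: "old z \<notin> K" "old z + 1 \<notin> K" using Cons.prems(1)[of z] by auto
      have w: "old w \<notin> K" "old w - 1 \<notin> K" using Cons.prems(1)[of w] r by auto
      have 1: "max 0 (new w + ?v - old w) + max 0 (new w - ?v - old w) = 2 * max 0 (new w - old w)"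
        by (rule max_affine) (use w in auto)
      have 2: "max 0 (new z + ?u - (old w - 1)) + max 0 (new z - ?u - (old w - 1)) = 2 * max 0 (new z - (old w - 1))"
        by (rule max_affine) (use w in auto)
      have 3: "max 0 (old z - (new z + ?u)) + max 0 (old z - (new z - ?u)) = 2 * max 0 (old z - new z)"
        by (rule max_affine) (use z in auto)
      have 4: "max 0 (old z + 1 - (new w + ?v)) + max 0 (old z + 1 - (new w - ?v)) = 2 * max 0 (old z + 1 - new w)"
        by (rule max_affine) (use z in auto)
      have "tc (old z) (new z + ?u) (old w) (new w + ?v) + tc (old z) (new z - ?u) (old w) (new w - ?v)
        = 2 * tc (old z) (new z) (old w) (new w)"
        unfolding tc_split[OF lt(1)] tc_split[OF lt(2)] tc_split[OF lt(3)] using 1 2 3 4 by (smt (verit))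
      then show ?thesis using IH r by (simp add: labs_def relabel_def up_def dn_def)
    qed
  qed
  show ?thesis
  proof (cases q)
    case (Cons z r)
    let ?u = "of_bool (new z \<in> K) :: int"
    have "max 0 (new z + ?u - old z) + max 0 (new z - ?u - old z) = 2 * max 0 (new z - old z)"
      by (rule max_affine) (use K[of z] Cons in auto)
    moreover have "pcost (labs (relabel up q)) = max 0 (new z + ?u - old z) + scost (labs (relabel up q))"
      "pcost (labs (relabel dn q)) = max 0 (new z - ?u - old z) + scost (labs (relabel dn q))"
      "pcost (labs q) = max 0 (new z - old z) + scost (labs q)"
      using Cons by (simp_all add: pcost_def labs_def relabel_def up_def dn_def)
    ultimately show ?thesis using s by (smt (verit))
  qed (simp add: pcost_def labs_def relabel_def)
qed

text \<open>Extremal argument: among the cheapest admissible relabellings, one is taken whose total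
  distance to a fixed given label \<open>m0\<close> is least. A value \<open>y0\<close> far from
  \<open>Lb\<close> lies in a run \<open>K\<close> of consecutive points that avoids all
  breakpoints. Moving \<open>K\<close> up and moving it down by one are both admissible, since
  \<open>closed\<close> asks that admissibility survive order-preserving changes that fix
  \<open>Lb\<close>. Their costs average to the least cost, so both are cheapest, and one of them
  comes closer to \<open>m0\<close>. In the distance, the sum of lengths and
  \<open>3 * card Lb\<close> bound the number of points that such a run can contain, and 1 accounts
  for the neighbours of \<open>Lb\<close>.\<close>

lemma rounding:
  fixes A :: "('i \<Rightarrow> ('b, 'c) prof) \<Rightarrow> bool" and I :: "'i set" and Lb :: "int set"
  assumes fin: "finite I" "finite Lb" and f: "A f"
    and srt: "\<And>g i. A g \<Longrightarrow> i \<in> I \<Longrightarrow> sorted_wrt (<) (map new (g i))"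
    and len: "\<And>g i. A g \<Longrightarrow> i \<in> I \<Longrightarrow> length (g i) = len i"
    and olds: "\<And>g i z. A g \<Longrightarrow> i \<in> I \<Longrightarrow> z \<in> set (g i) \<Longrightarrow> old z \<in> Lb"
    and closed: "\<And>g \<phi>. A g \<Longrightarrow> (\<And>a b. a \<in> values_of I g \<union> Lb \<Longrightarrow> b \<in> values_of I g \<union> Lb \<Longrightarrow> a < b \<Longrightarrow> \<phi> a < \<phi> b)
      \<Longrightarrow> (\<And>l. l \<in> Lb \<Longrightarrow> \<phi> l = l) \<Longrightarrow> A (\<lambda>i. relabel \<phi> (g i))"
  shows "\<exists>g. A g \<and> (\<Sum>i\<in>I. pcost (labs (g i))) \<le> (\<Sum>i\<in>I. pcost (labs (f i))) \<and>
    (\<forall>y\<in>values_of I g. \<exists>l\<in>Lb. \<bar>y - l\<bar> \<le> int ((\<Sum>i\<in>I. len i) + 3 * card Lb + 1))"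
proof (cases "Lb = {}")
  case True
  then have "values_of I f = {}" using olds[OF f] unfolding values_of_def by blast
  then show ?thesis using f by (intro exI[of _ f]) auto
next
  case False
  then obtain m0 where m0: "m0 \<in> Lb" by blast
  define M where "M g = nat (\<Sum>i\<in>I. pcost (labs (g i)))" for g :: "'i \<Rightarrow> ('b, 'c) prof"
  define B where "B g = nat (\<Sum>i\<in>I. \<Sum>z\<leftarrow>g i. \<bar>new z - m0\<bar>)" for g :: "'i \<Rightarrow> ('b, 'c) prof"
  have Mi: "int (M g) = (\<Sum>i\<in>I. pcost (labs (g i)))" for g
    unfolding M_def by (simp add: sum_nonneg pcost_nonneg)
  have Bi: "int (B g) = (\<Sum>i\<in>I. \<Sum>z\<leftarrow>g i. \<bar>new z - m0\<bar>)" for g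
  proof -
    have "0 \<le> (\<Sum>i\<in>I. \<Sum>z\<leftarrow>g i. \<bar>new z - m0\<bar>)" by (intro sum_nonneg sum_list_nonneg) auto
    then show ?thesis by (simp add: B_def)
  qed
  obtain g0 where g0: "A g0" "\<And>h. A h \<Longrightarrow> M g0 \<le> M h"
    using ex_has_least_nat[of A f M] f by blast
  obtain g where g: "A g" "M g = M g0" "\<And>h. A h \<Longrightarrow> M h = M g0 \<Longrightarrow> B g \<le> B h"
    using ex_has_least_nat[of "\<lambda>h. A h \<and> M h = M g0" g0 B] g0 by blast
  define La where "La = Lb \<union> (\<lambda>l. l - 1) ` Lb \<union> (\<lambda>l. l + 1) ` Lb"
  define X where "X = values_of I g \<union> La"
  have finX: "finite X" unfolding X_def La_def values_of_def using fin by auto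
  have cardX: "card X \<le> (\<Sum>i\<in>I. len i) + 3 * card Lb"
  proof -
    have "card (values_of I g) \<le> (\<Sum>i\<in>I. card (new ` set (g i)))"
      unfolding values_of_def by (rule card_UN_le[OF fin(1)])
    also have "\<dots> \<le> (\<Sum>i\<in>I. len i)"
    proof (rule sum_mono)
      fix i assume "i \<in> I"
      have "card (new ` set (g i)) \<le> card (set (g i))" by (rule card_image_le) simp
      also have "\<dots> \<le> length (g i)" by (rule card_length)
      finally show "card (new ` set (g i)) \<le> len i" using len[OF g(1) \<open>i \<in> I\<close>] by simp
    qed
    finally have 1: "card (values_of I g) \<le> (\<Sum>i\<in>I. len i)" .
    have "card La \<le> card (Lb \<union> (\<lambda>l. l - 1) ` Lb) + card ((\<lambda>l. l + 1) ` Lb)" unfolding La_def by (rule card_Un_le)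
    also have "\<dots> \<le> (card Lb + card ((\<lambda>l. l - 1) ` Lb)) + card ((\<lambda>l. l + 1) ` Lb)"
      by (rule add_right_mono, rule card_Un_le)
    also have "\<dots> \<le> 3 * card Lb"
      using card_image_le[OF fin(2), of "\<lambda>l. l - 1"] card_image_le[OF fin(2), of "\<lambda>l. l + 1"] by linarith
    finally have 2: "card La \<le> 3 * card Lb" .
    have "card X \<le> card (values_of I g) + card La" unfolding X_def by (rule card_Un_le)
    then show ?thesis using 1 2 by linarith
  qed
  have "\<exists>l\<in>Lb. \<bar>y0 - l\<bar> \<le> int ((\<Sum>i\<in>I. len i) + 3 * card Lb + 1)" if y0: "y0 \<in> values_of I g" for y0
  proof (rule ccontr)
    assume far: "\<not> ?thesis"
    \<comment> \<open>The maximal run of consecutive integers in \<open>X\<close> that contains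
      \<open>y0\<close>.\<close>
    define K where "K = {z. {min z y0..max z y0} \<subseteq> X}"
    have y0K: "y0 \<in> K" using y0 by (auto simp: K_def X_def)
    have KX: "K \<subseteq> X"
    proof
      fix z assume "z \<in> K"
      then have "{min z y0..max z y0} \<subseteq> X" by (simp add: K_def)
      moreover have "z \<in> {min z y0..max z y0}" by simp
      ultimately show "z \<in> X" by blast
    qed
    \<comment> \<open>Otherwise the whole interval between \<open>y0\<close> and a point of
      \<open>La\<close> would be contained in \<open>X\<close>. By counting, \<open>y0\<close> would
      be within \<open>card X\<close> of this point and within \<open>card X + 1\<close> of
      \<open>Lb\<close>.\<close>
    have KLa: "K \<inter> La = {}"
    proof (rule ccontr)
      assume "K \<inter> La \<noteq> {}"
      then obtain l where l: "l \<in> K" "l \<in> La" by blast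
      have "card {min l y0..max l y0} \<le> card X" by (rule card_mono[OF finX]) (use l in \<open>simp add: K_def\<close>)
      then have "\<bar>y0 - l\<bar> \<le> int (card X)" by simp
      moreover obtain l' where "l' \<in> Lb" "\<bar>l - l'\<bar> \<le> 1" using l(2) by (auto simp: La_def)
      ultimately show False using far cardX by (smt (verit) of_nat_mono of_nat_add of_nat_1)
    qed
    have conv: "w \<in> K" if "z \<in> K" "w \<in> {min z y0..max z y0}" for z w
    proof -
      have 1: "{min w y0..max w y0} \<subseteq> {min z y0..max z y0}" using that(2) by (auto simp: min_def max_def split: if_splits)
      have 2: "{min z y0..max z y0} \<subseteq> X" using that(1) by (simp only: K_def mem_Collect_eq)
      show ?thesis unfolding K_def mem_Collect_eq using 1 2 by (rule order_trans)
    qed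
    have adj: "b \<in> K" if "a \<in> K" "b \<in> X" "\<bar>a - b\<bar> = 1" for a b
    proof -
      have 1: "{min b y0..max b y0} \<subseteq> insert b {min a y0..max a y0}" using that(3) by (auto simp: min_def max_def split: if_splits)
      have "{min a y0..max a y0} \<subseteq> X" using that(1) by (simp only: K_def mem_Collect_eq)
      then have 2: "insert b {min a y0..max a y0} \<subseteq> X" using that(2) by (simp only: insert_subset simp_thms)
      show ?thesis unfolding K_def mem_Collect_eq using 1 2 by (rule order_trans)
    qed
    define up where "up = (\<lambda>y :: int. y + of_bool (y \<in> K))"
    define dn where "dn = (\<lambda>y :: int. y - of_bool (y \<in> K))"
    \<comment> \<open>Neighbouring integers in \<open>X\<close> lie both in \<open>K\<close> or both
      outside, and all other pairs leave room for one step.\<close>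
    have mono: "up a < up b" "dn a < dn b" if "a \<in> values_of I g \<union> Lb" "b \<in> values_of I g \<union> Lb" "a < b" for a b
    proof -
      have "a \<in> X" "b \<in> X" using that by (auto simp: X_def La_def)
      then have "a \<in> K \<longleftrightarrow> b \<in> K" if "b = a + 1" using adj[of a b] adj[of b a] that by auto
      moreover have "b = a + 1 \<or> a + 1 < b" using that(3) by linarith
      ultimately have "up a < up b \<and> dn a < dn b" unfolding up_def dn_def of_bool_def by auto
      then show "up a < up b" "dn a < dn b" by auto
    qed
    have fix_Lb: "up l = l" "dn l = l" if "l \<in> Lb" for l
      using that KLa by (auto simp: up_def dn_def La_def of_bool_def)
    have Au: "A (\<lambda>i. relabel up (g i))" by (rule closed[OF g(1)]) (use mono fix_Lb in auto)
    have Ad: "A (\<lambda>i. relabel dn (g i))" by (rule closed[OF g(1)]) (use mono fix_Lb in auto)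
    have "pcost (labs (relabel up (g i))) + pcost (labs (relabel dn (g i))) = 2 * pcost (labs (g i))" if i: "i \<in> I" for i
      unfolding up_def dn_def
    proof (rule pcost_relabel)
      fix z assume "z \<in> set (g i)"
      then have "old z \<in> Lb" by (rule olds[OF g(1) i])
      then show "old z \<notin> K \<and> old z - 1 \<notin> K \<and> old z + 1 \<notin> K" using KLa by (auto simp: La_def)
    qed (use srt[OF g(1) i] srt[OF Au i] srt[OF Ad i] in \<open>simp_all add: up_def dn_def\<close>)
    then have "(\<Sum>i\<in>I. pcost (labs (relabel up (g i))) + pcost (labs (relabel dn (g i)))) = (\<Sum>i\<in>I. 2 * pcost (labs (g i)))"
      by (intro sum.cong) auto
    then have "int (M (\<lambda>i. relabel up (g i))) + int (M (\<lambda>i. relabel dn (g i))) = 2 * int (M g)"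
      unfolding Mi by (simp add: sum.distrib sum_distrib_left)
    \<comment> \<open>Neither cost is below the least one and their mean equals it.\<close>
    then have M: "M (\<lambda>i. relabel up (g i)) = M g0" "M (\<lambda>i. relabel dn (g i)) = M g0"
      using g0(2)[OF Au] g0(2)[OF Ad] g(2) by linarith+
    have m0K: "m0 \<notin> K" using m0 KLa by (auto simp: La_def)
    \<comment> \<open>\<open>K\<close> is an interval without \<open>m0\<close>, so one of the two
      moves brings all of it closer to \<open>m0\<close>.\<close>
    have side: "(z < m0) = (y0 < m0)" if "z \<in> K" for z
    proof (rule ccontr)
      assume "(z < m0) \<noteq> (y0 < m0)"
      then have "m0 \<in> {min z y0..max z y0}" by (auto simp: min_def max_def)
      then show False using conv[OF that] m0K by blast
    qed
    have less: "B (\<lambda>i. relabel \<phi> (g i)) < B g"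
      if \<phi>: "\<And>y. \<bar>\<phi> y - m0\<bar> = \<bar>y - m0\<bar> - of_bool (y \<in> K)" for \<phi>
    proof -
      obtain i0 z0 where i0: "i0 \<in> I" "z0 \<in> set (g i0)" "new z0 = y0" using y0 by (auto simp: values_of_def)
      have le: "(\<Sum>z\<leftarrow>relabel \<phi> (g i). \<bar>new z - m0\<bar>) \<le> (\<Sum>z\<leftarrow>g i. \<bar>new z - m0\<bar>)" for i
        unfolding relabel_def by (simp add: comp_def \<phi>) (rule sum_list_mono, simp)
      have "(\<Sum>z\<leftarrow>q. \<bar>\<phi> (new z) - m0\<bar>) < (\<Sum>z\<leftarrow>q. \<bar>new z - m0\<bar>)" if "z0 \<in> set q" for q
        using that
      proof (induction q)
        case (Cons z q)
        have *: "(\<Sum>z\<leftarrow>q. \<bar>\<phi> (new z) - m0\<bar>) \<le> (\<Sum>z\<leftarrow>q. \<bar>new z - m0\<bar>)" by (rule sum_list_mono) (simp add: \<phi>)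
        show ?case
        proof (cases "z = z0")
          case True
          then show ?thesis using * i0(3) y0K by (simp add: \<phi>)
        next
          case False
          then have "(\<Sum>z\<leftarrow>q. \<bar>\<phi> (new z) - m0\<bar>) < (\<Sum>z\<leftarrow>q. \<bar>new z - m0\<bar>)" using Cons by simp
          moreover have "\<bar>\<phi> (new z) - m0\<bar> \<le> \<bar>new z - m0\<bar>" by (simp add: \<phi>)
          ultimately show ?thesis by simp
        qed
      qed simp
      from this[OF i0(2)] have lt: "(\<Sum>z\<leftarrow>relabel \<phi> (g i0). \<bar>new z - m0\<bar>) < (\<Sum>z\<leftarrow>g i0. \<bar>new z - m0\<bar>)"
        by (simp add: relabel_def comp_def)
      have "int (B (\<lambda>i. relabel \<phi> (g i))) < int (B g)"
        unfolding Bi by (rule sum_strict_mono_ex1[OF fin(1)]) (use le lt i0(1) in auto)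
      then show ?thesis by simp
    qed
    show False
    proof (cases "y0 < m0")
      case True
      have "\<bar>up y - m0\<bar> = \<bar>y - m0\<bar> - of_bool (y \<in> K)" for y
        using side[of y] True by (cases "y \<in> K") (auto simp: up_def)
      from less[OF this] show False using g(3)[OF Au M(1)] by simp
    next
      case False
      have "\<bar>dn y - m0\<bar> = \<bar>y - m0\<bar> - of_bool (y \<in> K)" for y
      proof (cases "y \<in> K")
        case True
        then have "y \<noteq> m0" "\<not> y < m0" using m0K side False by auto
        then show ?thesis using True by (simp add: dn_def)
      qed (simp add: dn_def)
      from less[OF this] show False using g(3)[OF Ad M(2)] by simp
    qed
  qed
  moreover have "(\<Sum>i\<in>I. pcost (labs (g i))) \<le> (\<Sum>i\<in>I. pcost (labs (f i)))"
    using g0(2)[OF f] g(2) Mi[of g] Mi[of f] by linarith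
  ultimately show ?thesis using g(1) by blast
qed

section \<open>Dynamic programming over sets of base paths\<close>

text \<open>An edge of a base path: arc, label, tail and head.\<close>

type_synonym edge = "nat \<times> int \<times> nat \<times> nat"
type_synonym item = "nat \<times> edge list"
type_synonym eprof = "(edge \<times> int) list"
type_synonym witness = "eprof \<times> (item \<times> eprof) list"
type_synonym key = "item list \<times> edge list \<times> int"
type_synonym dp_table = "(key \<times> witness) list"

abbreviation lab :: "edge \<Rightarrow> int" where "lab e \<equiv> fst (snd e)"
abbreviation tl_of :: "edge \<Rightarrow> nat" where "tl_of e \<equiv> fst (snd (snd e))"
abbreviation hd_of :: "edge \<Rightarrow> nat" where "hd_of e \<equiv> snd (snd (snd e))"

definition start :: "item \<Rightarrow> nat" where
  "start i = (case snd i of [] \<Rightarrow> 0 | e # _ \<Rightarrow> tl_of e)"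

definition ok :: "bool \<Rightarrow> bool \<Rightarrow> edge \<Rightarrow> int \<Rightarrow> bool" where
  "ok up dn e x \<longleftrightarrow> lab e = x \<or> (up \<and> lab e < x) \<or> (dn \<and> x < lab e)"

text \<open>The leading suffix is charged without the delay of its first edge. This delay is paid
  when the suffix is boarded and becomes an item, which is charged by \<open>pcost\<close>.\<close>

definition wcost :: "witness \<Rightarrow> int" where
  "wcost w = scost (labs (fst w)) + sum_list (map (\<lambda>iq. pcost (labs (snd iq))) (snd w))"

text \<open>
  A table entry for the key \<open>(S, suf, x)\<close> is a cheapest relabelling of \<open>suf\<close> and of the items in \<open>S\<close>
  such that the first edge of \<open>suf\<close> gets label \<open>x\<close> and every item in \<open>S\<close> is reached from \<open>suf\<close>.
  Either \<open>suf\<close> is left along its first edge by an item \<open>i\<close>, which takes over a part of \<open>S\<close>, or the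
  first edge of \<open>suf\<close> is dropped.
\<close>

definition base_cands :: "key \<Rightarrow> witness list" where
  "base_cands k = (case fst (snd k) of [] \<Rightarrow> [] | e # r \<Rightarrow>
     if r = [] \<and> fst k = [] then [([(e, snd (snd k))], [])] else [])"

definition move_cands :: "dp_table \<Rightarrow> key \<Rightarrow> witness list" where
  "move_cands tab k = (case fst (snd k) of [] \<Rightarrow> [] | e # r \<Rightarrow>
     concat (map (\<lambda>t. if r \<noteq> [] \<and> fst (fst t) = fst k \<and> fst (snd (fst t)) = r \<and> snd (snd k) < snd (snd (fst t))
       then [((e, snd (snd k)) # fst (snd t), snd (snd t))] else []) tab))"

definition serve_cands :: "dp_table \<Rightarrow> key \<Rightarrow> witness list" where
  "serve_cands tab k = (case fst (snd k) of [] \<Rightarrow> [] | e # r \<Rightarrow>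
     concat (map (\<lambda>i. if start i = hd_of e then
       concat (map (\<lambda>t. if fst (snd (fst t)) = snd i \<and> snd (snd k) < snd (snd (fst t)) \<and> i \<notin> set (fst (fst t)) \<and>
           list_all (\<lambda>j. j \<in> set (fst k)) (fst (fst t))
         then concat (map (\<lambda>u. if fst (snd (fst u)) = fst (snd k) \<and> snd (snd (fst u)) = snd (snd k) \<and>
             fst (fst u) = filter (\<lambda>j. j \<noteq> i \<and> j \<notin> set (fst (fst t))) (fst k)
           then [(fst (snd u), (i, fst (snd t)) # snd (snd t) @ snd (snd u))] else []) tab)
         else []) tab)
       else []) (fst k)))"

definition cands :: "dp_table \<Rightarrow> key \<Rightarrow> witness list" where
  "cands tab k = base_cands k @ move_cands tab k @ serve_cands tab k"

text \<open>A list of length at most one plays the role of an optional value.\<close>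

primrec pick :: "witness list \<Rightarrow> witness list" where
  "pick [] = []"
| "pick (w # ws) = (case pick ws of [] \<Rightarrow> [w] | v # _ \<Rightarrow> if wcost w \<le> wcost v then [w] else [v])"

text \<open>Every entry is recomputed from the table of the previous round, so the number of rounds
  only has to reach the depth of a derivation; \<open>dp_complete\<close> bounds it.\<close>

definition round_tab :: "key list \<Rightarrow> dp_table \<Rightarrow> dp_table" where
  "round_tab keys tab = concat (map (\<lambda>k. map (Pair k) (pick (cands tab k))) keys)"

text \<open>The second argument only serves as a counter.\<close>

primrec dp_rounds :: "key list \<Rightarrow> 'a list \<Rightarrow> dp_table" where
  "dp_rounds keys [] = []"
| "dp_rounds keys (_ # l) = round_tab keys (dp_rounds keys l)"

definition all_keys :: "bool \<Rightarrow> bool \<Rightarrow> item list list \<Rightarrow> edge list list \<Rightarrow> int list \<Rightarrow> key list" where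
  "all_keys up dn subs sufs X = concat (map (\<lambda>S. concat (map (\<lambda>suf. concat (map (\<lambda>x.
     case suf of [] \<Rightarrow> [] | e # _ \<Rightarrow> if ok up dn e x then [(S, suf, x)] else []) X)) sufs)) subs)"

lemma set_all_keys:
  "(S, suf, x) \<in> set (all_keys up dn subs sufs X) \<longleftrightarrow>
     S \<in> set subs \<and> suf \<in> set sufs \<and> x \<in> set X \<and> suf \<noteq> [] \<and> ok up dn (hd suf) x"
proof -
  have "(S, suf, x) \<in> set (case suf' of [] \<Rightarrow> [] | e # _ \<Rightarrow> if ok up dn e x' then [(S', suf', x')] else []) \<longleftrightarrow>
      S' = S \<and> suf' = suf \<and> x' = x \<and> suf \<noteq> [] \<and> ok up dn (hd suf) x" for S' suf' x'
    by (cases suf') auto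
  then show ?thesis unfolding all_keys_def by (simp del: split_paired_Ex)
qed

section \<open>Soundness and completeness of the table\<close>

lemma pick_in: "set (pick ws) \<subseteq> set ws"
  by (induction ws) (auto split: list.splits if_splits)

lemma length_pick: "length (pick ws) \<le> 1"
  by (induction ws) (auto split: list.splits if_splits)

lemma pick_eq_Nil [simp]: "pick ws = [] \<longleftrightarrow> ws = []"
  by (cases ws) (auto split: list.splits)

lemma pick_le: "w \<in> set ws \<Longrightarrow> \<exists>v. pick ws = [v] \<and> wcost v \<le> wcost w"
proof (induction ws)
  case (Cons u ws)
  show ?case
  proof (cases "pick ws")
    case Nil
    then show ?thesis using Cons.prems by simp
  next
    case (Cons v vs)
    then have "pick ws = [v]" using length_pick[of ws] by simp
    then show ?thesis using Cons.IH Cons.prems by (cases "w = u"; cases "wcost u \<le> wcost v") simp_all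
  qed
qed simp

definition events :: "witness \<Rightarrow> (edge \<times> int) set" where
  "events w = set (fst w) \<union> (\<Union>iq\<in>set (snd w). set (snd iq))"

text \<open>An item may be boarded at any event of the witness; no tree is recorded. Since the
  boarding event has a smaller label than the first edge of the item, circular boarding is
  impossible.\<close>

definition valid :: "bool \<Rightarrow> bool \<Rightarrow> int set \<Rightarrow> key \<Rightarrow> witness \<Rightarrow> bool" where
  "valid up dn X k w \<longleftrightarrow>
     map fst (fst w) = fst (snd k) \<and> fst w \<noteq> [] \<and> snd (hd (fst w)) = snd (snd k) \<and>
     sorted_wrt (<) (map snd (fst w)) \<and>
     distinct (map fst (snd w)) \<and> fst ` set (snd w) = set (fst k) \<and>
     (\<forall>iq\<in>set (snd w). map fst (snd iq) = snd (fst iq) \<and> snd iq \<noteq> [] \<and> sorted_wrt (<) (map snd (snd iq)) \<and>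
        (\<exists>ey\<in>events w. hd_of (fst ey) = start (fst iq) \<and> snd ey < snd (hd (snd iq)))) \<and>
     (\<forall>ey\<in>events w. ok up dn (fst ey) (snd ey) \<and> snd ey \<in> X)"

text \<open>In a candidate from \<open>serve_cands\<close> the two entries serve disjoint sets of
  items and \<open>i\<close> is in neither of them, so no item is relabelled twice.\<close>

lemma valid_cands:
  assumes tab: "\<And>k w. (k, w) \<in> set tab \<Longrightarrow> valid up dn X k w"
    and k: "k = (S, suf, x)" "suf \<noteq> []" "ok up dn (hd suf) x" "x \<in> X" "distinct S"
    and w: "w \<in> set (cands tab k)"
  shows "valid up dn X k w"
proof -
  obtain e r where er: "suf = e # r" using k(2) by (cases suf) auto
  consider "w \<in> set (base_cands k)" | "w \<in> set (move_cands tab k)" | "w \<in> set (serve_cands tab k)"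
    using w by (auto simp: cands_def)
  then show ?thesis
  proof cases
    case 1
    then have "r = []" "S = []" "w = ([(e, x)], [])" by (auto simp: base_cands_def k er split: if_splits)
    then show ?thesis using k er by (simp add: valid_def events_def)
  next
    case 2
    then obtain t where t: "t \<in> set tab" "r \<noteq> []" "fst (fst t) = S" "fst (snd (fst t)) = r" "x < snd (snd (fst t))"
      and wt: "w = ((e, x) # fst (snd t), snd (snd t))"
      by (auto simp: move_cands_def k er split: if_splits)
    obtain S' r' x' v where t': "t = ((S', r', x'), v)" by (metis prod.collapse)
    have v: "valid up dn X (S, r, x') v" using tab[of "(S, r, x')" v] t t' by simp
    have ev: "events w = insert (e, x) (events v)" by (auto simp: events_def wt t')
    have srt: "sorted_wrt (<) (map snd ((e, x) # fst v))"
    proof -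
      obtain z q where z: "fst v = z # q" using v by (cases "fst v") (auto simp: valid_def)
      have "snd z = x'" "sorted_wrt (<) (map snd (z # q))" using v z by (auto simp: valid_def)
      then show ?thesis using t(5) t' z by auto
    qed
    show ?thesis using v srt k er t(3) t' unfolding valid_def ev by (auto simp: wt)
  next
    case 3
    then obtain i t u where i: "i \<in> set S" "start i = hd_of e" and t: "t \<in> set tab" "fst (snd (fst t)) = snd i" "x < snd (snd (fst t))"
       "i \<notin> set (fst (fst t))" "\<forall>j\<in>set (fst (fst t)). j \<in> set S"
      and u: "u \<in> set tab" "fst (snd (fst u)) = suf" "snd (snd (fst u)) = x" "fst (fst u) = filter (\<lambda>j. j \<noteq> i \<and> j \<notin> set (fst (fst t))) S"
      and wt: "w = (fst (snd u), (i, fst (snd t)) # snd (snd t) @ snd (snd u))"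
      by (auto simp: serve_cands_def k er list_all_iff split: if_splits)
    obtain S' r' x' v where t': "t = ((S', r', x'), v)" by (metis prod.collapse)
    obtain S1 r1 x1 v1 where u': "u = ((S1, r1, x1), v1)" by (metis prod.collapse)
    have v: "valid up dn X (S', snd i, x') v" using tab[of "(S', r', x')" v] t t' by simp
    have v1: "valid up dn X (S1, suf, x) v1" using tab[of "(S1, r1, x1)" v1] u u' by simp
    have S: "set S' \<subseteq> set S" "i \<notin> set S'" "set S1 = {j \<in> set S. j \<noteq> i \<and> j \<notin> set S'}" using t u t' u' by auto
    have w': "w = (fst v1, (i, fst v) # snd v @ snd v1)" using wt t' u' by simp
    have ev: "events w = events v \<union> events v1" by (auto simp: events_def w')
    \<comment> \<open>The entry \<open>u\<close> still begins with the edge \<open>e\<close> at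
      label \<open>x\<close>; this is where \<open>i\<close> boards.\<close>
    have e1: "(e, x) \<in> events v1"
    proof -
      obtain z q where z: "fst v1 = z # q" using v1 by (cases "fst v1") (auto simp: valid_def)
      then have "fst z = e" "snd z = x" using v1 er by (auto simp: valid_def)
      then have "z = (e, x)" by (cases z) simp
      then show ?thesis using z by (auto simp: events_def)
    qed
    have x': "x < snd (hd (fst v))" using v t t' by (auto simp: valid_def)
    have dis: "distinct (map fst ((i, fst v) # snd v @ snd v1))"
      using v v1 S by (auto simp: valid_def)
    have set: "fst ` set ((i, fst v) # snd v @ snd v1) = set S"
      using v v1 S i by (auto simp: valid_def image_Un)
    have "map fst (fst v) = snd i \<and> fst v \<noteq> [] \<and> sorted_wrt (<) (map snd (fst v)) \<and>
        (\<exists>ey\<in>events w. hd_of (fst ey) = start i \<and> snd ey < snd (hd (fst v)))"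
    proof -
      have "\<exists>ey\<in>events w. hd_of (fst ey) = start i \<and> snd ey < snd (hd (fst v))"
        by (rule bexI[of _ "(e, x)"]) (use e1 i x' ev in simp_all)
      then show ?thesis using v by (simp add: valid_def)
    qed
    moreover have "\<forall>iq\<in>set (snd v @ snd v1). map fst (snd iq) = snd (fst iq) \<and> snd iq \<noteq> [] \<and> sorted_wrt (<) (map snd (snd iq)) \<and>
        (\<exists>ey\<in>events w. hd_of (fst ey) = start (fst iq) \<and> snd ey < snd (hd (snd iq)))"
      using v v1 unfolding valid_def ev by (simp add: ball_Un) blast
    ultimately have "\<forall>iq\<in>set (snd w). map fst (snd iq) = snd (fst iq) \<and> snd iq \<noteq> [] \<and> sorted_wrt (<) (map snd (snd iq)) \<and>
        (\<exists>ey\<in>events w. hd_of (fst ey) = start (fst iq) \<and> snd ey < snd (hd (snd iq)))"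
      by (simp add: w')
    moreover have "\<forall>ey\<in>events w. ok up dn (fst ey) (snd ey) \<and> snd ey \<in> X"
      using v v1 unfolding valid_def ev by blast
    moreover have "map fst (fst w) = suf \<and> fst w \<noteq> [] \<and> snd (hd (fst w)) = x \<and> sorted_wrt (<) (map snd (fst w))"
      using v1 by (simp add: valid_def w')
    ultimately show ?thesis unfolding valid_def k using dis set by (simp add: w')
  qed
qed

lemma valid_dp_rounds:
  assumes subs: "\<And>S. S \<in> set subs \<Longrightarrow> distinct S" and X: "set X \<subseteq> Y"
    and kw: "(k, w) \<in> set (dp_rounds (all_keys up dn subs sufs X) l)"
  shows "k \<in> set (all_keys up dn subs sufs X) \<and> valid up dn Y k w"
  using kw
proof (induction l arbitrary: k w)
  case (Cons a l)
  let ?t = "dp_rounds (all_keys up dn subs sufs X) l"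
  have k: "k \<in> set (all_keys up dn subs sufs X)" and w: "w \<in> set (pick (cands ?t k))"
    using Cons.prems by (auto simp: round_tab_def)
  have w: "w \<in> set (cands ?t k)" using w pick_in by blast
  obtain S suf x where kk: "k = (S, suf, x)" by (metis prod.collapse)
  have "valid up dn Y k w"
  proof (rule valid_cands[OF _ kk _ _ _ _ w])
    show "valid up dn Y k' w'" if "(k', w') \<in> set ?t" for k' w' using Cons.IH that by blast
  qed (use k subs X in \<open>auto simp: kk set_all_keys\<close>)
  then show ?case using k by simp
qed simp

lemma length_dp_rounds: "length (dp_rounds keys l) \<le> length keys"
proof (cases l)
  case (Cons a m)
  have "length (concat (map (\<lambda>k. map (Pair k) (pick (cands tab k))) ks)) \<le> length ks" for tab ks
  proof (induction ks)
    case (Cons k ks)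
    then show ?case using length_pick[of "cands tab k"] by simp
  qed simp
  then show ?thesis using Cons by (simp add: round_tab_def)
qed simp

definition fits :: "bool \<Rightarrow> bool \<Rightarrow> int set \<Rightarrow> (item \<Rightarrow> eprof) \<Rightarrow> item set \<Rightarrow> bool" where
  "fits up dn X f S \<longleftrightarrow> (\<forall>i\<in>S. map fst (f i) = snd i \<and> f i \<noteq> [] \<and> sorted_wrt (<) (map snd (f i)) \<and>
     (\<forall>ey\<in>set (f i). ok up dn (fst ey) (snd ey) \<and> snd ey \<in> X))"

definition served :: "(item \<Rightarrow> eprof) \<Rightarrow> (edge \<times> int) set \<Rightarrow> item \<Rightarrow> bool" where
  "served f E i \<longleftrightarrow> (\<exists>ey\<in>E. hd_of (fst ey) = start i \<and> snd ey < snd (hd (f i)))"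

text \<open>What \<open>pcost\<close> adds to \<open>scost\<close> depends only on the first edge
  and its label, and the key fixes both. So the comparison of \<open>scost\<close> in the table
  decides between relabellings of a suffix that is boarded later.\<close>

lemma pcost_boarding:
  "q \<noteq> [] \<Longrightarrow> pcost (labs q) = max 0 (new (hd q) - old (hd q)) + scost (labs q)"
  by (cases q) (auto simp: pcost_def labs_def)

lemma in_concat_map: "x \<in> set l \<Longrightarrow> y \<in> set (g x) \<Longrightarrow> y \<in> set (concat (map g l))"
  by auto

lemma in_set_if: "c \<Longrightarrow> y \<in> set a \<Longrightarrow> y \<in> set (if c then a else b)"
  by simp

lemma serve_candsI:
  assumes "suf = e # r" "i \<in> set S" "start i = hd_of e"
    and t: "((S', snd i, x'), w) \<in> set tab" "x < x'" "i \<notin> set S'" "set S' \<subseteq> set S"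
    and u: "((filter (\<lambda>j. j \<noteq> i \<and> j \<notin> set S') S, suf, x), w1) \<in> set tab"
  shows "(fst w1, (i, fst w) # snd w @ snd w1) \<in> set (serve_cands tab (S, suf, x))"
  unfolding serve_cands_def fst_conv snd_conv assms(1) list.case
  apply (rule in_concat_map[OF assms(2)])
  apply (rule in_set_if[OF assms(3)])
  apply (rule in_concat_map[OF t(1)])
  apply (rule in_set_if)
   apply (use t in \<open>auto simp: list_all_iff\<close>)[1]
  apply (simp only: fst_conv snd_conv)
  apply (rule in_concat_map[OF u])
  apply (rule in_set_if)
   apply (simp add: assms(1))
  apply simp
  done

text \<open>Induction on the rounds, following an arbitrary relabelling. If an item \<open>i\<close>
  boards at the first edge, the items that depend on \<open>i\<close> through boarding go with
  \<open>i\<close> and the others stay with \<open>suf\<close>; this cuts the boarding relation into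
  a tree. If no item boards there, the first edge is dropped. The required number of rounds
  decreases in both cases: removing an item from \<open>S\<close> frees \<open>L + 1\<close> rounds,
  enough for a new suffix of at most \<open>L\<close> edges.\<close>

lemma dp_complete:
  assumes its: "distinct its" "\<And>i. i \<in> set its \<Longrightarrow> length (snd i) \<le> L"
    and sufs: "\<And>i. i \<in> set its \<Longrightarrow> snd i \<in> set sufs" "\<And>e r. e # r \<in> set sufs \<Longrightarrow> r \<noteq> [] \<Longrightarrow> r \<in> set sufs"
    and X: "X = set Xs" and fit: "fits up dn X f (set its)"
    and S: "subseq S its" and suf: "suf \<in> set sufs"
    and pr: "map fst pr = suf" "pr \<noteq> []" "sorted_wrt (<) (map snd pr)" "\<And>ey. ey \<in> set pr \<Longrightarrow> ok up dn (fst ey) (snd ey) \<and> snd ey \<in> X"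
    and srv: "\<And>i. i \<in> set S \<Longrightarrow> served f (set pr \<union> (\<Union>j\<in>set S. set (f j))) i"
    and l: "length S * (L + 1) + length suf \<le> length l"
  shows "\<exists>w. ((S, suf, snd (hd pr)), w) \<in> set (dp_rounds (all_keys up dn (subseqs its) sufs Xs) l) \<and>
    wcost w \<le> scost (labs pr) + (\<Sum>i\<in>set S. pcost (labs (f i)))"
  using S suf pr srv l
proof (induction l arbitrary: S suf pr)
  case Nil
  then show ?case by simp
next
  case (Cons a l)
  let ?keys = "all_keys up dn (subseqs its) sufs Xs"
  let ?t = "dp_rounds ?keys l"
  obtain e x pr' where pr: "pr = (e, x) # pr'" using Cons.prems(4) by (metis list.exhaust prod.collapse)
  define r where "r = map fst pr'"
  have suf: "suf = e # r" using Cons.prems(3) by (simp add: pr r_def)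
  have dS: "distinct S" using Cons.prems(1) its(1) subseqs_distinctD[of S its] by simp
  have sub: "set S \<subseteq> set its" using Cons.prems(1) using subseqs_powset[of its] by auto
  have key: "(S, suf, x) \<in> set ?keys"
    using Cons.prems(1,2) Cons.prems(6)[of "(e, x)"] X by (simp add: set_all_keys suf pr)
  have hdpr: "snd (hd pr) = x" by (simp add: pr)
  have dist: "distinct T" if "T \<in> set (subseqs its)" for T using subseqs_distinctD[OF that its(1)] .
  have Xsub: "set Xs \<subseteq> X" using X by simp
  have step: ?case if w: "w \<in> set (cands ?t (S, suf, x))" and
    c: "wcost w \<le> scost (labs pr) + (\<Sum>i\<in>set S. pcost (labs (f i)))" for w
  proof -
    obtain v where v: "pick (cands ?t (S, suf, x)) = [v]" "wcost v \<le> wcost w" using pick_le[OF w] by blast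
    have "((S, suf, x), v) \<in> set (dp_rounds ?keys (a # l))"
      using key v(1) by (auto simp: round_tab_def intro!: bexI[of _ "(S, suf, x)"])
    then show ?thesis using v(2) c hdpr by (intro exI[of _ v]) simp
  qed
  show ?case
  proof (cases "\<exists>i\<in>set S. start i = hd_of e \<and> x < snd (hd (f i))")
    case True
    then obtain i where i: "i \<in> set S" "start i = hd_of e" "x < snd (hd (f i))" by blast
    define R where "R = {(j, k). j \<in> set S \<and> k \<in> set S \<and> (\<exists>ey\<in>set (f j). hd_of (fst ey) = start k \<and> snd ey < snd (hd (f k)))}"
    define D where "D j \<longleftrightarrow> j \<noteq> i \<and> (i, j) \<in> R\<^sup>+" for j
    define S' where "S' = filter D S"
    define S1 where "S1 = filter (\<lambda>j. j \<noteq> i \<and> j \<notin> set S') S"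
    have S1': "set S1 = {j \<in> set S. j \<noteq> i \<and> (i, j) \<notin> R\<^sup>+}" by (auto simp: S1_def S'_def D_def)
    have fi: "map fst (f i) = snd i" "f i \<noteq> []" "sorted_wrt (<) (map snd (f i))"
      "\<And>ey. ey \<in> set (f i) \<Longrightarrow> ok up dn (fst ey) (snd ey) \<and> snd ey \<in> X"
      using fit i(1) sub by (auto simp: fits_def)
    have lenS: "length S' < length S" "length S1 < length S"
      unfolding S'_def S1_def using i(1) by (auto intro!: length_filter_less simp: D_def)
    have "\<exists>w. ((S', snd i, snd (hd (f i))), w) \<in> set ?t \<and> wcost w \<le> scost (labs (f i)) + (\<Sum>j\<in>set S'. pcost (labs (f j)))"
    proof (rule Cons.IH[OF _ _ fi])
      show "subseq S' its" using Cons.prems(1) unfolding S'_def by (rule subseq_order.trans[OF subseq_filter_left])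
      show "snd i \<in> set sufs" using sufs(1) i(1) sub by blast
      have "length S' * (L + 1) + (L + 1) \<le> length S * (L + 1)" using lenS(1)
        by (metis Suc_leI add.commute mult_Suc mult_le_mono1)
      moreover have "length (snd i) \<le> L" using its(2) i(1) sub by blast
      ultimately show "length S' * (L + 1) + length (snd i) \<le> length l" using Cons.prems(8) suf by simp
      fix j assume j: "j \<in> set S'"
      then have "(i, j) \<in> R\<^sup>+" "j \<noteq> i" by (auto simp: S'_def D_def)
      then obtain k where "(i, k) \<in> R\<^sup>*" "(k, j) \<in> R" using tranclD2 by fast
      then have k: "(k, j) \<in> R" "k = i \<or> (i, k) \<in> R\<^sup>+" by (auto simp: rtrancl_eq_or_trancl)
      then have "k = i \<or> k \<in> set S'" by (auto simp: S'_def D_def R_def)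
      then show "served f (set (f i) \<union> (\<Union>j\<in>set S'. set (f j))) j" using k(1) by (auto simp: served_def R_def)
    qed
    then obtain w where w: "((S', snd i, snd (hd (f i))), w) \<in> set ?t"
      "wcost w \<le> scost (labs (f i)) + (\<Sum>j\<in>set S'. pcost (labs (f j)))" by blast
    have "\<exists>w. ((S1, suf, snd (hd pr)), w) \<in> set ?t \<and> wcost w \<le> scost (labs pr) + (\<Sum>j\<in>set S1. pcost (labs (f j)))"
    proof (rule Cons.IH[OF _ Cons.prems(2-6)])
      show "subseq S1 its" using Cons.prems(1) unfolding S1_def by (rule subseq_order.trans[OF subseq_filter_left])
      have "length S1 * (L + 1) < length S * (L + 1)" using lenS(2) by (rule mult_strict_right_mono) simp
      then show "length S1 * (L + 1) + length suf \<le> length l" using Cons.prems(8) by simp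
      fix j assume j: "j \<in> set S1"
      then have jS: "j \<in> set S" "j \<noteq> i" "(i, j) \<notin> R\<^sup>+" by (auto simp: S1')
      obtain ey where ey: "ey \<in> set pr \<union> (\<Union>j\<in>set S. set (f j))" "hd_of (fst ey) = start j" "snd ey < snd (hd (f j))"
        using Cons.prems(7)[OF jS(1)] unfolding served_def by blast
      \<comment> \<open>If the event belonged to \<open>i\<close> or to an item that depends on
        \<open>i\<close>, then \<open>j\<close> would depend on \<open>i\<close> as well.\<close>
      have "ey \<in> set pr \<union> (\<Union>j\<in>set S1. set (f j))"
      proof (rule ccontr)
        assume no: "\<not> ?thesis"
        then obtain k where k: "k \<in> set S" "ey \<in> set (f k)" "k \<notin> set S1" using ey(1) by blast
        then have "(k, j) \<in> R" "k = i \<or> (i, k) \<in> R\<^sup>+" using jS(1) ey by (auto simp: R_def S1')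
        then show False using jS(3) by (auto intro: trancl_into_trancl)
      qed
      then show "served f (set pr \<union> (\<Union>j\<in>set S1. set (f j))) j" using ey(2,3) unfolding served_def by blast
    qed
    then obtain w1 where w1: "((S1, suf, x), w1) \<in> set ?t"
      "wcost w1 \<le> scost (labs pr) + (\<Sum>j\<in>set S1. pcost (labs (f j)))" unfolding hdpr by blast
    let ?w = "(fst w1, (i, fst w) # snd w @ snd w1)"
    have "?w \<in> set (serve_cands ?t (S, suf, x))"
    proof -
      have "i \<notin> set S'" "set S' \<subseteq> set S" by (auto simp: S'_def D_def)
      then show ?thesis by (rule serve_candsI[OF suf i(1,2) w(1) i(3) _ _ w1(1)[unfolded S1_def]])
    qed
    then have cnd: "?w \<in> set (cands ?t (S, suf, x))" by (simp add: cands_def)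
    have vw: "valid up dn X (S', snd i, snd (hd (f i))) w"
      by (rule conjunct2[OF valid_dp_rounds[OF dist Xsub w(1)]])
    have w0: "fst w \<noteq> []" "fst (hd (fst w)) = fst (hd (f i))" "snd (hd (fst w)) = snd (hd (f i))"
    proof -
      show ne: "fst w \<noteq> []" using vw by (simp add: valid_def)
      have "map fst (fst w) = map fst (f i)" using vw fi(1) by (simp add: valid_def)
      then show "fst (hd (fst w)) = fst (hd (f i))" using ne fi(2) by (metis hd_map)
      show "snd (hd (fst w)) = snd (hd (f i))" using vw by (simp add: valid_def)
    qed
    have pc: "pcost (labs (fst w)) = pcost (labs (f i)) - scost (labs (f i)) + scost (labs (fst w))"
      using w0 fi(2) by (simp add: pcost_boarding)
    have "set S = insert i (set S' \<union> set S1)" using i(1) by (auto simp: S1_def S'_def)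
    moreover have "i \<notin> set S' \<union> set S1" "set S' \<inter> set S1 = {}" by (auto simp: S1_def S'_def D_def)
    ultimately have sum: "(\<Sum>j\<in>set S. pcost (labs (f j))) = pcost (labs (f i)) + (\<Sum>j\<in>set S'. pcost (labs (f j))) + (\<Sum>j\<in>set S1. pcost (labs (f j)))"
      by (simp add: sum.union_disjoint)
    have "wcost ?w = scost (labs (fst w1)) + pcost (labs (fst w)) + sum_list (map (\<lambda>iq. pcost (labs (snd iq))) (snd w))
       + sum_list (map (\<lambda>iq. pcost (labs (snd iq))) (snd w1))" by (simp add: wcost_def)
    then have "wcost ?w \<le> scost (labs pr) + (\<Sum>i\<in>set S. pcost (labs (f i)))"
      using w(2) w1(2) pc sum by (simp add: wcost_def)
    then show ?thesis by (rule step[OF cnd])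
  next
    case False
    have srv': "served f (set pr' \<union> (\<Union>j\<in>set S. set (f j))) i" if "i \<in> set S" for i
      using Cons.prems(7)[OF that] False that by (auto simp: served_def pr)
    show ?thesis
    proof (cases "pr' = []")
      case True
      \<comment> \<open>With no edges of \<open>suf\<close> left, an item with the least first label
        has nowhere to board, as no event of an item in \<open>S\<close> is earlier.\<close>
      have "S = []"
      proof (rule ccontr)
        assume "S \<noteq> []"
        then have "set S \<noteq> {}" by simp
        then obtain i where i: "i \<in> set S" "\<And>j. j \<in> set S \<Longrightarrow> snd (hd (f i)) \<le> snd (hd (f j))"
          using arg_min_if_finite[of "set S" "\<lambda>j. snd (hd (f j))"] by (metis List.finite_set not_le)
        obtain j ey where j: "j \<in> set S" "ey \<in> set (f j)" "snd ey < snd (hd (f i))"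
          using srv'[OF i(1)] unfolding served_def True by auto
        have "snd (hd (f j)) \<le> snd ey"
        proof -
          have "sorted_wrt (<) (map snd (f j))" using fit j(1) sub by (auto simp: fits_def)
          then show ?thesis using j(2) by (cases "f j") auto
        qed
        then show False using i(2)[OF j(1)] j(3) by linarith
      qed
      then have "([(e, x)], []) \<in> set (cands ?t (S, suf, x))" using True by (simp add: cands_def base_cands_def suf r_def)
      then show ?thesis by (rule step) (use True \<open>S = []\<close> in \<open>simp add: wcost_def pr\<close>)
    next
      case ne: False
      have hd': "x < snd (hd pr')" using Cons.prems(5) ne by (cases pr') (auto simp: pr)
      have "\<exists>w. ((S, r, snd (hd pr')), w) \<in> set ?t \<and> wcost w \<le> scost (labs pr') + (\<Sum>j\<in>set S. pcost (labs (f j)))"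
      proof (rule Cons.IH[OF Cons.prems(1)])
        show "r \<in> set sufs" using sufs(2)[of e r] Cons.prems(2) suf ne by (simp add: r_def)
      qed (use Cons.prems ne srv' in \<open>auto simp: r_def pr suf\<close>)
      then obtain w where w: "((S, r, snd (hd pr')), w) \<in> set ?t"
        "wcost w \<le> scost (labs pr') + (\<Sum>j\<in>set S. pcost (labs (f j)))" by blast
      let ?w = "((e, x) # fst w, snd w)"
      have "?w \<in> set (move_cands ?t (S, suf, x))"
        unfolding move_cands_def using w(1) hd' ne
        by (auto simp: suf r_def intro!: bexI[of _ "((S, r, snd (hd pr')), w)"])
      then have cnd: "?w \<in> set (cands ?t (S, suf, x))" by (simp add: cands_def)
      have vw: "valid up dn X (S, r, snd (hd pr')) w"
        by (rule conjunct2[OF valid_dp_rounds[OF dist Xsub w(1)]])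
      have w0: "fst w \<noteq> []" "fst (hd (fst w)) = fst (hd pr')" "snd (hd (fst w)) = snd (hd pr')"
      proof -
        show nw: "fst w \<noteq> []" using vw by (simp add: valid_def)
        have "map fst (fst w) = map fst pr'" using vw by (simp add: valid_def r_def)
        then show "fst (hd (fst w)) = fst (hd pr')" using nw ne by (metis hd_map)
        show "snd (hd (fst w)) = snd (hd pr')" using vw by (simp add: valid_def)
      qed
      \<comment> \<open>The term that \<open>e\<close> contributes depends only on the first edge
        and label of what follows, and these agree in the table entry and in
        \<open>pr'\<close>.\<close>
      have "scost (labs ((e, x) # fst w)) - scost (labs (fst w)) = scost (labs ((e, x) # pr')) - scost (labs pr')"
        using w0 ne by (cases "fst w"; cases pr') (auto simp: labs_def)
      then have "wcost ?w \<le> scost (labs pr) + (\<Sum>i\<in>set S. pcost (labs (f i)))"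
        using w(2) by (simp add: wcost_def pr del: scost.simps)
      then show ?thesis by (rule step[OF cnd])
    qed
  qed
qed

section \<open>The algorithm\<close>

type_synonym graph_data = "nat list \<times> (nat \<times> nat \<times> nat \<times> int list) list \<times> (nat \<times> int) list list"

text \<open>Its encoding is literally \<open>enc_path_graph G\<close> (see
  \<open>enc_path_graph_eq\<close>), so the algorithm can be written as a function on lists.\<close>

definition graph_data :: "(nat, nat) path_graph \<Rightarrow> graph_data" where
  "graph_data G = (let D = digraph_of G in
     (sorted_list_of_set (verts D),
      map (\<lambda>e. (e, tail D e, head D e, sorted_list_of_multiset (labels G e))) (sorted_list_of_set (arcs D)),
      base_paths G))"

definition arc_info :: "(nat \<times> nat \<times> nat \<times> int list) list \<Rightarrow> nat \<Rightarrow> nat \<times> nat" where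
  "arc_info rs a = (case filter (\<lambda>r. fst r = a) rs of [] \<Rightarrow> (0, 0) | r # _ \<Rightarrow> (fst (snd r), fst (snd (snd r))))"

definition mk_edge :: "(nat \<times> nat \<times> nat \<times> int list) list \<Rightarrow> nat \<times> int \<Rightarrow> edge" where
  "mk_edge rs al = (fst al, snd al, arc_info rs (fst al))"

text \<open>Numbering downwards needs no accumulator; reversed lists are numbered in their original order.\<close>

primrec numbered :: "'a list \<Rightarrow> (nat \<times> 'a) list" where
  "numbered [] = []"
| "numbered (p # ps) = (length ps, p) # numbered ps"

definition items_of :: "graph_data \<Rightarrow> item list" where
  "items_of gd = numbered (map (map (mk_edge (fst (snd gd)))) (rev (snd (snd gd))))"

definition labels_of :: "item list \<Rightarrow> int list" where
  "labels_of fs = concat (map (\<lambda>i. map lab (snd i)) fs)"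

text \<open>
  By lemma \<open>rounding\<close>, new labels at distance at most \<open>n + 3 * n + 1\<close> from the \<open>n\<close> given ones
  suffice. The distances up to \<open>5 * n\<close> are represented as lengths of the suffixes of a list.
\<close>

definition near_labels :: "item list \<Rightarrow> int list" where
  "near_labels fs = (let L = labels_of fs in
     concat (map (\<lambda>l. concat (map (\<lambda>t. [l + int (length t), l - int (length t)]) (tails (L @ L @ L @ L @ L)))) L))"

definition abs_sum :: "int list \<Rightarrow> int" where
  "abs_sum X = sum_list (map abs X)"

text \<open>Smaller than every element of \<open>X\<close>, so that every first edge at the source
  can be boarded from the artificial edge.\<close>

definition root_label :: "int list \<Rightarrow> int" where
  "root_label X = - abs_sum X - 1"

text \<open>Bounds the cost of every relabelling by near labels, since an edge moves by at most the
  sum of the absolute values of its old and new label. Repeated summation takes the place of a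
  product.\<close>

definition cost_bound :: "item list \<Rightarrow> int" where
  "cost_bound fs = sum_list (map (\<lambda>_. abs_sum (near_labels fs) + abs_sum (near_labels fs)) (labels_of fs))"

text \<open>
  A running time in terms of the size of the graph does not allow for calculations with the whole
  budget, which may have more digits than any relevant cost.
\<close>

definition truncate :: "bool list \<Rightarrow> nat \<Rightarrow> nat" where
  "truncate l b = (if length (bits b) \<le> length l then b else bits_val (map (\<lambda>_. True) l))"

definition dp_sufs :: "edge \<Rightarrow> item list \<Rightarrow> edge list list" where
  "dp_sufs re part = [re] # concat (map (\<lambda>i. tails (snd i)) part)"

text \<open>\<open>dp_complete\<close> asks for \<open>length part * (L + 1) + 1\<close> rounds,
  where \<open>L + 1 = length sufs\<close>; the counter has length
  \<open>(length part + 1) * length sufs\<close>.\<close>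

definition dp_table :: "bool \<Rightarrow> bool \<Rightarrow> edge \<Rightarrow> int list \<Rightarrow> item list \<Rightarrow> item list list \<Rightarrow> dp_table" where
  "dp_table up dn re X part subs = (let sufs = dp_sufs re part in
     dp_rounds (all_keys up dn subs sufs X) (sufs @ concat (map (\<lambda>_. sufs) part)))"

definition dp_result :: "bool \<Rightarrow> bool \<Rightarrow> edge \<Rightarrow> int list \<Rightarrow> item list \<Rightarrow> item list list \<Rightarrow> witness list" where
  "dp_result up dn re X part subs =
     pick (map snd (filter (\<lambda>t. fst t = (part, [re], lab re)) (dp_table up dn re X part subs)))"

text \<open>A lower bound on the number of reached vertices as soon as all chosen suffixes can be
  boarded; it is exact if these consist of all usable edges.\<close>

definition gain :: "nat \<Rightarrow> item list \<Rightarrow> int" where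
  "gain s part = int (length (remdups (s # concat (map (\<lambda>i. map hd_of (snd i)) part))))"

definition wops :: "witness \<Rightarrow> nat shift list" where
  "wops w = all_ops (map (\<lambda>iq. (fst (fst iq), snd iq)) (snd w))"

text \<open>The components are the truncated budget, the source, the artificial edge and the
  candidate labels.\<close>

type_synonym env = "int \<times> nat \<times> edge \<times> int list"

definition improve :: "env \<Rightarrow> item list \<Rightarrow> witness list \<Rightarrow> int \<times> nat shift list \<Rightarrow> int \<times> nat shift list" where
  "improve x part ws best = (case ws of [] \<Rightarrow> best | w # _ \<Rightarrow>
     if wcost w \<le> fst x \<and> fst best < gain (fst (snd x)) part then (gain (fst (snd x)) part, wops w) else best)"

definition process :: "bool \<Rightarrow> bool \<Rightarrow> env \<Rightarrow> item list \<Rightarrow> int \<times> nat shift list \<Rightarrow> int \<times> nat shift list" where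
  "process up dn x part best =
     improve x part (dp_result up dn (fst (snd (snd x))) (snd (snd (snd x))) part (subseqs part)) best"

primrec fold_tails :: "('a list \<Rightarrow> 'r \<Rightarrow> 'r) \<Rightarrow> 'a list \<Rightarrow> 'r \<Rightarrow> 'r" where
  "fold_tails g [] b = g [] b"
| "fold_tails g (a # c) b = fold_tails g c (g (a # c) b)"

definition ext_part :: "nat \<Rightarrow> edge list \<Rightarrow> item list \<Rightarrow> item list" where
  "ext_part i c part = (if c = [] then part else (i, c) # part)"

text \<open>Choices are processed while they are generated, and only the best result is kept. Thus
  their number enters the time as a factor, not as the base of a polynomial.\<close>

primrec search :: "(item list \<Rightarrow> 'r \<Rightarrow> 'r) \<Rightarrow> item list \<Rightarrow> item list \<Rightarrow> 'r \<Rightarrow> 'r" where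
  "search pr [] part b = pr part b"
| "search pr (f # fs) part b = fold_tails (\<lambda>c b. search pr fs (ext_part (fst f) c part) b) (snd f) b"

text \<open>The source is represented by an edge that ends in it and precedes all others.\<close>

definition make_env :: "graph_data \<Rightarrow> nat \<Rightarrow> nat \<Rightarrow> env" where
  "make_env gd b s = (let fs = items_of gd; X = near_labels fs in
     (int (truncate (bits (nat \<bar>cost_bound fs\<bar>)) b), s, (0, root_label X, 0, s), root_label X # X))"

definition solve :: "bool \<Rightarrow> bool \<Rightarrow> graph_data \<Rightarrow> nat \<Rightarrow> nat \<Rightarrow> nat shift list" where
  "solve up dn gd b s = snd (search (process up dn (make_env gd b s)) (items_of gd) [] (0, []))"

subsection \<open>Invariants of the search\<close>

primrec choices :: "item list \<Rightarrow> item list \<Rightarrow> item list set" where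
  "choices [] part = {part}"
| "choices (f # fs) part = (\<Union>c\<in>set (tails (snd f)). choices fs (ext_part (fst f) c part))"

lemma fold_tails_invariant:
  assumes "\<And>c b. c \<in> set (tails l) \<Longrightarrow> P b \<Longrightarrow> P (g c b)" "P b"
  shows "P (fold_tails g l b)"
  using assms by (induction l arbitrary: b) auto

lemma fold_tails_reaches:
  assumes "c0 \<in> set (tails l)" "\<And>b. P b \<Longrightarrow> Q (g c0 b)" "\<And>c b. c \<in> set (tails l) \<Longrightarrow> P b \<Longrightarrow> P (g c b)"
    and "\<And>c b. c \<in> set (tails l) \<Longrightarrow> P b \<Longrightarrow> Q b \<Longrightarrow> Q (g c b)" "P b"
  shows "Q (fold_tails g l b)"
  using assms
proof (induction l arbitrary: b)
  case (Cons a l)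
  show ?case
  proof (cases "c0 = a # l")
    case True
    have "P (fold_tails g l (g (a # l) b)) \<and> Q (fold_tails g l (g (a # l) b))"
      by (rule fold_tails_invariant) (use Cons.prems True in auto)
    then show ?thesis by simp
  next
    case False
    then show ?thesis using Cons by simp
  qed
qed simp

lemma choices_step: "c \<in> set (tails (snd f)) \<Longrightarrow> p \<in> choices fs (ext_part (fst f) c part) \<Longrightarrow> p \<in> choices (f # fs) part"
  by auto

lemma search_invariant:
  assumes "\<And>p b. p \<in> choices fs part \<Longrightarrow> P b \<Longrightarrow> P (pr p b)" "P b"
  shows "P (search pr fs part b)"
  using assms
proof (induction fs arbitrary: part b)
  case (Cons f fs)
  show ?case unfolding search.simps
  proof (rule fold_tails_invariant)
    fix c b assume c: "c \<in> set (tails (snd f))" and "P b"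
    show "P (search pr fs (ext_part (fst f) c part) b)"
      by (rule Cons.IH[OF Cons.prems(1)[OF choices_step[OF c]] \<open>P b\<close>])
  qed (rule Cons.prems)
qed simp

lemma search_reaches:
  assumes "p0 \<in> choices fs part" "\<And>b. P b \<Longrightarrow> Q (pr p0 b)" "\<And>p b. p \<in> choices fs part \<Longrightarrow> P b \<Longrightarrow> P (pr p b)"
    and "\<And>p b. p \<in> choices fs part \<Longrightarrow> P b \<Longrightarrow> Q b \<Longrightarrow> Q (pr p b)" "P b"
  shows "Q (search pr fs part b)"
  using assms
proof (induction fs arbitrary: part b)
  case (Cons f fs)
  obtain c0 where c0: "c0 \<in> set (tails (snd f))" "p0 \<in> choices fs (ext_part (fst f) c0 part)"
    using Cons.prems(1) by auto
  show ?case unfolding search.simps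
  proof (rule fold_tails_reaches[where P = P, OF c0(1)])
    show "Q (search pr fs (ext_part (fst f) c0 part) b)" if "P b" for b
      by (rule Cons.IH[OF c0(2) Cons.prems(2) Cons.prems(3)[OF choices_step[OF c0(1)]]
            Cons.prems(4)[OF choices_step[OF c0(1)]] that])
    show "P (search pr fs (ext_part (fst f) c part) b)" if c: "c \<in> set (tails (snd f))" and "P b" for c b
      by (rule search_invariant[where P = P, OF Cons.prems(3)[OF choices_step[OF c]] that(2)])
    show "Q (search pr fs (ext_part (fst f) c part) b)" if c: "c \<in> set (tails (snd f))" and "P b" "Q b" for c b
    proof -
      have "P (search pr fs (ext_part (fst f) c part) b) \<and> Q (search pr fs (ext_part (fst f) c part) b)"
      proof (rule search_invariant[where P = "\<lambda>b. P b \<and> Q b"])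
        fix p b assume p: "p \<in> choices fs (ext_part (fst f) c part)" and "P b \<and> Q b"
        then show "P (pr p b) \<and> Q (pr p b)"
          using Cons.prems(3)[OF choices_step[OF c p]] Cons.prems(4)[OF choices_step[OF c p]] by blast
      qed (use that in simp)
      then show ?thesis by simp
    qed
  qed (rule Cons.prems)
qed simp

definition good_part :: "item list \<Rightarrow> item list \<Rightarrow> bool" where
  "good_part fs part \<longleftrightarrow> distinct (map fst part) \<and>
     (\<forall>(i, c)\<in>set part. c \<noteq> [] \<and> (\<exists>k l. (i, l) \<in> set fs \<and> c = drop k l))"

lemma choices_good:
  assumes "p \<in> choices fs part" "good_part gs part" "distinct (map fst fs)"
    "fst ` set fs \<inter> fst ` set part = {}" "set fs \<subseteq> set gs"
  shows "good_part gs p"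
  using assms
proof (induction fs arbitrary: part)
  case (Cons f fs)
  obtain c where c: "c \<in> set (tails (snd f))" "p \<in> choices fs (ext_part (fst f) c part)" using Cons.prems(1) by auto
  obtain k where k: "c = drop k (snd f)" using c(1) by (auto simp: set_tails)
  have "\<exists>k l. (fst f, l) \<in> set gs \<and> c = drop k l"
    by (rule exI[of _ k], rule exI[of _ "snd f"]) (use k Cons.prems(5) in simp)
  then have "good_part gs (ext_part (fst f) c part)"
    using Cons.prems(2,4) by (simp add: good_part_def ext_part_def)
  then show ?case by (rule Cons.IH[OF c(2)]) (use Cons.prems in \<open>auto simp: ext_part_def\<close>)
qed simp

lemma choices_exist:
  "\<exists>p\<in>choices fs part. set p = set part \<union> {(fst f, drop (k f) (snd f)) |f. f \<in> set fs \<and> drop (k f) (snd f) \<noteq> []}"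
proof (induction fs arbitrary: part)
  case (Cons f fs)
  let ?c = "drop (k f) (snd f)"
  obtain p where p: "p \<in> choices fs (ext_part (fst f) ?c part)"
    "set p = set (ext_part (fst f) ?c part) \<union> {(fst f, drop (k f) (snd f)) |f. f \<in> set fs \<and> drop (k f) (snd f) \<noteq> []}"
    using Cons by blast
  have "?c \<in> set (tails (snd f))" by (auto simp: set_tails)
  then have "p \<in> choices (f # fs) part" using p(1) by auto
  moreover have "set p = set part \<union> {(fst g, drop (k g) (snd g)) |g. g \<in> set (f # fs) \<and> drop (k g) (snd g) \<noteq> []}"
    unfolding p(2) ext_part_def by (auto simp del: split_paired_Ex split_paired_All)
  ultimately show ?case by blast
qed simp

section \<open>Candidate labels and the truncated budget\<close>

lemma near_labels_mem:
  assumes "l \<in> set (labels_of fs)" "\<bar>y - l\<bar> \<le> 5 * int (length (labels_of fs))"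
  shows "y \<in> set (near_labels fs)"
proof -
  let ?L = "labels_of fs"
  define u where "u = ?L @ ?L @ ?L @ ?L @ ?L"
  define c where "c = nat \<bar>y - l\<bar>"
  have "length u = 5 * length ?L" by (simp add: u_def)
  then have c: "c \<le> length u" using assms(2) by (simp add: c_def)
  define t where "t = drop (length u - c) u"
  have t: "t \<in> set (tails u)" "length t = c" using c by (auto simp: set_tails t_def)
  have "y = l + int c \<or> y = l - int c" by (auto simp: c_def)
  then have "y \<in> set [l + int (length t), l - int (length t)]" using t(2) by simp
  then show ?thesis unfolding near_labels_def Let_def u_def[symmetric]
    by (intro in_concat_map[OF assms(1)] in_concat_map[OF t(1)])
qed

lemma labels_near: "l \<in> set (labels_of fs) \<Longrightarrow> l \<in> set (near_labels fs)"
  by (rule near_labels_mem) auto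

lemma abs_le_abs_sum: "x \<in> set X \<Longrightarrow> \<bar>x\<bar> \<le> abs_sum X"
proof (induction X)
  case (Cons a X)
  have "0 \<le> sum_list (map abs X)" by (rule sum_list_nonneg) auto
  then show ?case using Cons by (auto simp: abs_sum_def)
qed simp

lemma root_label_less: "x \<in> set X \<Longrightarrow> root_label X < x"
  using abs_le_abs_sum[of x X] by (auto simp: root_label_def)

lemma bits_val_trues: "bits_val (map (\<lambda>_. True) l) + 1 = 2 ^ length l"
proof (induction l)
  case (Cons a l)
  have "bits_val (map (\<lambda>_. True) (a # l)) + 1 = 2 * (bits_val (map (\<lambda>_. True) l) + 1)" by simp
  then show ?case unfolding Cons by simp
qed simp

lemma truncate_le: "truncate l b \<le> b"
proof (cases "length (bits b) \<le> length l")
  case False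
  have "2 ^ length l \<le> b"
  proof (rule ccontr)
    assume "\<not> 2 ^ length l \<le> b"
    then have "length (bits b) \<le> length l" by (intro length_bits_le) simp
    then show False using False by simp
  qed
  then have "bits_val (map (\<lambda>_. True) l) < b" using bits_val_trues[of l] by linarith
  then show ?thesis using False by (simp add: truncate_def)
qed (simp add: truncate_def)

lemma le_truncate: assumes "c \<le> int b" "c \<le> int n" shows "c \<le> int (truncate (bits n) b)"
proof (cases "length (bits b) \<le> length (bits n)")
  case False
  have "n \<le> bits_val (map (\<lambda>_. True) (bits n))" using less_length_bits[of n] bits_val_trues[of "bits n"] by linarith
  then have "int n \<le> int (truncate (bits n) b)" using False by (simp add: truncate_def)
  then show ?thesis using assms by linarith
qed (use assms in \<open>simp add: truncate_def\<close>)

lemma set_numbered: "set (numbered ps) = (\<lambda>i. (i, rev ps ! i)) ` {..<length ps}"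
proof (induction ps)
  case (Cons p ps)
  have "(\<lambda>i. (i, rev (p # ps) ! i)) ` {..<length ps} = (\<lambda>i. (i, rev ps ! i)) ` {..<length ps}"
    by (rule image_cong) (simp_all add: nth_append)
  then show ?case using Cons by (simp add: lessThan_Suc nth_append)
qed simp

lemma fst_numbered: "map fst (numbered ps) = rev [0..<length ps]"
  by (induction ps) auto

lemma set_items_of:
  "set (items_of gd) = (\<lambda>i. (i, map (mk_edge (fst (snd gd))) (snd (snd gd) ! i))) ` {..<length (snd (snd gd))}"
  unfolding items_of_def set_numbered by (rule image_cong) (simp_all add: rev_map)

lemma distinct_items_of: "distinct (map fst (items_of gd))"
  by (simp add: items_of_def fst_numbered)

lemma dp_result_in: "w \<in> set (dp_result up dn re X part subs) \<Longrightarrow>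
    ((part, [re], lab re), w) \<in> set (dp_table up dn re X part subs)"
  using pick_in unfolding dp_result_def by fastforce

lemma dp_result_le:
  "((part, [re], lab re), w) \<in> set (dp_table up dn re X part subs) \<Longrightarrow>
   \<exists>v. dp_result up dn re X part subs = [v] \<and> wcost v \<le> wcost w"
  unfolding dp_result_def by (rule pick_le) force

lemma improve_mono: "fst best \<le> fst (improve x part ws best)"
  by (auto simp: improve_def split: list.splits)

section \<open>Correctness\<close>

text \<open>All three problems are treated at once, as only the permitted signs matter. The amount 0
  is left open: no generated operation has it, and it is compatible with both cases of
  \<open>pshifts_sign\<close>.\<close>

locale mr =
  fixes G :: "(nat, nat) path_graph" and b s :: nat and up dn :: bool and D :: "int set"
  assumes wf: "wf_path_graph G" and s: "s \<in> verts (digraph_of G)"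
    and D_pos: "\<And>\<delta>. \<delta> > 0 \<Longrightarrow> \<delta> \<in> D \<longleftrightarrow> up" and D_neg: "\<And>\<delta>. \<delta> < 0 \<Longrightarrow> \<delta> \<in> D \<longleftrightarrow> dn"
begin

sublocale fin_digraph "digraph_of G"
  using wf unfolding wf_path_graph_def by blast

abbreviation "P \<equiv> base_paths G"
abbreviation "mk \<equiv> mk_edge (fst (snd (graph_data G)))"
abbreviation "fs \<equiv> items_of (graph_data G)"
abbreviation "X \<equiv> near_labels fs"
abbreviation "L0 \<equiv> root_label X"
abbreviation "re \<equiv> (0, L0, 0, s) :: edge"
abbreviation "edges_of Q \<equiv> \<Union> (set ` set Q) :: (nat \<times> int) set"

section \<open>Base paths, arcs and usable edges of an instance\<close>

lemma P_path:
  assumes "i < length P"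
  shows "\<exists>u v. apath u (map fst (P ! i)) v" "sorted_wrt (<) (map snd (P ! i))"
  using wf assms nth_mem[OF assms] unfolding wf_path_graph_def temporal_path_def by blast+

lemma P_arcs: assumes "i < length P" "a \<in> set (P ! i)" shows "fst a \<in> arcs (digraph_of G)"
proof -
  obtain u v where "apath u (map fst (P ! i)) v" using P_path[OF assms(1)] by blast
  then have "set (map fst (P ! i)) \<subseteq> arcs (digraph_of G)" unfolding apath_def awalk_def by blast
  then show ?thesis using assms(2) by auto
qed

lemma same_P: "same_arcs P P"
  using P_path(2) by (simp add: same_arcs_def)

lemma same_nth:
  assumes "same_arcs P Q" "i < length P"
  shows "length Q = length P" "map fst (Q ! i) = map fst (P ! i)" "length (Q ! i) = length (P ! i)"
    "sorted_wrt (<) (map snd (Q ! i))" "\<exists>u v. apath u (map fst (Q ! i)) v"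
proof -
  show 1: "length Q = length P" "map fst (Q ! i) = map fst (P ! i)" "sorted_wrt (<) (map snd (Q ! i))"
    using assms by (auto simp: same_arcs_def)
  show "length (Q ! i) = length (P ! i)" using 1(2) by (metis length_map)
  show "\<exists>u v. apath u (map fst (Q ! i)) v" unfolding 1(2) by (rule P_path[OF assms(2)])
qed

lemma edges_of_iff: "a \<in> edges_of Q \<longleftrightarrow> (\<exists>i<length Q. \<exists>m<length (Q ! i). Q ! i ! m = a)"
proof
  assume "a \<in> edges_of Q"
  then obtain p where p: "p \<in> set Q" "a \<in> set p" by blast
  obtain i where "i < length Q" "Q ! i = p" using p(1) unfolding in_set_conv_nth by blast
  moreover obtain m where "m < length p" "p ! m = a" using p(2) unfolding in_set_conv_nth by blast
  ultimately show "\<exists>i<length Q. \<exists>m<length (Q ! i). Q ! i ! m = a" by blast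
next
  assume "\<exists>i<length Q. \<exists>m<length (Q ! i). Q ! i ! m = a"
  then obtain i m where im: "i < length Q" "m < length (Q ! i)" "Q ! i ! m = a" by blast
  have "a \<in> set (Q ! i)" using nth_mem[OF im(2)] im(3) by simp
  then show "a \<in> edges_of Q" using nth_mem[OF im(1)] by blast
qed

lemma edges_arcs: assumes "same_arcs P Q" shows "fst ` edges_of Q \<subseteq> arcs (digraph_of G)"
proof
  fix e assume "e \<in> fst ` edges_of Q"
  then obtain a where a: "a \<in> edges_of Q" "e = fst a" by blast
  obtain i m where im: "i < length Q" "m < length (Q ! i)" "e = fst (Q ! i ! m)"
    using a(1)[unfolded edges_of_iff] a(2) by blast
  have i: "i < length P" using assms im(1) by (simp add: same_arcs_def)
  have "e = map fst (Q ! i) ! m" using im by simp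
  also have "\<dots> = fst (P ! i ! m)" using same_nth[OF assms i] im(2) by (metis length_map nth_map)
  finally show "e \<in> arcs (digraph_of G)" using P_arcs[OF i] same_nth(3)[OF assms i] im(2) by simp
qed

lemma set_Union: "set_mset (\<Sum>p \<in># mset Q. mset p) = edges_of Q"
  by (auto simp: in_Union_mset_iff)

lemma temporal_edges_set:
  assumes "same_arcs P Q"
  shows "set_mset (temporal_edges (set_base_paths Q G)) = edges_of Q"
proof -
  have "set_mset (temporal_edges (set_base_paths Q G)) =
     (\<Union>e\<in>arcs (digraph_of G). set_mset (image_mset (Pair e) (path_labels Q e)))"
    unfolding temporal_edges_def by (simp add: set_base_paths_def set_mset_sum)
  also have "\<dots> = (\<Union>e\<in>arcs (digraph_of G). {a \<in> edges_of Q. fst a = e})"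
  proof (rule SUP_cong)
    fix e
    have "set_mset (path_labels Q e) = snd ` {a \<in> edges_of Q. fst a = e}"
      unfolding path_labels_def set_image_mset set_mset_filter set_Union ..
    then show "set_mset (image_mset (Pair e) (path_labels Q e)) = {a \<in> edges_of Q. fst a = e}"
      by (force simp: image_iff)
  qed simp
  also have "\<dots> = edges_of Q" using edges_arcs[OF assms] by blast
  finally show ?thesis .
qed

lemma temporal_edges_G: "set_mset (temporal_edges G) = edges_of P"
  using wf unfolding wf_path_graph_def by (metis set_Union)

text \<open>The second alternative covers the empty sequence of operations, which leaves
  \<open>G\<close> itself.\<close>

lemma reached_char:
  assumes "same_arcs P Q" "H = set_base_paths Q G \<or> (H = G \<and> Q = P)"
  shows "reached H s = insert s (head (digraph_of G) ` fst ` act (edges_of Q) s)"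
proof (rule reached_eq[OF _ _ edges_arcs[OF assms(1)] s])
  show "digraph_of H = digraph_of G" using assms(2) by auto
  show "set_mset (temporal_edges H) = edges_of Q"
    using assms temporal_edges_set temporal_edges_G by auto
qed

lemma finite_reached: assumes "same_arcs P Q" "H = set_base_paths Q G \<or> (H = G \<and> Q = P)"
  shows "finite (reached H s)"
proof -
  have "finite (edges_of Q)" by simp
  then have "finite (act (edges_of Q) s)" using act_subset finite_subset by blast
  then show ?thesis unfolding reached_char[OF assms] by simp
qed

lemma act_edges_suffix:
  assumes "same_arcs P Q" "i < length P" "Q ! i ! m \<in> act (edges_of Q) s" "m \<le> n" "n < length (P ! i)"
  shows "Q ! i ! n \<in> act (edges_of Q) s"
proof -
  obtain u v where "apath u (map fst (Q ! i)) v" using same_nth(5)[OF assms(1,2)] by blast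
  moreover have "Q ! i \<in> set Q" by (rule nth_mem) (use assms(2) same_nth(1)[OF assms(1,2)] in simp)
  then have "set (Q ! i) \<subseteq> edges_of Q" by blast
  ultimately show ?thesis using act_suffix[OF _ _ same_nth(4)[OF assms(1,2)] assms(3,4)] same_nth(3)[OF assms(1,2)] assms(5)
    by metis
qed

lemma arc_info_eq:
  assumes "a \<in> arcs (digraph_of G)"
  shows "arc_info (fst (snd (graph_data G))) a = (tail (digraph_of G) a, head (digraph_of G) a)"
proof -
  let ?rs = "fst (snd (graph_data G))"
  have r: "fst (snd r) = tail (digraph_of G) a \<and> fst (snd (snd r)) = head (digraph_of G) a"
    if "r \<in> set (filter (\<lambda>r. fst r = a) ?rs)" for r
    using that by (auto simp: graph_data_def Let_def)
  have "(a, tail (digraph_of G) a, head (digraph_of G) a, sorted_list_of_multiset (labels G a)) \<in> set (filter (\<lambda>r. fst r = a) ?rs)"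
    using assms by (auto simp: graph_data_def Let_def)
  then obtain r l where rl: "filter (\<lambda>r. fst r = a) ?rs = r # l" by (cases "filter (\<lambda>r. fst r = a) ?rs") auto
  then have "r \<in> set (filter (\<lambda>r. fst r = a) ?rs)" by simp
  from r[OF this] show ?thesis by (simp add: arc_info_def rl)
qed

lemma mk_simps [simp]: "fst (mk a) = fst a" "lab (mk a) = snd a"
  by (simp_all add: mk_edge_def)

lemma mk_ends: assumes "fst a \<in> arcs (digraph_of G)"
  shows "tl_of (mk a) = tail (digraph_of G) (fst a)" "hd_of (mk a) = head (digraph_of G) (fst a)"
  by (simp_all add: mk_edge_def arc_info_eq[OF assms])

lemma fs_iff: "(i, l) \<in> set fs \<longleftrightarrow> i < length P \<and> l = map mk (P ! i)"
  unfolding set_items_of by (auto simp: graph_data_def Let_def)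

lemma set_fs: "set fs = (\<lambda>i. (i, map mk (P ! i))) ` {..<length P}"
  unfolding set_items_of by (simp add: graph_data_def Let_def)

lemma length_labels: "length (labels_of fs) = (\<Sum>i<length P. length (P ! i))"
proof -
  have "length (labels_of fs) = sum_list (map (\<lambda>f. length (snd f)) fs)"
    by (simp add: labels_of_def length_concat comp_def)
  also have "\<dots> = (\<Sum>f\<in>set fs. length (snd f))"
    by (rule sum_list_distinct_conv_sum_set) (use distinct_items_of in \<open>simp add: distinct_map\<close>)
  also have "\<dots> = (\<Sum>i<length P. length (P ! i))"
    unfolding set_fs by (subst sum.reindex) (auto simp: inj_on_def)
  finally show ?thesis .
qed

lemma part_item:
  assumes "good_part fs part" "(i, c) \<in> set part"
  shows "c \<noteq> []" "i < length P" "\<exists>k. c = map mk (drop k (P ! i))"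
proof -
  have "c \<noteq> [] \<and> (\<exists>k l. (i, l) \<in> set fs \<and> c = drop k l)" using assms unfolding good_part_def by auto
  then obtain k l where "c \<noteq> []" "(i, l) \<in> set fs" "c = drop k l" by blast
  then show "c \<noteq> []" "i < length P" "\<exists>k. c = map mk (drop k (P ! i))" by (auto simp: fs_iff drop_map)
qed

text \<open>The first edge of each item is usable, because its boarding event belongs to the
  artificial edge, so that it starts at the source, or to an item with a smaller first label.
  Usability then spreads over the suffix. Vertices that are reached otherwise only increase the
  right-hand side.\<close>

lemma sound:
  assumes part: "good_part fs part" and w: "valid up dn Y (part, [re], L0) w"
    and Y: "\<And>y. y \<in> Y \<Longrightarrow> L0 \<le> y" and b: "wcost w \<le> int b"
  shows "\<exists>H. feasible D G b (wops w) H \<and> gain s part \<le> int (card (reached H s))"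
proof -
  define iqs where "iqs = map (\<lambda>iq. (fst (fst iq), snd iq)) (snd w)"
  have fw: "fst w = [(re, L0)]"
    using w by (cases "fst w") (auto simp: valid_def)
  have in_part: "fst iq \<in> set part" if "iq \<in> set (snd w)" for iq
    using w that by (auto simp: valid_def)
  have dist: "distinct (map fst iqs)"
  proof -
    have "inj_on fst (set part)" using part by (auto simp: good_part_def distinct_map)
    moreover have "set (map fst (snd w)) = set part" "distinct (map fst (snd w))" using w by (auto simp: valid_def)
    ultimately have "distinct (map fst (map fst (snd w)))" by (metis distinct_map)
    then show ?thesis by (simp add: iqs_def comp_def)
  qed
  have q_facts: "map fst (snd iq) = snd (fst iq)" "snd iq \<noteq> []" "sorted_wrt (<) (map snd (snd iq))"
     "\<exists>ey\<in>events w. hd_of (fst ey) = start (fst iq) \<and> snd ey < snd (hd (snd iq))"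
    if "iq \<in> set (snd w)" for iq using w that by (auto simp: valid_def)
  have old: "\<exists>k. at_old (snd iq) = drop k (P ! fst (fst iq)) \<and> fst (fst iq) < length P" if iq: "iq \<in> set (snd w)" for iq
  proof -
    obtain i c where ic: "fst iq = (i, c)" by fastforce
    have "(i, c) \<in> set part" using in_part[OF iq] ic by simp
    from part_item[OF part this] obtain k where k: "c = map mk (drop k (P ! i))" "i < length P" by blast
    have "at_old (snd iq) = map (\<lambda>e. (fst e, lab e)) (map fst (snd iq))" by (simp add: at_old_def)
    also have "\<dots> = map (\<lambda>e. (fst e, lab e)) c" using q_facts(1)[OF iq] ic by simp
    also have "\<dots> = drop k (P ! i)" unfolding k(1) by (simp add: comp_def)
    finally show ?thesis using k(2) ic by auto
  qed
  have edge: "tl_of (fst z) = tail (digraph_of G) (arc_of z) \<and> hd_of (fst z) = head (digraph_of G) (arc_of z)"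
    if iq: "iq \<in> set (snd w)" and z: "z \<in> set (snd iq)" for iq z
  proof -
    obtain i c where ic: "fst iq = (i, c)" by fastforce
    have "(i, c) \<in> set part" using in_part[OF iq] ic by simp
    from part_item[OF part this] obtain k where k: "c = map mk (drop k (P ! i))" "i < length P" by blast
    have "fst z \<in> set (map fst (snd iq))" using z by simp
    then have "fst z \<in> set (map mk (drop k (P ! i)))" unfolding q_facts(1)[OF iq] using ic k by simp
    then obtain a where a: "a \<in> set (P ! i)" "fst z = mk a" by (auto dest: in_set_dropD)
    show ?thesis unfolding a(2) using mk_ends[OF P_arcs[OF k(2) a(1)]] by simp
  qed
  have "\<exists>Q. pshifts P (all_ops iqs) Q \<and> length Q = length P \<and>
    (\<forall>(i, q)\<in>set iqs. \<exists>pre. Q ! i = pre @ at_new q) \<and> (\<forall>i. i \<notin> fst ` set iqs \<longrightarrow> Q ! i = P ! i)"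
  proof (rule pshifts_all_ops[OF dist])
    fix i q assume "(i, q) \<in> set iqs"
    then obtain iq where iq: "iq \<in> set (snd w)" "i = fst (fst iq)" "q = snd iq" by (auto simp: iqs_def)
    obtain k where k: "at_old q = drop k (P ! i)" "i < length P" using old[OF iq(1)] iq by auto
    have pre: "\<exists>pre. P ! i = pre @ at_old q" unfolding k(1) by (rule exI[of _ "take k (P ! i)"]) simp
    have q: "q \<noteq> []" "sorted_wrt (<) (map snd q)" using q_facts(2,3)[OF iq(1)] iq(3) by simp_all
    show "i < length P \<and> q \<noteq> [] \<and> (\<exists>pre. P ! i = pre @ at_old q) \<and> sorted_wrt (<) (map snd (P ! i)) \<and> sorted_wrt (<) (map snd q)"
      by (intro conjI k(2) q pre P_path(2))
  qed
  then obtain Q where Q: "pshifts P (wops w) Q" "\<And>i q. (i, q) \<in> set iqs \<Longrightarrow> \<exists>pre. Q ! i = pre @ at_new q"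
    unfolding wops_def iqs_def[symmetric] by blast
  have sQ: "same_arcs P Q" using pshifts_cost[OF same_P same_P Q(1)] by blast
  define H where "H = (if wops w = [] then G else set_base_paths Q G)"
  have H: "H = set_base_paths Q G \<or> (H = G \<and> Q = P)" using Q(1) by (auto simp: H_def)
  have "cost (wops w) = (\<Sum>iq\<leftarrow>iqs. pcost (labs (snd iq)))"
    unfolding wops_def iqs_def[symmetric]
  proof (rule cost_all_ops)
    fix i q assume "(i, q) \<in> set iqs"
    then obtain iq where iq: "iq \<in> set (snd w)" "i = fst (fst iq)" "q = snd iq" by (auto simp: iqs_def)
    obtain k where k: "at_old q = drop k (P ! i)" "i < length P" using old[OF iq(1)] iq by auto
    have "map old q = map snd (at_old q)" by (simp add: at_old_def)
    also have "\<dots> = drop k (map snd (P ! i))" by (simp add: k drop_map)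
    finally show "sorted_wrt (<) (map old q) \<and> sorted_wrt (<) (map new q)"
      using q_facts(3)[OF iq(1)] iq P_path(2)[OF k(2)] by (simp add: sorted_wrt_drop)
  qed
  also have "\<dots> = wcost w" unfolding wcost_def fw by (simp add: iqs_def labs_def comp_def)
  finally have cost: "cost (wops w) \<le> int b" using b by simp
  have okz: "ok up dn (fst z) (snd z)" if "iq \<in> set (snd w)" "z \<in> set (snd iq)" for iq z
    using w that by (auto simp: valid_def events_def)
  have amount: "shift_amount \<sigma> \<in> D" if sg: "\<sigma> \<in> set (wops w)" for \<sigma>
  proof -
    obtain iq where iq: "iq \<in> set (snd w)" "\<sigma> \<in> set (prof_ops (fst (fst iq)) (snd iq))"
      using sg by (auto simp: wops_def all_ops_def)
    from amount_prof_ops[OF q_facts(3)[OF iq(1)] iq(2)] show ?thesis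
    proof (elim disjE conjE bexE)
      fix z assume "shift_amount \<sigma> < 0" "z \<in> set (snd iq)" "new z < old z"
      then show ?thesis using okz[OF iq(1), of z] D_neg by (auto simp: ok_def)
    next
      fix z assume "shift_amount \<sigma> > 0" "z \<in> set (snd iq)" "old z < new z"
      then show ?thesis using okz[OF iq(1), of z] D_pos by (auto simp: ok_def)
    qed
  qed
  have feas: "feasible D G b (wops w) H"
    unfolding feasible_def shifts_to_iff_pshifts using Q(1) cost amount by (auto simp: H_def)
  let ?A = "act (edges_of Q) s"
  have q_act: "(arc_of z, new z) \<in> ?A" if "(arc_of (hd (snd iq)), new (hd (snd iq))) \<in> ?A"
    and iq: "iq \<in> set (snd w)" and z: "z \<in> set (snd iq)" for iq z
  proof -
    have "(fst (fst iq), snd iq) \<in> set iqs" using iq by (auto simp: iqs_def)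
    from Q(2)[OF this] obtain pre where pre: "Q ! fst (fst iq) = pre @ at_new (snd iq)" by blast
    have i: "fst (fst iq) < length P" using old[OF iq] by blast
    obtain m where m: "m < length (snd iq)" "snd iq ! m = z" using z by (metis in_set_conv_nth)
    have "Q ! fst (fst iq) ! length pre = (arc_of (hd (snd iq)), new (hd (snd iq)))"
      unfolding pre using q_facts(2)[OF iq] by (simp add: nth_append at_new_def hd_conv_nth)
    moreover have "Q ! fst (fst iq) ! (length pre + m) = (arc_of z, new z)"
      unfolding pre using m by (simp add: nth_append at_new_def)
    moreover have "length pre + m < length (P ! fst (fst iq))"
      using same_nth(3)[OF sQ i] m(1) unfolding pre by (simp add: at_new_def)
    ultimately show ?thesis using act_edges_suffix[OF sQ i, of "length pre" "length pre + m"] that(1) by simp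
  qed
  \<comment> \<open>All labels of the witness are at least \<open>L0\<close>, which makes the
    induction on the first label well-founded.\<close>
  have hd_act: "(arc_of (hd (snd iq)), new (hd (snd iq))) \<in> ?A" if "iq \<in> set (snd w)" for iq
    using that
  proof (induction "nat (new (hd (snd iq)) - L0)" arbitrary: iq rule: less_induct)
    case less
    let ?z = "hd (snd iq)"
    have z: "?z \<in> set (snd iq)" using q_facts(2)[OF less.prems] by simp
    have start: "start (fst iq) = tail (digraph_of G) (arc_of ?z)"
    proof -
      have "snd (fst iq) = map fst (snd iq)" using q_facts(1)[OF less.prems] by simp
      then have "start (fst iq) = tl_of (fst ?z)" using q_facts(2)[OF less.prems]
        by (cases "snd iq") (auto simp: start_def)
      then show ?thesis using edge[OF less.prems z] by simp
    qed
    have inE: "(arc_of ?z, new ?z) \<in> edges_of Q"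
    proof -
      have "(fst (fst iq), snd iq) \<in> set iqs" using less.prems by (auto simp: iqs_def)
      from Q(2)[OF this] obtain pre where pre: "Q ! fst (fst iq) = pre @ at_new (snd iq)" by blast
      have i: "fst (fst iq) < length P" using old[OF less.prems] by blast
      have "(arc_of ?z, new ?z) \<in> set (Q ! fst (fst iq))" unfolding pre using z by (auto simp: at_new_def)
      moreover have "Q ! fst (fst iq) \<in> set Q" using i same_nth(1)[OF sQ i] by simp
      ultimately show ?thesis by blast
    qed
    obtain ey where ey: "ey \<in> events w" "hd_of (fst ey) = start (fst iq)" "snd ey < new ?z"
      using q_facts(4)[OF less.prems] by blast
    have evL: "L0 \<le> snd ey" using w ey(1) Y by (auto simp: valid_def)
    consider "ey = (re, L0)" | jq where "jq \<in> set (snd w)" "ey \<in> set (snd jq)"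
      using ey(1) fw by (auto simp: events_def)
    then show ?case
    proof cases
      case 1
      then have "s = tail (digraph_of G) (arc_of ?z)" using ey(2) start by simp
      then show ?thesis using act.start[OF inE] by simp
    next
      case 2
      have "new (hd (snd jq)) \<le> snd ey"
        using q_facts(3)[OF 2(1)] 2(2) by (cases "snd jq") auto
      then have "nat (new (hd (snd jq)) - L0) < nat (new ?z - L0)" using ey(3) evL by linarith
      from less.hyps[OF this 2(1)] have "(arc_of ey, new ey) \<in> ?A" by (rule q_act[OF _ 2])
      moreover have "head (digraph_of G) (arc_of ey) = tail (digraph_of G) (arc_of ?z)"
        using edge[OF 2] ey(2) start by simp
      ultimately show ?thesis using act.step[OF _ inE] ey(3) by simp
    qed
  qed
  have "set (s # concat (map (\<lambda>i. map hd_of (snd i)) part)) \<subseteq> reached H s"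
  proof -
    have "hd_of e \<in> reached H s" if ic: "(i, c) \<in> set part" "e \<in> set c" for i c e
    proof -
      have "(i, c) \<in> fst ` set (snd w)" using w ic(1) by (simp add: valid_def)
      then obtain iq where "(i, c) = fst iq" and iq1: "iq \<in> set (snd w)" by (rule imageE)
      then have iq: "iq \<in> set (snd w)" "fst iq = (i, c)" by simp_all
      have "e \<in> set (map fst (snd iq))" unfolding q_facts(1)[OF iq(1)] using iq(2) ic(2) by simp
      then obtain z where z: "z \<in> set (snd iq)" "e = fst z" by auto
      have "(arc_of z, new z) \<in> ?A" by (rule q_act[OF hd_act[OF iq(1)] iq(1) z(1)])
      then show ?thesis unfolding reached_char[OF sQ H] using edge[OF iq(1) z(1)] z(2) by force
    qed
    moreover have "s \<in> reached H s" unfolding reached_char[OF sQ H] by simp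
    ultimately show ?thesis by auto
  qed
  then have "gain s part \<le> int (card (reached H s))"
    unfolding gain_def length_remdups_card_conv using card_mono[OF finite_reached[OF sQ H]] by simp
  then show ?thesis using feas by blast
qed

text \<open>\<open>k\<close> records where the usable edges of each path begin in the given result.
  Their relabelling costs at most the budget, is rounded to near labels at no extra cost and is
  matched by the table. The part is quantified afterwards because the search determines the order of
  its items.\<close>

lemma complete:
  assumes feas: "feasible D G b \<sigma>s H"
  obtains k where "\<And>part. good_part fs part \<Longrightarrow>
      set part = {(fst f, drop (k f) (snd f)) |f. f \<in> set fs \<and> drop (k f) (snd f) \<noteq> []} \<Longrightarrow>
      gain s part = int (card (reached H s)) \<and>
      (\<exists>v. dp_result up dn re (L0 # X) part (subseqs part) = [v] \<and> wcost v \<le> int b \<and> wcost v \<le> cost_bound fs)"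
proof -
  obtain Q where Q: "pshifts P \<sigma>s Q" "H = (if \<sigma>s = [] then G else set_base_paths Q G)"
    and am: "shift_amount ` set \<sigma>s \<subseteq> D" and cost: "cost \<sigma>s \<le> int b"
    using feas unfolding feasible_def shifts_to_iff_pshifts by blast
  have sQ: "same_arcs P Q" and tc: "tcost P Q \<le> int b"
    using pshifts_cost[OF same_P same_P Q(1)] cost tcost_same[OF same_P] by auto
  have H: "H = set_base_paths Q G \<or> (H = G \<and> Q = P)" using Q by auto
  let ?A = "act (edges_of Q) s"
  \<comment> \<open>The value \<open>length (P ! i)\<close> occurs if no edge of the path is
    usable.\<close>
  define kk where "kk i = (LEAST m. m = length (P ! i) \<or> (m < length (P ! i) \<and> Q ! i ! m \<in> ?A))" for i
  have kk_le: "kk i \<le> length (P ! i)" for i unfolding kk_def by (rule Least_le) simp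
  have kk: "Q ! i ! m \<in> ?A \<longleftrightarrow> kk i \<le> m" if i: "i < length P" and m: "m < length (P ! i)" for i m
  proof
    assume "Q ! i ! m \<in> ?A" then show "kk i \<le> m" unfolding kk_def using m by (intro Least_le) simp
  next
    assume le: "kk i \<le> m"
    have "kk i = length (P ! i) \<or> (kk i < length (P ! i) \<and> Q ! i ! kk i \<in> ?A)"
      unfolding kk_def by (rule LeastI[of _ "length (P ! i)"]) simp
    then have "Q ! i ! kk i \<in> ?A" using le m by auto
    then show "Q ! i ! m \<in> ?A" by (rule act_edges_suffix[OF sQ i _ le m])
  qed
  show thesis
  proof (rule that[of "\<lambda>f. kk (fst f)"])
    fix part
    assume gp: "good_part fs part"
      and part: "set part = {(fst f, drop (kk (fst f)) (snd f)) |f. f \<in> set fs \<and> drop (kk (fst f)) (snd f) \<noteq> []}"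
    have part_iff: "(i, c) \<in> set part \<longleftrightarrow> i < length P \<and> kk i < length (P ! i) \<and> c = map mk (drop (kk i) (P ! i))" for i c
    proof -
      have "(i, c) \<in> set part \<longleftrightarrow> (\<exists>l. (i, l) \<in> set fs \<and> c = drop (kk i) l \<and> drop (kk i) l \<noteq> [])"
        unfolding part by auto
      then show ?thesis unfolding fs_iff by (auto simp: drop_map not_le)
    qed
    have inj: "inj_on fst (set part)" using gp by (auto simp: good_part_def distinct_map)
    have dpart: "distinct part" using gp by (auto simp: good_part_def distinct_map)
    define F :: "item \<Rightarrow> eprof" where
      "F j = zip (snd j) (map snd (drop (kk (fst j)) (Q ! fst j)))" for j
    have j_facts: "fst j < length P" "kk (fst j) < length (P ! fst j)" "snd j = map mk (drop (kk (fst j)) (P ! fst j))"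
      if "j \<in> set part" for j using that part_iff[of "fst j" "snd j"] by simp_all
    have F_eq: "F j = drop (kk (fst j)) (zip (map mk (P ! fst j)) (map snd (Q ! fst j)))"
      and F_len: "length (F j) = length (snd j)" and F_fst: "map fst (F j) = snd j"
      and F_snd: "map snd (F j) = drop (kk (fst j)) (map snd (Q ! fst j))"
      and F_nth: "\<And>m. m < length (snd j) \<Longrightarrow> F j ! m = (mk (P ! fst j ! (kk (fst j) + m)), snd (Q ! fst j ! (kk (fst j) + m)))"
      if j: "j \<in> set part" for j
    proof -
      have len: "length (Q ! fst j) = length (P ! fst j)" using same_nth(3)[OF sQ j_facts(1)[OF j]] .
      show "F j = drop (kk (fst j)) (zip (map mk (P ! fst j)) (map snd (Q ! fst j)))"
        unfolding F_def j_facts(3)[OF j] by (simp add: drop_zip drop_map)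
      have ln: "length (snd j) = length (map snd (drop (kk (fst j)) (Q ! fst j)))"
        unfolding j_facts(3)[OF j] using len by simp
      show "length (F j) = length (snd j)" unfolding F_def using ln by simp
      show "map fst (F j) = snd j" unfolding F_def by (rule map_fst_zip[OF ln])
      show "map snd (F j) = drop (kk (fst j)) (map snd (Q ! fst j))" unfolding F_def using map_snd_zip[OF ln] by (simp add: drop_map)
      fix m assume m: "m < length (snd j)"
      then have "kk (fst j) + m < length (P ! fst j)" using arg_cong[OF j_facts(3)[OF j], of length] by simp
      then show "F j ! m = (mk (P ! fst j ! (kk (fst j) + m)), snd (Q ! fst j ! (kk (fst j) + m)))"
        unfolding F_def using m ln j_facts(3)[OF j] len by simp
    qed
    have arc_eq: "fst (Q ! i ! m) = fst (P ! i ! m)" if "i < length P" "m < length (P ! i)" for i m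
      using same_nth(2,3)[OF sQ that(1)] that(2) by (metis length_map nth_map)
    \<comment> \<open>Apart from fixed data, \<open>Adm\<close> only compares new labels with each
      other and with given labels. Hence it survives the order-preserving changes considered in
      \<open>rounding\<close>.\<close>
    define Adm where "Adm g \<longleftrightarrow> (\<forall>j\<in>set part. map fst (g j) = snd j \<and> sorted_wrt (<) (map snd (g j)) \<and>
      (\<forall>z\<in>set (g j). ok up dn (fst z) (snd z)) \<and>
      (start j = s \<or> (\<exists>j'\<in>set part. \<exists>z\<in>set (g j'). hd_of (fst z) = start j \<and> snd z < snd (hd (g j)))))" for g :: "item \<Rightarrow> eprof"
    have "Adm F" unfolding Adm_def
    proof (intro ballI conjI)
      fix j assume j: "j \<in> set part"
      note jf = j_facts[OF j]
      show "map fst (F j) = snd j" by (rule F_fst[OF j])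
      show "sorted_wrt (<) (map snd (F j))" unfolding F_snd[OF j] by (rule sorted_wrt_drop[OF same_nth(4)[OF sQ jf(1)]])
      show "ok up dn (fst z) (snd z)" if z: "z \<in> set (F j)" for z
      proof -
        obtain m where m: "m < length (snd j)" "z = F j ! m" using z F_len[OF j] by (metis in_set_conv_nth)
        let ?m = "kk (fst j) + m"
        have m': "?m < length (P ! fst j)" using m(1) arg_cong[OF jf(3), of length] by simp
        have z: "lab (fst z) = snd (P ! fst j ! ?m)" "snd z = snd (Q ! fst j ! ?m)" using m F_nth[OF j] by auto
        \<comment> \<open>If \<open>up\<close> fails, no operation is a delay and labels cannot
          rise; likewise they cannot fall if \<open>dn\<close> fails.\<close>
        note sgn = pshifts_sign[OF same_P Q(1) jf(1) m']
        show ?thesis unfolding ok_def z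
        proof (rule ccontr)
          assume no: "\<not> (snd (P ! fst j ! ?m) = snd (Q ! fst j ! ?m) \<or> up \<and> snd (P ! fst j ! ?m) < snd (Q ! fst j ! ?m) \<or>
             dn \<and> snd (Q ! fst j ! ?m) < snd (P ! fst j ! ?m))"
          consider "\<not> up" "snd (P ! fst j ! ?m) < snd (Q ! fst j ! ?m)" | "\<not> dn" "snd (Q ! fst j ! ?m) < snd (P ! fst j ! ?m)"
            using no by linarith
          then show False
          proof cases
            case 1
            have "shift_amount \<sigma> \<le> 0" if "\<sigma> \<in> set \<sigma>s" for \<sigma> using that am D_pos[of "shift_amount \<sigma>"] 1 by force
            then show False using sgn(2) 1 by simp
          next
            case 2
            have "shift_amount \<sigma> \<ge> 0" if "\<sigma> \<in> set \<sigma>s" for \<sigma> using that am D_neg[of "shift_amount \<sigma>"] 2 by force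
            then show False using sgn(1) 2 by simp
          qed
        qed
      qed
      let ?a = "Q ! fst j ! kk (fst j)"
      have a: "?a \<in> ?A" using kk[OF jf(1,2)] by simp
      have Pa: "P ! fst j ! kk (fst j) \<in> set (P ! fst j)" using jf(2) by simp
      have pos: "0 < length (snd j)" using jf(2,3) by simp
      have st: "start j = tail (digraph_of G) (fst ?a)"
      proof -
        have "snd j = mk (P ! fst j ! kk (fst j)) # map mk (drop (Suc (kk (fst j))) (P ! fst j))"
          unfolding jf(3) using jf(2) by (simp add: Cons_nth_drop_Suc[symmetric])
        then have "start j = tl_of (mk (P ! fst j ! kk (fst j)))" unfolding start_def by simp
        then show ?thesis using mk_ends(1)[OF P_arcs[OF jf(1) Pa]] arc_eq[OF jf(1,2)] by simp
      qed
      have hdF: "snd (hd (F j)) = snd ?a"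
        using F_nth[OF j pos] pos F_len[OF j] by (metis add_0_right hd_conv_nth length_greater_0_conv snd_conv)
      obtain e0 t0 where et: "?a = (e0, t0)" by fastforce
      have st: "start j = tail (digraph_of G) e0" using st et by simp
      have hdF: "snd (hd (F j)) = t0" using hdF et by simp
      from a[unfolded et] show "start j = s \<or> (\<exists>j'\<in>set part. \<exists>z\<in>set (F j'). hd_of (fst z) = start j \<and> snd z < snd (hd (F j)))"
      proof (cases rule: act.cases)
        case start
        then show ?thesis using st by simp
      next
        \<comment> \<open>The preceding edge is usable too, so it belongs to the chosen suffix of
          its own path.\<close>
        case (step a' t')
        have a': "(a', t') \<in> ?A" using step by simp
        then have "(a', t') \<in> edges_of Q" using act_subset by blast
        then obtain i m where im: "i < length Q" "m < length (Q ! i)" "Q ! i ! m = (a', t')" unfolding edges_of_iff by blast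
        have i: "i < length P" using im(1) sQ by (simp add: same_arcs_def)
        have m: "m < length (P ! i)" using im(2) same_nth(3)[OF sQ i] by simp
        have km: "kk i \<le> m" using kk[OF i m] im(3) a' by simp
        let ?j = "(i, map mk (drop (kk i) (P ! i)))"
        have j': "?j \<in> set part" using part_iff i km m by simp
        have ml: "m - kk i < length (snd ?j)" using m km by simp
        let ?z = "F ?j ! (m - kk i)"
        have z: "?z = (mk (P ! i ! m), t')" using F_nth[OF j' ml] km im(3) by simp
        have Pm: "P ! i ! m \<in> set (P ! i)" using m by simp
        have "hd_of (fst ?z) = head (digraph_of G) a'"
          using mk_ends(2)[OF P_arcs[OF i Pm]] arc_eq[OF i m] im(3) z by simp
        then have "hd_of (fst ?z) = start j" using step st by simp
        moreover have "snd ?z < snd (hd (F j))" using step hdF z by simp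
        moreover have "?z \<in> set (F ?j)" using ml F_len[OF j'] by (metis nth_mem)
        ultimately show ?thesis using j' by blast
      qed
    qed
    define len where "len j = length (snd j)" for j :: item
    have len_sum: "(\<Sum>j\<in>set part. len j) \<le> length (labels_of fs)"
    proof -
      have "(\<Sum>j\<in>set part. len j) \<le> (\<Sum>j\<in>set part. length (P ! fst j))"
        by (rule sum_mono) (use j_facts(3) in \<open>force simp: len_def\<close>)
      also have "\<dots> = (\<Sum>i\<in>fst ` set part. length (P ! i))" by (rule sum.reindex[OF inj, unfolded comp_def, symmetric])
      also have "\<dots> \<le> (\<Sum>i<length P. length (P ! i))" by (rule sum_mono2) (use j_facts(1) in auto)
      finally show ?thesis unfolding length_labels .
    qed
    have labels_sub: "set (labels_of part) \<subseteq> set (labels_of fs)"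
    proof
      fix l assume "l \<in> set (labels_of part)"
      then obtain j e where je: "j \<in> set part" "e \<in> set (snd j)" "l = lab e" by (auto simp: labels_of_def)
      then have "e \<in> set (map mk (P ! fst j))" using j_facts(3)[OF je(1)] by (auto dest: in_set_dropD)
      moreover have "(fst j, map mk (P ! fst j)) \<in> set fs" using fs_iff j_facts(1)[OF je(1)] by simp
      ultimately show "l \<in> set (labels_of fs)" using je(3) by (force simp: labels_of_def)
    qed
    have "\<exists>g. Adm g \<and> (\<Sum>j\<in>set part. pcost (labs (g j))) \<le> (\<Sum>j\<in>set part. pcost (labs (F j))) \<and>
      (\<forall>y\<in>values_of (set part) g. \<exists>l\<in>set (labels_of part). \<bar>y - l\<bar> \<le> int ((\<Sum>j\<in>set part. len j) + 3 * card (set (labels_of part)) + 1))"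
    proof (rule rounding[where A = Adm and f = F])
      show "Adm F" by fact
      show "sorted_wrt (<) (map snd (g j))" if "Adm g" "j \<in> set part" for g j using that unfolding Adm_def by blast
      show "length (g j) = len j" if "Adm g" "j \<in> set part" for g j
      proof -
        have "map fst (g j) = snd j" using that unfolding Adm_def by blast
        then show ?thesis unfolding len_def by (metis length_map)
      qed
      show "old z \<in> set (labels_of part)" if "Adm g" "j \<in> set part" "z \<in> set (g j)" for g j z
      proof -
        have "map fst (g j) = snd j" using that unfolding Adm_def by blast
        then have "fst z \<in> set (snd j)" using that(3) by (metis image_eqI set_map)
        then show ?thesis using that(2) unfolding labels_of_def by auto
      qed
      show "Adm (\<lambda>j. relabel \<phi> (g j))" if g: "Adm g"
        and mono: "\<And>a b. a \<in> values_of (set part) g \<union> set (labels_of part) \<Longrightarrow> b \<in> values_of (set part) g \<union> set (labels_of part) \<Longrightarrow> a < b \<Longrightarrow> \<phi> a < \<phi> b"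
        and fixl: "\<And>l. l \<in> set (labels_of part) \<Longrightarrow> \<phi> l = l" for g \<phi>
        unfolding Adm_def
      proof (intro ballI conjI)
        have val: "snd z \<in> values_of (set part) g" if "j \<in> set part" "z \<in> set (g j)" for j z
          using that by (auto simp: values_of_def)
        fix j assume j: "j \<in> set part"
        have gj: "map fst (g j) = snd j" "sorted_wrt (<) (map snd (g j))" "\<And>z. z \<in> set (g j) \<Longrightarrow> ok up dn (fst z) (snd z)"
          "start j = s \<or> (\<exists>j'\<in>set part. \<exists>z\<in>set (g j'). hd_of (fst z) = start j \<and> snd z < snd (hd (g j)))"
          using g j unfolding Adm_def by blast+
        show "map fst (relabel \<phi> (g j)) = snd j" using gj(1) by (simp add: relabel_def comp_def)
        have "sorted_wrt (\<lambda>a b. \<phi> a < \<phi> b) (map snd (g j))"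
          by (rule sorted_wrt_mono_rel[OF _ gj(2)]) (use mono val[OF j] in auto)
        then show "sorted_wrt (<) (map snd (relabel \<phi> (g j)))" by (simp add: relabel_def sorted_wrt_map comp_def)
        show "ok up dn (fst y) (snd y)" if y: "y \<in> set (relabel \<phi> (g j))" for y
        proof -
          obtain z where z: "z \<in> set (g j)" "y = (fst z, \<phi> (snd z))" using y by (auto simp: relabel_def)
          have "fst z \<in> set (snd j)" using gj(1) z(1) by (metis image_eqI set_map)
          then have l: "lab (fst z) \<in> set (labels_of part)" using j unfolding labels_of_def by auto
          show ?thesis using gj(3)[OF z(1)] mono[of "lab (fst z)" "snd z"] mono[of "snd z" "lab (fst z)"] fixl[OF l] val[OF j z(1)] l
            unfolding ok_def z(2) by auto
        qed
        show "start j = s \<or> (\<exists>j'\<in>set part. \<exists>z\<in>set (relabel \<phi> (g j')). hd_of (fst z) = start j \<and> snd z < snd (hd (relabel \<phi> (g j))))"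
          using gj(4)
        proof (elim disjE bexE conjE)
          fix j' z assume z: "j' \<in> set part" "z \<in> set (g j')" "hd_of (fst z) = start j" "snd z < snd (hd (g j))"
          have ne: "g j \<noteq> []" using gj(1) part_item(1)[OF gp, of "fst j" "snd j"] j by auto
          have "\<phi> (snd z) < \<phi> (snd (hd (g j)))"
            by (rule mono) (use z val[OF z(1,2)] val[OF j, of "hd (g j)"] ne in auto)
          moreover have "snd (hd (relabel \<phi> (g j))) = \<phi> (snd (hd (g j)))" using ne by (simp add: relabel_def hd_map)
          moreover have "(fst z, \<phi> (snd z)) \<in> set (relabel \<phi> (g j'))" using z(2) by (auto simp: relabel_def)
          ultimately show ?thesis using z(1,3) by (metis fst_conv snd_conv)
        qed simp
      qed
    qed simp_all
    then obtain g where g: "Adm g" "(\<Sum>j\<in>set part. pcost (labs (g j))) \<le> (\<Sum>j\<in>set part. pcost (labs (F j)))"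
      and near: "\<And>y. y \<in> values_of (set part) g \<Longrightarrow> \<exists>l\<in>set (labels_of part). \<bar>y - l\<bar> \<le> int ((\<Sum>j\<in>set part. len j) + 3 * card (set (labels_of part)) + 1)"
      by blast
    have g_facts: "map fst (g j) = snd j" "sorted_wrt (<) (map snd (g j))" "\<And>z. z \<in> set (g j) \<Longrightarrow> ok up dn (fst z) (snd z)"
          "start j = s \<or> (\<exists>j'\<in>set part. \<exists>z\<in>set (g j'). hd_of (fst z) = start j \<and> snd z < snd (hd (g j)))" "g j \<noteq> []"
      if j: "j \<in> set part" for j
    proof -
      show m: "map fst (g j) = snd j" and "sorted_wrt (<) (map snd (g j))" "\<And>z. z \<in> set (g j) \<Longrightarrow> ok up dn (fst z) (snd z)"
          "start j = s \<or> (\<exists>j'\<in>set part. \<exists>z\<in>set (g j'). hd_of (fst z) = start j \<and> snd z < snd (hd (g j)))"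
        using g(1) j unfolding Adm_def by blast+
      show "g j \<noteq> []" using m part_item(1)[OF gp, of "fst j" "snd j"] j by auto
    qed
    have inX: "snd z \<in> set X" if "j \<in> set part" "z \<in> set (g j)" for j z
    proof -
      have "snd z \<in> values_of (set part) g" using that by (auto simp: values_of_def)
      from near[OF this] obtain l where l: "l \<in> set (labels_of part)"
        "\<bar>snd z - l\<bar> \<le> int ((\<Sum>j\<in>set part. len j) + 3 * card (set (labels_of part)) + 1)" by blast
      have "card (set (labels_of part)) \<le> card (set (labels_of fs))" by (rule card_mono[OF _ labels_sub]) simp
      also have "\<dots> \<le> length (labels_of fs)" by (rule card_length)
      finally have c: "card (set (labels_of part)) \<le> length (labels_of fs)" .
      have lf: "l \<in> set (labels_of fs)" using l(1) labels_sub by blast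
      \<comment> \<open>With \<open>n\<close> given labels, this turns the distance
        \<open>4 * n + 1\<close> from \<open>rounding\<close> into the \<open>5 * n\<close> of
        \<open>near_labels_mem\<close>.\<close>
      then have "1 \<le> length (labels_of fs)" by (cases "labels_of fs") auto
      then show ?thesis using near_labels_mem[OF lf, of "snd z"] l(2) c len_sum by linarith
    qed
    have fit: "fits up dn (set (L0 # X)) g (set part)"
      unfolding fits_def using g_facts inX by auto
    \<comment> \<open>Dropping unusable prefixes does not raise the cost, and the cost of all whole
      paths is at most that of the operations.\<close>
    have sumF: "(\<Sum>j\<in>set part. pcost (labs (F j))) \<le> int b"
    proof -
      have "(\<Sum>j\<in>set part. pcost (labs (F j))) \<le> (\<Sum>j\<in>set part. pcost (zip (map snd (P ! fst j)) (map snd (Q ! fst j))))"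
      proof (rule sum_mono)
        fix j assume j: "j \<in> set part"
        note jf = j_facts[OF j]
        let ?q = "zip (map snd (P ! fst j)) (map snd (Q ! fst j))"
        have len: "length (Q ! fst j) = length (P ! fst j)" using same_nth(3)[OF sQ jf(1)] .
        have "labs (zip (map mk (P ! fst j)) (map snd (Q ! fst j))) = ?q"
          unfolding labs_def by (rule nth_equalityI) (use len in auto)
        then have "labs (F j) = drop (kk (fst j)) ?q" unfolding F_eq[OF j] labs_def by (simp add: drop_map[symmetric])
        then show "pcost (labs (F j)) \<le> pcost ?q"
          using pcost_drop[of ?q "kk (fst j)"] len P_path(2)[OF jf(1)] same_nth(4)[OF sQ jf(1)] by simp
      qed
      also have "\<dots> = (\<Sum>i\<in>fst ` set part. pcost (zip (map snd (P ! i)) (map snd (Q ! i))))"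
        by (rule sum.reindex[OF inj, unfolded comp_def, symmetric])
      also have "\<dots> \<le> tcost P Q" unfolding tcost_def
        by (rule sum_mono2) (use j_facts(1) pcost_nonneg in auto)
      finally show ?thesis using tc by simp
    qed
    \<comment> \<open>This bound is independent of \<open>b\<close>, so truncating the budget does
      not lose the solution.\<close>
    have bound: "(\<Sum>j\<in>set part. pcost (labs (g j))) \<le> cost_bound fs"
    proof -
      let ?S = "abs_sum X"
      have S: "0 \<le> ?S" unfolding abs_sum_def by (rule sum_list_nonneg) auto
      have "pcost (labs (g j)) \<le> int (len j) * (?S + ?S)" if j: "j \<in> set part" for j
      proof -
        have olds: "map old (g j) = map snd (drop (kk (fst j)) (P ! fst j))"
        proof -
          have "map old (g j) = map lab (map fst (g j))" by simp
          also have "\<dots> = map lab (map mk (drop (kk (fst j)) (P ! fst j)))" unfolding g_facts(1)[OF j] j_facts(3)[OF j, symmetric] ..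
          finally show ?thesis by (simp add: comp_def)
        qed
        have "pcost (labs (g j)) \<le> (\<Sum>z\<leftarrow>labs (g j). \<bar>snd z - fst z\<bar>)"
        proof (rule pcost_le_sum)
          show "sorted_wrt (<) (map fst (labs (g j)))" unfolding labs_def
            using olds sorted_wrt_drop[OF P_path(2)[OF j_facts(1)[OF j]], of "kk (fst j)"] by (simp add: comp_def drop_map)
          show "sorted_wrt (<) (map snd (labs (g j)))" unfolding labs_def using g_facts(2)[OF j] by (simp add: comp_def)
        qed
        also have "\<dots> = (\<Sum>z\<leftarrow>g j. \<bar>new z - old z\<bar>)" by (simp add: labs_def comp_def)
        also have "\<dots> \<le> (\<Sum>z\<leftarrow>g j. ?S + ?S)"
        proof (rule sum_list_mono)
          fix z assume z: "z \<in> set (g j)"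
          have "fst z \<in> set (snd j)" using g_facts(1)[OF j] z by (metis image_eqI set_map)
          then have "old z \<in> set (labels_of part)" using j unfolding labels_of_def by auto
          then have "old z \<in> set X" using labels_sub labels_near by blast
          then show "\<bar>new z - old z\<bar> \<le> ?S + ?S" using abs_le_abs_sum[of "old z" X] abs_le_abs_sum[OF inX[OF j z]] by linarith
        qed
        also have "\<dots> = int (len j) * (?S + ?S)"
          using arg_cong[OF g_facts(1)[OF j], of length] by (simp add: sum_list_triv len_def)
        finally show ?thesis .
      qed
      then have "(\<Sum>j\<in>set part. pcost (labs (g j))) \<le> (\<Sum>j\<in>set part. int (len j) * (?S + ?S))" by (rule sum_mono)
      also have "\<dots> = int (\<Sum>j\<in>set part. len j) * (?S + ?S)" by (simp add: sum_distrib_right)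
      also have "\<dots> \<le> int (length (labels_of fs)) * (?S + ?S)" by (rule mult_right_mono[OF of_nat_mono[OF len_sum]]) (use S in simp)
      also have "\<dots> = cost_bound fs" by (simp add: cost_bound_def sum_list_triv)
      finally show ?thesis .
    qed
    define sufs where "sufs = dp_sufs re part"
    define L where "L = length (concat (map (\<lambda>i. tails (snd i)) part))"
    have tl: "set (tails (snd i)) \<subseteq> set sufs" "length (snd i) \<le> L" if "i \<in> set part" for i
    proof -
      show "set (tails (snd i)) \<subseteq> set sufs" unfolding sufs_def dp_sufs_def using that by auto
      have "length (tails (snd i)) \<le> L" unfolding L_def length_concat map_map
        by (rule member_le_sum_list) (use that in auto)
      then show "length (snd i) \<le> L" by simp
    qed
    have "\<exists>w. ((part, [re], snd (hd [(re, L0)])), w) \<in> set (dp_rounds (all_keys up dn (subseqs part) sufs (L0 # X)) (sufs @ concat (map (\<lambda>_. sufs) part))) \<and>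
      wcost w \<le> scost (labs [(re, L0)]) + (\<Sum>i\<in>set part. pcost (labs (g i)))"
    proof (rule dp_complete[OF dpart tl(2)])
      show "snd i \<in> set sufs" if i: "i \<in> set part" for i
      proof -
        have "drop 0 (snd i) \<in> set (tails (snd i))" unfolding set_tails by blast
        then show ?thesis using tl(1)[OF i] by auto
      qed
      show "r \<in> set sufs" if er: "e # r \<in> set sufs" "r \<noteq> []" for e r
      proof -
        obtain i where i: "i \<in> set part" "e # r \<in> set (tails (snd i))" using er by (auto simp: sufs_def dp_sufs_def)
        obtain k where "e # r = drop k (snd i)" using i(2) unfolding set_tails by blast
        then have "r = drop (Suc k) (snd i)" by (metis drop_Suc list.sel(3) tl_drop)
        then have "r \<in> set (tails (snd i))" unfolding set_tails by blast
        then show ?thesis using tl(1)[OF i(1)] by blast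
      qed
      show "served g (set [(re, L0)] \<union> (\<Union>j\<in>set part. set (g j))) i" if i: "i \<in> set part" for i
        using g_facts(4)[OF i]
      proof (elim disjE bexE conjE)
        assume "start i = s"
        moreover have "L0 < snd (hd (g i))" by (rule root_label_less, rule inX[OF i]) (use g_facts(5)[OF i] in simp)
        ultimately show ?thesis unfolding served_def by (intro bexI[of _ "(re, L0)"]) auto
      next
        fix j z assume "j \<in> set part" "z \<in> set (g j)" "hd_of (fst z) = start i" "snd z < snd (hd (g i))"
        then show ?thesis unfolding served_def by blast
      qed
      have "length (concat (map (\<lambda>_. sufs) part)) = length part * length sufs"
        by (simp add: length_concat comp_def sum_list_triv)
      moreover have "length sufs = L + 1" by (simp add: sufs_def dp_sufs_def L_def)
      ultimately show "length part * (L + 1) + length [re] \<le> length (sufs @ concat (map (\<lambda>_. sufs) part))" by simp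
      show "set (L0 # X) = set (L0 # X)" ..
      show "fits up dn (set (L0 # X)) g (set part)" by (rule fit)
    qed (auto simp: sufs_def dp_sufs_def ok_def)
    then obtain w where w: "((part, [re], lab re), w) \<in> set (dp_table up dn re (L0 # X) part (subseqs part))"
      "wcost w \<le> (\<Sum>i\<in>set part. pcost (labs (g i)))"
      by (auto simp: dp_table_def Let_def sufs_def labs_def)
    obtain v where v: "dp_result up dn re (L0 # X) part (subseqs part) = [v]" "wcost v \<le> wcost w"
      using dp_result_le[OF w(1)] by blast
    have "set (s # concat (map (\<lambda>i. map hd_of (snd i)) part)) = reached H s"
    proof -
      have "{e. \<exists>j\<in>set part. e \<in> hd_of ` set (snd j)} = head (digraph_of G) ` fst ` ?A"
      proof (intro equalityI subsetI)
        fix v assume "v \<in> {e. \<exists>j\<in>set part. e \<in> hd_of ` set (snd j)}"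
        then obtain j e where je: "j \<in> set part" "e \<in> set (snd j)" "v = hd_of e" by blast
        note jf = j_facts[OF je(1)]
        obtain m where m: "m < length (snd j)" "snd j ! m = e" using je(2) by (metis in_set_conv_nth)
        let ?m = "kk (fst j) + m"
        have m': "?m < length (P ! fst j)" using m(1) arg_cong[OF jf(3), of length] by simp
        have "map mk (drop (kk (fst j)) (P ! fst j)) ! m = mk (P ! fst j ! ?m)" using m' by simp
        then have e: "e = mk (P ! fst j ! ?m)" using m(2) jf(3) by simp
        have "Q ! fst j ! ?m \<in> ?A" using kk[OF jf(1) m'] by simp
        moreover have "P ! fst j ! ?m \<in> set (P ! fst j)" using m' by simp
        then have "v = head (digraph_of G) (fst (Q ! fst j ! ?m))"
          using mk_ends(2)[OF P_arcs[OF jf(1)]] e je(3) arc_eq[OF jf(1) m'] by simp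
        ultimately show "v \<in> head (digraph_of G) ` fst ` ?A" by blast
      next
        fix v assume "v \<in> head (digraph_of G) ` fst ` ?A"
        then obtain a where a: "a \<in> ?A" "v = head (digraph_of G) (fst a)" by blast
        have "a \<in> edges_of Q" using a(1) act_subset by blast
        then obtain i m where im: "i < length Q" "m < length (Q ! i)" "Q ! i ! m = a" unfolding edges_of_iff by blast
        have i: "i < length P" using im(1) sQ by (simp add: same_arcs_def)
        have m: "m < length (P ! i)" using im(2) same_nth(3)[OF sQ i] by simp
        have km: "kk i \<le> m" using kk[OF i m] im(3) a(1) by simp
        let ?j = "(i, map mk (drop (kk i) (P ! i)))"
        have j': "?j \<in> set part" using part_iff i km m by simp
        have "drop (kk i) (P ! i) ! (m - kk i) = P ! i ! m" using km m by simp
        moreover have "m - kk i < length (drop (kk i) (P ! i))" using km m by simp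
        ultimately have "P ! i ! m \<in> set (drop (kk i) (P ! i))" using nth_mem[of "m - kk i" "drop (kk i) (P ! i)"] by simp
        then have "mk (P ! i ! m) \<in> set (snd ?j)" by simp
        moreover have "P ! i ! m \<in> set (P ! i)" using m by simp
        then have "v = hd_of (mk (P ! i ! m))" using mk_ends(2)[OF P_arcs[OF i]] arc_eq[OF i m] im(3) a(2) by simp
        ultimately show "v \<in> {e. \<exists>j\<in>set part. e \<in> hd_of ` set (snd j)}" using j' by blast
      qed
      moreover have "set (concat (map (\<lambda>i. map hd_of (snd i)) part)) = {e. \<exists>j\<in>set part. e \<in> hd_of ` set (snd j)}" by auto
      ultimately show ?thesis unfolding reached_char[OF sQ H] by simp
    qed
    then have "gain s part = int (card (reached H s))" unfolding gain_def length_remdups_card_conv by simp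
    moreover have "wcost v \<le> int b" "wcost v \<le> cost_bound fs" using v(2) w(2) g(2) sumF bound by linarith+
    ultimately show "gain s part = int (card (reached H s)) \<and>
      (\<exists>v. dp_result up dn re (L0 # X) part (subseqs part) = [v] \<and> wcost v \<le> int b \<and> wcost v \<le> cost_bound fs)"
      using v(1) by blast
  qed
qed

text \<open>The stored gain never exceeds what the stored operations reach, by \<open>sound\<close>.
  By \<open>complete\<close> it is at least the number of vertices that any feasible solution
  reaches, since the search meets the part induced by that solution.\<close>

lemma solve_optimal: "optimal D G b s (solve up dn (graph_data G) b s)"
proof -
  let ?env = "make_env (graph_data G) b s"
  let ?pr = "process up dn ?env"
  define b' where "b' = truncate (bits (nat \<bar>cost_bound fs\<bar>)) b"
  have env: "?env = (int b', s, re, L0 # X)" by (simp add: make_env_def Let_def b'_def)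
  have good: "good_part fs p" if "p \<in> choices fs []" for p
    by (rule choices_good[OF that]) (simp_all add: good_part_def distinct_items_of)
  define ok_best where "ok_best best \<longleftrightarrow> (\<exists>H. feasible D G b (snd best) H \<and> fst best \<le> int (card (reached H s)))" for best
  have inv: "ok_best (?pr p best)" if p: "p \<in> choices fs []" and best: "ok_best best" for p best
  proof (cases "dp_result up dn re (L0 # X) p (subseqs p)")
    case Nil
    then show ?thesis using best by (simp add: process_def improve_def env)
  next
    case (Cons w ws)
    have "\<exists>H. feasible D G b (wops w) H \<and> gain s p \<le> int (card (reached H s))" if c: "wcost w \<le> int b'"
    proof (rule sound[OF good[OF p], where Y = "set (L0 # X)"])
      have "((p, [re], L0), w) \<in> set (dp_table up dn re (L0 # X) p (subseqs p))"
        using dp_result_in[of w up dn re "L0 # X" p "subseqs p"] Cons by simp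
      then show "valid up dn (set (L0 # X)) (p, [re], L0) w"
        unfolding dp_table_def Let_def using valid_dp_rounds[OF _ order_refl]
        subseqs_distinctD good[OF p] unfolding good_part_def distinct_map by blast
      show "L0 \<le> y" if "y \<in> set (L0 # X)" for y using that root_label_less[of y X] by auto
      show "wcost w \<le> int b" using c truncate_le[of "bits (nat \<bar>cost_bound fs\<bar>)" b] by (simp add: b'_def)
    qed
    then show ?thesis using best Cons by (auto simp: process_def improve_def env ok_best_def)
  qed
  have "feasible D G b [] G" by (simp add: feasible_def cost_def)
  then have init: "ok_best (0, [])" by (auto simp: ok_best_def)
  have final: "ok_best (search ?pr fs [] (0, []))" by (rule search_invariant[where P = ok_best, OF inv init])
  then obtain H where H: "feasible D G b (solve up dn (graph_data G) b s) H"
    "fst (search ?pr fs [] (0, [])) \<le> int (card (reached H s))"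
    unfolding ok_best_def solve_def by blast
  have "card (reached H' s) \<le> card (reached H s)" if H': "feasible D G b \<sigma>s H'" for \<sigma>s H'
  proof -
    obtain k where k: "\<And>part. good_part fs part \<Longrightarrow>
      set part = {(fst f, drop (k f) (snd f)) |f. f \<in> set fs \<and> drop (k f) (snd f) \<noteq> []} \<Longrightarrow>
      gain s part = int (card (reached H' s)) \<and>
      (\<exists>v. dp_result up dn re (L0 # X) part (subseqs part) = [v] \<and> wcost v \<le> int b \<and> wcost v \<le> cost_bound fs)"
      using complete[OF H'] by blast
    obtain p where p: "p \<in> choices fs []" "set p = {(fst f, drop (k f) (snd f)) |f. f \<in> set fs \<and> drop (k f) (snd f) \<noteq> []}"
      using choices_exist[of fs "[]" k] by auto
    from k[OF good[OF p(1)] p(2)] obtain v where v: "gain s p = int (card (reached H' s))"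
      "dp_result up dn re (L0 # X) p (subseqs p) = [v]" "wcost v \<le> int b" "wcost v \<le> cost_bound fs" by blast
    have "wcost v \<le> int b'" unfolding b'_def by (rule le_truncate) (use v in auto)
    then have hit: "gain s p \<le> fst (?pr p best)" for best
      using v(2) by (simp add: process_def improve_def env)
    have "gain s p \<le> fst (search ?pr fs [] (0, []))"
    proof (rule search_reaches[OF p(1), where P = "\<lambda>_. True" and Q = "\<lambda>best. gain s p \<le> fst best"])
      fix q and best :: "int \<times> nat shift list" assume "gain s p \<le> fst best"
      then show "gain s p \<le> fst (?pr q best)"
        unfolding process_def using improve_mono order_trans by blast
    qed (use hit in auto)
    then show ?thesis using H(2) v(1) by linarith
  qed
  then show ?thesis unfolding optimal_def using H(1) by blast
qed

end

section \<open>Running time\<close>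

abbreviation "enc_edge \<equiv> enc_pair enc_nat (enc_pair enc_int (enc_pair enc_nat enc_nat))"
abbreviation "enc_item \<equiv> enc_pair enc_nat (enc_list enc_edge)"
abbreviation "enc_prof \<equiv> enc_list (enc_pair enc_edge enc_int)"
abbreviation "enc_wit \<equiv> enc_pair enc_prof (enc_list (enc_pair enc_item enc_prof))"
abbreviation "enc_key \<equiv> enc_pair (enc_list enc_item) (enc_pair (enc_list enc_edge) enc_int)"
abbreviation "enc_tab \<equiv> enc_list (enc_pair enc_key enc_wit)"
abbreviation "enc_arcs \<equiv> enc_list (enc_pair enc_nat (enc_pair enc_nat (enc_pair enc_nat (enc_list enc_int))))"
abbreviation "enc_paths \<equiv> enc_list (enc_list (enc_pair enc_nat enc_int))"
abbreviation "enc_gd \<equiv> enc_pair (enc_list enc_nat) (enc_pair enc_arcs enc_paths)"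
abbreviation "enc_op \<equiv> enc_pair enc_nat (enc_pair (enc_pair enc_nat enc_int) enc_int)"
abbreviation "enc_best \<equiv> enc_pair enc_int (enc_list enc_op)"
abbreviation "enc_env \<equiv> enc_pair enc_int (enc_pair enc_nat (enc_pair enc_edge (enc_list enc_int)))"

declare pt_eq [pt_intros] pt_mem [pt_intros] pt_remdups [pt_intros] inj_encs [pt_intros]

text \<open>Covers recursions that only prepend to the recursive result. They are maps over the
  suffixes, so no bound on intermediate results has to be proved for each of them.\<close>

primrec scan :: "('a \<Rightarrow> 'a list \<Rightarrow> 'b) \<Rightarrow> 'a list \<Rightarrow> 'b list" where
  "scan h [] = []"
| "scan h (a # l) = h a l # scan h l"

lemma scan_tails: "scan h l = concat (map (\<lambda>t. case t of [] \<Rightarrow> [] | a # r \<Rightarrow> [h a r]) (tails l))"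
  by (induction l) auto

lemma pt_scan:
  assumes "ptime ea (enc_list eb) xs"
    and h: "ptime (enc_pair ea (enc_pair eb (enc_list eb))) ec (\<lambda>z. h (fst z) (fst (snd z)) (snd (snd z)))"
  shows "ptime ea (enc_list ec) (\<lambda>x. scan (h x) (xs x))"
proof -
  have "ptime (enc_pair (enc_pair ea (enc_list eb)) (enc_pair eb (enc_list eb))) (enc_pair ea (enc_pair eb (enc_list eb)))
     (\<lambda>z. (fst (fst z), fst (snd z), snd (snd z)))" by (rule pt_intros)+
  note 1 = pt_comp[OF h this, unfolded fst_conv snd_conv]
  show ?thesis unfolding scan_tails by (rule pt_intros assms 1)+
qed

lemma pt_comp2:
  assumes "ptime (enc_pair eb ec) ed (\<lambda>z. h (fst z) (snd z))" "pt A \<mu> ea eb f" "pt A \<mu> ea ec g"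
  shows "pt A \<mu> ea ed (\<lambda>x. h (f x) (g x))"
  using pt_comp[OF assms(1) pt_pair[OF assms(2,3)]] by simp

lemma pt_tc [pt_intros]:
  assumes "pt A \<mu> ea enc_int f1" "pt A \<mu> ea enc_int f2" "pt A \<mu> ea enc_int f3" "pt A \<mu> ea enc_int f4"
  shows "pt A \<mu> ea enc_int (\<lambda>x. tc (f1 x) (f2 x) (f3 x) (f4 x))"
  unfolding tc_def by (rule pt_intros assms)+

lemma scost_scan: "scost q = sum_list (scan (\<lambda>a r. case r of [] \<Rightarrow> max 0 (fst a - snd a) | b # _ \<Rightarrow> tc (fst a) (snd a) (fst b) (snd b)) q)"
  by (induction q) auto

lemma pt_scost [pt_intros]:
  assumes "pt A \<mu> ea (enc_list (enc_pair enc_int enc_int)) f" shows "pt A \<mu> ea enc_int (\<lambda>x. scost (f x))"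
proof -
  have "ptime (enc_list (enc_pair enc_int enc_int)) enc_int scost"
    unfolding scost_scan by (rule pt_intros pt_scan)+
  from pt_comp[OF this assms] show ?thesis .
qed

lemma pt_pcost [pt_intros]:
  assumes "pt A \<mu> ea (enc_list (enc_pair enc_int enc_int)) f" shows "pt A \<mu> ea enc_int (\<lambda>x. pcost (f x))"
proof -
  have "ptime (enc_list (enc_pair enc_int enc_int)) enc_int pcost"
    unfolding pcost_def by (rule pt_intros)+
  from pt_comp[OF this assms] show ?thesis .
qed

lemma pt_labs [pt_intros]:
  assumes "pt A \<mu> ea enc_prof f" shows "pt A \<mu> ea (enc_list (enc_pair enc_int enc_int)) (\<lambda>x. labs (f x))"
proof -
  have "ptime enc_prof (enc_list (enc_pair enc_int enc_int)) labs"
    unfolding labs_def by (rule pt_intros)+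
  from pt_comp[OF this assms] show ?thesis .
qed

lemma pt_wcost [pt_intros]:
  assumes "pt A \<mu> ea enc_wit f" shows "pt A \<mu> ea enc_int (\<lambda>x. wcost (f x))"
proof -
  have "ptime enc_wit enc_int wcost" unfolding wcost_def by (rule pt_intros)+
  from pt_comp[OF this assms] show ?thesis .
qed

lemma pt_start [pt_intros]:
  assumes "pt A \<mu> ea enc_item f" shows "pt A \<mu> ea enc_nat (\<lambda>x. start (f x))"
proof -
  have "ptime enc_item enc_nat start" unfolding start_def by (rule pt_intros)+
  from pt_comp[OF this assms] show ?thesis .
qed

lemma pt_ok [pt_intros]:
  assumes "pt A \<mu> ea enc_edge f" "pt A \<mu> ea enc_int g" shows "pt A \<mu> ea enc_bool (\<lambda>x. ok up dn (f x) (g x))"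
  unfolding ok_def by (rule pt_intros assms)+

lemma pt_base_cands [pt_intros]:
  assumes "pt A \<mu> ea enc_key f" shows "pt A \<mu> ea (enc_list enc_wit) (\<lambda>x. base_cands (f x))"
proof -
  have "ptime enc_key (enc_list enc_wit) base_cands" unfolding base_cands_def by (rule pt_intros)+
  from pt_comp[OF this assms] show ?thesis .
qed

lemma pt_move_cands [pt_intros]:
  assumes "pt A \<mu> ea enc_tab f" "pt A \<mu> ea enc_key g" shows "pt A \<mu> ea (enc_list enc_wit) (\<lambda>x. move_cands (f x) (g x))"
proof -
  have "ptime (enc_pair enc_tab enc_key) (enc_list enc_wit) (\<lambda>z. move_cands (fst z) (snd z))"
    unfolding move_cands_def by (rule pt_intros)+
  from pt_comp2[OF this assms] show ?thesis .
qed

lemma pt_serve_cands [pt_intros]: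
  assumes "pt A \<mu> ea enc_tab f" "pt A \<mu> ea enc_key g" shows "pt A \<mu> ea (enc_list enc_wit) (\<lambda>x. serve_cands (f x) (g x))"
proof -
  have "ptime (enc_pair enc_tab enc_key) (enc_list enc_wit) (\<lambda>z. serve_cands (fst z) (snd z))"
    unfolding serve_cands_def by (rule pt_intros)+
  from pt_comp2[OF this assms] show ?thesis .
qed

lemma pt_cands [pt_intros]:
  assumes "pt A \<mu> ea enc_tab f" "pt A \<mu> ea enc_key g" shows "pt A \<mu> ea (enc_list enc_wit) (\<lambda>x. cands (f x) (g x))"
  unfolding cands_def by (rule pt_intros assms)+

lemma pt_pick [pt_intros]:
  assumes "pt A \<mu> ea (enc_list enc_wit) f" shows "pt A \<mu> ea (enc_list enc_wit) (\<lambda>x. pick (f x))"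
proof -
  let ?s = "\<lambda>x a l r. case r of [] \<Rightarrow> [a] | v # _ \<Rightarrow> if wcost a \<le> wcost v then [a] else [v]"
  have grow: "data_size (enc_list enc_wit (?s x a l r)) \<le> data_size (enc_list enc_wit r) +
      (data_size (enc_list enc_wit x) + data_size (enc_wit a) + data_size (enc_list enc_wit l) + 2) ^ 1" for x a l r
    by (cases r) simp_all
  have "ptime (enc_list enc_wit) (enc_list enc_wit) (\<lambda>x. (\<lambda>_. pick) x x)"
    by (rule pt_list_rec_size[where F = "\<lambda>_. pick" and i = "\<lambda>_. []" and xs = "\<lambda>x. x" and s = ?s],
        (rule pt_intros)+, simp, simp, intro exI[of _ 1] allI, rule grow)
  from pt_comp[OF this assms] show ?thesis by simp
qed

lemma pt_round_tab [pt_intros]: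
  assumes "pt A \<mu> ea (enc_list enc_key) f" "pt A \<mu> ea enc_tab g" shows "pt A \<mu> ea enc_tab (\<lambda>x. round_tab (f x) (g x))"
proof -
  have "ptime (enc_pair (enc_list enc_key) enc_tab) enc_tab (\<lambda>z. round_tab (fst z) (snd z))"
    unfolding round_tab_def by (rule pt_intros)+
  from pt_comp2[OF this assms] show ?thesis .
qed

lemma pt_all_keys [pt_intros]:
  assumes "pt A \<mu> ea (enc_list (enc_list enc_item)) f1" "pt A \<mu> ea (enc_list (enc_list enc_edge)) f2" "pt A \<mu> ea (enc_list enc_int) f3"
  shows "pt A \<mu> ea (enc_list enc_key) (\<lambda>x. all_keys up dn (f1 x) (f2 x) (f3 x))"
proof -
  have "ptime (enc_pair (enc_list (enc_list enc_item)) (enc_pair (enc_list (enc_list enc_edge)) (enc_list enc_int))) (enc_list enc_key)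
     (\<lambda>z. all_keys up dn (fst z) (fst (snd z)) (snd (snd z)))"
    unfolding all_keys_def by (rule pt_intros)+
  from pt_comp[OF this pt_pair[OF assms(1) pt_pair[OF assms(2,3)]]] show ?thesis by simp
qed

lemma pt_dp_sufs [pt_intros]:
  assumes "pt A \<mu> ea enc_edge f" "pt A \<mu> ea (enc_list enc_item) g"
  shows "pt A \<mu> ea (enc_list (enc_list enc_edge)) (\<lambda>x. dp_sufs (f x) (g x))"
proof -
  have "ptime (enc_pair enc_edge (enc_list enc_item)) (enc_list (enc_list enc_edge)) (\<lambda>z. dp_sufs (fst z) (snd z))"
    unfolding dp_sufs_def by (rule pt_intros)+
  from pt_comp2[OF this assms] show ?thesis .
qed

lemma adv_ops_scan: "adv_ops i q = concat (rev (scan (\<lambda>z r. let c = (case r of [] \<Rightarrow> old z | w # _ \<Rightarrow> min (old z) (new w - 1)) in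
      if new z < c then [(i, (arc_of z, c), new z - c)] else []) q))"
  by (induction q) (simp_all add: Let_def)

lemma del_ops_scan: "del_ops i q = concat (scan (\<lambda>z r. case r of [] \<Rightarrow> [] | w # _ \<Rightarrow>
       (let c = max (min (old w) (new w)) (new z + 1) in
        if c < new w then [(i, (arc_of w, c), new w - c)] else [])) q)"
  by (induction q) (simp_all only: del_ops.simps scan.simps concat.simps)

lemma pt_adv_ops: "ptime (enc_pair enc_nat enc_prof) (enc_list enc_op) (\<lambda>z. adv_ops (fst z) (snd z))"
  unfolding adv_ops_scan by (rule pt_intros pt_scan)+

lemma pt_del_ops: "ptime (enc_pair enc_nat enc_prof) (enc_list enc_op) (\<lambda>z. del_ops (fst z) (snd z))"
  unfolding del_ops_scan by (rule pt_intros pt_scan)+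

lemma pt_prof_ops [pt_intros]:
  assumes "pt A \<mu> ea enc_nat f" "pt A \<mu> ea enc_prof g"
  shows "pt A \<mu> ea (enc_list enc_op) (\<lambda>x. prof_ops (f x) (g x))"
proof -
  have "ptime (enc_pair enc_nat enc_prof) (enc_list enc_op) (\<lambda>z. prof_ops (fst z) (snd z))"
    unfolding prof_ops_def by (rule pt_append pt_adv_ops pt_del_ops pt_intros)+
  from pt_comp2[OF this assms] show ?thesis .
qed

lemma pt_wops [pt_intros]:
  assumes "pt A \<mu> ea enc_wit f" shows "pt A \<mu> ea (enc_list enc_op) (\<lambda>x. wops (f x))"
proof -
  have "ptime enc_wit (enc_list enc_op) wops" unfolding wops_def all_ops_def by (rule pt_intros)+
  from pt_comp[OF this assms] show ?thesis .
qed

lemma pt_gain [pt_intros]: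
  assumes "pt A \<mu> ea enc_nat f" "pt A \<mu> ea (enc_list enc_item) g"
  shows "pt A \<mu> ea enc_int (\<lambda>x. gain (f x) (g x))"
proof -
  have "ptime (enc_pair enc_nat (enc_list enc_item)) enc_int (\<lambda>z. gain (fst z) (snd z))"
    unfolding gain_def by (rule pt_intros)+
  from pt_comp2[OF this assms] show ?thesis .
qed

lemma pt_improve:
  "ptime (enc_pair enc_env (enc_pair (enc_list enc_item) (enc_pair (enc_list enc_wit) enc_best))) enc_best
     (\<lambda>z. improve (fst z) (fst (snd z)) (fst (snd (snd z))) (snd (snd (snd z))))"
  unfolding improve_def by (rule pt_intros)+

lemma pt_labels_of [pt_intros]:
  assumes "pt A \<mu> ea (enc_list enc_item) f" shows "pt A \<mu> ea (enc_list enc_int) (\<lambda>x. labels_of (f x))"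
proof -
  have "ptime (enc_list enc_item) (enc_list enc_int) labels_of" unfolding labels_of_def by (rule pt_intros)+
  from pt_comp[OF this assms] show ?thesis .
qed

lemma pt_near_labels [pt_intros]:
  assumes "pt A \<mu> ea (enc_list enc_item) f" shows "pt A \<mu> ea (enc_list enc_int) (\<lambda>x. near_labels (f x))"
proof -
  have "ptime (enc_list enc_item) (enc_list enc_int) near_labels" unfolding near_labels_def by (rule pt_intros)+
  from pt_comp[OF this assms] show ?thesis .
qed

lemma pt_abs_sum [pt_intros]:
  assumes "pt A \<mu> ea (enc_list enc_int) f" shows "pt A \<mu> ea enc_int (\<lambda>x. abs_sum (f x))"
proof -
  have "ptime (enc_list enc_int) enc_int abs_sum" unfolding abs_sum_def by (rule pt_intros)+
  from pt_comp[OF this assms] show ?thesis .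
qed

lemma pt_root_label [pt_intros]:
  assumes "pt A \<mu> ea (enc_list enc_int) f" shows "pt A \<mu> ea enc_int (\<lambda>x. root_label (f x))"
  unfolding root_label_def by (rule pt_intros assms)+

lemma pt_cost_bound [pt_intros]:
  assumes "pt A \<mu> ea (enc_list enc_item) f" shows "pt A \<mu> ea enc_int (\<lambda>x. cost_bound (f x))"
proof -
  have "ptime (enc_list enc_item) enc_int cost_bound" unfolding cost_bound_def by (rule pt_intros)+
  from pt_comp[OF this assms] show ?thesis .
qed

lemma numbered_scan: "numbered ps = scan (\<lambda>p l. (length l, p)) ps"
  by (induction ps) auto

lemma pt_mk_edge: "ptime (enc_pair enc_arcs (enc_pair enc_nat enc_int)) enc_edge (\<lambda>z. mk_edge (fst z) (snd z))"
  unfolding mk_edge_def arc_info_def by (rule pt_intros)+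

lemma pt_items_of [pt_intros]:
  assumes "pt A \<mu> ea enc_gd f" shows "pt A \<mu> ea (enc_list enc_item) (\<lambda>x. items_of (f x))"
proof -
  have "ptime enc_gd (enc_list enc_item) items_of"
    unfolding items_of_def numbered_scan by (rule pt_intros pt_scan pt_comp2[OF pt_mk_edge])+
  from pt_comp[OF this assms] show ?thesis .
qed

section \<open>Size of the dynamic programming tables\<close>

lemma size_list_le:
  "(\<And>a. a \<in> set l \<Longrightarrow> data_size (e a) \<le> m) \<Longrightarrow> data_size (enc_list e l) \<le> length l * (m + 1) + 1"
proof (induction l)
  case (Cons a l)
  then have "data_size (e a) \<le> m" "data_size (enc_list e l) \<le> length l * (m + 1) + 1" by auto
  then show ?case by simp
qed simp

text \<open>By \<open>size_list_le\<close>, a list of at most \<open>Z\<close> elements of size at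
  most \<open>m\<close> has size at most \<open>Z * (m + 1) + 1\<close>. The three bounds nest this
  for a relabelled suffix, a witness and a table.\<close>

definition prof_bound :: "nat \<Rightarrow> nat" where "prof_bound Z = Z * (2 * Z + 1 + 1) + 1"
definition wit_bound :: "nat \<Rightarrow> nat" where "wit_bound Z = prof_bound Z + (Z * (Z + prof_bound Z + 1 + 1) + 1) + 1"
definition tab_bound :: "nat \<Rightarrow> nat" where "tab_bound Z = Z * (Z + wit_bound Z + 1 + 1) + 1"

lemma size_prof:
  assumes "map fst q = suf" "data_size (enc_list enc_edge suf) \<le> Z" "\<And>z. z \<in> set q \<Longrightarrow> data_size (enc_int (snd z)) \<le> Z"
  shows "data_size (enc_prof q) \<le> prof_bound Z"
proof -
  have l: "length q \<le> Z" using assms(1,2) length_le_size[of suf enc_edge] by (metis length_map less_imp_le order_trans)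
  have "data_size (enc_pair enc_edge enc_int z) \<le> 2 * Z + 1" if z: "z \<in> set q" for z
  proof -
    have "fst z \<in> set suf" using assms(1) z by auto
    then have "data_size (enc_edge (fst z)) \<le> Z" using size_mem[of "fst z" suf enc_edge] assms(2) by linarith
    then show ?thesis using assms(3)[OF z] unfolding size_pair[of enc_edge enc_int z] by linarith
  qed
  then have "data_size (enc_prof q) \<le> length q * (2 * Z + 1 + 1) + 1" by (rule size_list_le)
  also have "\<dots> \<le> prof_bound Z" unfolding prof_bound_def using l by (intro add_mono mult_right_mono) auto
  finally show ?thesis .
qed

text \<open>The counter \<open>l\<close> does not enter the bound: every entry is a valid witness,
  hence built from items of \<open>part\<close> with labels in \<open>X\<close>, and there is at
  most one entry per key.\<close>

lemma size_dp_rounds: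
  assumes subs: "\<And>S. S \<in> set subs \<Longrightarrow> distinct S \<and> set S \<subseteq> set part"
    and Z: "data_size (enc_list enc_item part) \<le> Z" "data_size (enc_list (enc_list enc_edge) sufs) \<le> Z"
      "data_size (enc_list enc_int X) \<le> Z" "data_size (enc_list enc_key (all_keys up dn subs sufs X)) \<le> Z"
  shows "data_size (enc_tab (dp_rounds (all_keys up dn subs sufs X) l)) \<le> tab_bound Z"
proof -
  let ?keys = "all_keys up dn subs sufs X"
  have entry: "data_size (enc_pair enc_key enc_wit t) \<le> Z + wit_bound Z + 1" if t: "t \<in> set (dp_rounds ?keys l)" for t
  proof -
    obtain k w where kw: "t = (k, w)" by (rule prod.exhaust)
    obtain S suf x where k: "k = (S, suf, x)" by (rule prod_cases3)
    have "k \<in> set ?keys \<and> valid up dn (set X) k w"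
      by (rule valid_dp_rounds[where l = l]) (use subs t kw in auto)
    then have key: "(S, suf, x) \<in> set ?keys" and v: "valid up dn (set X) (S, suf, x) w" unfolding k by auto
    have S: "S \<in> set subs" "suf \<in> set sufs" using key unfolding set_all_keys by auto
    have sk: "data_size (enc_key k) \<le> Z" using size_mem[of k ?keys enc_key] key Z(4) k by simp
    have val: "data_size (enc_int (snd ey)) \<le> Z" if "ey \<in> events w" for ey
    proof -
      have "snd ey \<in> set X" using v that unfolding valid_def by blast
      then show ?thesis using size_mem[of "snd ey" X enc_int] Z(3) by linarith
    qed
    have p1: "data_size (enc_prof (fst w)) \<le> prof_bound Z"
    proof (rule size_prof)
      show "map fst (fst w) = suf" using v by (simp add: valid_def)
      show "data_size (enc_list enc_edge suf) \<le> Z" using size_mem[OF S(2), of "enc_list enc_edge"] Z(2) by linarith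
      show "data_size (enc_int (snd z)) \<le> Z" if "z \<in> set (fst w)" for z using val[of z] that by (simp add: events_def)
    qed
    have p2: "data_size (enc_pair enc_item enc_prof iq) \<le> Z + prof_bound Z + 1" if iq: "iq \<in> set (snd w)" for iq
    proof -
      have "fst iq \<in> set part" using v iq subs[OF S(1)] unfolding valid_def by (metis fst_conv image_eqI subsetD)
      then have it: "data_size (enc_item (fst iq)) \<le> Z" using size_mem[of "fst iq" part enc_item] Z(1) by linarith
      have "data_size (enc_prof (snd iq)) \<le> prof_bound Z"
      proof (rule size_prof)
        show "map fst (snd iq) = snd (fst iq)" using v iq unfolding valid_def by blast
        show "data_size (enc_list enc_edge (snd (fst iq))) \<le> Z" using it unfolding size_pair[of enc_nat] by linarith
        show "data_size (enc_int (snd z)) \<le> Z" if "z \<in> set (snd iq)" for z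
        proof (rule val)
          show "z \<in> events w" unfolding events_def using iq that by blast
        qed
      qed
      then show ?thesis using it unfolding size_pair[of enc_item] by linarith
    qed
    have "length (snd w) = card (set (map fst (snd w)))"
      using v distinct_card[of "map fst (snd w)"] unfolding valid_def by simp
    also have "\<dots> = card (set S)" using v unfolding valid_def by simp
    also have "\<dots> \<le> card (set part)" by (rule card_mono) (use subs[OF S(1)] in auto)
    also have "\<dots> \<le> length part" by (rule card_length)
    also have "\<dots> \<le> Z" using length_le_size[of part enc_item] Z(1) by linarith
    finally have len: "length (snd w) \<le> Z" .
    have "data_size (enc_list (enc_pair enc_item enc_prof) (snd w)) \<le> length (snd w) * (Z + prof_bound Z + 1 + 1) + 1"
      by (rule size_list_le[OF p2])
    also have "\<dots> \<le> Z * (Z + prof_bound Z + 1 + 1) + 1" using len by (intro add_mono mult_right_mono) auto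
    finally have "data_size (enc_wit w) \<le> wit_bound Z"
      using p1 unfolding wit_bound_def size_pair[of enc_prof] by linarith
    then show ?thesis using sk unfolding kw size_pair[of enc_key] fst_conv snd_conv by linarith
  qed
  have "length (dp_rounds ?keys l) \<le> Z"
    using length_dp_rounds[of ?keys l] length_le_size[of ?keys enc_key] Z(4) by linarith
  then have "length (dp_rounds ?keys l) * (Z + wit_bound Z + 1 + 1) + 1 \<le> tab_bound Z"
    unfolding tab_bound_def by (intro add_mono mult_right_mono) auto
  then show ?thesis using size_list_le[OF entry] by (rule order_trans[rotated])
qed

abbreviation "enc_dp_in \<equiv> enc_pair enc_edge (enc_pair (enc_list enc_int) (enc_pair (enc_list enc_item) (enc_list (enc_list enc_item))))"

text \<open>The list of subsets is an argument instead of being computed inside. Its exponential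
  length thus counts as input size, and the dynamic program is a polynomial-time function.\<close>

definition dp_dom :: "(edge \<times> int list \<times> item list \<times> item list list) set" where
  "dp_dom = {y. distinct (fst (snd (snd y))) \<and> snd (snd (snd y)) = subseqs (fst (snd (snd y)))}"

lemma pt_dp_table:
  "pt dp_dom (\<lambda>y. data_size (enc_dp_in y)) enc_dp_in enc_tab
     (\<lambda>y. dp_table up dn (fst y) (fst (snd y)) (fst (snd (snd y))) (snd (snd (snd y))))"
proof -
  define keys where "keys y = all_keys up dn (snd (snd (snd y))) (dp_sufs (fst y) (fst (snd (snd y)))) (fst (snd y))"
    for y :: "edge \<times> int list \<times> item list \<times> item list list"
  define sufs where "sufs y = dp_sufs (fst y) (fst (snd (snd y)))"
    for y :: "edge \<times> int list \<times> item list \<times> item list list"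
  define fuel where "fuel y = sufs y @ concat (map (\<lambda>_. sufs y) (fst (snd (snd y))))" for y
  have keys: "ptime enc_dp_in (enc_list enc_key) keys" unfolding keys_def by (rule pt_intros)+
  have sufs: "ptime enc_dp_in (enc_list (enc_list enc_edge)) sufs" unfolding sufs_def by (rule pt_intros)+
  have fuel: "ptime enc_dp_in (enc_list (enc_list enc_edge)) fuel" unfolding fuel_def sufs_def by (rule pt_intros)+
  have part: "ptime enc_dp_in (enc_list enc_item) (\<lambda>y. fst (snd (snd y)))" by (rule pt_intros)+
  have X: "ptime enc_dp_in (enc_list enc_int) (\<lambda>y. fst (snd y))" by (rule pt_intros)+
  have "pt dp_dom (\<lambda>y. data_size (enc_dp_in y)) enc_dp_in enc_tab (\<lambda>y. dp_rounds (keys y) (fuel y))"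
  proof (rule pt_list_rec_on[where F = "\<lambda>y l. dp_rounds (keys y) l" and i = "\<lambda>_. []"
        and s = "\<lambda>y a l r. round_tab (keys y) r" and B = UNIV])
    show "pt dp_dom (\<lambda>y. data_size (enc_dp_in y)) enc_dp_in (enc_list (enc_list enc_edge)) fuel"
      by (rule pt_subset[OF fuel]) simp
    show "pt dp_dom (\<lambda>y. data_size (enc_dp_in y)) enc_dp_in enc_dp_in (\<lambda>y. y)" by (rule pt_id)
    show "pt dp_dom (\<lambda>y. data_size (enc_dp_in y)) enc_dp_in enc_tab (\<lambda>_. [])" by (rule pt_const)
    show "ptime (enc_pair enc_dp_in (enc_pair (enc_list enc_edge) (enc_pair (enc_list (enc_list enc_edge)) enc_tab))) enc_tab
      (\<lambda>z. round_tab (keys (fst z)) (snd (snd (snd z))))"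
      by (rule pt_intros pt_comp[OF keys])+
    define Zf where "Zf y = data_size (enc_list enc_item (fst (snd (snd y)))) + data_size (enc_list (enc_list enc_edge) (sufs y)) +
      data_size (enc_list enc_int (fst (snd y))) + data_size (enc_list enc_key (keys y))" for y
    have "pb UNIV (\<lambda>y. data_size (enc_dp_in y)) (\<lambda>y. tab_bound (Zf y))"
      unfolding tab_bound_def wit_bound_def prof_bound_def Zf_def
      by (intro pb_const pb_add pb_mult keys[THEN pt_size] sufs[THEN pt_size] part[THEN pt_size] X[THEN pt_size])
    then obtain c where c: "\<And>y. tab_bound (Zf y) \<le> (data_size (enc_dp_in y) + 2) ^ c" unfolding pb_def by blast
    have "data_size (enc_tab (dp_rounds (keys y) (drop k (fuel y)))) \<le> tab_bound (Zf y)" if y: "y \<in> dp_dom" for y k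
      unfolding keys_def
    proof (rule size_dp_rounds)
      fix S assume "S \<in> set (snd (snd (snd y)))"
      then have "S \<in> set (subseqs (fst (snd (snd y))))" using y by (simp add: dp_dom_def)
      then have "distinct S" "set S \<in> Pow (set (fst (snd (snd y))))"
        using subseqs_distinctD[of S "fst (snd (snd y))"] y unfolding subseqs_powset[symmetric] dp_dom_def by blast+
      then show "distinct S \<and> set S \<subseteq> set (fst (snd (snd y)))" by simp
    qed (simp_all add: Zf_def keys_def sufs_def)
    then show "\<exists>c. \<forall>y\<in>dp_dom. \<forall>k. data_size (enc_tab (dp_rounds (keys y) (drop k (fuel y)))) \<le> (data_size (enc_dp_in y) + 2) ^ c"
      using c order_trans by blast
  qed simp_all
  then show ?thesis by (simp only: dp_table_def Let_def keys_def fuel_def sufs_def)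
qed

lemma pt_dp_result:
  "pt dp_dom (\<lambda>y. data_size (enc_dp_in y)) enc_dp_in (enc_list enc_wit)
     (\<lambda>y. dp_result up dn (fst y) (fst (snd y)) (fst (snd (snd y))) (snd (snd (snd y))))"
proof -
  have "ptime (enc_pair enc_dp_in enc_tab) (enc_list enc_wit)
    (\<lambda>z. pick (map snd (filter (\<lambda>t. fst t = (fst (snd (snd (fst z))), [fst (fst z)], lab (fst (fst z)))) (snd z))))"
    by (rule pt_intros)+
  from pt_comp[OF this pt_pair[OF pt_id pt_dp_table]] show ?thesis unfolding dp_result_def fst_conv snd_conv .
qed

lemma pt_id_le: "pb A \<mu> (\<lambda>x. data_size (ea x)) \<Longrightarrow> pt A \<mu> ea ea (\<lambda>x. x)"
  by (rule ptI[OF tm_id pb_const])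

lemma size_subseqs_mem: "S \<in> set (subseqs l) \<Longrightarrow> data_size (enc_list e S) \<le> data_size (enc_list e l)"
  by (induction l arbitrary: S) (auto simp: Let_def intro: le_SucI trans_le_add2)

lemma size_subseqs: "data_size (enc_list (enc_list e) (subseqs l)) \<le> 2 ^ length l * (data_size (enc_list e l) + 1) + 1"
  using size_list_le[of "subseqs l" "enc_list e" "data_size (enc_list e l)"] size_subseqs_mem[of _ l e]
  by (simp add: length_subseqs)

abbreviation "enc_proc_in \<equiv> enc_pair enc_env (enc_pair (enc_list enc_item) enc_best)"

text \<open>A polynomial in this measure is \<open>2 ^ O(k)\<close> times a polynomial in the size
  of the argument.\<close>

definition proc_measure :: "env \<times> item list \<times> (int \<times> nat shift list) \<Rightarrow> nat" where
  "proc_measure z = 2 ^ length (fst (snd z)) * data_size (enc_proc_in z)"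

definition proc_dom :: "(env \<times> item list \<times> (int \<times> nat shift list)) set" where
  "proc_dom = {z. distinct (fst (snd z))}"

lemma proc_measure_ge: "data_size (enc_proc_in z) \<le> proc_measure z" "2 ^ length (fst (snd z)) \<le> proc_measure z"
proof -
  have "a \<le> 2 ^ l * a \<and> 2 ^ l \<le> 2 ^ l * a" if "0 < a" for a l :: nat using that by simp
  from this[OF data_size_pos[of "enc_proc_in z"]]
  show "data_size (enc_proc_in z) \<le> proc_measure z" "2 ^ length (fst (snd z)) \<le> proc_measure z"
    unfolding proc_measure_def by blast+
qed

lemma pt_process:
  "pt proc_dom proc_measure enc_proc_in enc_best (\<lambda>z. process up dn (fst z) (fst (snd z)) (snd (snd z)))"
proof -
  have id: "pt proc_dom proc_measure enc_proc_in enc_proc_in (\<lambda>z. z)"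
    by (rule pt_id_le, rule pb_mono[OF pb_id]) (rule proc_measure_ge)
  note z = pt_fst[OF id] pt_snd[OF id] pt_fst[OF pt_snd[OF id]] pt_snd[OF pt_snd[OF id]]
  have subs: "pt proc_dom proc_measure enc_proc_in (enc_list (enc_list enc_item)) (\<lambda>z. subseqs (fst (snd z)))"
  proof (rule pt_list_rec_on[where F = "\<lambda>_. subseqs" and i = "\<lambda>_. [[]]" and B = UNIV
        and s = "\<lambda>z a l r. map (\<lambda>S. a # S) r @ r", OF z(3) id pt_const])
    show "ptime (enc_pair enc_proc_in (enc_pair enc_item (enc_pair (enc_list enc_item) (enc_list (enc_list enc_item)))))
       (enc_list (enc_list enc_item)) (\<lambda>z. map (\<lambda>S. fst (snd z) # S) (snd (snd (snd z))) @ snd (snd (snd z)))"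
      by (rule pt_intros)+
    have "pb proc_dom proc_measure (\<lambda>z. proc_measure z * (proc_measure z + 1) + 1)" by (intro pb_intros)
    then obtain c where c: "\<And>z. z \<in> proc_dom \<Longrightarrow> proc_measure z * (proc_measure z + 1) + 1 \<le> (proc_measure z + 2) ^ c"
      unfolding pb_def by blast
    have "data_size (enc_list (enc_list enc_item) (subseqs (drop k (fst (snd z))))) \<le> proc_measure z * (proc_measure z + 1) + 1" for z k
    proof -
      let ?p = "fst (snd z)"
      have "data_size (enc_list enc_item (drop k ?p)) \<le> data_size (enc_list enc_item ?p)" by (rule size_drop)
      also have "\<dots> \<le> data_size (enc_proc_in z)" by simp
      finally have 1: "data_size (enc_list enc_item (drop k ?p)) \<le> proc_measure z" using proc_measure_ge(1)[of z] by linarith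
      have "(2 :: nat) ^ length (drop k ?p) \<le> 2 ^ length ?p" by (rule power_increasing) auto
      then have "(2 :: nat) ^ length (drop k ?p) \<le> proc_measure z" using proc_measure_ge(2)[of z] by linarith
      then have "2 ^ length (drop k ?p) * (data_size (enc_list enc_item (drop k ?p)) + 1) + 1 \<le> proc_measure z * (proc_measure z + 1) + 1"
        using 1 by (intro add_mono mult_mono) auto
      then show ?thesis using size_subseqs[of enc_item "drop k ?p"] by linarith
    qed
    then show "\<exists>c. \<forall>z\<in>proc_dom. \<forall>k. data_size (enc_list (enc_list enc_item) (subseqs (drop k (fst (snd z))))) \<le> (proc_measure z + 2) ^ c"
      using c order_trans by blast
  qed (simp_all add: Let_def)
  have "pt proc_dom proc_measure enc_proc_in enc_dp_in
     (\<lambda>z. (fst (snd (snd (fst z))), snd (snd (snd (fst z))), fst (snd z), subseqs (fst (snd z))))"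
    by (rule pt_pair pt_fst pt_snd subs id)+
  from pt_comp_on[OF pt_dp_result this] have res: "pt proc_dom proc_measure enc_proc_in (enc_list enc_wit)
     (\<lambda>z. dp_result up dn (fst (snd (snd (fst z)))) (snd (snd (snd (fst z)))) (fst (snd z)) (subseqs (fst (snd z))))"
    by (simp add: dp_dom_def proc_dom_def)
  have "pt proc_dom proc_measure enc_proc_in (enc_pair enc_env (enc_pair (enc_list enc_item) (enc_pair (enc_list enc_wit) enc_best)))
    (\<lambda>z. (fst z, fst (snd z), dp_result up dn (fst (snd (snd (fst z)))) (snd (snd (snd (fst z)))) (fst (snd z)) (subseqs (fst (snd z))), snd (snd z)))"
    by (intro pt_pair z res)
  from pt_comp[OF pt_improve this] show ?thesis unfolding process_def fst_conv snd_conv .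
qed

subsection \<open>Time of the search\<close>

text \<open>Units of work: each suffix of the first path causes one search in the remaining paths,
  and the summand 2 pays for the loop itself.\<close>

primrec search_steps :: "item list \<Rightarrow> nat" where
  "search_steps [] = 1"
| "search_steps (f # fs) = (length (snd f) + 1) * (search_steps fs + 2)"

lemma search_steps_le: "search_steps fs \<le> 3 ^ length fs * (\<Prod>f\<leftarrow>fs. length (snd f) + 1)"
proof (induction fs)
  case (Cons f fs)
  let ?R = "3 ^ length fs * (\<Prod>f\<leftarrow>fs. length (snd f) + 1)"
  have "(\<Prod>f\<leftarrow>fs. length (snd f) + 1) \<noteq> 0" by (induction fs) auto
  then have "1 \<le> ?R" by (metis One_nat_def Suc_leI mult_eq_0_iff neq0_conv power_not_zero zero_neq_numeral)
  then have "search_steps fs + 2 \<le> 3 * ?R" using Cons by linarith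
  then have "search_steps (f # fs) \<le> (length (snd f) + 1) * (3 * ?R)" unfolding search_steps.simps by (rule mult_left_mono) simp
  then show ?case by (simp add: algebra_simps)
qed simp

text \<open>Each call of \<open>pr\<close> is charged the same amount \<open>K\<close>, which
  requires a bound for all accumulators that can occur. \<open>Bst\<close> is a set of accumulators
  that contains the initial one and is closed under processing.\<close>

lemma tm_search:
  fixes pr :: "'x \<Rightarrow> item list \<Rightarrow> 'r \<Rightarrow> 'r"
  assumes pr: "tm Z (enc_pair ex (enc_pair (enc_list enc_item) er)) er (\<lambda>z. pr (fst z) (fst (snd z)) (snd (snd z))) T"
    and inv: "\<And>x fs p b. (x, fs) \<in> A \<Longrightarrow> p \<in> choices fs [] \<Longrightarrow> b \<in> Bst x fs \<Longrightarrow>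
      (x, p, b) \<in> Z \<and> T (x, p, b) \<le> K x fs \<and> pr x p b \<in> Bst x fs"
    and init: "\<And>x fs. (x, fs) \<in> A \<Longrightarrow> b0 \<in> Bst x fs"
  shows "tm A (enc_pair ex (enc_list enc_item)) er (\<lambda>z. search (pr (fst z)) (snd z) [] b0)
    (\<lambda>z. (K (fst z) (snd z) + 60) * search_steps (snd z) + data_size (er b0) + 20)"
proof -
  let ?e = "enc_pair ex (enc_pair (enc_list enc_item) er)"
  obtain p e where e: "\<And>z. z \<in> Z \<Longrightarrow> \<exists>n\<le>T z. eval p [?e z] e (er (pr (fst z) (fst (snd z)) (snd (snd z)))) n"
    using pr unfolding tm_def by blast
  define N where "N = length p"
  \<comment> \<open>\<open>go\<close> realizes \<open>search\<close> on the arguments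
    \<open>x\<close>, \<open>fs\<close>, \<open>part\<close>, \<open>b\<close>.\<close>
  define go where "go = ECond (EVar 1)
    (ECall (N + 1) [EVar 0, EHd (EHd (EVar 1)), ETl (EHd (EVar 1)), ETl (EVar 1), EVar 2, EVar 3])
    (ECall (N + 2) [ECons (EVar 0) (ECons (EVar 2) (EVar 3))])"
  \<comment> \<open>\<open>gos\<close> realizes \<open>fold_tails\<close> on \<open>x\<close>,
    \<open>i\<close>, \<open>c\<close>, \<open>fs\<close>, \<open>part\<close>, \<open>b\<close>;
    the inner call of \<open>go\<close> computes the next accumulator.\<close>
  define gos where "gos = ECond (EVar 2)
    (ECall (N + 1) [EVar 0, EVar 1, ETl (EVar 2), EVar 3, EVar 4,
       ECall N [EVar 0, EVar 3, ECons (ECons (EVar 1) (EVar 2)) (EVar 4), EVar 5]])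
    (ECall N [EVar 0, EVar 3, EVar 4, EVar 5])"
  define q where "q = p @ [go, gos, e]"
  have q: "q ! N = go" "q ! (N + 1) = gos" "q ! (N + 2) = e" "length q = N + 3"
    by (auto simp: q_def N_def nth_append)
  have var: "eval q xs (EVar i) (xs ! i) 1" if "i < length xs" for i xs
    using that by (rule eval_Var)
  have var': "eval q xs (EVar i) v 1" if "i < length xs" "xs ! i = v" for i xs v
    using eval_Var that by blast
  note ev = evals_Cons evals_Nil
  have main: "\<exists>n\<le>(K x gs + 60) * search_steps fs.
      eval q [ex x, enc_list enc_item fs, enc_list enc_item part, er b] go (er (search (pr x) fs part b)) n"
    if xg: "(x, gs) \<in> A" and "choices fs part \<subseteq> choices gs []" "b \<in> Bst x gs" for x gs fs part b
    using that(2,3)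
  proof (induction fs arbitrary: part b)
    case Nil
    let ?env = "[ex x, Leaf, enc_list enc_item part, er b]"
    have "part \<in> choices gs []" using Nil.prems by simp
    from inv[OF xg this Nil.prems(2)] have z: "(x, part, b) \<in> Z" "T (x, part, b) \<le> K x gs" by auto
    obtain n where n: "n \<le> K x gs" "eval q [?e (x, part, b)] e (er (pr x part b)) n"
    proof -
      obtain n where "n \<le> T (x, part, b)" "eval p [?e (x, part, b)] e (er (pr x part b)) n"
        using e[OF z(1)] unfolding fst_conv snd_conv by blast
      then show ?thesis using that z(2) eval_append[of p "[?e (x, part, b)]" e] unfolding q_def by (meson order_trans)
    qed
    have arg: "eval q ?env (ECons (EVar 0) (ECons (EVar 2) (EVar 3))) (?e (x, part, b)) (1 + (1 + 1 + 1) + 1)"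
    proof -
      have "?e (x, part, b) = Node (ex x) (Node (enc_list enc_item part) (er b))" by (simp add: enc_pair_def)
      then show ?thesis by (simp only:) (intro eval_Cons var'; simp)
    qed
    have "eval q ?env (ECall (N + 2) [ECons (EVar 0) (ECons (EVar 2) (EVar 3))]) (er (pr x part b)) (((1 + (1 + 1 + 1) + 1) + 0) + n + 1)"
      by (rule eval_Call[OF evals_Cons[OF arg evals_Nil]]) (use n q in auto)
    then have "eval q ?env go (er (pr x part b)) (1 + (((1 + (1 + 1 + 1) + 1) + 0) + n + 1) + 1)"
      unfolding go_def by (intro eval_Cond[where v = Leaf] var') simp_all
    moreover have "1 + (((1 + (1 + 1 + 1) + 1) + 0) + n + 1) + 1 \<le> (K x gs + 60) * search_steps []" using n(1) by simp
    ultimately show ?case unfolding enc_list.simps search.simps by blast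
  next
    case (Cons f fs)
    note IH = Cons.IH
    let ?W = "K x gs + 60"
    obtain i c0 where f: "f = (i, c0)" by (rule prod.exhaust)
    have ext: "choices fs (ext_part i c part) \<subseteq> choices gs []" if "c \<in> set (tails c0)" for c
      using Cons.prems(1) choices_step[of c f _ fs part] that f by auto
    have inner: "\<exists>n\<le>(length c + 1) * (?W * search_steps fs + 30).
       eval q [ex x, enc_nat i, enc_list enc_edge c, enc_list enc_item fs, enc_list enc_item part, er b] gos
         (er (fold_tails (\<lambda>c b. search (pr x) fs (ext_part i c part) b) c b)) n"
      if "set (tails c) \<subseteq> set (tails c0)" "b \<in> Bst x gs" for c b
      using that
    proof (induction c arbitrary: b)
      case Nil
      let ?env = "[ex x, enc_nat i, Leaf, enc_list enc_item fs, enc_list enc_item part, er b]"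
      have "choices fs part \<subseteq> choices gs []" using ext[of "[]"] Nil.prems(1) by (simp add: ext_part_def)
      from IH[OF this Nil.prems(2)] obtain n where n: "n \<le> ?W * search_steps fs"
        "eval q [ex x, enc_list enc_item fs, enc_list enc_item part, er b] go (er (search (pr x) fs part b)) n" by blast
      have "evals q ?env [EVar 0, EVar 3, EVar 4, EVar 5] [ex x, enc_list enc_item fs, enc_list enc_item part, er b] (1 + (1 + (1 + (1 + 0))))"
        by (intro ev var'; simp)
      then have "eval q ?env (ECall N [EVar 0, EVar 3, EVar 4, EVar 5]) (er (search (pr x) fs part b)) ((1 + (1 + (1 + (1 + 0)))) + n + 1)"
        by (rule eval_Call) (use n q in auto)
      then have "eval q ?env gos (er (search (pr x) fs part b)) (1 + ((1 + (1 + (1 + (1 + 0)))) + n + 1) + 1)"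
        unfolding gos_def by (intro eval_Cond[where v = Leaf] var') simp_all
      moreover have "1 + ((1 + (1 + (1 + (1 + 0)))) + n + 1) + 1 \<le> (length ([] :: edge list) + 1) * (?W * search_steps fs + 30)" using n(1) by simp
      ultimately show ?case unfolding enc_list.simps fold_tails.simps ext_part_def if_P[OF refl] by blast
    next
      case (Cons a c)
      let ?c = "a # c" let ?part = "(i, a # c) # part" let ?b = "search (pr x) fs ?part b"
      let ?env = "[ex x, enc_nat i, enc_list enc_edge ?c, enc_list enc_item fs, enc_list enc_item part, er b]"
      have sub: "choices fs ?part \<subseteq> choices gs []" using ext[of ?c] Cons.prems(1) by (simp add: ext_part_def)
      from IH[OF sub Cons.prems(2)]
      obtain n where n: "n \<le> ?W * search_steps fs"
        "eval q [ex x, enc_list enc_item fs, enc_list enc_item ?part, er b] go (er ?b) n" by blast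
      have "?b \<in> Bst x gs"
        by (rule search_invariant[where P = "\<lambda>b. b \<in> Bst x gs"]) (use inv[OF xg] sub Cons.prems(2) in auto)
      from Cons.IH[OF _ this] obtain m where m: "m \<le> (length c + 1) * (?W * search_steps fs + 30)"
        "eval q [ex x, enc_nat i, enc_list enc_edge c, enc_list enc_item fs, enc_list enc_item part, er ?b] gos
         (er (fold_tails (\<lambda>c b. search (pr x) fs (ext_part i c part) b) c ?b)) m"
        using Cons.prems(1) by auto
      have pt: "eval q ?env (ECons (ECons (EVar 1) (EVar 2)) (EVar 4)) (enc_list enc_item ?part) ((1 + 1 + 1) + 1 + 1)"
      proof -
        have "enc_list enc_item ?part = Node (Node (enc_nat i) (enc_list enc_edge ?c)) (enc_list enc_item part)" by (simp add: enc_pair_def)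
        then show ?thesis by (simp only:) (intro eval_Cons var'; simp)
      qed
      have "evals q ?env [EVar 0, EVar 3, ECons (ECons (EVar 1) (EVar 2)) (EVar 4), EVar 5]
         [ex x, enc_list enc_item fs, enc_list enc_item ?part, er b] (1 + (1 + (((1 + 1 + 1) + 1 + 1) + (1 + 0))))"
        by (intro ev var' pt; simp)
      then have go: "eval q ?env (ECall N [EVar 0, EVar 3, ECons (ECons (EVar 1) (EVar 2)) (EVar 4), EVar 5]) (er ?b)
         ((1 + (1 + (((1 + 1 + 1) + 1 + 1) + (1 + 0)))) + n + 1)"
        by (rule eval_Call) (use n q in auto)
      have tl: "eval q ?env (ETl (EVar 2)) (enc_list enc_edge c) (1 + 1)"
        using eval_Tl[OF var[of 2 ?env]] by simp
      have "evals q ?env [EVar 0, EVar 1, ETl (EVar 2), EVar 3, EVar 4, ECall N [EVar 0, EVar 3, ECons (ECons (EVar 1) (EVar 2)) (EVar 4), EVar 5]]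
         [ex x, enc_nat i, enc_list enc_edge c, enc_list enc_item fs, enc_list enc_item part, er ?b]
         (1 + (1 + ((1 + 1) + (1 + (1 + (((1 + (1 + (((1 + 1 + 1) + 1 + 1) + (1 + 0)))) + n + 1) + 0))))))"
        by (intro ev var' tl go; simp)
      then have "eval q ?env (ECall (N + 1) [EVar 0, EVar 1, ETl (EVar 2), EVar 3, EVar 4, ECall N [EVar 0, EVar 3, ECons (ECons (EVar 1) (EVar 2)) (EVar 4), EVar 5]])
         (er (fold_tails (\<lambda>c b. search (pr x) fs (ext_part i c part) b) c ?b))
         ((1 + (1 + ((1 + 1) + (1 + (1 + (((1 + (1 + (((1 + 1 + 1) + 1 + 1) + (1 + 0)))) + n + 1) + 0)))))) + m + 1)"
        by (rule eval_Call) (use m q in auto)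
      then have "eval q ?env gos (er (fold_tails (\<lambda>c b. search (pr x) fs (ext_part i c part) b) c ?b))
         (1 + ((1 + (1 + ((1 + 1) + (1 + (1 + (((1 + (1 + (((1 + 1 + 1) + 1 + 1) + (1 + 0)))) + n + 1) + 0)))))) + m + 1) + 1)"
        unfolding gos_def by (intro eval_Cond[where v = "enc_list enc_edge ?c"] var') simp_all
      moreover have "1 + ((1 + (1 + ((1 + 1) + (1 + (1 + (((1 + (1 + (((1 + 1 + 1) + 1 + 1) + (1 + 0)))) + n + 1) + 0)))))) + m + 1) + 1
         \<le> (length ?c + 1) * (?W * search_steps fs + 30)"
        using n(1) m(1) by (simp add: algebra_simps)
      moreover have "fold_tails (\<lambda>c b. search (pr x) fs (ext_part i c part) b) ?c b = fold_tails (\<lambda>c b. search (pr x) fs (ext_part i c part) b) c ?b"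
        by (simp add: ext_part_def)
      ultimately show ?case by (simp only:) blast
    qed
    let ?env = "[ex x, enc_list enc_item (f # fs), enc_list enc_item part, er b]"
    from inner[OF order_refl Cons.prems(2)] obtain n where n: "n \<le> (length c0 + 1) * (?W * search_steps fs + 30)"
      "eval q [ex x, enc_nat i, enc_list enc_edge c0, enc_list enc_item fs, enc_list enc_item part, er b] gos
         (er (search (pr x) (f # fs) part b)) n" by (auto simp: f)
    have hd: "eval q ?env (EHd (EVar 1)) (enc_item f) (1 + 1)" and tl: "eval q ?env (ETl (EVar 1)) (enc_list enc_item fs) (1 + 1)"
      using eval_Hd[OF var[of 1 ?env]] eval_Tl[OF var[of 1 ?env]] by simp_all
    have hh: "eval q ?env (EHd (EHd (EVar 1))) (enc_nat i) (1 + 1 + 1)" and ht: "eval q ?env (ETl (EHd (EVar 1))) (enc_list enc_edge c0) (1 + 1 + 1)"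
      using eval_Hd[OF hd] eval_Tl[OF hd] unfolding f enc_pair_def by simp_all
    have "evals q ?env [EVar 0, EHd (EHd (EVar 1)), ETl (EHd (EVar 1)), ETl (EVar 1), EVar 2, EVar 3]
       [ex x, enc_nat i, enc_list enc_edge c0, enc_list enc_item fs, enc_list enc_item part, er b]
       (1 + ((1 + 1 + 1) + ((1 + 1 + 1) + ((1 + 1) + (1 + (1 + 0))))))"
      by (intro ev var' hh ht tl; simp)
    then have "eval q ?env (ECall (N + 1) [EVar 0, EHd (EHd (EVar 1)), ETl (EHd (EVar 1)), ETl (EVar 1), EVar 2, EVar 3])
       (er (search (pr x) (f # fs) part b)) ((1 + ((1 + 1 + 1) + ((1 + 1 + 1) + ((1 + 1) + (1 + (1 + 0)))))) + n + 1)"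
      by (rule eval_Call) (use n q in auto)
    then have "eval q ?env go (er (search (pr x) (f # fs) part b)) (1 + ((1 + ((1 + 1 + 1) + ((1 + 1 + 1) + ((1 + 1) + (1 + (1 + 0)))))) + n + 1) + 1)"
      unfolding go_def by (intro eval_Cond[where v = "enc_list enc_item (f # fs)"] var') simp_all
    moreover have "1 + ((1 + ((1 + 1 + 1) + ((1 + 1 + 1) + ((1 + 1) + (1 + (1 + 0)))))) + n + 1) + 1 \<le> ?W * search_steps (f # fs)"
    proof -
      have "(length c0 + 1) * (?W * search_steps fs + 30) + 30 \<le> (length c0 + 1) * (?W * search_steps fs + ?W)"
        by (simp add: algebra_simps)
      also have "\<dots> \<le> ?W * search_steps (f # fs)" by (simp add: f algebra_simps)
      finally show ?thesis using n(1) by linarith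
    qed
    ultimately show ?case by blast
  qed
  show ?thesis unfolding tm_def
  proof (rule exI[of _ q])
    obtain eb where eb: "\<And>p xs. eval p xs eb (er b0) (data_size (er b0))" using eval_const by blast
    show "\<exists>e. \<forall>z\<in>A. \<exists>n\<le>(K (fst z) (snd z) + 60) * search_steps (snd z) + data_size (er b0) + 20.
       eval q [enc_pair ex (enc_list enc_item) z] e (er (search (pr (fst z)) (snd z) [] b0)) n"
    proof (rule exI[of _ "ECall N [EHd (EVar 0), ETl (EVar 0), ENil, eb]"], rule ballI)
      fix z assume z: "z \<in> A"
      obtain x fs where xf: "z = (x, fs)" by (rule prod.exhaust)
      let ?env = "[enc_pair ex (enc_list enc_item) z]"
      obtain n where n: "n \<le> (K x fs + 60) * search_steps fs"
        "eval q [ex x, enc_list enc_item fs, enc_list enc_item [], er b0] go (er (search (pr x) fs [] b0)) n"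
        using main[of x fs fs "[]" b0] z init[of x fs] unfolding xf by blast
      have h: "eval q ?env (EHd (EVar 0)) (ex x) (1 + 1)" "eval q ?env (ETl (EVar 0)) (enc_list enc_item fs) (1 + 1)"
        using eval_Hd[OF var[of 0 ?env]] eval_Tl[OF var[of 0 ?env]] by (simp_all add: xf enc_pair_def)
      have "evals q ?env [EHd (EVar 0), ETl (EVar 0), ENil, eb] [ex x, enc_list enc_item fs, enc_list enc_item [], er b0]
         ((1 + 1) + ((1 + 1) + (1 + (data_size (er b0) + 0))))"
        using h eval_Nil[of q ?env] eb by (intro ev) simp_all
      then have "eval q ?env (ECall N [EHd (EVar 0), ETl (EVar 0), ENil, eb]) (er (search (pr x) fs [] b0))
         (((1 + 1) + ((1 + 1) + (1 + (data_size (er b0) + 0)))) + n + 1)"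
        by (rule eval_Call) (use n q in auto)
      moreover have "((1 + 1) + ((1 + 1) + (1 + (data_size (er b0) + 0)))) + n + 1 \<le> (K x fs + 60) * search_steps fs + data_size (er b0) + 20"
        using n(1) by simp
      ultimately show "\<exists>n\<le>(K (fst z) (snd z) + 60) * search_steps (snd z) + data_size (er b0) + 20.
         eval q ?env (ECall N [EHd (EVar 0), ETl (EVar 0), ENil, eb]) (er (search (pr (fst z)) (snd z) [] b0)) n"
        unfolding xf fst_conv snd_conv by blast
    qed
  qed
qed

subsection \<open>Reading the input\<close>

text \<open>Both lists are traversed in parallel, so the time is bounded by the second one alone. A
  huge budget is not read beyond the number of digits of the cost bound.\<close>

definition length_le_body :: expr where
  "length_le_body = ECond (EVar 0) (ECond (EVar 1) (ECall 0 [ETl (EVar 0), ETl (EVar 1)]) ENil) (ECons ENil ENil)"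

lemma eval_Var_eq: "i < length xs \<Longrightarrow> xs ! i = v \<Longrightarrow> eval p xs (EVar i) v 1"
  using eval_Var by blast

lemma eval_Cond_if:
  "eval p xs e v n \<Longrightarrow> v \<noteq> Leaf \<Longrightarrow> eval p xs e1 w m \<Longrightarrow> eval p xs (ECond e e1 e2) w (n + m + 1)"
  "eval p xs e Leaf n \<Longrightarrow> eval p xs e2 w m \<Longrightarrow> eval p xs (ECond e e1 e2) w (n + m + 1)"
  using eval_Cond[of p xs e v n e1 e2 w m] eval_Cond[of p xs e Leaf n e1 e2 w m] by auto

lemma eval_length_le:
  "\<exists>n \<le> 10 * (length m + 1). eval [length_le_body] [enc_list ea l, enc_list eb m] length_le_body
     (enc_bool (length l \<le> length m)) n"
proof (induction m arbitrary: l)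
  case Nil
  show ?case
  proof (cases l)
    case l: Nil
    have "eval [length_le_body] [enc_list ea l, enc_list eb []] length_le_body (Node Leaf Leaf) (1 + (1 + 1 + 1) + 1)"
      unfolding length_le_body_def by (rule eval_Cond_if(2) eval_Var_eq eval_Cons eval_Nil | simp add: l)+
    then show ?thesis using l by (intro exI[of _ "1 + (1 + 1 + 1) + 1"]) (simp add: enc_bool_def)
  next
    case l: (Cons a l')
    have "eval [length_le_body] [enc_list ea l, enc_list eb []] length_le_body Leaf (1 + (1 + 1 + 1) + 1)"
      unfolding length_le_body_def
      by (rule eval_Cond_if(1)[where v = "enc_list ea l"] eval_Cond_if(2)[where e = "EVar 1"] eval_Var_eq eval_Nil | simp add: l)+
    then show ?thesis using l by (intro exI[of _ "1 + (1 + 1 + 1) + 1"]) (simp add: enc_bool_def)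
  qed
next
  case (Cons y m)
  let ?env = "[enc_list ea l, enc_list eb (y # m)]"
  show ?case
  proof (cases l)
    case l: Nil
    have "eval [length_le_body] ?env length_le_body (Node Leaf Leaf) (1 + (1 + 1 + 1) + 1)"
      unfolding length_le_body_def by (rule eval_Cond_if(2) eval_Var_eq eval_Cons eval_Nil | simp add: l)+
    then show ?thesis using l by (intro exI[of _ "1 + (1 + 1 + 1) + 1"]) (simp add: enc_bool_def)
  next
    case l: (Cons a l')
    obtain n where n: "n \<le> 10 * (length m + 1)"
      "eval [length_le_body] [enc_list ea l', enc_list eb m] length_le_body (enc_bool (length l' \<le> length m)) n"
      using Cons.IH by blast
    have t: "eval [length_le_body] ?env (ETl (EVar 0)) (enc_list ea l') (1 + 1)"
      "eval [length_le_body] ?env (ETl (EVar 1)) (enc_list eb m) (1 + 1)"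
      using eval_Tl[OF eval_Var[of 0 ?env]] eval_Tl[OF eval_Var[of 1 ?env]] by (simp_all add: l)
    have "eval [length_le_body] ?env (ECall 0 [ETl (EVar 0), ETl (EVar 1)]) (enc_bool (length l' \<le> length m))
       ((1 + 1) + ((1 + 1) + 0) + n + 1)"
      by (rule eval_Call, (rule evals_Cons t evals_Nil)+) (use n in auto)
    from eval_Cond_if(1)[OF eval_Var_eq[of 0 ?env "enc_list ea l"] _ eval_Cond_if(1)[OF eval_Var_eq[of 1 ?env "enc_list eb (y # m)"] _ this]]
    have "eval [length_le_body] ?env length_le_body (enc_bool (length l' \<le> length m))
       (1 + (1 + ((1 + 1) + ((1 + 1) + 0) + n + 1) + 1) + 1)"
      unfolding length_le_body_def by (simp add: l)
    then show ?thesis using n(1) l by (intro exI[of _ "1 + (1 + ((1 + 1) + ((1 + 1) + 0) + n + 1) + 1) + 1"]) simp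
  qed
qed

lemma tm_length_le:
  "tm UNIV (enc_pair (enc_list ea) (enc_list eb)) enc_bool (\<lambda>z. length (fst z) \<le> length (snd z))
     (\<lambda>z. 10 * (length (snd z) + 1) + 5)"
  unfolding tm_def
proof (rule exI, rule exI, rule ballI)
  fix z :: "'a list \<times> 'b list"
  let ?env = "[enc_pair (enc_list ea) (enc_list eb) z]"
  obtain n where n: "n \<le> 10 * (length (snd z) + 1)"
    "eval [length_le_body] [enc_list ea (fst z), enc_list eb (snd z)] length_le_body (enc_bool (length (fst z) \<le> length (snd z))) n"
    using eval_length_le by blast
  have t: "eval [length_le_body] ?env (EHd (EVar 0)) (enc_list ea (fst z)) (1 + 1)"
    "eval [length_le_body] ?env (ETl (EVar 0)) (enc_list eb (snd z)) (1 + 1)"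
    using eval_Hd[OF eval_Var[of 0 ?env]] eval_Tl[OF eval_Var[of 0 ?env]] by (simp_all add: enc_pair_def case_prod_unfold)
  have "eval [length_le_body] ?env (ECall 0 [EHd (EVar 0), ETl (EVar 0)]) (enc_bool (length (fst z) \<le> length (snd z)))
     ((1 + 1) + ((1 + 1) + 0) + n + 1)"
    by (rule eval_Call, (rule evals_Cons t evals_Nil)+) (use n in auto)
  moreover have "(1 + 1) + ((1 + 1) + 0) + n + 1 \<le> 10 * (length (snd z) + 1) + 5" using n(1) by simp
  ultimately show "\<exists>n\<le>10 * (length (snd z) + 1) + 5.
      eval [length_le_body] ?env (ECall 0 [EHd (EVar 0), ETl (EVar 0)]) (enc_bool (length (fst z) \<le> length (snd z))) n"
    by blast
qed

lemma trim_trues: "trim (map (\<lambda>_. True) l) = map (\<lambda>_. True) l"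
  by (induction l) auto

text \<open>Only the time to fetch \<open>b x\<close> is bounded, not its size. Where
  \<open>b x\<close> survives, its number of digits is at most the length of
  \<open>l x\<close>.\<close>

lemma pt_truncate:
  assumes l: "pt A \<mu> ea (enc_list enc_bool) l" and b: "tm A ea enc_nat b S" "pb A \<mu> S"
  shows "pt A \<mu> ea enc_nat (\<lambda>x. truncate (l x) (b x))"
proof -
  obtain T where T: "tm A ea (enc_list enc_bool) l T" "pb A \<mu> T" using l unfolding pt_def by blast
  have len: "pb A \<mu> (\<lambda>x. length (l x))"
    by (rule pb_mono[OF pt_size[OF l]]) (simp add: length_le_size less_imp_le)
  have "tm A ea (enc_list enc_bool) (\<lambda>x. bits (b x)) S" by (rule tm_cong[OF b(1)]) (simp add: enc_nat_bits)
  from tm_comp[OF tm_pair[OF this T(1)] tm_length_le]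
  have "tm A ea enc_bool (\<lambda>x. length (bits (b x)) \<le> length (l x))
     (\<lambda>x. (S x + T x + 1) + (10 * (length (l x) + 1) + 5) + 1)" by simp
  then have c: "pt A \<mu> ea enc_bool (\<lambda>x. length (bits (b x)) \<le> length (l x))"
  proof (rule ptI)
    show "pb A \<mu> (\<lambda>x. (S x + T x + 1) + (10 * (length (l x) + 1) + 5) + 1)" by (intro pb_intros b T len)
    show "pb A \<mu> (\<lambda>x. data_size (enc_bool (length (bits (b x)) \<le> length (l x))))"
      by (rule pb_mono[OF pb_const[of A \<mu> 3]]) (rule size_bool)
  qed
  have fit: "pt {x \<in> A. length (bits (b x)) \<le> length (l x)} \<mu> ea enc_nat b"
  proof (rule ptI)
    show "tm {x \<in> A. length (bits (b x)) \<le> length (l x)} ea enc_nat b S" by (rule tm_mono[OF b(1)]) auto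
    show "pb {x \<in> A. length (bits (b x)) \<le> length (l x)} \<mu> S" using b(2) unfolding pb_def by blast
    have "pb {x \<in> A. length (bits (b x)) \<le> length (l x)} \<mu> (\<lambda>x. 4 * length (l x) + 1)"
      by (intro pb_intros) (use len in \<open>auto simp: pb_def\<close>)
    then show "pb {x \<in> A. length (bits (b x)) \<le> length (l x)} \<mu> (\<lambda>x. data_size (enc_nat (b x)))"
    proof (rule pb_mono)
      fix x assume "x \<in> {x \<in> A. length (bits (b x)) \<le> length (l x)}"
      then show "data_size (enc_nat (b x)) \<le> 4 * length (l x) + 1"
        using size_bools[of "bits (b x)"] by (simp add: enc_nat_bits)
    qed
  qed
  have "ptime (enc_list enc_bool) (enc_list enc_bool) (\<lambda>l. map (\<lambda>_. True) l)" by (rule pt_intros)+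
  from pt_comp[OF this l] have "pt A \<mu> ea enc_nat (\<lambda>x. bits_val (map (\<lambda>_. True) (l x)))"
    by (intro pt_of_bits) (simp add: bits_bits_val trim_trues)
  then have "pt {x \<in> A. \<not> length (bits (b x)) \<le> length (l x)} \<mu> ea enc_nat (\<lambda>x. bits_val (map (\<lambda>_. True) (l x)))"
    by (rule pt_subset) auto
  from pt_if_on[OF c fit this] show ?thesis unfolding truncate_def .
qed

lemma enc_list_map: "enc_list e (map f l) = enc_list (\<lambda>x. e (f x)) l"
  by (induction l) auto

lemma enc_path_graph_eq: "enc_path_graph G = enc_gd (graph_data G)"
  unfolding enc_path_graph_def graph_data_def Let_def enc_pair_def prod.case enc_list_map enc_temporal_path_def ..

abbreviation "enc_inst \<equiv> enc_pair enc_path_graph (enc_pair enc_nat enc_nat)"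

definition insts :: "mr_instance set" where
  "insts = {(G, b, s). wf_path_graph G \<and> s \<in> verts (digraph_of G)}"

definition gsize :: "mr_instance \<Rightarrow> nat" where
  "gsize x = data_size (enc_path_graph (fst x))"

definition inp :: "mr_instance \<Rightarrow> env \<times> item list" where
  "inp x = (make_env (graph_data (fst x)) (fst (snd x)) (snd (snd x)), items_of (graph_data (fst x)))"

lemma set_verts_list: "wf_path_graph G \<Longrightarrow> set (fst (graph_data G)) = verts (digraph_of G)"
proof -
  assume "wf_path_graph G"
  then interpret fin_digraph "digraph_of G" unfolding wf_path_graph_def by blast
  show ?thesis by (simp add: graph_data_def Let_def)
qed

lemma pt_inp: "pt insts gsize enc_inst (enc_pair enc_env (enc_list enc_item)) inp"
proof -
  have gd: "pt insts gsize enc_inst enc_gd (\<lambda>x. graph_data (fst x))"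
  proof (rule ptI)
    show "tm insts enc_inst enc_gd (\<lambda>x. graph_data (fst x)) (\<lambda>_. 1 + 1)"
      by (rule tm_cong[OF tm_fst[OF tm_id]]) (rule enc_path_graph_eq[symmetric])
    have "pb insts gsize gsize" by (rule pb_id)
    then show "pb insts gsize (\<lambda>x. data_size (enc_gd (graph_data (fst x))))"
      unfolding gsize_def enc_path_graph_eq .
  qed (rule pb_const)
  have s: "pt insts gsize enc_inst enc_nat (\<lambda>x. snd (snd x))"
  proof (rule ptI)
    show "tm insts enc_inst enc_nat (\<lambda>x. snd (snd x)) (\<lambda>_. 1 + 1 + 1)" by (rule tm_snd[OF tm_snd[OF tm_id]])
    \<comment> \<open>The source occurs in the encoded list of vertices.\<close>
    show "pb insts gsize (\<lambda>x. data_size (enc_nat (snd (snd x))))"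
    proof (rule pb_mono[OF pb_id])
      fix x assume "x \<in> insts"
      then have "snd (snd x) \<in> set (fst (graph_data (fst x)))"
        using set_verts_list[of "fst x"] by (auto simp: insts_def)
      then have "data_size (enc_nat (snd (snd x))) \<le> data_size (enc_list enc_nat (fst (graph_data (fst x))))" by (rule size_mem)
      also have "\<dots> \<le> gsize x" unfolding gsize_def enc_path_graph_eq size_pair[of "enc_list enc_nat"] by linarith
      finally show "data_size (enc_nat (snd (snd x))) \<le> gsize x" .
    qed
  qed (rule pb_const)
  \<comment> \<open>For the budget there is only a time bound, as its size is not bounded in terms
    of the graph.\<close>
  have b: "tm insts enc_inst enc_nat (\<lambda>x. fst (snd x)) (\<lambda>_. 1 + 1 + 1)" by (rule tm_fst[OF tm_snd[OF tm_id]])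
  note fs = pt_items_of[OF gd]
  note X = pt_near_labels[OF fs]
  have tr: "pt insts gsize enc_inst enc_nat (\<lambda>x. truncate (bits (nat \<bar>cost_bound (items_of (graph_data (fst x)))\<bar>)) (fst (snd x)))"
    by (rule pt_truncate[OF pt_bits[OF pt_nat_abs[OF pt_cost_bound[OF fs]]] b pb_const])
  have "int n = signed False n" for n by (simp add: signed_def)
  then have t: "pt insts gsize enc_inst enc_int (\<lambda>x. int (truncate (bits (nat \<bar>cost_bound (items_of (graph_data (fst x)))\<bar>)) (fst (snd x))))"
    using pt_signed[OF pt_const[of _ _ _ _ False] tr] by simp
  show ?thesis unfolding inp_def make_env_def Let_def
    by (rule pt_pair pt_Cons pt_root_label t s X fs pt_const)+
qed

lemma size_choices:
  "p \<in> choices fs part \<Longrightarrow> length p \<le> length fs + length part \<and>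
     data_size (enc_list enc_item p) \<le> data_size (enc_list enc_item fs) + data_size (enc_list enc_item part)"
proof (induction fs arbitrary: part)
  case (Cons f fs)
  obtain c where c: "c \<in> set (tails (snd f))" "p \<in> choices fs (ext_part (fst f) c part)" using Cons.prems by auto
  obtain k where k: "c = drop k (snd f)" using c(1) by (auto simp: set_tails)
  have "data_size (enc_list enc_edge c) \<le> data_size (enc_list enc_edge (snd f))" unfolding k by (rule size_drop)
  then have "data_size (enc_list enc_item (ext_part (fst f) c part)) \<le> data_size (enc_item f) + data_size (enc_list enc_item part) + 1"
    unfolding ext_part_def using size_pair[of enc_nat "enc_list enc_edge" f] size_pair[of enc_nat "enc_list enc_edge" "(fst f, c)"] by simp
  moreover have "length (ext_part (fst f) c part) \<le> length part + 1" by (simp add: ext_part_def)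
  ultimately show ?case using Cons.IH[OF c(2)] by simp
qed simp

text \<open>Processing either keeps the best result or replaces it by a value that does not depend
  on it. So the accumulator cannot grow along the search.\<close>

lemma process_cases: "process up dn x p best = best \<or> process up dn x p best = process up dn x p (-1, [])"
proof -
  have "- 1 < gain s p" for s by (simp add: gain_def)
  then show ?thesis by (auto simp: process_def improve_def split: list.splits)
qed

definition search_measure :: "env \<Rightarrow> item list \<Rightarrow> nat" where
  "search_measure x fs = 2 ^ length fs * (data_size (enc_env x) + data_size (enc_list enc_item fs) + data_size (enc_best (-1, [])) + 2)"

lemma proc_measure_le:
  assumes "p \<in> choices fs []" "data_size (enc_best b) \<le> B"
  shows "proc_measure (x, p, b) \<le> search_measure x fs * (B + 1)"
proof -
  let ?W = "data_size (enc_env x) + data_size (enc_list enc_item fs) + data_size (enc_best (-1, [])) + 2"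
  have "data_size (enc_proc_in (x, p, b)) \<le> ?W + B"
    using size_choices[OF assms(1)] assms(2) unfolding size_pair[of enc_env] size_pair[of "enc_list enc_item"] by simp
  also have "\<dots> \<le> ?W * (B + 1)" by simp
  finally have "data_size (enc_proc_in (x, p, b)) \<le> ?W * (B + 1)" .
  moreover have "(2 :: nat) ^ length p \<le> 2 ^ length fs" using size_choices[OF assms(1)] by (intro power_increasing) auto
  ultimately have "2 ^ length p * data_size (enc_proc_in (x, p, b)) \<le> 2 ^ length fs * (?W * (B + 1))" by (intro mult_le_mono)
  then show ?thesis unfolding proc_measure_def search_measure_def by (simp only: fst_conv snd_conv mult.assoc)
qed

lemma tm_search_process:
  "\<exists>c. tm {z. distinct (map fst (snd z))} (enc_pair enc_env (enc_list enc_item)) enc_best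
     (\<lambda>z. search (process up dn (fst z)) (snd z) [] (0, []))
     (\<lambda>z. (search_measure (fst z) (snd z) + 2) ^ c * search_steps (snd z))"
proof -
  obtain T d where T: "tm proc_dom enc_proc_in enc_best (\<lambda>z. process up dn (fst z) (fst (snd z)) (snd (snd z))) T"
    and d: "\<And>z. z \<in> proc_dom \<Longrightarrow> T z \<le> (proc_measure z + 2) ^ d"
    using pt_process[of up dn] unfolding pt_def pb_def by blast
  obtain d' where d': "\<And>z. z \<in> proc_dom \<Longrightarrow>
      data_size (enc_best (process up dn (fst z) (fst (snd z)) (snd (snd z)))) \<le> (proc_measure z + 2) ^ d'"
    using pt_size[OF pt_process[of up dn]] unfolding pb_def by blast
  let ?A = "{z :: env \<times> item list. distinct (map fst (snd z))}"
  define c0 where "c0 = data_size (enc_best (0, []))"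
  define c1 where "c1 = data_size (enc_best (-1, []))"
  define M where "M z = search_measure (fst z) (snd z)" for z
  define B where "B z = (M z * (c1 + 1) + 2) ^ d' + c0" for z
  define K where "K z = (M z * (B z + 1) + 2) ^ d" for z
  \<comment> \<open>Starting from \<open>-1\<close>, every result counts as an improvement; hence these are all values the best result can take.\<close>
  define Bst where "Bst x fs = {b. b = (0, []) \<or> (\<exists>p\<in>choices fs []. b = process up dn x p (-1, []))}" for x fs
  have dom: "(x, p, b) \<in> proc_dom" if "(x, fs) \<in> ?A" "p \<in> choices fs []" for x fs p b
  proof -
    have "good_part fs p" by (rule choices_good[OF that(2)]) (use that(1) in \<open>simp_all add: good_part_def\<close>)
    then show ?thesis by (simp add: good_part_def proc_dom_def distinct_map)
  qed
  have size: "data_size (enc_best b) \<le> B (x, fs)" if x: "(x, fs) \<in> ?A" and b: "b \<in> Bst x fs" for x fs b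
    using b unfolding Bst_def
  proof (elim CollectE disjE bexE)
    fix p assume p: "p \<in> choices fs []" "b = process up dn x p (-1, [])"
    have "data_size (enc_best b) \<le> (proc_measure (x, p, (-1, [])) + 2) ^ d'"
      using d'[OF dom[OF x p(1)]] unfolding p(2) fst_conv snd_conv .
    also have "\<dots> \<le> (M (x, fs) * (c1 + 1) + 2) ^ d'"
      unfolding M_def fst_conv snd_conv by (intro power_mono add_mono proc_measure_le p) (auto simp only: c1_def)
    finally show ?thesis unfolding B_def by linarith
  qed (simp only: B_def c0_def le_add2)
  have "tm ?A (enc_pair enc_env (enc_list enc_item)) enc_best
     (\<lambda>z. search (process up dn (fst z)) (snd z) [] (0, []))
     (\<lambda>z. (K (fst z, snd z) + 60) * search_steps (snd z) + data_size (enc_best (0, [])) + 20)"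
  proof (rule tm_search[OF T, where Bst = Bst])
    fix x fs p b assume x: "(x, fs) \<in> ?A" and p: "p \<in> choices fs []" and b: "b \<in> Bst x fs"
    have "T (x, p, b) \<le> (proc_measure (x, p, b) + 2) ^ d" by (rule d[OF dom[OF x p]])
    also have "\<dots> \<le> (M (x, fs) * (B (x, fs) + 1) + 2) ^ d"
      unfolding M_def fst_conv snd_conv by (intro power_mono add_mono proc_measure_le p size[OF x b]) simp_all
    finally have "T (x, p, b) \<le> K (x, fs)" by (simp only: K_def)
    moreover have "process up dn x p b \<in> Bst x fs"
      using process_cases[of up dn x p b] b p unfolding Bst_def by auto
    ultimately show "(x, p, b) \<in> proc_dom \<and> T (x, p, b) \<le> K (x, fs) \<and> process up dn x p b \<in> Bst x fs"
      using dom[OF x p] by blast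
  qed (simp add: Bst_def)
  moreover have "pb ?A M (\<lambda>z. K (fst z, snd z) + 60 + c0 + 20)"
    unfolding K_def B_def prod.collapse by (intro pb_intros)
  then obtain c where c: "\<And>z. z \<in> ?A \<Longrightarrow> K (fst z, snd z) + 60 + c0 + 20 \<le> (M z + 2) ^ c" unfolding pb_def by blast
  ultimately have "tm ?A (enc_pair enc_env (enc_list enc_item)) enc_best
     (\<lambda>z. search (process up dn (fst z)) (snd z) [] (0, [])) (\<lambda>z. (M z + 2) ^ c * search_steps (snd z))"
  proof (elim tm_mono)
    fix z assume z: "z \<in> ?A"
    have pos: "1 \<le> search_steps fs" for fs by (induction fs) auto
    have "(K (fst z, snd z) + 60) * search_steps (snd z) + data_size (enc_best (0, [])) + 20 \<le> (K (fst z, snd z) + 60 + c0 + 20) * search_steps (snd z)"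
      using mult_le_mono2[OF pos[of "snd z"], of "c0 + 20"] unfolding c0_def[symmetric] by (simp add: algebra_simps)
    also have "\<dots> \<le> (M z + 2) ^ c * search_steps (snd z)" by (rule mult_le_mono1[OF c[OF z]])
    finally show "(K (fst z, snd z) + 60) * search_steps (snd z) + data_size (enc_best (0, [])) + 20 \<le> (M z + 2) ^ c * search_steps (snd z)" .
  qed simp
  then show ?thesis unfolding M_def by blast
qed

section \<open>The main theorem\<close>

definition npaths :: "mr_instance \<Rightarrow> nat" where
  "npaths x = length (base_paths (fst x))"

lemma length_items_of: "length (items_of gd) = length (snd (snd gd))"
proof -
  have "length (numbered ps) = length ps" for ps :: "edge list list" by (induction ps) auto
  then show ?thesis by (simp add: items_of_def)
qed

lemma pb_measure: "pb A \<mu> g \<Longrightarrow> (\<And>x. x \<in> A \<Longrightarrow> \<mu> x \<le> \<nu> x) \<Longrightarrow> pb A \<nu> g"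
  using pb_comp[of A \<mu> g A \<nu> "\<lambda>x. x"] pb_mono[OF pb_id[of A \<nu>], of \<mu>] by blast

lemma tm_solve:
  "\<exists>c. tm insts enc_inst (enc_list enc_op) (\<lambda>x. solve up dn (graph_data (fst x)) (fst (snd x)) (snd (snd x)))
     (\<lambda>x. (2 ^ npaths x * gsize x + 2) ^ c * search_steps (snd (inp x)))"
proof -
  let ?\<nu> = "\<lambda>x. 2 ^ npaths x * gsize x"
  obtain S where S: "tm insts enc_inst (enc_pair enc_env (enc_list enc_item)) inp S" "pb insts gsize S"
    using pt_inp unfolding pt_def by blast
  obtain c where c: "tm {z. distinct (map fst (snd z))} (enc_pair enc_env (enc_list enc_item)) enc_best
     (\<lambda>z. search (process up dn (fst z)) (snd z) [] (0, []))
     (\<lambda>z. (search_measure (fst z) (snd z) + 2) ^ c * search_steps (snd z))" using tm_search_process by blast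
  define M where "M x = search_measure (fst (inp x)) (snd (inp x))" for x
  have "tm insts enc_inst enc_best (\<lambda>x. search (process up dn (fst (inp x))) (snd (inp x)) [] (0, []))
     (\<lambda>x. S x + (search_measure (fst (inp x)) (snd (inp x)) + 2) ^ c * search_steps (snd (inp x)) + 1)"
    by (rule tm_comp[OF S(1) c]) (simp add: inp_def distinct_items_of)
  from tm_snd[OF this] have t: "tm insts enc_inst (enc_list enc_op)
     (\<lambda>x. solve up dn (graph_data (fst x)) (fst (snd x)) (snd (snd x))) (\<lambda>x. S x + (M x + 2) ^ c * search_steps (snd (inp x)) + 1 + 1)"
    unfolding M_def by (simp add: solve_def inp_def)
  have le: "gsize x \<le> ?\<nu> x" "2 ^ npaths x \<le> ?\<nu> x" for x
    using data_size_pos[of "enc_path_graph (fst x)"] by (simp_all add: gsize_def)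
  have up: "pb insts ?\<nu> g" if "pb insts gsize g" for g by (rule pb_measure[OF that]) (rule le)
  note z = up[OF pt_size[OF pt_fst[OF pt_inp]]] up[OF pt_size[OF pt_snd[OF pt_inp]]] up[OF S(2)]
  have "length (snd (inp x)) = npaths x" for x
    by (simp add: inp_def npaths_def length_items_of graph_data_def Let_def)
  then have "pb insts ?\<nu> (\<lambda>x. 2 ^ length (snd (inp x)))" using pb_mono[OF pb_id[of insts ?\<nu>]] le(2) by simp
  then have "pb insts ?\<nu> M" unfolding M_def search_measure_def by (intro pb_add pb_mult pb_const z)
  then have "pb insts ?\<nu> (\<lambda>x. S x + (M x + 2) ^ c + 1 + 1)" by (intro pb_add pb_power pb_const z)
  then obtain c' where c': "\<And>x. x \<in> insts \<Longrightarrow> S x + (M x + 2) ^ c + 1 + 1 \<le> (?\<nu> x + 2) ^ c'" unfolding pb_def by blast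
  have "tm insts enc_inst (enc_list enc_op)
     (\<lambda>x. solve up dn (graph_data (fst x)) (fst (snd x)) (snd (snd x))) (\<lambda>x. (?\<nu> x + 2) ^ c' * search_steps (snd (inp x)))"
  proof (rule tm_mono[OF t order_refl])
    fix x assume x: "x \<in> insts"
    let ?s = "search_steps (snd (inp x))"
    have pos: "1 \<le> search_steps fs" for fs by (induction fs) auto
    have "S x + (M x + 2) ^ c * ?s + 1 + 1 \<le> (S x + (M x + 2) ^ c + 1 + 1) * ?s"
      using mult_le_mono2[OF pos[of "snd (inp x)"], of "S x + 1 + 1"] by (simp add: algebra_simps)
    also have "\<dots> \<le> (?\<nu> x + 2) ^ c' * ?s" by (rule mult_le_mono1[OF c'[OF x]])
    finally show "S x + (M x + 2) ^ c * ?s + 1 + 1 \<le> (?\<nu> x + 2) ^ c' * ?s" .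
  qed
  then show ?thesis by blast
qed

lemma tm_run:
  assumes "tm A ea eb f T" obtains p where "\<And>x. x \<in> A \<Longrightarrow> \<exists>n\<le>T x. run p (ea x) (eb (f x)) n"
proof -
  obtain p e where p: "\<And>x. x \<in> A \<Longrightarrow> \<exists>n\<le>T x. eval p [ea x] e (eb (f x)) n" using assms unfolding tm_def by blast
  have "\<exists>n\<le>T x. run (shift_calls 1 e # map (shift_calls 1) p) (ea x) (eb (f x)) n" if x: "x \<in> A" for x
  proof -
    obtain n where n: "n \<le> T x" "eval p [ea x] e (eb (f x)) n" using p[OF x] by blast
    have "eval (shift_calls 1 e # map (shift_calls 1) p) [ea x] (shift_calls 1 e) (eb (f x)) n"
      using eval_relocate[OF n(2), of "[shift_calls 1 e]" "[]"] by simp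
    then show ?thesis using n(1) unfolding run_def by auto
  qed
  then show ?thesis by (rule that)
qed

text \<open>A simple path has fewer arcs than there are vertices, so it has at most
  \<open>|V|\<close> suffixes, the empty one included.\<close>

lemma search_steps_inp:
  assumes "x \<in> insts"
  shows "search_steps (snd (inp x)) \<le> 3 ^ npaths x * card (verts (digraph_of (fst x))) ^ npaths x"
proof -
  obtain G b s where x: "x = (G, b, s)" by (rule prod_cases3)
  have wf: "wf_path_graph G" using assms by (simp add: insts_def x)
  then interpret fin_digraph "digraph_of G" unfolding wf_path_graph_def by blast
  let ?fs = "snd (inp x)" let ?n = "card (verts (digraph_of G))"
  have len: "length ?fs = npaths x"
    by (simp add: inp_def npaths_def length_items_of graph_data_def Let_def)
  have le: "length (snd f) + 1 \<le> ?n" if f: "f \<in> set ?fs" for f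
  proof -
    obtain i where i: "i < length (base_paths G)" "length (snd f) = length (base_paths G ! i)"
      using f unfolding inp_def snd_conv set_items_of by (auto simp: x graph_data_def Let_def)
    obtain u v where "apath u (map fst (base_paths G ! i)) v"
      using wf nth_mem[OF i(1)] unfolding wf_path_graph_def temporal_path_def by blast
    from length_apath_less[OF this] show ?thesis using i(2) by simp
  qed
  have "(\<Prod>f\<leftarrow>gs. length (snd f) + 1) \<le> ?n ^ length gs" if "set gs \<subseteq> set ?fs" for gs
    using that
  proof (induction gs)
    case (Cons f gs)
    then have "(length (snd f) + 1) * (\<Prod>f\<leftarrow>gs. length (snd f) + 1) \<le> ?n * ?n ^ length gs"
      using le[of f] by (intro mult_le_mono) auto
    then show ?case by simp
  qed simp
  from this[OF order_refl] have "3 ^ length ?fs * (\<Prod>f\<leftarrow>?fs. length (snd f) + 1) \<le> 3 ^ length ?fs * ?n ^ length ?fs" by simp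
  then have "search_steps ?fs \<le> 3 ^ length ?fs * ?n ^ length ?fs"
    using search_steps_le[of ?fs] by (rule order_trans[rotated])
  then show ?thesis unfolding len by (simp add: x)
qed

lemma MR_solvable:
  assumes D: "\<And>\<delta>. \<delta> > 0 \<Longrightarrow> \<delta> \<in> D \<longleftrightarrow> up" "\<And>\<delta>. \<delta> < 0 \<Longrightarrow> \<delta> \<in> D \<longleftrightarrow> dn"
  obtains p c where "solves_in_time p (MR D) (\<lambda>x. real (2 ^ ((c + 2) * npaths x) *
    card (verts (digraph_of (fst x))) ^ npaths x * (gsize x + 4) ^ c))"
proof -
  obtain c where c: "tm insts enc_inst (enc_list enc_op) (\<lambda>x. solve up dn (graph_data (fst x)) (fst (snd x)) (snd (snd x)))
     (\<lambda>x. (2 ^ npaths x * gsize x + 2) ^ c * search_steps (snd (inp x)))" using tm_solve by blast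
  obtain p where p: "\<And>x. x \<in> insts \<Longrightarrow> \<exists>n\<le>(2 ^ npaths x * gsize x + 2) ^ c * search_steps (snd (inp x)).
      run p (enc_inst x) (enc_list enc_op (solve up dn (graph_data (fst x)) (fst (snd x)) (snd (snd x)))) n"
    using tm_run[OF c] by blast
  have "solves_in_time p (MR D) (\<lambda>x. real (2 ^ ((c + 2) * npaths x) *
    card (verts (digraph_of (fst x))) ^ npaths x * (gsize x + 4) ^ c))"
    unfolding solves_in_time_def
  proof
    fix x assume "x \<in> instances (MR D)"
    then have x: "x \<in> insts" by (simp add: MR_def insts_def)
    obtain G b s where xd: "x = (G, b, s)" by (rule prod_cases3)
    interpret mr G b s up dn D by unfold_locales (use x D in \<open>auto simp: insts_def xd\<close>)
    let ?k = "npaths x" let ?V = "card (verts (digraph_of (fst x))) ^ ?k"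
    obtain n where n: "n \<le> (2 ^ ?k * gsize x + 2) ^ c * search_steps (snd (inp x))"
      "run p (enc_inst x) (enc_list enc_op (solve up dn (graph_data G) b s)) n" using p[OF x] unfolding xd fst_conv snd_conv by blast
    \<comment> \<open>The full encoding exceeds that of the graph by at least 4; thus
      \<open>gsize x + 4\<close> stays below the input size in the bound for XP.\<close>
    have "2 ^ ?k * gsize x + 2 \<le> 2 ^ ?k * (gsize x + 4)"
      using one_le_power[of "2 :: nat" ?k] unfolding distrib_left by linarith
    then have "(2 ^ ?k * gsize x + 2) ^ c \<le> (2 ^ ?k * (gsize x + 4)) ^ c" by (rule power_mono) simp
    \<comment> \<open>Replacing 3 by 4 lets this factor be merged with the powers of 2.\<close>
    moreover have "search_steps (snd (inp x)) \<le> 4 ^ ?k * ?V"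
      using search_steps_inp[OF x] by (rule order_trans) (intro mult_le_mono power_mono; simp)
    ultimately have "n \<le> (2 ^ ?k * (gsize x + 4)) ^ c * (4 ^ ?k * ?V)" using n(1) mult_le_mono order_trans by blast
    also have "\<dots> = 2 ^ ((c + 2) * ?k) * ?V * (gsize x + 4) ^ c"
    proof -
      have "(2 ^ k * g) ^ c * (4 ^ k * v) = 2 ^ ((c + 2) * k) * v * g ^ c" for k g v :: nat
      proof -
        have "(4 :: nat) ^ k = 2 ^ (2 * k)" by (simp add: power_mult)
        moreover have "(2 ^ k) ^ c = (2 :: nat) ^ (c * k)" by (simp only: power_mult[symmetric] mult.commute)
        moreover have "(2 :: nat) ^ ((c + 2) * k) = 2 ^ (c * k) * 2 ^ (2 * k)" by (simp only: distrib_right power_add)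
        ultimately show ?thesis by (simp only: power_mult_distrib mult_ac)
      qed
      then show ?thesis .
    qed
    finally have "real n \<le> real (2 ^ ((c + 2) * ?k) * ?V * (gsize x + 4) ^ c)" by (rule of_nat_mono)
    moreover have "run p (encode (MR D) x) (enc_shifts (solve up dn (graph_data G) b s)) n"
      using n(2) by (simp add: MR_def enc_shifts_def)
    moreover have "enc_shifts (solve up dn (graph_data G) b s) \<in> solutions (MR D) x"
      using solve_optimal by (auto simp: MR_def xd)
    ultimately show "\<exists>v n. run p (encode (MR D) x) v n \<and> v \<in> solutions (MR D) x \<and>
       real n \<le> real (2 ^ ((c + 2) * ?k) * ?V * (gsize x + 4) ^ c)" by blast
  qed
  then show ?thesis by (rule that)
qed

text \<open>In binary, least significant bit first, \<open>m\<close> becomes \<open>2 * m + 1\<close> by prepending a digit.\<close>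

primrec double_expr :: "nat \<Rightarrow> expr" where
  "double_expr 0 = EVar 0"
| "double_expr (Suc i) = ECons (ECons ENil ENil) (double_expr i)"

text \<open>XP asks for a computable function of the parameter. This iterate equals
  \<open>2 ^ i * (m + 1) - 1\<close>, so a suitable \<open>i\<close> makes it dominate any given
  linear exponent.\<close>

lemma computable_double: "computable ((\<lambda>m. 2 * m + 1) ^^ i)"
  unfolding computable_def
proof (rule exI, rule allI)
  fix m
  have "\<exists>n. eval [double_expr i] [enc_nat m] (double_expr j) (enc_nat (((\<lambda>m. 2 * m + 1) ^^ j) m)) n" for j
  proof (induction j)
    case 0
    then show ?case using eval_Var_eq[of 0 "[enc_nat m]"] by auto
  next
    case (Suc j)
    have "enc_nat (2 * r + 1) = Node (Node Leaf Leaf) (enc_nat r)" for r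
      by (subst enc_nat.simps) (simp add: enc_bool_def)
    then have "enc_nat (((\<lambda>m. 2 * m + 1) ^^ Suc j) m) = Node (Node Leaf Leaf) (enc_nat (((\<lambda>m. 2 * m + 1) ^^ j) m))" by simp
    moreover obtain n where "eval [double_expr i] [enc_nat m] (double_expr j) (enc_nat (((\<lambda>m. 2 * m + 1) ^^ j) m)) n"
      using Suc by blast
    ultimately show ?case using eval_Cons[OF eval_Cons[OF eval_Nil eval_Nil]] unfolding double_expr.simps by metis
  qed
  then show "\<exists>n. run [double_expr i] (enc_nat m) (enc_nat (((\<lambda>m. 2 * m + 1) ^^ i) m)) n"
    unfolding run_def by auto
qed

lemma double_add_one: "((\<lambda>m. 2 * m + 1) ^^ i) m + 1 = 2 ^ i * (m + 1)" for m :: nat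
  by (induction i) (auto simp: algebra_simps)

lemma solves_in_time_mono:
  "solves_in_time p \<Pi> S \<Longrightarrow> (\<And>x. x \<in> instances \<Pi> \<Longrightarrow> S x \<le> T x) \<Longrightarrow> solves_in_time p \<Pi> T"
  unfolding solves_in_time_def by (meson order_trans)

lemma MR_theorem:
  assumes D: "\<And>\<delta>. \<delta> > 0 \<Longrightarrow> \<delta> \<in> D \<longleftrightarrow> up" "\<And>\<delta>. \<delta> < 0 \<Longrightarrow> \<delta> \<in> D \<longleftrightarrow> dn"
  shows "in_XP (MR D) \<and>
    (\<exists>(p :: program) (C :: nat) (c :: nat) (q :: nat poly).
       solves_in_time p (MR D)
         (\<lambda>(G, b, s). let k = length (base_paths G) in
            real C * real (card (verts (digraph_of G))) ^ k *
            max 2 (log 2 (real k)) ^ (c * k) *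
            real (poly q (data_size (enc_path_graph G)))))"
proof -
  obtain p c where p: "solves_in_time p (MR D) (\<lambda>x. real (2 ^ ((c + 2) * npaths x) *
    card (verts (digraph_of (fst x))) ^ npaths x * (gsize x + 4) ^ c))" by (rule MR_solvable[OF D])
  let ?f = "(\<lambda>m. 2 * m + 1) ^^ (c + 4) :: nat \<Rightarrow> nat"
  have "solves_in_time p (MR D) (\<lambda>x. real (?f (param (MR D) x) * data_size (encode (MR D) x) ^ ?f (param (MR D) x)))"
  proof (rule solves_in_time_mono[OF p], rule of_nat_mono)
    fix x assume "x \<in> instances (MR D)"
    then have x: "x \<in> insts" by (simp add: MR_def insts_def)
    let ?k = "npaths x" let ?N = "data_size (encode (MR D) x)"
    have par: "param (MR D) x = ?k" by (simp add: MR_def npaths_def split: prod.split)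
    have N: "gsize x + 4 \<le> ?N"
      using data_size_pos[of "enc_nat (fst (snd x))"] data_size_pos[of "enc_nat (snd (snd x))"]
      by (simp add: MR_def gsize_def)
    have "card (verts (digraph_of (fst x))) \<le> gsize x"
    proof -
      have "wf_path_graph (fst x)" using x by (auto simp: insts_def)
      then have "card (verts (digraph_of (fst x))) \<le> length (fst (graph_data (fst x)))"
        using set_verts_list card_length by metis
      also have "\<dots> \<le> data_size (enc_list enc_nat (fst (graph_data (fst x))))" by (simp add: length_le_size less_imp_le)
      also have "\<dots> \<le> gsize x" unfolding gsize_def enc_path_graph_eq size_pair[of "enc_list enc_nat"] by linarith
      finally show ?thesis .
    qed
    then have V: "card (verts (digraph_of (fst x))) \<le> ?N" using N by linarith
    \<comment> \<open>The left-hand side is the total exponent of the input size, increased by 1 so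
      that \<open>?f ?k\<close> is a positive factor as well.\<close>
    have f: "(c + 2) * ?k + ?k + c + 1 \<le> ?f ?k"
    proof -
      have "(c + 4) * (?k + 1) \<le> 2 ^ (c + 4) * (?k + 1)" by (rule mult_le_mono1) (simp add: less_imp_le del: power_add)
      also have "\<dots> = ?f ?k + 1" by (rule double_add_one[symmetric])
      finally show ?thesis by (simp add: algebra_simps)
    qed
    have "2 ^ ((c + 2) * ?k) * card (verts (digraph_of (fst x))) ^ ?k * (gsize x + 4) ^ c \<le>
       ?N ^ ((c + 2) * ?k) * ?N ^ ?k * ?N ^ c"
      by (intro mult_le_mono power_mono V N) (use N in linarith)+
    also have "\<dots> = ?N ^ ((c + 2) * ?k + ?k + c)" by (simp add: power_add)
    also have "\<dots> \<le> ?N ^ ?f ?k" by (rule power_increasing) (use f N in linarith)+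
    also have "\<dots> \<le> ?f ?k * ?N ^ ?f ?k" using f by simp
    finally show "2 ^ ((c + 2) * ?k) * card (verts (digraph_of (fst x))) ^ ?k * (gsize x + 4) ^ c \<le>
      ?f (param (MR D) x) * ?N ^ ?f (param (MR D) x)" unfolding par .
  qed
  then have "in_XP (MR D)" unfolding in_XP_def using computable_double by blast
  moreover have "solves_in_time p (MR D)
         (\<lambda>(G, b, s). let k = length (base_paths G) in
            real 1 * real (card (verts (digraph_of G))) ^ k *
            max 2 (log 2 (real k)) ^ ((c + 2) * k) *
            real (poly ([:4, 1:] ^ c) (data_size (enc_path_graph G))))"
  proof (rule solves_in_time_mono[OF p])
    fix x :: mr_instance
    obtain G b s where x: "x = (G, b, s)" by (rule prod_cases3)
    let ?k = "length (base_paths G)" let ?V = "card (verts (digraph_of G)) ^ ?k"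
    \<comment> \<open>The maximum with 2 absorbs the factor \<open>2 ^ O(k)\<close>, also for small
      \<open>k\<close>.\<close>
    have "(2 :: real) ^ ((c + 2) * ?k) \<le> max 2 (log 2 (real ?k)) ^ ((c + 2) * ?k)" by (rule power_mono) auto
    then have "2 ^ ((c + 2) * ?k) * (real ?V * real ((gsize x + 4) ^ c)) \<le>
       max 2 (log 2 (real ?k)) ^ ((c + 2) * ?k) * (real ?V * real ((gsize x + 4) ^ c))" by (rule mult_right_mono) simp
    moreover have "poly ([:4, 1:] ^ c) (gsize x) = (gsize x + 4) ^ c" by (simp add: add.commute)
    ultimately show "real (2 ^ ((c + 2) * npaths x) * card (verts (digraph_of (fst x))) ^ npaths x * (gsize x + 4) ^ c) \<le>
      (case x of (G, b, s) \<Rightarrow> let k = length (base_paths G) in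
            real 1 * real (card (verts (digraph_of G))) ^ k * max 2 (log 2 (real k)) ^ ((c + 2) * k) *
            real (poly ([:4, 1:] ^ c) (data_size (enc_path_graph G))))"
      unfolding x by (simp add: npaths_def gsize_def Let_def mult_ac add.commute[of _ 4])
  qed
  ultimately show ?thesis by blast
qed

theorem theorem30:
  fixes \<Pi> :: "mr_instance param_problem"
  assumes "\<Pi> \<in> {MR_DP, MR_AP, MR_SP}"
  shows "in_XP \<Pi> \<and>
    (\<exists>(p :: program) (C :: nat) (c :: nat) (q :: nat poly).
       solves_in_time p \<Pi>
         (\<lambda>(G, b, s). let k = length (base_paths G) in
            real C * real (card (verts (digraph_of G))) ^ k *
            max 2 (log 2 (real k)) ^ (c * k) *
            real (poly q (data_size (enc_path_graph G)))))"
  using assms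
proof (elim insertE emptyE)
  assume "\<Pi> = MR_DP"
  then show ?thesis unfolding MR_DP_def by (simp only:) (rule MR_theorem[of _ True False]; simp)
next
  assume "\<Pi> = MR_AP"
  then show ?thesis unfolding MR_AP_def by (simp only:) (rule MR_theorem[of _ False True]; simp)
next
  assume "\<Pi> = MR_SP"
  then show ?thesis unfolding MR_SP_def by (simp only:) (rule MR_theorem[of _ True True]; simp)
qed

end
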